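(* Let $N\ge2$, $\mu>0$, $\lambda+2\mu>0$, $\kappa>0$. Let $q_0\in B^{N/2}_{2,2}\cap L^\infty$ and $u_0\in B^{N/2-1}_{2,2}$. Let $(q,u)$ be the solution of $$\begin{cases}\partial_tq+\operatorname{div}u=0,\\ \partial_tu-\mu\Delta u-(\lambda+\mu)\nabla\operatorname{div}u-\kappa\nabla\Delta q=0,\\ (q(0,\cdot),u(0,\cdot))=(q_0,u_0)\end{cases}$$ on $\mathbb{R}^N$. Then there is a constant $C>0$, independent of $T$ and of the data, such that for all $T>0$ $$\sup_{t\in[0,T]}\big(\sqrt t\,\|(\nabla q,u)(t,\cdot)\|_{L^\infty}\big)\le C\|(\nabla q_0,u_0)\|_{B^{N/2-1}_{2,2}},$$ $$\|q\|_{L^\infty_T(L^\infty)}\le\|q_0\|_{L^\infty}+C\|(\nabla q_0,u_0)\|_{B^{N/2-1}_{2,2}}.$$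
   Context: Here $q$ is scalar and $u$ is $\mathbb{R}^N$-valued; $L^\infty_T(L^\infty)=L^\infty((0,T);L^\infty(\mathbb{R}^N))$. Littlewood–Paley: fix $\varphi,\chi\in C^\infty(\mathbb{R}^N)$ supported in $\{3/4\le|\xi|\le8/3\}$ and $B(0,4/3)$ respectively, with $\sum_{l\in\mathbb Z}\varphi(2^{-l}\xi)=1$ for $\xi\ne0$ and $\chi(\xi)+\sum_{l\ge0}\varphi(2^{-l}\xi)=1$ for all $\xi$. Set $\Delta_l u=\varphi(2^{-l}D)u$ and $S_lu=\chi(2^{-l}D)u$. $\mathcal S'_h$ is the space of tempered distributions $u$ with $S_ju\to0$ in $\mathcal S'$ as $j\to-\infty$. The homogeneous Besov norm is $\|u\|_{B^s_{p,r}}=\big(\sum_{l\in\mathbb Z}(2^{ls}\|\Delta_lu\|_{L^p})^r\big)^{1/r}$, and $B^s_{p,r}=\{u\in\mathcal S'_h:\|u\|_{B^s_{p,r}}<\infty\}$, also for vector-valued $u$. *)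

theory Defs
  imports "HOL-Analysis.Analysis" "HOL-Probability.Essential_Supremum"
begin

definition partial_deriv :: "'n::finite \<Rightarrow> (real^'n \<Rightarrow> 'b::real_normed_vector) \<Rightarrow> real^'n \<Rightarrow> 'b" where
  "partial_deriv i f = (\<lambda>x. frechet_derivative f (at x) (axis i 1))"

text \<open>Multi-indices are replaced by lists of coordinate directions.\<close>

definition iter_deriv :: "'n::finite list \<Rightarrow> (real^'n \<Rightarrow> 'b::real_normed_vector) \<Rightarrow> real^'n \<Rightarrow> 'b" where
  "iter_deriv ds f = foldr partial_deriv ds f"

text \<open>Differentiability of all iterated partial derivatives forces their continuity, so this is
  membership in \<open>C\<^sup>\<infinity>\<close>.\<close>

definition smooth :: "(real^'n::finite \<Rightarrow> 'b::real_normed_vector) \<Rightarrow> bool" where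
  "smooth f \<longleftrightarrow> (\<forall>ds. iter_deriv ds f differentiable_on UNIV)"

definition schwartz :: "(real^'n::finite \<Rightarrow> complex) \<Rightarrow> bool" where
  "schwartz f \<longleftrightarrow> smooth f \<and>
     (\<forall>k ds. \<exists>B. \<forall>x. (1 + norm x) ^ k * norm (iter_deriv ds f x) \<le> B)"

definition schwartz_seminorm :: "nat \<Rightarrow> (real^'n::finite \<Rightarrow> complex) \<Rightarrow> real" where
  "schwartz_seminorm k f =
     (\<Sum>ds | length ds \<le> k. SUP x. (1 + norm x) ^ k * norm (iter_deriv ds f x))"

definition fourier :: "(real^'n::finite \<Rightarrow> complex) \<Rightarrow> real^'n \<Rightarrow> complex" where
  "fourier f = (\<lambda>\<xi>. LINT x|lborel. cis (- (x \<bullet> \<xi>)) * f x)"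

definition inv_fourier :: "(real^'n::finite \<Rightarrow> complex) \<Rightarrow> real^'n \<Rightarrow> complex" where
  "inv_fourier f = (\<lambda>x. (LINT \<xi>|lborel. cis (x \<bullet> \<xi>) * f \<xi>) / of_real ((2 * pi) ^ CARD('n)))"

text \<open>Distributions are functionals whose values matter only on Schwartz functions.\<close>

type_synonym 'n distr = "(real^'n \<Rightarrow> complex) \<Rightarrow> complex"

definition tempered :: "'n::finite distr \<Rightarrow> bool" where
  "tempered T \<longleftrightarrow>
     (\<forall>f g. schwartz f \<longrightarrow> schwartz g \<longrightarrow> T (\<lambda>x. f x + g x) = T f + T g) \<and>
     (\<forall>c f. schwartz f \<longrightarrow> T (\<lambda>x. c * f x) = c * T f) \<and>
     (\<exists>B k. \<forall>f. schwartz f \<longrightarrow> norm (T f) \<le> B * schwartz_seminorm k f)"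

definition real_valued :: "'n::finite distr \<Rightarrow> bool" where
  "real_valued T \<longleftrightarrow> (\<forall>f. schwartz f \<longrightarrow> (\<forall>x. f x \<in> \<real>) \<longrightarrow> T f \<in> \<real>)"

definition distr_partial :: "'n::finite \<Rightarrow> 'n distr \<Rightarrow> 'n distr" where
  "distr_partial i T = (\<lambda>f. - T (partial_deriv i f))"

definition distr_grad :: "'n::finite distr \<Rightarrow> 'n \<Rightarrow> 'n distr" where
  "distr_grad T = (\<lambda>i. distr_partial i T)"

definition distr_div :: "('n::finite \<Rightarrow> 'n distr) \<Rightarrow> 'n distr" where
  "distr_div U = (\<lambda>f. \<Sum>i\<in>UNIV. distr_partial i (U i) f)"

definition distr_laplacian :: "'n::finite distr \<Rightarrow> 'n distr" where
  "distr_laplacian T = distr_div (distr_grad T)"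

definition distr_fourier :: "'n::finite distr \<Rightarrow> 'n distr" where
  "distr_fourier T = (\<lambda>f. T (fourier f))"

definition distr_inv_fourier :: "'n::finite distr \<Rightarrow> 'n distr" where
  "distr_inv_fourier T = (\<lambda>f. T (inv_fourier f))"

definition distr_mult :: "(real^'n::finite \<Rightarrow> real) \<Rightarrow> 'n distr \<Rightarrow> 'n distr" where
  "distr_mult a T = (\<lambda>f. T (\<lambda>x. of_real (a x) * f x))"

definition fourier_multiplier :: "(real^'n::finite \<Rightarrow> real) \<Rightarrow> 'n distr \<Rightarrow> 'n distr" where
  "fourier_multiplier a T = distr_inv_fourier (distr_mult a (distr_fourier T))"

text \<open>Real power of an extended nonnegative number; only used with exponent \<open>a > 0\<close>.\<close>

definition epowr :: "ennreal \<Rightarrow> real \<Rightarrow> ennreal" where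
  "epowr x a = (if x = \<infinity> then \<infinity> else ennreal (enn2real x powr a))"

text \<open>For \<open>1 \<le> p \<le> \<infinity>\<close>; over \<open>count_space\<close> this is the \<open>\<ell>\<^sup>p\<close> norm.\<close>

definition eLp_norm :: "'a measure \<Rightarrow> ennreal \<Rightarrow> ('a \<Rightarrow> ennreal) \<Rightarrow> ennreal" where
  "eLp_norm M p g =
     (if p = \<infinity> then esssup M g
      else epowr (\<integral>\<^sup>+ x. epowr (g x) (enn2real p) \<partial>M) (1 / enn2real p))"

text \<open>Vector-valued distributions are finite families of distributions, the scalar case being
  indexed by \<open>unit\<close>.\<close>

abbreviation scalar :: "'n distr \<Rightarrow> unit \<Rightarrow> 'n distr" where
  "scalar T \<equiv> (\<lambda>_. T)"

definition represents :: "(real^'n::finite \<Rightarrow> complex^'i::finite) \<Rightarrow> ('i \<Rightarrow> 'n distr) \<Rightarrow> bool" where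
  "represents g T \<longleftrightarrow> g \<in> borel_measurable lborel \<and>
     (\<forall>i f. schwartz f \<longrightarrow> integrable lborel (\<lambda>x. g x $ i * f x) \<and>
        T i f = (LINT x|lborel. g x $ i * f x))"

text \<open>A representing function is unique almost everywhere, so the infimum is its norm; it is
  \<open>\<infinity>\<close> if the distribution is not a function. The pointwise norm is Euclidean.\<close>

definition distr_Lp_norm :: "ennreal \<Rightarrow> ('i::finite \<Rightarrow> 'n::finite distr) \<Rightarrow> ennreal" where
  "distr_Lp_norm p T =
     (INF g \<in> {g. represents g T}. eLp_norm lborel p (\<lambda>x. ennreal (norm (g x))))"

definition littlewood_paley ::
    "(real^'n::finite \<Rightarrow> real) \<Rightarrow> (real^'n \<Rightarrow> real) \<Rightarrow> bool" where
  "littlewood_paley \<phi> chi \<longleftrightarrow> smooth \<phi> \<and> smooth chi \<and>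
     closure {\<xi>. \<phi> \<xi> \<noteq> 0} \<subseteq> {\<xi>. 3/4 \<le> norm \<xi> \<and> norm \<xi> \<le> 8/3} \<and>
     closure {\<xi>. chi \<xi> \<noteq> 0} \<subseteq> cball 0 (4/3) \<and>
     (\<forall>\<xi>. \<xi> \<noteq> 0 \<longrightarrow> ((\<lambda>l::int. \<phi> ((2 powi (- l)) *\<^sub>R \<xi>)) has_sum 1) UNIV) \<and>
     (\<forall>\<xi>. ((\<lambda>l::int. \<phi> ((2 powi (- l)) *\<^sub>R \<xi>)) has_sum (1 - chi \<xi>)) {0..})"

definition dyadic_block :: "(real^'n::finite \<Rightarrow> real) \<Rightarrow> int \<Rightarrow> 'n distr \<Rightarrow> 'n distr" where
  "dyadic_block \<phi> l T = fourier_multiplier (\<lambda>\<xi>. \<phi> ((2 powi (- l)) *\<^sub>R \<xi>)) T"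

definition low_cutoff :: "(real^'n::finite \<Rightarrow> real) \<Rightarrow> int \<Rightarrow> 'n distr \<Rightarrow> 'n distr" where
  "low_cutoff chi l T = fourier_multiplier (\<lambda>\<xi>. chi ((2 powi (- l)) *\<^sub>R \<xi>)) T"

definition tempered_h :: "(real^'n::finite \<Rightarrow> real) \<Rightarrow> 'n distr \<Rightarrow> bool" where
  "tempered_h chi T \<longleftrightarrow> tempered T \<and>
     (\<forall>f. schwartz f \<longrightarrow> ((\<lambda>j. low_cutoff chi j T f) \<longlongrightarrow> 0) at_bot)"

definition besov_norm ::
    "(real^'n::finite \<Rightarrow> real) \<Rightarrow> real \<Rightarrow> ennreal \<Rightarrow> ennreal \<Rightarrow> ('i::finite \<Rightarrow> 'n distr) \<Rightarrow> ennreal" where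
  "besov_norm \<phi> s p r T =
     eLp_norm (count_space (UNIV :: int set)) r
       (\<lambda>l. ennreal (2 powr (of_int l * s)) * distr_Lp_norm p (\<lambda>i. dyadic_block \<phi> l (T i)))"

definition besov_space ::
    "(real^'n::finite \<Rightarrow> real) \<Rightarrow> (real^'n \<Rightarrow> real) \<Rightarrow> real \<Rightarrow> ennreal \<Rightarrow> ennreal
      \<Rightarrow> ('i::finite \<Rightarrow> 'n distr) set" where
  "besov_space \<phi> chi s p r = {T. (\<forall>i. tempered_h chi (T i)) \<and> besov_norm \<phi> s p r T < \<infinity>}"

text \<open>Solutions are weakly continuous curves in the space of real tempered distributions that
  satisfy the equations, tested against every Schwartz function, at all positive times. In this
  class the solution with given data is unique.\<close>

definition korteweg_solution ::
    "real \<Rightarrow> real \<Rightarrow> real \<Rightarrow> 'n::finite distr \<Rightarrow> ('n \<Rightarrow> 'n distr)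
      \<Rightarrow> (real \<Rightarrow> 'n distr) \<Rightarrow> (real \<Rightarrow> 'n \<Rightarrow> 'n distr) \<Rightarrow> bool" where
  "korteweg_solution \<mu> lam \<kappa> q0 u0 q u \<longleftrightarrow>
     (\<forall>t\<ge>0. tempered (q t) \<and> real_valued (q t) \<and>
        (\<forall>i. tempered (u t i) \<and> real_valued (u t i))) \<and>
     (\<forall>f. schwartz f \<longrightarrow>
        q 0 f = q0 f \<and> (\<forall>i. u 0 i f = u0 i f) \<and>
        continuous_on {0..} (\<lambda>t. q t f) \<and> (\<forall>i. continuous_on {0..} (\<lambda>t. u t i f)) \<and>
        (\<forall>t>0. ((\<lambda>s. q s f) has_vector_derivative - distr_div (u t) f) (at t)) \<and>
        (\<forall>t>0. \<forall>i. ((\<lambda>s. u s i f) has_vector_derivative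
             of_real \<mu> * distr_laplacian (u t i) f
           + of_real (lam + \<mu>) * distr_grad (distr_div (u t)) i f
           + of_real \<kappa> * distr_grad (distr_laplacian (q t)) i f) (at t)))"

end

theory Submission
  imports Defs "HOL-Probability.Sinc_Integral"
begin

text \<open>
  Apply the Fourier transform in space. For each frequency \<open>\<xi>\<close> the system becomes a linear ordinary
  differential equation in time, and apart from the direction of \<open>\<xi>\<close> the matrix that
  propagates \<open>(\<nabla>q, u)\<close> depends only on the dimensionless variable \<open>s = t \<bar>\<xi>\<bar>\<^sup>2\<close>. Let \<open>\<nu> = \<lambda> + 2 \<mu>\<close> and let \<open>\<beta>\<close> be the damped oscillator
  \<open>\<beta>'' + \<nu> \<beta>' + \<kappa> \<beta> = 0\<close> with \<open>\<beta>(0) = 0\<close>, \<open>\<beta>'(0) = 1\<close>. The density and the compressible part of the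
  velocity are propagated by \<open>\<beta>\<close>, \<open>\<beta>'\<close> and \<open>\<alpha> = \<beta>' + \<nu> \<beta>\<close>, the incompressible part by the heat factor
  \<open>exp (- \<mu> s)\<close>. Since \<open>\<nu>\<close> and \<open>\<kappa>\<close> are positive, both roots of the characteristic equation lie on the
  decaying side (\<open>oscillator_exists\<close>), so all these functions are \<open>O(exp (- c s))\<close> for some \<open>c > 0\<close>. Hence
  \<open>(\<nabla>q, u)\<close> at time \<open>t\<close> arises from \<open>(\<nabla>q\<^sub>0, u\<^sub>0)\<close> by a matrix of Fourier multipliers bounded by a constant
  times \<open>exp (- c t \<bar>\<xi>\<bar>\<^sup>2 / 2)\<close> (\<open>flow_representation\<close>, \<open>symbol_bounds\<close>).

  A multiplier \<open>m\<close> with that Gaussian bound maps the Besov space with exponent \<open>N/2 - 1\<close> to bounded functions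
  with norm \<open>O(1 / sqrt t)\<close> (\<open>smoothing_estimate\<close>). On the dyadic ring \<open>\<bar>\<xi>\<bar> \<approx> 2\<^sup>l\<close> Cauchy--Schwarz and
  Plancherel's theorem bound the block of \<open>m(D) T\<close> pointwise by
  \<open>2\<^bsup>l N/2\<^esup> exp (- c' 4\<^sup>l t)\<close> times its \<open>L\<^sup>2\<close> norm. The weight \<open>2\<^bsup>l (N/2 - 1)\<^esup>\<close> in the Besov norm leaves the
  factor \<open>2\<^sup>l exp (- c' 4\<^sup>l t)\<close>, whose square has a sum over \<open>l\<close> of size \<open>1 / t\<close>, and Cauchy--Schwarz in \<open>l\<close>
  finishes. This is the first estimate.

  For the bound on \<open>q\<close>, compare with the heat flow of \<open>q\<^sub>0\<close>, which is a contraction in \<open>L\<^sup>\<infinity>\<close>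
  (\<open>heat_contraction\<close>). The multiplier \<open>\<alpha> - exp (- s)\<close> of the difference vanishes at \<open>s = 0\<close>, so it has the
  form \<open>t \<bar>\<xi>\<bar>\<^sup>2 A(s)\<close> with \<open>A\<close> smooth and decaying. One factor \<open>\<xi>\<close> turns \<open>q\<^sub>0\<close> into its gradient, and the
  remaining factor \<open>t \<xi>\<close> is \<open>O(sqrt t)\<close>, which cancels the \<open>1 / sqrt t\<close> of the smoothing estimate
  (\<open>q_representation\<close>).

  The solution is only assumed to be a weakly continuous curve of tempered distributions, so that the
  formula for it needs a proof. The pairing of the solution at time \<open>s\<close> with the solution of the
  transposed ordinary differential equation at time \<open>t - s\<close> is constant in \<open>s\<close> (\<open>duality\<close>). To
  differentiate a pairing in which both the distribution and the test function move, the distributions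
  must be bounded uniformly in time on bounded sets of test functions, and this follows from weak
  continuity (\<open>uniform_boundedness\<close>). Finally, the essential supremum over time requires that the \<open>L\<^sup>\<infinity>\<close> norm
  of \<open>q\<close> depends measurably on time. It is a supremum of absolute values of pairings with fixed test
  functions, hence lower semicontinuous (\<open>distr_Lp_norm_eq_SUP_probe\<close>).
\<close>

section \<open>Bounded sets of Schwartz functions and of multipliers\<close>

text \<open>The topology of Schwartz space enters only through its bounded sets, and the lemmas below concern
  sets of functions rather than single functions: what has to be controlled are families that
  depend on a parameter, such as Taylor remainders in time.\<close>

definition schwartz_bounded :: "(real^'n::finite \<Rightarrow> complex) set \<Rightarrow> bool" where
  "schwartz_bounded B \<longleftrightarrow> (\<forall>f\<in>B. smooth f) \<and>
     (\<forall>k ds. \<exists>C. \<forall>f\<in>B. \<forall>x. (1 + norm x) ^ k * norm (iter_deriv ds f x) \<le> C)"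

text \<open>Bounded sets of multipliers of Schwartz space.\<close>

definition moderate_bounded :: "(real^'n::finite \<Rightarrow> complex) set \<Rightarrow> bool" where
  "moderate_bounded A \<longleftrightarrow> (\<forall>f\<in>A. smooth f) \<and>
     (\<forall>ds. \<exists>k C. \<forall>f\<in>A. \<forall>x. norm (iter_deriv ds f x) \<le> C * (1 + norm x) ^ k)"

abbreviation moderate :: "(real^'n::finite \<Rightarrow> complex) \<Rightarrow> bool" where
  "moderate a \<equiv> moderate_bounded {a}"

lemma schwartz_bounded_singleton: "schwartz_bounded {f} \<longleftrightarrow> schwartz f"
  by (simp add: schwartz_bounded_def schwartz_def)

lemma schwartz_bounded_imp_schwartz: "schwartz_bounded B \<Longrightarrow> f \<in> B \<Longrightarrow> schwartz f"
  unfolding schwartz_bounded_def schwartz_def by blast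

lemma moderate_bounded_imp_moderate: "moderate_bounded A \<Longrightarrow> a \<in> A \<Longrightarrow> moderate a"
  unfolding moderate_bounded_def by (metis singletonD)

lemma schwartz_bounded_subset: "schwartz_bounded B \<Longrightarrow> A \<subseteq> B \<Longrightarrow> schwartz_bounded A"
  unfolding schwartz_bounded_def by (meson subsetD)

lemma moderate_bounded_subset: "moderate_bounded B \<Longrightarrow> A \<subseteq> B \<Longrightarrow> moderate_bounded A"
  unfolding moderate_bounded_def by (meson subsetD)

subsection \<open>Iterated derivatives\<close>

lemma partial_deriv_eq:
  "(f has_derivative f') (at x) \<Longrightarrow> partial_deriv i f x = f' (axis i 1)"
  unfolding partial_deriv_def by (metis frechet_derivative_at)

lemma iter_deriv_Nil [simp]: "iter_deriv [] f = f"
  by (simp add: iter_deriv_def)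

lemma iter_deriv_Cons: "iter_deriv (i # ds) f = partial_deriv i (iter_deriv ds f)"
  by (simp add: iter_deriv_def)

lemma iter_deriv_snoc: "iter_deriv (ds @ [i]) f = iter_deriv ds (partial_deriv i f)"
  by (simp add: iter_deriv_def)

lemma smooth_imp_differentiable: "smooth f \<Longrightarrow> f differentiable (at x)"
  unfolding smooth_def by (metis iter_deriv_Nil UNIV_I differentiable_on_def)

lemma smooth_partial_deriv: "smooth f \<Longrightarrow> smooth (partial_deriv i f)"
  unfolding smooth_def by (metis iter_deriv_snoc)

lemma smooth_iter_deriv: "smooth f \<Longrightarrow> smooth (iter_deriv ds f)"
  by (induction ds) (auto simp: iter_deriv_Cons smooth_partial_deriv)

lemma partial_deriv_add:
  fixes f g :: "real^'n::finite \<Rightarrow> 'b::real_normed_vector"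
  assumes "f differentiable (at x)" "g differentiable (at x)"
  shows "partial_deriv i (\<lambda>x. f x + g x) x = partial_deriv i f x + partial_deriv i g x"
proof -
  obtain f' g' where *: "(f has_derivative f') (at x)" "(g has_derivative g') (at x)"
    using assms unfolding differentiable_def by blast
  show ?thesis
    by (simp add: partial_deriv_eq[OF has_derivative_add[OF *]] partial_deriv_eq[OF *(1)]
        partial_deriv_eq[OF *(2)])
qed

lemma partial_deriv_mult:
  fixes f g :: "real^'n::finite \<Rightarrow> complex"
  assumes "f differentiable (at x)" "g differentiable (at x)"
  shows "partial_deriv i (\<lambda>x. f x * g x) x = partial_deriv i f x * g x + f x * partial_deriv i g x"
proof -
  obtain f' g' where *: "(f has_derivative f') (at x)" "(g has_derivative g') (at x)"
    using assms unfolding differentiable_def by blast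
  show ?thesis
    by (simp add: partial_deriv_eq[OF has_derivative_mult[OF *]] partial_deriv_eq[OF *(1)]
        partial_deriv_eq[OF *(2)])
qed

lemma iter_deriv_closed:
  assumes "X A" and "\<And>A i. X A \<Longrightarrow> \<exists>A'. X A' \<and> partial_deriv i ` A \<subseteq> A'"
  shows "\<exists>A'. X A' \<and> iter_deriv ds ` A \<subseteq> A'"
proof (induction ds)
  case Nil
  then show ?case using assms(1) by auto
next
  case (Cons d ds)
  then obtain A' where A': "X A'" "iter_deriv ds ` A \<subseteq> A'" by blast
  then obtain A'' where A'': "X A''" "partial_deriv d ` A' \<subseteq> A''" using assms(2) by blast
  then have "iter_deriv (d # ds) ` A \<subseteq> A''"
    using A' by (force simp: iter_deriv_Cons image_subset_iff)
  then show ?case using A'' by blast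
qed

text \<open>The undifferentiated estimate suffices if it holds throughout a class of sets that is closed under
  partial derivatives, because the iterated derivatives of a member then lie in another member.\<close>

lemma schwartz_bounded_coinduct:
  assumes "X A"
    and diff: "\<And>A f x. X A \<Longrightarrow> f \<in> A \<Longrightarrow> f differentiable (at x)"
    and bd: "\<And>A k. X A \<Longrightarrow> \<exists>C. \<forall>f\<in>A. \<forall>x. (1 + norm x) ^ k * norm (f x) \<le> C"
    and step: "\<And>A i. X A \<Longrightarrow> \<exists>A'. X A' \<and> partial_deriv i ` A \<subseteq> A'"
  shows "schwartz_bounded A"
  unfolding schwartz_bounded_def smooth_def
proof (intro conjI ballI allI)
  fix f ds assume "f \<in> A"
  obtain A' where "X A'" "iter_deriv ds ` A \<subseteq> A'"
    using iter_deriv_closed[where X=X, OF assms(1) step] by blast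
  then show "iter_deriv ds f differentiable_on UNIV"
    using diff \<open>f \<in> A\<close> by (auto simp: differentiable_on_def image_subset_iff)
next
  fix k and ds :: "'a list"
  obtain A' where "X A'" "iter_deriv ds ` A \<subseteq> A'"
    using iter_deriv_closed[where X=X, OF assms(1) step] by blast
  with bd[of A' k] show "\<exists>C. \<forall>f\<in>A. \<forall>x. (1 + norm x) ^ k * norm (iter_deriv ds f x) \<le> C"
    by (auto simp: image_subset_iff)
qed

lemma moderate_bounded_coinduct:
  assumes "X A"
    and diff: "\<And>A f x. X A \<Longrightarrow> f \<in> A \<Longrightarrow> f differentiable (at x)"
    and bd: "\<And>A. X A \<Longrightarrow> \<exists>k C. \<forall>f\<in>A. \<forall>x. norm (f x) \<le> C * (1 + norm x) ^ k"
    and step: "\<And>A i. X A \<Longrightarrow> \<exists>A'. X A' \<and> partial_deriv i ` A \<subseteq> A'"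
  shows "moderate_bounded A"
  unfolding moderate_bounded_def smooth_def
proof (intro conjI ballI allI)
  fix f ds assume "f \<in> A"
  obtain A' where "X A'" "iter_deriv ds ` A \<subseteq> A'"
    using iter_deriv_closed[where X=X, OF assms(1) step] by blast
  then show "iter_deriv ds f differentiable_on UNIV"
    using diff \<open>f \<in> A\<close> by (auto simp: differentiable_on_def image_subset_iff)
next
  fix ds :: "'a list"
  obtain A' where A': "X A'" "iter_deriv ds ` A \<subseteq> A'"
    using iter_deriv_closed[where X=X, OF assms(1) step] by blast
  obtain k C where "\<forall>f\<in>A'. \<forall>x. norm (f x) \<le> C * (1 + norm x) ^ k" using bd[OF A'(1)] by blast
  with A'(2) show "\<exists>k C. \<forall>f\<in>A. \<forall>x. norm (iter_deriv ds f x) \<le> C * (1 + norm x) ^ k"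
    unfolding image_subset_iff by blast
qed

lemma schwartz_bounded_deriv:
  assumes "schwartz_bounded B"
  shows "schwartz_bounded (partial_deriv i ` B)"
  unfolding schwartz_bounded_def
proof (intro conjI ballI allI)
  fix f assume "f \<in> partial_deriv i ` B"
  then show "smooth f" using assms smooth_partial_deriv unfolding schwartz_bounded_def by blast
next
  fix k ds
  obtain C where "\<forall>f\<in>B. \<forall>x. (1 + norm x) ^ k * norm (iter_deriv (ds @ [i]) f x) \<le> C"
    using assms unfolding schwartz_bounded_def by blast
  then show "\<exists>C. \<forall>f\<in>partial_deriv i ` B. \<forall>x. (1 + norm x) ^ k * norm (iter_deriv ds f x) \<le> C"
    by (auto simp: iter_deriv_snoc)
qed

lemma moderate_bounded_deriv:
  assumes "moderate_bounded B"
  shows "moderate_bounded (partial_deriv i ` B)"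
  unfolding moderate_bounded_def
proof (intro conjI ballI allI)
  fix f assume "f \<in> partial_deriv i ` B"
  then show "smooth f" using assms smooth_partial_deriv unfolding moderate_bounded_def by blast
next
  fix ds
  obtain C k where "\<forall>f\<in>B. \<forall>x. norm (iter_deriv (ds @ [i]) f x) \<le> C * (1 + norm x) ^ k"
    using assms unfolding moderate_bounded_def by blast
  then show "\<exists>k C. \<forall>f\<in>partial_deriv i ` B. \<forall>x. norm (iter_deriv ds f x) \<le> C * (1 + norm x) ^ k"
    by (auto simp: iter_deriv_snoc)
qed

lemma schwartz_bounded_bound:
  "schwartz_bounded B \<Longrightarrow> \<exists>C. \<forall>f\<in>B. \<forall>x. (1 + norm x) ^ k * norm (f x) \<le> C"
  unfolding schwartz_bounded_def by (metis iter_deriv_Nil)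

lemma moderate_bounded_bound:
  assumes "moderate_bounded B"
  shows "\<exists>k C. \<forall>f\<in>B. \<forall>x. norm (f x) \<le> C * (1 + norm x) ^ k"
  using assms unfolding moderate_bounded_def by (metis iter_deriv_Nil)

subsection \<open>Modules over the multipliers\<close>

definition fun_times :: "('a \<Rightarrow> complex) set \<Rightarrow> ('a \<Rightarrow> complex) set \<Rightarrow> ('a \<Rightarrow> complex) set" where
  "fun_times A B = {\<lambda>x. a x * b x | a b. a \<in> A \<and> b \<in> B}"

definition fun_plus :: "('a \<Rightarrow> complex) set \<Rightarrow> ('a \<Rightarrow> complex) set \<Rightarrow> ('a \<Rightarrow> complex) set" where
  "fun_plus A B = {\<lambda>x. a x + b x | a b. a \<in> A \<and> b \<in> B}"

lemma fun_timesI: "a \<in> A \<Longrightarrow> b \<in> B \<Longrightarrow> (\<And>x. f x = a x * b x) \<Longrightarrow> f \<in> fun_times A B"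
  unfolding fun_times_def by (auto intro: exI[of _ a] exI[of _ b])

lemma fun_plusI: "a \<in> A \<Longrightarrow> b \<in> B \<Longrightarrow> (\<And>x. f x = a x + b x) \<Longrightarrow> f \<in> fun_plus A B"
  unfolding fun_plus_def by (auto intro: exI[of _ a] exI[of _ b])

text \<open>By the product rule this family is closed under partial derivatives as soon as the derivatives of
  the generators belong to it, so that the coinduction principles apply to it. Products, sums and
  radial functions are instances.\<close>

inductive multiplier_span ::
    "((real^'n::finite \<Rightarrow> complex) set \<Rightarrow> bool) \<Rightarrow> (real^'n \<Rightarrow> complex) set \<Rightarrow> bool" for Gen where
  gen: "Gen G \<Longrightarrow> multiplier_span Gen G"
| mult: "moderate_bounded A \<Longrightarrow> multiplier_span Gen G \<Longrightarrow> multiplier_span Gen (fun_times A G)"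
| add: "multiplier_span Gen G \<Longrightarrow> multiplier_span Gen H \<Longrightarrow> multiplier_span Gen (fun_plus G H)"

lemma multiplier_span_differentiable:
  assumes "multiplier_span Gen G" and "\<And>G g x. Gen G \<Longrightarrow> g \<in> G \<Longrightarrow> g differentiable (at x)"
    and "g \<in> G"
  shows "g differentiable (at x)"
  using assms(1,3)
proof (induction arbitrary: g)
  case (gen G)
  then show ?case using assms(2) by blast
next
  case (mult A G)
  then obtain a h where "g = (\<lambda>x. a x * h x)" "a \<in> A" "h \<in> G" unfolding fun_times_def by blast
  moreover from this have "a differentiable (at x)"
    using mult(1) smooth_imp_differentiable unfolding moderate_bounded_def by blast
  ultimately show ?case using mult by (auto intro!: differentiable_mult)
next
  case (add G H)
  then show ?case by (auto simp: fun_plus_def intro!: differentiable_add)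
qed

lemma multiplier_span_deriv:
  assumes "multiplier_span Gen G" and diff: "\<And>G g x. Gen G \<Longrightarrow> g \<in> G \<Longrightarrow> g differentiable (at x)"
    and step: "\<And>G i. Gen G \<Longrightarrow> \<exists>H. multiplier_span Gen H \<and> partial_deriv i ` G \<subseteq> H"
  shows "\<exists>H. multiplier_span Gen H \<and> partial_deriv i ` G \<subseteq> H"
  using assms(1)
proof induction
  case (gen G)
  then show ?case using step by blast
next
  case (mult A G)
  then obtain H where H: "multiplier_span Gen H" "partial_deriv i ` G \<subseteq> H" by blast
  have "partial_deriv i f \<in> fun_plus (fun_times (partial_deriv i ` A) G) (fun_times A H)"
    if f: "f \<in> fun_times A G" for f
  proof -
    obtain a g where f: "f = (\<lambda>x. a x * g x)" "a \<in> A" "g \<in> G" using f unfolding fun_times_def by blast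
    have "a differentiable (at x)" for x
      using mult(1) f(2) smooth_imp_differentiable unfolding moderate_bounded_def by blast
    moreover have "g differentiable (at x)" for x
      using diff by (rule multiplier_span_differentiable[OF mult(2) _ f(3)])
    ultimately have "partial_deriv i f = (\<lambda>x. partial_deriv i a x * g x + a x * partial_deriv i g x)"
      by (auto simp: f partial_deriv_mult)
    moreover have "partial_deriv i g \<in> H" using H f by blast
    then have "(\<lambda>x. partial_deriv i a x * g x) \<in> fun_times (partial_deriv i ` A) G"
      "(\<lambda>x. a x * partial_deriv i g x) \<in> fun_times A H"
      using f(2,3) unfolding fun_times_def by blast+
    ultimately show ?thesis by (intro fun_plusI) auto
  qed
  moreover have "multiplier_span Gen (fun_plus (fun_times (partial_deriv i ` A) G) (fun_times A H))"
    by (intro multiplier_span.intros moderate_bounded_deriv mult H)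
  ultimately show ?case by blast
next
  case (add G1 G2)
  then obtain H1 H2 where H: "multiplier_span Gen H1" "partial_deriv i ` G1 \<subseteq> H1"
     "multiplier_span Gen H2" "partial_deriv i ` G2 \<subseteq> H2" by blast
  have "partial_deriv i f \<in> fun_plus H1 H2" if f: "f \<in> fun_plus G1 G2" for f
  proof -
    obtain a g where f: "f = (\<lambda>x. a x + g x)" "a \<in> G1" "g \<in> G2" using f unfolding fun_plus_def by blast
    have "a differentiable (at x)" for x
      using diff by (rule multiplier_span_differentiable[OF add(1) _ f(2)])
    moreover have "g differentiable (at x)" for x
      using diff by (rule multiplier_span_differentiable[OF add(2) _ f(3)])
    ultimately have "partial_deriv i f = (\<lambda>x. partial_deriv i a x + partial_deriv i g x)"
      by (auto simp: f partial_deriv_add)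
    then show ?thesis using f(2,3) H unfolding fun_plus_def by blast
  qed
  then show ?case using H by (auto intro!: multiplier_span.add)
qed

lemma multiplier_span_schwartz:
  assumes "multiplier_span Gen G" and diff: "\<And>G g x. Gen G \<Longrightarrow> g \<in> G \<Longrightarrow> g differentiable (at x)"
    and step: "\<And>G i. Gen G \<Longrightarrow> \<exists>H. multiplier_span Gen H \<and> partial_deriv i ` G \<subseteq> H"
    and bd: "\<And>G k. Gen G \<Longrightarrow> \<exists>C. \<forall>f\<in>G. \<forall>x. (1 + norm x) ^ k * norm (f x) \<le> C"
  shows "schwartz_bounded G"
proof (rule schwartz_bounded_coinduct[of "multiplier_span Gen"])
  fix A k assume "multiplier_span Gen A"
  then show "\<exists>C. \<forall>f\<in>A. \<forall>x. (1 + norm x) ^ k * norm (f x) \<le> C"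
  proof (induction arbitrary: k)
    case (gen G)
    then show ?case using bd by blast
  next
    case (mult A G)
    obtain l C where C: "\<And>f x. f\<in>A \<Longrightarrow> norm (f x) \<le> C * (1 + norm x) ^ l"
      using moderate_bounded_bound[OF mult(1)] by blast
    obtain D where D: "\<And>f x. f\<in>G \<Longrightarrow> (1 + norm x) ^ (k + l) * norm (f x) \<le> D" using mult.IH by blast
    have "(1 + norm x) ^ k * norm (a x * g x) \<le> C * D" if "a \<in> A" "g \<in> G" for a g x
    proof -
      have Cpos: "C \<ge> 0"
        using order_trans[OF norm_ge_zero C[OF that(1), of 0]] by simp
      have "(1 + norm x) ^ k * norm (a x * g x) \<le> (1 + norm x) ^ k * ((C * (1 + norm x) ^ l) * norm (g x))"
        using C[OF that(1), of x] by (auto simp: norm_mult intro!: mult_left_mono mult_right_mono)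
      also have "\<dots> = C * ((1 + norm x) ^ (k + l) * norm (g x))" by (simp add: power_add)
      also have "\<dots> \<le> C * D" using D[OF that(2), of x] Cpos by (rule mult_left_mono)
      finally show ?thesis .
    qed
    then show ?case unfolding fun_times_def by blast
  next
    case (add G H)
    obtain C where C: "\<And>f x. f\<in>G \<Longrightarrow> (1 + norm x) ^ k * norm (f x) \<le> C" using add.IH(1) by blast
    obtain D where D: "\<And>f x. f\<in>H \<Longrightarrow> (1 + norm x) ^ k * norm (f x) \<le> D" using add.IH(2) by blast
    have "(1 + norm x) ^ k * norm (a x + g x) \<le> C + D" if "a \<in> G" "g \<in> H" for a g x
    proof -
      have "(1 + norm x) ^ k * norm (a x + g x) \<le> (1 + norm x) ^ k * (norm (a x) + norm (g x))"
        by (intro mult_left_mono norm_triangle_ineq) auto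
      also have "\<dots> \<le> C + D" using C[OF that(1), of x] D[OF that(2), of x] by (simp add: distrib_left)
      finally show ?thesis .
    qed
    then show ?case unfolding fun_plus_def by blast
  qed
next
  fix A f x assume "multiplier_span Gen A" "f \<in> A"
  show "f differentiable (at x)"
    using diff by (rule multiplier_span_differentiable[OF \<open>multiplier_span Gen A\<close> _ \<open>f \<in> A\<close>])
next
  fix A i assume "multiplier_span Gen A"
  then show "\<exists>A'. multiplier_span Gen A' \<and> partial_deriv i ` A \<subseteq> A'"
    using diff step by (rule multiplier_span_deriv)
qed (rule assms(1))

lemma multiplier_span_moderate:
  assumes "multiplier_span Gen G" and diff: "\<And>G g x. Gen G \<Longrightarrow> g \<in> G \<Longrightarrow> g differentiable (at x)"
    and step: "\<And>G i. Gen G \<Longrightarrow> \<exists>H. multiplier_span Gen H \<and> partial_deriv i ` G \<subseteq> H"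
    and bd: "\<And>G. Gen G \<Longrightarrow> \<exists>k C. \<forall>f\<in>G. \<forall>x. norm (f x) \<le> C * (1 + norm x) ^ k"
  shows "moderate_bounded G"
proof (rule moderate_bounded_coinduct[of "multiplier_span Gen"])
  fix A assume "multiplier_span Gen A"
  then show "\<exists>k C. \<forall>f\<in>A. \<forall>x. norm (f x) \<le> C * (1 + norm x) ^ k"
  proof induction
    case (gen G)
    then show ?case using bd by blast
  next
    case (mult A G)
    obtain l C where C: "\<And>f x. f\<in>A \<Longrightarrow> norm (f x) \<le> C * (1 + norm x) ^ l"
      using moderate_bounded_bound[OF mult(1)] by blast
    obtain k D where D: "\<And>f x. f\<in>G \<Longrightarrow> norm (f x) \<le> D * (1 + norm x) ^ k" using mult.IH by blast
    have "norm (a x * g x) \<le> (C * D) * (1 + norm x) ^ (l + k)" if "a \<in> A" "g \<in> G" for a g x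
    proof -
      have "norm (a x * g x) \<le> (C * (1 + norm x) ^ l) * (D * (1 + norm x) ^ k)"
        unfolding norm_mult using C[OF that(1), of x] D[OF that(2), of x]
        by (intro mult_mono) (auto intro: order_trans[OF norm_ge_zero])
      then show ?thesis by (simp add: power_add algebra_simps)
    qed
    then show ?case unfolding fun_times_def by blast
  next
    case (add G H)
    obtain l C where C: "\<And>f x. f\<in>G \<Longrightarrow> norm (f x) \<le> C * (1 + norm x) ^ l" using add.IH(1) by blast
    obtain k D where D: "\<And>f x. f\<in>H \<Longrightarrow> norm (f x) \<le> D * (1 + norm x) ^ k" using add.IH(2) by blast
    have "norm (a x + g x) \<le> (C + D) * (1 + norm x) ^ (l + k)" if "a \<in> G" "g \<in> H" for a g x
    proof -
      have "C \<ge> 0" "D \<ge> 0"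
        using order_trans[OF norm_ge_zero C[OF that(1), of 0]]
         order_trans[OF norm_ge_zero D[OF that(2), of 0]] by auto
      then have "C * (1 + norm x) ^ l \<le> C * (1 + norm x) ^ (l + k)"
        "D * (1 + norm x) ^ k \<le> D * (1 + norm x) ^ (l + k)"
        by (intro mult_left_mono power_increasing; simp)+
      then show ?thesis
        using C[OF that(1), of x] D[OF that(2), of x] norm_triangle_ineq[of "a x" "g x"]
        unfolding distrib_right by linarith
    qed
    then show ?case unfolding fun_plus_def by blast
  qed
next
  fix A f x assume "multiplier_span Gen A" "f \<in> A"
  show "f differentiable (at x)"
    using diff by (rule multiplier_span_differentiable[OF \<open>multiplier_span Gen A\<close> _ \<open>f \<in> A\<close>])
next
  fix A i assume "multiplier_span Gen A"
  then show "\<exists>A'. multiplier_span Gen A' \<and> partial_deriv i ` A \<subseteq> A'"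
    using diff step by (rule multiplier_span_deriv)
qed (rule assms(1))

lemma moderate_span:
  assumes "multiplier_span moderate_bounded G"
  shows "moderate_bounded G"
  using assms
proof (rule multiplier_span_moderate)
  show "\<exists>H. multiplier_span moderate_bounded H \<and> partial_deriv i ` G \<subseteq> H"
    if "moderate_bounded G" for G :: "(real^'n \<Rightarrow> complex) set" and i
    using multiplier_span.gen[of moderate_bounded, OF moderate_bounded_deriv[OF that]] by blast
  show "g differentiable (at x)"
    if "moderate_bounded G" "g \<in> G" for G and g :: "real^'n \<Rightarrow> complex" and x
    using that smooth_imp_differentiable unfolding moderate_bounded_def by blast
qed (rule moderate_bounded_bound)

lemma schwartz_span:
  assumes "multiplier_span schwartz_bounded G"
  shows "schwartz_bounded G"
  using assms
proof (rule multiplier_span_schwartz)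
  show "\<exists>H. multiplier_span schwartz_bounded H \<and> partial_deriv i ` G \<subseteq> H"
    if "schwartz_bounded G" for G :: "(real^'n \<Rightarrow> complex) set" and i
    using multiplier_span.gen[of schwartz_bounded, OF schwartz_bounded_deriv[OF that]] by blast
  show "g differentiable (at x)"
    if "schwartz_bounded G" "g \<in> G" for G and g :: "real^'n \<Rightarrow> complex" and x
    using that smooth_imp_differentiable unfolding schwartz_bounded_def by blast
qed (rule schwartz_bounded_bound)

subsection \<open>Closure properties\<close>

lemma moderate_bounded_times:
  "moderate_bounded A \<Longrightarrow> moderate_bounded B \<Longrightarrow> moderate_bounded (fun_times A B)"
  by (rule moderate_span[OF multiplier_span.mult[OF _ multiplier_span.gen]])

lemma moderate_bounded_plus:
  "moderate_bounded A \<Longrightarrow> moderate_bounded B \<Longrightarrow> moderate_bounded (fun_plus A B)"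
  by (rule moderate_span[OF multiplier_span.add[OF multiplier_span.gen multiplier_span.gen]])

lemma schwartz_bounded_times:
  "moderate_bounded A \<Longrightarrow> schwartz_bounded B \<Longrightarrow> schwartz_bounded (fun_times A B)"
  by (rule schwartz_span[OF multiplier_span.mult[OF _ multiplier_span.gen]])

lemma schwartz_bounded_plus:
  "schwartz_bounded A \<Longrightarrow> schwartz_bounded B \<Longrightarrow> schwartz_bounded (fun_plus A B)"
  by (rule schwartz_span[OF multiplier_span.add[OF multiplier_span.gen multiplier_span.gen]])

lemma schwartz_bounded_imp_moderate:
  assumes "schwartz_bounded B" shows "moderate_bounded B"
  unfolding moderate_bounded_def
proof (intro conjI allI)
  show "\<forall>f\<in>B. smooth f" using assms by (simp add: schwartz_bounded_def)
  fix ds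
  obtain C where "\<forall>f\<in>B. \<forall>x. (1 + norm x) ^ 0 * norm (iter_deriv ds f x) \<le> C"
    using assms unfolding schwartz_bounded_def by blast
  then show "\<exists>k C. \<forall>f\<in>B. \<forall>x. norm (iter_deriv ds f x) \<le> C * (1 + norm x) ^ k"
    by (intro exI[of _ 0] exI[of _ C]) simp
qed

lemma partial_deriv_const: "partial_deriv i (\<lambda>x. c) = (\<lambda>x. 0)"
proof
  show "partial_deriv i (\<lambda>x. c) x = 0" for x :: "real^'a"
    using partial_deriv_eq[OF has_derivative_const[of c "at x"], of i] by simp
qed

lemma moderate_const: "moderate_bounded {\<lambda>x::real^'n::finite. c | c. norm c \<le> R}"
proof (rule moderate_bounded_coinduct[of "\<lambda>A. \<exists>R. A = {\<lambda>x. c | c. norm c \<le> R}"])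
  fix A :: "(real^'n \<Rightarrow> complex) set" and i
  assume "\<exists>R. A = {\<lambda>x. c |c. norm c \<le> R}"
  then have "partial_deriv i ` A \<subseteq> {\<lambda>x. c |c. norm c \<le> 0}"
    by (auto simp: partial_deriv_const)
  then show "\<exists>A'. (\<exists>R. A' = {\<lambda>x. c |c. norm c \<le> R}) \<and> partial_deriv i ` A \<subseteq> A'" by blast
next
  fix A :: "(real^'n \<Rightarrow> complex) set"
  assume "\<exists>R. A = {\<lambda>x. c |c. norm c \<le> R}"
  then obtain R where "A = {\<lambda>x. c |c. norm c \<le> R}" by blast
  then show "\<exists>k C. \<forall>f\<in>A. \<forall>x. norm (f x) \<le> C * (1 + norm x) ^ k"
    by (intro exI[of _ 0] exI[of _ R]) auto
qed auto

lemma moderate_const1: "moderate (\<lambda>x. c)"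
  by (rule moderate_bounded_subset[OF moderate_const[of "norm c"]]) auto

lemma moderate_times: "moderate a \<Longrightarrow> moderate b \<Longrightarrow> moderate (\<lambda>x. a x * b x)"
  by (rule moderate_bounded_subset[OF moderate_bounded_times[of "{a}" "{b}"]]) (auto simp: fun_times_def)

lemma moderate_plus: "moderate a \<Longrightarrow> moderate b \<Longrightarrow> moderate (\<lambda>x. a x + b x)"
  by (rule moderate_bounded_subset[OF moderate_bounded_plus[of "{a}" "{b}"]]) (auto simp: fun_plus_def)

lemma moderate_cmult: "moderate b \<Longrightarrow> moderate (\<lambda>x. c * b x)"
  by (intro moderate_times moderate_const1)

lemma moderate_uminus: "moderate b \<Longrightarrow> moderate (\<lambda>x. - b x)"
  using moderate_cmult[of b "-1"] by simp

lemma moderate_sum: "(\<And>i. i \<in> I \<Longrightarrow> moderate (a i)) \<Longrightarrow> moderate (\<lambda>x. \<Sum>i\<in>I. a i x)"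
  by (induction I rule: infinite_finite_induct) (auto intro: moderate_const1 moderate_plus)

lemma schwartz_times: "moderate a \<Longrightarrow> schwartz f \<Longrightarrow> schwartz (\<lambda>x. a x * f x)"
  unfolding schwartz_bounded_singleton[symmetric]
  by (rule schwartz_bounded_subset[OF schwartz_bounded_times[of "{a}" "{f}"]]) (auto simp: fun_times_def)

lemma schwartz_plus: "schwartz a \<Longrightarrow> schwartz f \<Longrightarrow> schwartz (\<lambda>x. a x + f x)"
  unfolding schwartz_bounded_singleton[symmetric]
  by (rule schwartz_bounded_subset[OF schwartz_bounded_plus[of "{a}" "{f}"]]) (auto simp: fun_plus_def)

lemma schwartz_cmult: "schwartz f \<Longrightarrow> schwartz (\<lambda>x. c * f x)"
  by (intro schwartz_times moderate_const1)

lemma schwartz_uminus: "schwartz b \<Longrightarrow> schwartz (\<lambda>x. - b x)"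
  using schwartz_cmult[of b "-1"] by simp

lemma schwartz_minus: "schwartz a \<Longrightarrow> schwartz b \<Longrightarrow> schwartz (\<lambda>x. a x - b x)"
  using schwartz_plus[OF _ schwartz_uminus, of a b] by simp

lemma schwartz_zero: "schwartz (\<lambda>x. 0)"
  unfolding schwartz_bounded_singleton[symmetric]
  by (rule schwartz_bounded_coinduct[of "\<lambda>A. A = {\<lambda>x. 0}"]) (auto simp: partial_deriv_const)

lemma schwartz_sum: "(\<And>i. i \<in> I \<Longrightarrow> schwartz (a i)) \<Longrightarrow> schwartz (\<lambda>x. \<Sum>i\<in>I. a i x)"
  by (induction I rule: infinite_finite_induct) (auto intro: schwartz_zero schwartz_plus)

lemma schwartz_imp_moderate: "schwartz f \<Longrightarrow> moderate f"
  unfolding schwartz_bounded_singleton[symmetric] by (rule schwartz_bounded_imp_moderate)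

lemma schwartz_partial_deriv: "schwartz f \<Longrightarrow> schwartz (partial_deriv i f)"
  unfolding schwartz_bounded_singleton[symmetric]
  using schwartz_bounded_deriv[of "{f}"] by simp

lemma schwartz_smooth: "schwartz f \<Longrightarrow> smooth f"
  by (simp add: schwartz_def)

lemma schwartz_differentiable: "schwartz f \<Longrightarrow> f differentiable (at x)"
  by (simp add: schwartz_smooth smooth_imp_differentiable)

lemma smooth_continuous: "smooth f \<Longrightarrow> continuous_on S f"
  by (intro continuous_at_imp_continuous_on ballI differentiable_imp_continuous_within
      smooth_imp_differentiable)

lemma schwartz_continuous: "schwartz f \<Longrightarrow> continuous_on S f"
  by (simp add: schwartz_smooth smooth_continuous)

lemma has_derivative_coord: "((\<lambda>x::real^'n::finite. of_real (x $ j) :: complex) has_derivative (\<lambda>h. of_real (h $ j))) (at x)"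
  by (intro bounded_linear_imp_has_derivative bounded_linear_compose[OF bounded_linear_of_real] bounded_linear_vec_nth)

lemma moderate_coord: "moderate (\<lambda>x::real^'n::finite. of_real (x $ j))"
proof -
  define X where "X = (\<lambda>A :: (real^'n \<Rightarrow> complex) set. A = {\<lambda>x. of_real (x $ j)} \<or> (\<exists>c. A = {\<lambda>x. c}))"
  show ?thesis
  proof (rule moderate_bounded_coinduct[of X])
    show "X {\<lambda>x. of_real (x $ j)}" by (simp add: X_def)
  next
    fix A f and x :: "real^'n" assume "X A" "f \<in> A"
    then show "f differentiable (at x)"
      using differentiableI[OF has_derivative_coord[of j x]] unfolding X_def by auto
  next
    fix A assume "X A"
    then consider "A = {\<lambda>x. of_real (x $ j)}" | c where "A = {\<lambda>x. c}" unfolding X_def by blast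
    then show "\<exists>k C. \<forall>f\<in>A. \<forall>x. norm (f x) \<le> C * (1 + norm x) ^ k"
    proof cases
      case 1
      have "\<bar>x $ j\<bar> \<le> 1 * (1 + norm x) ^ 1" for x :: "real^'n"
        using component_le_norm_cart[of x j] by simp
      then show ?thesis unfolding 1 by (intro exI[of _ 1]) auto
    next
      case 2
      then show ?thesis by (intro exI[of _ 0] exI[of _ "norm c"]) auto
    qed
  next
    fix A i assume "X A"
    then consider "A = {\<lambda>x. of_real (x $ j)}" | c where "A = {\<lambda>x. c}" unfolding X_def by blast
    then show "\<exists>A'. X A' \<and> partial_deriv i ` A \<subseteq> A'"
    proof cases
      case 1
      have "partial_deriv i ` A \<subseteq> {\<lambda>x. of_real (axis i 1 $ j)}"
        unfolding 1 by (auto simp: partial_deriv_eq[OF has_derivative_coord])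
      then show ?thesis unfolding X_def by blast
    next
      case 2
      then have "partial_deriv i ` A \<subseteq> {\<lambda>x. 0}" by (auto simp: partial_deriv_const)
      then show ?thesis unfolding X_def by blast
    qed
  qed
qed

lemma inner_eq_sum_coord: "of_real (x \<bullet> y) = (\<Sum>i\<in>UNIV. of_real (x $ i) * of_real (y $ i) :: complex)"
  for x y :: "real^'n::finite"
  by (simp add: inner_vec_def)

lemma moderate_inner_self: "moderate (\<lambda>x::real^'n::finite. of_real (x \<bullet> x))"
  unfolding inner_eq_sum_coord by (intro moderate_sum moderate_times moderate_coord)

subsection \<open>Dilations and bounded linear maps of the values\<close>

lemma iter_deriv_dilation:
  fixes f :: "real^'n::finite \<Rightarrow> complex"
  assumes "smooth f"
  shows "iter_deriv ds (\<lambda>x. f (c *\<^sub>R x)) = (\<lambda>x. of_real (c ^ length ds) * iter_deriv ds f (c *\<^sub>R x))"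
proof (induction ds)
  case (Cons i ds)
  have "partial_deriv i (\<lambda>x. of_real (c ^ length ds) * iter_deriv ds f (c *\<^sub>R x)) x =
      of_real (c ^ length (i # ds)) * partial_deriv i (iter_deriv ds f) (c *\<^sub>R x)" for x
  proof -
    obtain D where D: "(iter_deriv ds f has_derivative D) (at (c *\<^sub>R x))"
      using smooth_imp_differentiable[OF smooth_iter_deriv[OF assms]] unfolding differentiable_def by blast
    have "((\<lambda>x. of_real (c ^ length ds) * iter_deriv ds f (c *\<^sub>R x)) has_derivative
        (\<lambda>h. of_real (c ^ length ds) * D (c *\<^sub>R h))) (at x)"
      by (intro has_derivative_mult_right has_derivative_scaleR_right has_derivative_ident
          has_derivative_compose[of "\<lambda>x. c *\<^sub>R x" _ x UNIV "iter_deriv ds f" D, OF _ D])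
    then have "partial_deriv i (\<lambda>x. of_real (c ^ length ds) * iter_deriv ds f (c *\<^sub>R x)) x =
        of_real (c ^ length ds) * D (c *\<^sub>R axis i 1)" by (rule partial_deriv_eq)
    also have "D (c *\<^sub>R axis i 1) = c *\<^sub>R partial_deriv i (iter_deriv ds f) (c *\<^sub>R x)"
      using D by (simp add: partial_deriv_eq[OF D] linear_cmul has_derivative_linear)
    finally show ?thesis by (simp add: scaleR_conv_of_real)
  qed
  then show ?case by (simp add: iter_deriv_Cons Cons)
qed simp

lemma iter_deriv_bounded_linear:
  fixes f :: "real^'n::finite \<Rightarrow> 'b::real_normed_vector"
  assumes "smooth f" "bounded_linear L"
  shows "iter_deriv ds (\<lambda>x. L (f x)) = (\<lambda>x. L (iter_deriv ds f x))"
proof (induction ds)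
  case (Cons i ds)
  have "partial_deriv i (\<lambda>x. L (iter_deriv ds f x)) x = L (partial_deriv i (iter_deriv ds f) x)" for x
  proof -
    obtain D where D: "(iter_deriv ds f has_derivative D) (at x)"
      using smooth_imp_differentiable[OF smooth_iter_deriv[OF assms(1)]] unfolding differentiable_def by blast
    show ?thesis
      using partial_deriv_eq[OF bounded_linear.has_derivative[OF assms(2) D]] partial_deriv_eq[OF D] by simp
  qed
  then show ?case by (simp add: iter_deriv_Cons Cons)
qed simp

lemma smooth_dilation: 
  fixes f :: "real^'n::finite \<Rightarrow> complex"
  assumes "smooth f" shows "smooth (\<lambda>x. f (c *\<^sub>R x))"
  unfolding smooth_def iter_deriv_dilation[OF assms] differentiable_on_def
proof (intro allI ballI)
  fix ds and x :: "real^'n"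
  have "iter_deriv ds f \<circ> (*\<^sub>R) c differentiable at x"
    by (intro differentiable_chain_at smooth_imp_differentiable[OF smooth_iter_deriv[OF assms]]
       bounded_linear_imp_differentiable bounded_linear_scaleR_right)
  then show "(\<lambda>x. complex_of_real (c ^ length ds) * iter_deriv ds f (c *\<^sub>R x)) differentiable at x within UNIV"
    by (intro differentiable_mult) (auto simp: o_def)
qed

lemma smooth_bounded_linear:
  fixes f :: "real^'n::finite \<Rightarrow> 'b::real_normed_vector"
  assumes "smooth f" "bounded_linear L"
  shows "smooth (\<lambda>x. L (f x))"
  unfolding smooth_def iter_deriv_bounded_linear[OF assms] differentiable_on_def
proof (intro allI ballI)
  fix ds and x :: "real^'n"
  obtain D where "(iter_deriv ds f has_derivative D) (at x)"
    using smooth_imp_differentiable[OF smooth_iter_deriv[OF assms(1)]] unfolding differentiable_def by blast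
  then show "(\<lambda>x. L (iter_deriv ds f x)) differentiable at x within UNIV"
    unfolding differentiable_def by (blast intro: bounded_linear.has_derivative[OF assms(2)])
qed

text \<open>Dilation by \<open>c\<close> multiplies a derivative of order \<open>k\<close> by \<open>c\<^sup>k\<close>, which is harmless for \<open>c \<le> 1\<close>.\<close>

lemma moderate_dilations:
  assumes "schwartz f"
  shows "moderate_bounded {\<lambda>x. f (c *\<^sub>R x) | c. 0 \<le> c \<and> c \<le> 1}"
  unfolding moderate_bounded_def
proof (intro conjI ballI allI)
  fix ds
  obtain C where C: "\<And>x. norm (iter_deriv ds f x) \<le> C"
  proof -
    have "\<exists>B. \<forall>x. (1 + norm x) ^ 0 * norm (iter_deriv ds f x) \<le> B"
      using assms unfolding schwartz_def by blast
    then show ?thesis using that by auto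
  qed
  have "norm (iter_deriv ds (\<lambda>x. f (c *\<^sub>R x)) x) \<le> C * (1 + norm x) ^ 0" if "0 \<le> c" "c \<le> 1" for c x
  proof -
    have "\<bar>c\<bar> ^ length ds * norm (iter_deriv ds f (c *\<^sub>R x)) \<le> 1 * C"
      using that C by (intro mult_mono power_le_one) auto
    then show ?thesis by (simp add: iter_deriv_dilation[OF schwartz_smooth[OF assms]] norm_mult norm_power)
  qed
  then show "\<exists>k C. \<forall>f\<in>{\<lambda>x. f (c *\<^sub>R x) |c. 0 \<le> c \<and> c \<le> 1}.
              \<forall>x. norm (iter_deriv ds f x) \<le> C * (1 + norm x) ^ k" by blast
qed (use smooth_dilation[OF schwartz_smooth[OF assms]] in blast)

lemma schwartz_bounded_reflect:
  assumes "schwartz_bounded B"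
  shows "schwartz_bounded {\<lambda>x. f (- x) | f. f \<in> B}"
  unfolding schwartz_bounded_def
proof (intro conjI ballI allI)
  fix k ds
  obtain C where C: "\<And>f x. f \<in> B \<Longrightarrow> (1 + norm x) ^ k * norm (iter_deriv ds f x) \<le> C"
    using assms unfolding schwartz_bounded_def by blast
  have "(1 + norm x) ^ k * norm (iter_deriv ds (\<lambda>x. f (- x)) x) \<le> C" if "f \<in> B" for f x
    using iter_deriv_dilation[of f ds "-1"] C[OF that, of "-x"] assms that
    by (auto simp: norm_mult norm_power schwartz_bounded_def)
  then show "\<exists>C. \<forall>f\<in>{\<lambda>x. f (- x) |f. f \<in> B}. \<forall>x. (1 + norm x) ^ k * cmod (iter_deriv ds f x) \<le> C"
    by blast
next
  fix g assume "g \<in> {\<lambda>x. f (- x) |f. f \<in> B}"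
  then obtain f where "g = (\<lambda>x. f (-1 *\<^sub>R x))" "f \<in> B" by auto
  moreover have "smooth f" using assms \<open>f \<in> B\<close> by (simp add: schwartz_bounded_def)
  ultimately show "smooth g" using smooth_dilation by blast
qed

lemma schwartz_cnj:
  assumes "schwartz f" shows "schwartz (\<lambda>x. cnj (f x))"
  using assms smooth_bounded_linear[OF _ bounded_linear_cnj, of f]
  by (auto simp: schwartz_def iter_deriv_bounded_linear[OF _ bounded_linear_cnj])

lemma iter_deriv_supp:
  fixes f :: "real^'n::finite \<Rightarrow> 'b::real_normed_vector"
  assumes "x \<notin> closure {x. f x \<noteq> 0}"
  shows "iter_deriv ds f x = 0"
  using assms
proof (induction ds arbitrary: x)
  case Nil
  then show ?case using closure_subset[of "{x. f x \<noteq> 0}"] by auto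
next
  case (Cons i ds)
  have "open (- closure {x. f x \<noteq> 0})" by auto
  then obtain e where "e > 0" "ball x e \<subseteq> - closure {x. f x \<noteq> 0}"
    using Cons.prems unfolding open_contains_ball by blast
  then have "(iter_deriv ds f has_derivative (\<lambda>h. 0)) (at x)"
    using Cons.IH
    by (intro has_derivative_transform_within[OF has_derivative_const[of 0 "at x"], of e])
       (auto simp: dist_commute subset_iff)
  then show ?case by (simp add: iter_deriv_Cons partial_deriv_eq)
qed

lemma compact_support_schwartz:
  fixes f :: "real^'n::finite \<Rightarrow> real"
  assumes f: "smooth f" and supp: "closure {x. f x \<noteq> 0} \<subseteq> cball 0 R"
  shows "schwartz (\<lambda>x. of_real (f x))"
  unfolding schwartz_def
proof (intro conjI allI)
  show "smooth (\<lambda>x. complex_of_real (f x))"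
    by (rule smooth_bounded_linear[OF f bounded_linear_of_real])
  fix k ds
  have "compact ((\<lambda>x. (1 + norm x) ^ k * norm (iter_deriv ds f x)) ` cball 0 R)"
    by (intro compact_continuous_image continuous_intros smooth_continuous smooth_iter_deriv f compact_cball)
  then obtain B where B0: "\<And>y. y \<in> (\<lambda>x. (1 + norm x) ^ k * norm (iter_deriv ds f x)) ` cball 0 R \<Longrightarrow> \<bar>y\<bar> \<le> B"
    using compact_imp_bounded bounded_real by meson
  have B: "\<bar>(1 + norm x) ^ k * norm (iter_deriv ds f x)\<bar> \<le> B" if "norm x \<le> R" for x
    by (rule B0, rule imageI) (simp add: that)
  have "(1 + norm x) ^ k * norm (iter_deriv ds f x) \<le> max B 0" for x
  proof (cases "norm x \<le> R")
    case False
    then have "x \<notin> closure {x. f x \<noteq> 0}" using supp by auto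
    then show ?thesis by (simp add: iter_deriv_supp)
  qed (use B[of x] in auto)
  then show "\<exists>B. \<forall>x. (1 + norm x) ^ k * norm (iter_deriv ds (\<lambda>x. complex_of_real (f x)) x) \<le> B"
    unfolding iter_deriv_bounded_linear[OF f bounded_linear_of_real] by auto
qed

subsection \<open>Radial multipliers\<close>

lemma has_derivative_radial:
  fixes x :: "real^'n::finite" and g :: "real \<Rightarrow> complex"
  assumes "(g has_vector_derivative g') (at (x \<bullet> x))"
  shows "((\<lambda>x. g (x \<bullet> x)) has_derivative (\<lambda>h. of_real (2 * (x \<bullet> h)) * g')) (at x)"
proof -
  have "((\<lambda>x. g (x \<bullet> x)) has_derivative (\<lambda>h. (x \<bullet> h + h \<bullet> x) *\<^sub>R g')) (at x)"
    using assms unfolding has_vector_derivative_def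
    by (intro has_derivative_compose[of "\<lambda>x. x \<bullet> x" _ x UNIV g "\<lambda>h. h *\<^sub>R g'"])
       (auto intro!: derivative_eq_intros)
  then show ?thesis by (simp add: inner_commute scaleR_conv_of_real)
qed

text \<open>The \<open>n\<close>-th entry is the \<open>n\<close>-th derivative of the entry with index \<open>0\<close>. Radial functions are handled as
  \<open>J 0 (x \<bullet> x)\<close>, which is smooth at the origin.\<close>

definition jet :: "(nat \<Rightarrow> real \<Rightarrow> complex) \<Rightarrow> bool" where
  "jet J \<longleftrightarrow> (\<forall>n y. (J n has_vector_derivative J (Suc n) y) (at y))"

lemma jetD: "jet J \<Longrightarrow> (J n has_vector_derivative J (Suc n) y) (at y)"
  by (simp add: jet_def)

text \<open>A partial derivative of \<open>J n (x \<bullet> x)\<close> is the multiplier \<open>2 x\<^sub>i\<close> times \<open>J (n + 1) (x \<bullet> x)\<close>.\<close>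

lemma radial_span:
  fixes JJ :: "(nat \<Rightarrow> real \<Rightarrow> complex) set"
  defines "Gen \<equiv> \<lambda>G :: (real^'n::finite \<Rightarrow> complex) set. \<exists>n. G = {\<lambda>x. J n (x \<bullet> x) | J. J \<in> JJ}"
  assumes jet: "\<And>J. J \<in> JJ \<Longrightarrow> jet J"
  shows "Gen G \<Longrightarrow> g \<in> G \<Longrightarrow> g differentiable (at x)"
    and "Gen G \<Longrightarrow> \<exists>H. multiplier_span Gen H \<and> partial_deriv i ` G \<subseteq> H"
proof -
  assume G: "Gen G"
  then obtain n where n: "G = {\<lambda>x. J n (x \<bullet> x) | J. J \<in> JJ}" unfolding Gen_def by blast
  define A where "A = {\<lambda>x::real^'n. of_real 2 * of_real (x $ i) :: complex}"
  define G' where "G' = {\<lambda>x::real^'n. J (Suc n) (x \<bullet> x) | J. J \<in> JJ}"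
  have "partial_deriv i g \<in> fun_times A G'" if "g \<in> G" for g
  proof -
    obtain J where J: "g = (\<lambda>x. J n (x \<bullet> x))" "J \<in> JJ" using \<open>g \<in> G\<close> n by blast
    have "partial_deriv i g x = (of_real 2 * of_real (x $ i)) * J (Suc n) (x \<bullet> x)" for x
      unfolding J using partial_deriv_eq[OF has_derivative_radial[OF jetD[OF jet[OF J(2)]]]]
      by (simp add: inner_axis)
    then show ?thesis unfolding A_def using J
      by (intro fun_timesI[of "\<lambda>x. of_real 2 * of_real (x $ i)" _ "\<lambda>x. J (Suc n) (x \<bullet> x)"]) (auto simp: G'_def)
  qed
  moreover have "multiplier_span Gen (fun_times A G')"
  proof (rule multiplier_span.mult)
    show "moderate_bounded A" unfolding A_def by (intro moderate_cmult moderate_coord)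
    show "multiplier_span Gen G'" by (rule multiplier_span.gen) (auto simp: Gen_def G'_def)
  qed
  ultimately show "\<exists>H. multiplier_span Gen H \<and> partial_deriv i ` G \<subseteq> H" by blast
  assume "g \<in> G"
  then obtain J where J: "g = (\<lambda>x. J n (x \<bullet> x))" "J \<in> JJ" using n by blast
  show "g differentiable (at x)"
    unfolding J by (rule differentiableI[OF has_derivative_radial[OF jetD[OF jet[OF J(2)]]]])
qed

lemma norm_power_le_inner: "(1 + norm x) ^ k \<le> 2 ^ k * (1 + x \<bullet> x) ^ k"
  for x :: "real^'n::finite"
proof -
  have "0 \<le> (norm x - 1)\<^sup>2" by simp
  then have "2 * norm x \<le> 1 + (norm x)\<^sup>2" by (simp add: power2_diff)
  then have "1 + norm x \<le> 2 * (1 + (norm x)\<^sup>2)"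
    using norm_ge_zero[of x] zero_le_power2[of "norm x"] unfolding distrib_left by linarith
  then have "(1 + norm x) ^ k \<le> (2 * (1 + (norm x)\<^sup>2)) ^ k" by (intro power_mono) auto
  then show ?thesis by (simp only: power_mult_distrib power2_norm_eq_inner)
qed

lemma inner_power_le_norm: "(1 + x \<bullet> x) ^ k \<le> (1 + norm x) ^ (2 * k)"
  for x :: "real^'n::finite"
proof -
  have "1 + x \<bullet> x \<le> (1 + norm x)\<^sup>2"
    by (simp add: power2_eq_square algebra_simps dot_square_norm)
  then show ?thesis unfolding power_mult by (intro power_mono) auto
qed

lemma radial_moderate:
  assumes jet: "\<And>J. J \<in> JJ \<Longrightarrow> jet J"
    and bd: "\<And>n. \<exists>k C. \<forall>J\<in>JJ. \<forall>y\<ge>0. norm (J n y) \<le> C * (1 + y) ^ k"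
  shows "moderate_bounded {\<lambda>x::real^'n::finite. J 0 (x \<bullet> x) | J. J \<in> JJ}"
proof (rule multiplier_span_moderate[OF multiplier_span.gen radial_span(1)[OF jet] radial_span(2)[OF jet]])
  show "\<exists>n. {\<lambda>x::real^'n. J 0 (x \<bullet> x) |J. J \<in> JJ} = {\<lambda>x. J n (x \<bullet> x) |J. J \<in> JJ}" by blast
next
  fix G :: "(real^'n \<Rightarrow> complex) set" assume "\<exists>n. G = {\<lambda>x. J n (x \<bullet> x) |J. J \<in> JJ}"
  then obtain n where G: "G = {\<lambda>x. J n (x \<bullet> x) |J. J \<in> JJ}" by blast
  obtain k C where C: "\<And>J y. J \<in> JJ \<Longrightarrow> y \<ge> 0 \<Longrightarrow> norm (J n y) \<le> C * (1 + y) ^ k"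
    using bd by blast
  have "norm (J n (x \<bullet> x)) \<le> \<bar>C\<bar> * (1 + norm x) ^ (2 * k)" if "J \<in> JJ" for J and x :: "real^'n"
  proof -
    have "norm (J n (x \<bullet> x)) \<le> C * (1 + x \<bullet> x) ^ k" using C[OF that] by auto
    also have "\<dots> \<le> \<bar>C\<bar> * (1 + norm x) ^ (2 * k)"
      by (intro mult_mono inner_power_le_norm) auto
    finally show ?thesis .
  qed
  then show "\<exists>k C. \<forall>f\<in>G. \<forall>x. norm (f x) \<le> C * (1 + norm x) ^ k" unfolding G by blast
qed auto

lemma radial_schwartz:
  assumes jet: "\<And>J. J \<in> JJ \<Longrightarrow> jet J"
    and bd: "\<And>n k. \<exists>C. \<forall>J\<in>JJ. \<forall>y\<ge>0. (1 + y) ^ k * norm (J n y) \<le> C"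
  shows "schwartz_bounded {\<lambda>x::real^'n::finite. J 0 (x \<bullet> x) | J. J \<in> JJ}"
proof (rule multiplier_span_schwartz[OF multiplier_span.gen radial_span(1)[OF jet] radial_span(2)[OF jet]])
  show "\<exists>n. {\<lambda>x::real^'n. J 0 (x \<bullet> x) |J. J \<in> JJ} = {\<lambda>x. J n (x \<bullet> x) |J. J \<in> JJ}" by blast
next
  fix G :: "(real^'n \<Rightarrow> complex) set" and k assume "\<exists>n. G = {\<lambda>x. J n (x \<bullet> x) |J. J \<in> JJ}"
  then obtain n where G: "G = {\<lambda>x. J n (x \<bullet> x) |J. J \<in> JJ}" by blast
  obtain C where C: "\<And>J y. J \<in> JJ \<Longrightarrow> y \<ge> 0 \<Longrightarrow> (1 + y) ^ k * norm (J n y) \<le> C"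
    using bd by blast
  have "(1 + norm x) ^ k * norm (J n (x \<bullet> x)) \<le> 2 ^ k * C" if "J \<in> JJ" for J and x :: "real^'n"
  proof -
    have "(1 + norm x) ^ k * norm (J n (x \<bullet> x)) \<le> 2 ^ k * (1 + x \<bullet> x) ^ k * norm (J n (x \<bullet> x))"
      by (intro mult_right_mono norm_power_le_inner) auto
    also have "\<dots> \<le> 2 ^ k * C" using C[OF that, of "x \<bullet> x"] by (simp add: mult.assoc)
    finally show ?thesis .
  qed
  then show "\<exists>C. \<forall>f\<in>G. \<forall>x. (1 + norm x) ^ k * norm (f x) \<le> C" unfolding G by blast
qed auto

subsection \<open>Smooth curves of multipliers\<close>

text \<open>A curve of multipliers with velocity \<open>m'\<close> whose second-order Taylor remainder is a bounded set of
  multipliers. This is the strength needed to differentiate \<open>w t (m t * f)\<close> for distributions \<open>w t\<close>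
  that are uniformly bounded on bounded sets.\<close>

definition smooth_curve ::
    "real set \<Rightarrow> (real \<Rightarrow> real^'n::finite \<Rightarrow> complex) \<Rightarrow> (real \<Rightarrow> real^'n \<Rightarrow> complex) \<Rightarrow> bool" where
  "smooth_curve S m m' \<longleftrightarrow> moderate_bounded (m ` S) \<and> moderate_bounded (m' ` S) \<and>
     (\<exists>R. moderate_bounded R \<and> (\<forall>s\<in>S. \<forall>t\<in>S. \<exists>r\<in>R. \<forall>x.
        m t x = m s x + of_real (t - s) * m' s x + of_real ((t - s)\<^sup>2) * r x))"

lemma smooth_curve_const: "moderate a \<Longrightarrow> smooth_curve S (\<lambda>_. a) (\<lambda>_ _. 0)"
  unfolding smooth_curve_def using moderate_const1[of 0]
  by (auto intro: moderate_bounded_subset intro!: exI[of _ "{\<lambda>_. 0}"])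

lemma smooth_curve_add:
  assumes "smooth_curve S m m'" "smooth_curve S n n'"
  shows "smooth_curve S (\<lambda>t x. m t x + n t x) (\<lambda>t x. m' t x + n' t x)"
proof -
  obtain R where R: "moderate_bounded R" "\<And>s t. s \<in> S \<Longrightarrow> t \<in> S \<Longrightarrow> \<exists>r\<in>R. \<forall>x.
        m t x = m s x + of_real (t - s) * m' s x + of_real ((t - s)\<^sup>2) * r x"
    using assms(1) unfolding smooth_curve_def by blast
  obtain Q where Q: "moderate_bounded Q" "\<And>s t. s \<in> S \<Longrightarrow> t \<in> S \<Longrightarrow> \<exists>r\<in>Q. \<forall>x.
        n t x = n s x + of_real (t - s) * n' s x + of_real ((t - s)\<^sup>2) * r x"
    using assms(2) unfolding smooth_curve_def by blast
  have 1: "moderate_bounded (m ` S)" "moderate_bounded (n ` S)" "moderate_bounded (m' ` S)" "moderate_bounded (n' ` S)"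
    using assms unfolding smooth_curve_def by auto
  have "\<exists>r\<in>fun_plus R Q. \<forall>x. m t x + n t x = m s x + n s x + of_real (t - s) * (m' s x + n' s x) +
             of_real ((t - s)\<^sup>2) * r x" if st: "s \<in> S" "t \<in> S" for s t
  proof -
    obtain r q where r: "r \<in> R" "\<And>x. m t x = m s x + of_real (t - s) * m' s x + of_real ((t - s)\<^sup>2) * r x"
      and q: "q \<in> Q" "\<And>x. n t x = n s x + of_real (t - s) * n' s x + of_real ((t - s)\<^sup>2) * q x"
      using R(2)[OF st] Q(2)[OF st] by blast
    show ?thesis
      by (rule bexI[OF _ fun_plusI[OF r(1) q(1) refl]]) (simp add: r(2) q(2) algebra_simps)
  qed
  moreover have "moderate_bounded ((\<lambda>t x. m t x + n t x) ` S)"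
    by (rule moderate_bounded_subset[OF moderate_bounded_plus[OF 1(1,2)]]) (auto intro: fun_plusI)
  moreover have "moderate_bounded ((\<lambda>t x. m' t x + n' t x) ` S)"
    by (rule moderate_bounded_subset[OF moderate_bounded_plus[OF 1(3,4)]]) (auto intro: fun_plusI)
  ultimately show ?thesis
    using moderate_bounded_plus[OF R(1) Q(1)] unfolding smooth_curve_def by blast
qed

lemma product_remainder:
  fixes d :: complex
  assumes "mt = ms + d * m' + d\<^sup>2 * r" "nt = ns + d * n' + d\<^sup>2 * q"
  shows "mt * nt = ms * ns + d * (m' * ns + ms * n') + d\<^sup>2 * ((r * nt + (ms * q + d * (m' * q))) + m' * n')"
proof -
  have "mt * nt = (ms + d * m') * nt + d\<^sup>2 * r * nt" by (simp add: assms(1) algebra_simps)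
  also have "(ms + d * m') * nt = (ms + d * m') * (ns + d * n' + d\<^sup>2 * q)" by (simp only: assms(2))
  finally show ?thesis by (simp add: algebra_simps power2_eq_square)
qed

lemma smooth_curve_times:
  assumes "smooth_curve S m m'" "smooth_curve S n n'" and S: "S \<subseteq> {-B..B}"
  shows "smooth_curve S (\<lambda>t x. m t x * n t x) (\<lambda>t x. m' t x * n t x + m t x * n' t x)"
proof -
  obtain R where R: "moderate_bounded R" "\<And>s t. s \<in> S \<Longrightarrow> t \<in> S \<Longrightarrow> \<exists>r\<in>R. \<forall>x.
        m t x = m s x + of_real (t - s) * m' s x + of_real ((t - s)\<^sup>2) * r x"
    using assms(1) unfolding smooth_curve_def by blast
  obtain Q where Q: "moderate_bounded Q" "\<And>s t. s \<in> S \<Longrightarrow> t \<in> S \<Longrightarrow> \<exists>r\<in>Q. \<forall>x.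
        n t x = n s x + of_real (t - s) * n' s x + of_real ((t - s)\<^sup>2) * r x"
    using assms(2) unfolding smooth_curve_def by blast
  have 1: "moderate_bounded (m ` S)" "moderate_bounded (n ` S)" "moderate_bounded (m' ` S)" "moderate_bounded (n' ` S)"
    using assms unfolding smooth_curve_def by auto
  \<comment> \<open>the remainder of a product, written with the factor at time \<open>t\<close> in the last two terms so that
     no power of the increment is left over\<close>
  define W where "W = fun_plus (fun_times R (n ` S)) (fun_plus (fun_times (m ` S) Q)
    (fun_times {\<lambda>x. c | c. norm c \<le> 2 * B} (fun_times (m' ` S) Q)))"
  define W' where "W' = fun_plus W (fun_times (m' ` S) (n' ` S))"
  have "\<exists>r\<in>W'. \<forall>x. m t x * n t x = m s x * n s x + of_real (t - s) * (m' s x * n s x + m s x * n' s x) +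
             of_real ((t - s)\<^sup>2) * r x" if st: "s \<in> S" "t \<in> S" for s t
  proof -
    obtain r q where r: "r \<in> R" "\<And>x. m t x = m s x + of_real (t - s) * m' s x + of_real ((t - s)\<^sup>2) * r x"
      and q: "q \<in> Q" "\<And>x. n t x = n s x + of_real (t - s) * n' s x + of_real ((t - s)\<^sup>2) * q x"
      using R(2)[OF st] Q(2)[OF st] by blast
    have b: "norm (of_real (t - s) :: complex) \<le> 2 * B"
    proof -
      have "s \<in> {-B..B}" "t \<in> {-B..B}" using S st by auto
      then show ?thesis unfolding norm_of_real by auto
    qed
    define w where "w = (\<lambda>x. (r x * n t x + (m s x * q x + of_real (t - s) * (m' s x * q x))) + m' s x * n' s x)"
    have "w \<in> W'" unfolding w_def W'_def W_def
      using st b r(1) q(1) by (intro fun_plusI fun_timesI refl imageI) auto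
    moreover have "m t x * n t x = m s x * n s x + of_real (t - s) * (m' s x * n s x + m s x * n' s x) +
             of_real ((t - s)\<^sup>2) * w x" for x
      unfolding w_def by (rule product_remainder[OF r(2)[of x, unfolded of_real_power] q(2)[of x, unfolded of_real_power], folded of_real_power])
    ultimately show ?thesis by blast
  qed
  moreover have "moderate_bounded W'" unfolding W'_def W_def
    by (intro moderate_bounded_plus moderate_bounded_times 1 R(1) Q(1) moderate_const)
  moreover have "moderate_bounded ((\<lambda>t x. m t x * n t x) ` S)"
    by (rule moderate_bounded_subset[OF moderate_bounded_times[OF 1(1,2)]]) (auto intro: fun_timesI)
  moreover have "moderate_bounded ((\<lambda>t x. m' t x * n t x + m t x * n' t x) ` S)"
    by (rule moderate_bounded_subset[OF moderate_bounded_plus[OF moderate_bounded_times[OF 1(3,2)] moderate_bounded_times[OF 1(1,4)]]])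
       (auto intro!: fun_plusI[OF fun_timesI fun_timesI])
  ultimately show ?thesis unfolding smooth_curve_def by blast
qed

lemma smooth_curve_id:
  assumes "S \<subseteq> {-B..B}"
  shows "smooth_curve S (\<lambda>t x::real^'n::finite. of_real t) (\<lambda>_ _. 1)"
  unfolding smooth_curve_def
proof (intro conjI exI[of _ "{\<lambda>_. 0}"])
  show "moderate_bounded ((\<lambda>t (x::real^'n). of_real t) ` S)"
    by (rule moderate_bounded_subset[OF moderate_const[of B]]) (use assms in force)
  show "moderate_bounded ((\<lambda>_ (_::real^'n). 1) ` S)"
    by (rule moderate_bounded_subset[OF moderate_const1[of 1]]) auto
qed (use moderate_const1[of 0] in auto)

lemma vector_mean_value_bound:
  fixes f :: "real \<Rightarrow> 'b::real_normed_vector"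
  assumes "\<And>x. x \<in> closed_segment a b \<Longrightarrow> (f has_vector_derivative f' x) (at x)"
    and "\<And>x. x \<in> closed_segment a b \<Longrightarrow> norm (f' x) \<le> B"
  shows "norm (f b - f a) \<le> \<bar>b - a\<bar> * B"
proof -
  have "norm (f b - f a) \<le> B * norm (b - a)"
  proof (rule differentiable_bound[of "closed_segment a b" f "\<lambda>x h. h *\<^sub>R f' x"])
    fix x assume x: "x \<in> closed_segment a b"
    show "(f has_derivative (\<lambda>h. h *\<^sub>R f' x)) (at x within closed_segment a b)"
      using assms(1)[OF x] unfolding has_vector_derivative_def by (rule has_derivative_at_withinI)
    show "onorm (\<lambda>h. h *\<^sub>R f' x) \<le> B"
      using assms(2)[OF x] by (subst onorm_scaleR_left) (auto intro: bounded_linear_ident simp: onorm_id)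
  qed auto
  then show ?thesis by (simp add: mult.commute)
qed

lemma second_order_taylor_bound:
  fixes f :: "real \<Rightarrow> 'b::real_normed_vector"
  assumes "\<And>x. x \<in> closed_segment a b \<Longrightarrow> (f has_vector_derivative f' x) (at x)"
    and "\<And>x. x \<in> closed_segment a b \<Longrightarrow> (f' has_vector_derivative f'' x) (at x)"
    and "\<And>x. x \<in> closed_segment a b \<Longrightarrow> norm (f'' x) \<le> M"
  shows "norm (f b - f a - (b - a) *\<^sub>R f' a) \<le> (b - a)\<^sup>2 * M"
proof -
  have M: "0 \<le> M" using order_trans[OF norm_ge_zero assms(3)[of a]] by simp
  have "norm (f' x - f' a) \<le> \<bar>b - a\<bar> * M" if x: "x \<in> closed_segment a b" for x
  proof -
    have sub: "closed_segment a x \<subseteq> closed_segment a b" using x by (simp add: subset_closed_segment)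
    have "norm (f' x - f' a) \<le> \<bar>x - a\<bar> * M"
      using assms(2,3) sub by (intro vector_mean_value_bound[of a x f' f'']) auto
    also have "\<bar>x - a\<bar> \<le> \<bar>b - a\<bar>" using x by (auto simp: closed_segment_eq_real_ivl split: if_splits)
    finally show ?thesis using M by (simp add: mult_right_mono)
  qed
  then have "norm (f b - f a - (b - a) *\<^sub>R f' a) \<le> norm (b - a) * (\<bar>b - a\<bar> * M)"
    using assms(1)
    by (intro vector_differentiable_bound_linearization[of "closed_segment a b"])
       (auto intro: has_vector_derivative_at_within)
  then show ?thesis by (simp add: power2_eq_square mult.assoc[symmetric] abs_mult[symmetric])
qed

lemma has_vector_derivative_mult_real: "((\<lambda>y::real. c * y) has_vector_derivative c) (at y)"
  by (auto simp flip: has_real_derivative_iff_has_vector_derivative intro!: derivative_eq_intros)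

lemma jet_dilate:
  assumes "jet D"
  shows "jet (\<lambda>n y. of_real (c ^ n) * D n (c * y))"
  unfolding jet_def
proof (intro allI)
  fix n y
  have "((\<lambda>y. D n (c * y)) has_vector_derivative (c *\<^sub>R D (Suc n) (c * y))) (at y)"
    using vector_diff_chain_at[OF has_vector_derivative_mult_real jetD[OF assms, of n "c * y"]]
    by (simp add: o_def)
  then have "((\<lambda>y. of_real (c ^ n) * D n (c * y)) has_vector_derivative
      (of_real (c ^ n) * (c *\<^sub>R D (Suc n) (c * y)))) (at y)"
    by (rule has_vector_derivative_mult_right)
  then show "((\<lambda>y. of_real (c ^ n) * D n (c * y)) has_vector_derivative
      (of_real (c ^ Suc n) * D (Suc n) (c * y))) (at y)"
    by (simp add: scaleR_conv_of_real mult_ac)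
qed

lemma jet_shift: "jet D \<Longrightarrow> jet (\<lambda>n. D (Suc n))"
  by (simp add: jet_def)

lemma moderate_dilated_jets:
  assumes "jet D" and bd: "\<And>n. \<exists>C. \<forall>y\<ge>0. norm (D n y) \<le> C"
  shows "moderate_bounded ((\<lambda>t x::real^'n::finite. D 0 (t * (x \<bullet> x))) ` {0..R})"
proof -
  define JJ where "JJ = {\<lambda>n y. of_real (t ^ n) * D n (t * y) | t. 0 \<le> t \<and> t \<le> R}"
  have "moderate_bounded {\<lambda>x::real^'n. J 0 (x \<bullet> x) | J. J \<in> JJ}"
  proof (rule radial_moderate)
    show "jet J" if "J \<in> JJ" for J using that jet_dilate[OF assms(1)] unfolding JJ_def by blast
    fix n
    obtain C where C: "\<And>y. y \<ge> 0 \<Longrightarrow> norm (D n y) \<le> C" using bd by blast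
    have "norm (of_real (t ^ n) * D n (t * y)) \<le> (R ^ n * C) * (1 + y) ^ 0" if "0 \<le> t" "t \<le> R" "y \<ge> 0" for t y
      using C[of "t * y"] that by (auto simp: norm_mult norm_power intro!: mult_mono power_mono)
    then show "\<exists>k C. \<forall>J\<in>JJ. \<forall>y\<ge>0. norm (J n y) \<le> C * (1 + y) ^ k" unfolding JJ_def by blast
  qed
  then show ?thesis by (rule moderate_bounded_subset) (auto simp: JJ_def intro!: exI[of _ "\<lambda>n y. of_real (_ ^ n) * D n (_ * y)"])
qed

text \<open>Divided by the square of the time increment, the Taylor remainder of \<open>D 0 (t * y)\<close> in \<open>t\<close> is again the
  first entry of a jet in \<open>y\<close>. Its \<open>n\<close>-th entry is the remainder of the \<open>n\<close>-th derivative and is estimated by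
  the second derivative in \<open>t\<close>, which grows at most quadratically in \<open>y\<close>.\<close>

lemma smooth_curve_radial:
  assumes D: "jet D" and bd: "\<And>n. \<exists>C. \<forall>y\<ge>0. norm (D n y) \<le> C"
  shows "smooth_curve {0..R} (\<lambda>t x::real^'n::finite. D 0 (t * (x \<bullet> x)))
           (\<lambda>t x. of_real (x \<bullet> x) * D (Suc 0) (t * (x \<bullet> x)))"
proof -
  \<comment> \<open>\<open>E n\<close> is the \<open>n\<close>-th derivative in \<open>y\<close> of \<open>D 0 (t * y)\<close>; \<open>E1\<close> and \<open>E2\<close> are its first two derivatives in \<open>t\<close>\<close>
  define E where "E = (\<lambda>n t y. of_real (t ^ n) * D n (t * y))"
  define E1 where "E1 = (\<lambda>n t y. of_real (of_nat n * t ^ (n - 1)) * D n (t * y)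
      + of_real (t ^ n * y) * D (Suc n) (t * y))"
  define E2 where "E2 = (\<lambda>n t y. of_real (of_nat n * (of_nat (n - 1) * t ^ (n - 2))) * D n (t * y)
      + of_real (2 * of_nat n * t ^ (n - 1) * y) * D (Suc n) (t * y)
      + of_real (t ^ n * y\<^sup>2) * D (Suc (Suc n)) (t * y))"
  have Dy: "((\<lambda>y. D n (t * y)) has_vector_derivative (of_real t * D (Suc n) (t * y))) (at y)" for n t y
    using vector_diff_chain_at[OF has_vector_derivative_mult_real jetD[OF D, of n "t * y"]]
    by (simp add: o_def scaleR_conv_of_real)
  have Dt: "((\<lambda>t. D n (t * y)) has_vector_derivative (of_real y * D (Suc n) (t * y))) (at t)" for n t y
    using Dy[of n y t] by (simp add: mult.commute)
  have Ey: "(E n t has_vector_derivative E (Suc n) t y) (at y)" for n t y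
    using jetD[OF jet_dilate[OF D]] by (simp add: E_def)
  have E1y: "(E1 n t has_vector_derivative E1 (Suc n) t y) (at y)" for n t y
  proof -
    have "((\<lambda>y. of_real (t ^ n * y) :: complex) has_vector_derivative of_real (t ^ n)) (at y)"
      by (rule has_vector_derivative_of_real) (auto intro!: derivative_eq_intros)
    from has_vector_derivative_add[OF has_vector_derivative_mult_right[OF Dy] has_vector_derivative_mult[OF this Dy]]
    have "(E1 n t has_vector_derivative of_real (of_nat n * t ^ (n - 1)) * (of_real t * D (Suc n) (t * y)) +
       (of_real (t ^ n * y) * (of_real t * D (Suc (Suc n)) (t * y)) + of_real (t ^ n) * D (Suc n) (t * y))) (at y)"
      unfolding E1_def by simp
    then show ?thesis unfolding E1_def
      by (cases n) (simp_all add: algebra_simps)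
  qed
  have Et: "((\<lambda>t. E n t y) has_vector_derivative E1 n t y) (at t)" for n t y
  proof -
    have "((\<lambda>t. of_real (t ^ n) :: complex) has_vector_derivative of_real (of_nat n * t ^ (n - 1))) (at t)"
      by (rule has_vector_derivative_of_real) (auto intro!: derivative_eq_intros)
    note 1 = has_vector_derivative_mult[OF this Dt]
    show ?thesis
      unfolding E_def E1_def by (rule has_vector_derivative_eq_rhs[OF 1]) (simp add: algebra_simps)
  qed
  have E1t: "((\<lambda>t. E1 n t y) has_vector_derivative E2 n t y) (at t)" for n t y
  proof -
    have "((\<lambda>t. of_real (of_nat n * t ^ (n - 1)) :: complex) has_vector_derivative
        of_real (of_nat n * (of_nat (n - 1) * t ^ (n - 2)))) (at t)"
      by (rule has_vector_derivative_of_real) (auto intro!: derivative_eq_intros simp: numeral_2_eq_2)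
    note 1 = has_vector_derivative_mult[OF this Dt]
    have "((\<lambda>t. of_real (t ^ n * y) :: complex) has_vector_derivative of_real (of_nat n * t ^ (n - 1) * y)) (at t)"
      by (rule has_vector_derivative_of_real) (auto intro!: derivative_eq_intros)
    note 2 = has_vector_derivative_mult[OF this Dt]
    show ?thesis
      unfolding E1_def E2_def
      by (rule has_vector_derivative_eq_rhs[OF has_vector_derivative_add[OF 1 2]])
         (simp add: algebra_simps power2_eq_square)
  qed
  define JJ where "JJ = {\<lambda>n y. of_real (inverse ((t - s)\<^sup>2)) * (E n t y - E n s y - of_real (t - s) * E1 n s y) | s t.
      0 \<le> s \<and> s \<le> R \<and> 0 \<le> t \<and> t \<le> R}"
  have rem: "moderate_bounded {\<lambda>x::real^'n. J 0 (x \<bullet> x) | J. J \<in> JJ}"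
  proof (rule radial_moderate)
    show "jet J" if JJ: "J \<in> JJ" for J
    proof -
      obtain s t where J: "J = (\<lambda>n y. of_real (inverse ((t - s)\<^sup>2)) * (E n t y - E n s y - of_real (t - s) * E1 n s y))"
        using JJ unfolding JJ_def by blast
      show ?thesis unfolding jet_def J
        by (intro allI has_vector_derivative_mult_right has_vector_derivative_diff Ey E1y)
    qed
    fix n
    obtain C0 where C0: "\<And>y. y \<ge> 0 \<Longrightarrow> norm (D n y) \<le> C0" using bd by blast
    obtain C1 where C1: "\<And>y. y \<ge> 0 \<Longrightarrow> norm (D (Suc n) y) \<le> C1" using bd by blast
    obtain C2 where C2: "\<And>y. y \<ge> 0 \<Longrightarrow> norm (D (Suc (Suc n)) y) \<le> C2" using bd by blast
    have Cpos: "0 \<le> C0" "0 \<le> C1" "0 \<le> C2"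
      using order_trans[OF norm_ge_zero C0[of 0]] order_trans[OF norm_ge_zero C1[of 0]]
         order_trans[OF norm_ge_zero C2[of 0]] by auto
    \<comment> \<open>a bound for all powers of \<open>t\<close> up to the \<open>n\<close>-th, also if \<open>R < 1\<close>\<close>
    define K where "K = max 1 R ^ n"
    define M where "M = of_nat n * (of_nat n * K) * C0 + 2 * of_nat n * K * C1 + K * C2"
    have K: "t ^ j \<le> K" "0 \<le> t ^ j" if "j \<le> n" "0 \<le> t" "t \<le> R" for j t
    proof -
      have "t ^ j \<le> max 1 R ^ j" using that by (intro power_mono) auto
      also have "\<dots> \<le> K" unfolding K_def using that by (intro power_increasing) auto
      finally show "t ^ j \<le> K" .
    qed (use that in auto)
    have K0: "0 \<le> K" by (simp add: K_def)
    have E2b: "norm (E2 n t y) \<le> M * (1 + y)\<^sup>2" if t: "0 \<le> t" "t \<le> R" and y: "y \<ge> 0" for t y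
    proof -
      have ty: "t * y \<ge> 0" using t y by simp
      have y1: "1 \<le> (1 + y)\<^sup>2" "y \<le> (1 + y)\<^sup>2" "y\<^sup>2 \<le> (1 + y)\<^sup>2"
        using y by (auto simp: power2_eq_square algebra_simps)
      have "norm (E2 n t y) \<le> norm (of_real (of_nat n * (of_nat (n - 1) * t ^ (n - 2))) * D n (t * y))
          + norm (of_real (2 * of_nat n * t ^ (n - 1) * y) * D (Suc n) (t * y))
          + norm (of_real (t ^ n * y\<^sup>2) * D (Suc (Suc n)) (t * y))"
        unfolding E2_def by (intro norm_triangle_le add_mono norm_triangle_ineq order_refl)
      also have "\<dots> = of_nat n * (of_nat (n - 1) * t ^ (n - 2)) * norm (D n (t * y))
          + 2 * of_nat n * t ^ (n - 1) * y * norm (D (Suc n) (t * y))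
          + t ^ n * y\<^sup>2 * norm (D (Suc (Suc n)) (t * y))"
        using t y by (simp only: norm_mult norm_of_real abs_mult) simp
      also have "\<dots> \<le> of_nat n * (of_nat n * K) * C0 + 2 * of_nat n * K * y * C1 + K * y\<^sup>2 * C2"
        using K t y C0[OF ty] C1[OF ty] C2[OF ty] Cpos K0
        by (intro add_mono mult_mono) auto
      also have "\<dots> \<le> of_nat n * (of_nat n * K) * C0 * (1 + y)\<^sup>2 + 2 * of_nat n * K * C1 * (1 + y)\<^sup>2 + K * C2 * (1 + y)\<^sup>2"
      proof (intro add_mono)
        show "of_nat n * (of_nat n * K) * C0 \<le> of_nat n * (of_nat n * K) * C0 * (1 + y)\<^sup>2"
          using mult_left_mono[OF y1(1), of "of_nat n * (of_nat n * K) * C0"] Cpos K0 by simp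
        show "2 * of_nat n * K * y * C1 \<le> 2 * of_nat n * K * C1 * (1 + y)\<^sup>2"
          using mult_left_mono[OF y1(2), of "2 * of_nat n * K * C1"] Cpos K0 by (simp add: mult_ac)
        show "K * y\<^sup>2 * C2 \<le> K * C2 * (1 + y)\<^sup>2"
          using mult_left_mono[OF y1(3), of "K * C2"] Cpos K0 by (simp add: mult_ac)
      qed
      also have "\<dots> = M * (1 + y)\<^sup>2" unfolding M_def by (simp add: algebra_simps)
      finally show ?thesis .
    qed
    have "norm (of_real (inverse ((t - s)\<^sup>2)) * (E n t y - E n s y - of_real (t - s) * E1 n s y)) \<le> M * (1 + y) ^ 2"
      if st: "0 \<le> s" "s \<le> R" "0 \<le> t" "t \<le> R" and y: "y \<ge> 0" for s t y
    proof (cases "s = t")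
      case True
      have "0 \<le> M * (1 + y)\<^sup>2" using order_trans[OF norm_ge_zero E2b[OF st(1,2) y]] .
      then show ?thesis using True by simp
    next
      case False
      have "norm (E n t y - E n s y - (t - s) *\<^sub>R E1 n s y) \<le> (t - s)\<^sup>2 * (M * (1 + y)\<^sup>2)"
        using st y
        by (intro second_order_taylor_bound[of s t "\<lambda>t. E n t y" "\<lambda>t. E1 n t y" "\<lambda>t. E2 n t y"] Et E1t E2b)
           (auto simp: closed_segment_eq_real_ivl split: if_splits)
      then show ?thesis using False
        by (simp add: norm_mult norm_inverse norm_power scaleR_conv_of_real norm_divide field_simps flip: of_real_diff)
    qed
    then show "\<exists>k C. \<forall>J\<in>JJ. \<forall>y\<ge>0. norm (J n y) \<le> C * (1 + y) ^ k" unfolding JJ_def by blast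
  qed
  have m': "moderate_bounded ((\<lambda>t x::real^'n. of_real (x \<bullet> x) * D (Suc 0) (t * (x \<bullet> x))) ` {0..R})"
  proof (rule moderate_bounded_subset[OF moderate_bounded_times[OF moderate_inner_self
          moderate_dilated_jets[OF jet_shift[OF D], of R]]])
    show "\<exists>C. \<forall>y\<ge>0. norm (D (Suc n) y) \<le> C" for n by (rule bd)
    show "(\<lambda>t x::real^'n. of_real (x \<bullet> x) * D (Suc 0) (t * (x \<bullet> x))) ` {0..R} \<subseteq>
      fun_times {\<lambda>x. of_real (x \<bullet> x)} ((\<lambda>t x. D (Suc 0) (t * (x \<bullet> x))) ` {0..R})"
      by (rule image_subsetI, rule fun_timesI[OF singletonI imageI]) auto
  qed
  have "\<exists>r\<in>{\<lambda>x::real^'n. J 0 (x \<bullet> x) | J. J \<in> JJ}. \<forall>x. D 0 (t * (x \<bullet> x)) = D 0 (s * (x \<bullet> x)) +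
      of_real (t - s) * (of_real (x \<bullet> x) * D (Suc 0) (s * (x \<bullet> x))) + of_real ((t - s)\<^sup>2) * r x"
    if st: "s \<in> {0..R}" "t \<in> {0..R}" for s t
  proof -
    define J where "J = (\<lambda>n y. of_real (inverse ((t - s)\<^sup>2)) * (E n t y - E n s y - of_real (t - s) * E1 n s y))"
    have "J \<in> JJ" using st unfolding J_def JJ_def by auto
    moreover have "D 0 (t * (x \<bullet> x)) = D 0 (s * (x \<bullet> x)) +
      of_real (t - s) * (of_real (x \<bullet> x) * D (Suc 0) (s * (x \<bullet> x))) + of_real ((t - s)\<^sup>2) * J 0 (x \<bullet> x)" for x :: "real^'n"
    proof (cases "s = t")
      case False
      then show ?thesis by (simp add: J_def E_def E1_def field_simps flip: of_real_diff)
    qed simp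
    ultimately show ?thesis by (intro bexI[of _ "\<lambda>x. J 0 (x \<bullet> x)"]) blast+
  qed
  then show ?thesis
    using moderate_dilated_jets[OF D bd, of R] m' rem unfolding smooth_curve_def by blast
qed

subsection \<open>Characters\<close>

lemma has_derivative_cis_inner:
  "((\<lambda>x::real^'n::finite. c * cis (y \<bullet> x)) has_derivative (\<lambda>h. c * (\<i> * of_real (y \<bullet> h) * cis (y \<bullet> x)))) (at x)"
  by (auto intro!: derivative_eq_intros simp: scaleR_conv_of_real)

lemma moderate_characters:
  "moderate_bounded {\<lambda>x::real^'n::finite. c * cis (y \<bullet> x) | c y. norm c \<le> K \<and> norm y \<le> R}"
proof (rule moderate_bounded_coinduct[of "\<lambda>A. \<exists>K. A = {\<lambda>x. c * cis (y \<bullet> x) | c y. norm c \<le> K \<and> norm y \<le> R}"])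
  fix A :: "(real^'n \<Rightarrow> complex) set" and i
  assume "\<exists>K. A = {\<lambda>x. c * cis (y \<bullet> x) | c y. norm c \<le> K \<and> norm y \<le> R}"
  then obtain K where A: "A = {\<lambda>x. c * cis (y \<bullet> x) | c y. norm c \<le> K \<and> norm y \<le> R}" by blast
  have "\<exists>c' y'. partial_deriv i (\<lambda>x. c * cis (y \<bullet> x)) = (\<lambda>x. c' * cis (y' \<bullet> x)) \<and> norm c' \<le> K * R \<and> norm y' \<le> R"
    if cy: "norm c \<le> K" "norm y \<le> R" for c and y :: "real^'n"
  proof (intro exI conjI)
    show "partial_deriv i (\<lambda>x. c * cis (y \<bullet> x)) = (\<lambda>x. (c * \<i> * of_real (y $ i)) * cis (y \<bullet> x))"
      using partial_deriv_eq[OF has_derivative_cis_inner[of c y]] by (auto simp: inner_axis)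
    show "norm (c * \<i> * of_real (y $ i)) \<le> K * R"
      using cy component_le_norm_cart[of y i] order_trans[OF norm_ge_zero cy(1)]
      by (auto simp: norm_mult intro!: mult_mono)
  qed (rule cy)
  then have "partial_deriv i ` A \<subseteq> {\<lambda>x. c * cis (y \<bullet> x) | c y. norm c \<le> K * R \<and> norm y \<le> R}"
    unfolding A image_subset_iff by blast
  then show "\<exists>A'. (\<exists>K. A' = {\<lambda>x. c * cis (y \<bullet> x) | c y. norm c \<le> K \<and> norm y \<le> R}) \<and> partial_deriv i ` A \<subseteq> A'"
    by blast
next
  fix A :: "(real^'n \<Rightarrow> complex) set"
  assume "\<exists>K. A = {\<lambda>x. c * cis (y \<bullet> x) | c y. norm c \<le> K \<and> norm y \<le> R}"
  then obtain K where A: "A = {\<lambda>x. c * cis (y \<bullet> x) | c y. norm c \<le> K \<and> norm y \<le> R}" by blast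
  show "\<exists>k C. \<forall>f\<in>A. \<forall>x. norm (f x) \<le> C * (1 + norm x) ^ k"
    by (intro exI[of _ 0] exI[of _ K]) (auto simp: A norm_mult)
qed (auto intro: differentiableI[OF has_derivative_cis_inner])

lemma moderate_character: "moderate (\<lambda>x::real^'n::finite. cis (y \<bullet> x))"
  by (rule moderate_bounded_subset[OF moderate_characters[of 1 "norm y"]]) (auto intro!: exI[of _ 1] exI[of _ y])

lemma norm_cis_diff_le: "norm (cis a - 1) \<le> \<bar>a\<bar>"
  using vector_mean_value_bound[of 0 a cis "\<lambda>x. \<i> * cis x" 1]
  using has_derivative_cis[OF has_derivative_ident] by (auto simp: norm_mult has_vector_derivative_def)

text \<open>Difference quotients of characters grow linearly, but their derivatives are characters with
  bounded coefficients.\<close>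

lemma moderate_character_differences:
  "moderate_bounded {\<lambda>x::real^'n::finite. (cis (h \<bullet> x) - 1) / of_real (norm h) | h. norm h \<le> 1}" (is "moderate_bounded ?D")
proof -
  define Ch where "Ch = {\<lambda>x::real^'n. c * cis (y \<bullet> x) | c y. norm c \<le> 1 \<and> norm y \<le> 1}"
  define X where "X = (\<lambda>A. A = ?D \<or> moderate_bounded A)"
  have D: "((\<lambda>x. (cis (h \<bullet> x) - 1) / of_real (norm h)) has_derivative
     (\<lambda>k. (\<i> * of_real (h \<bullet> k) * cis (h \<bullet> x)) / of_real (norm h))) (at x)" for h x :: "real^'n"
    using has_derivative_cis_inner[of 1 h x]
    by (auto intro!: derivative_eq_intros simp: divide_inverse scaleR_conv_of_real mult_ac)
  show ?thesis
  proof (rule moderate_bounded_coinduct[of X])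
    fix A assume "X A"
    have "norm ((cis (h \<bullet> x) - 1) / of_real (norm h)) \<le> 1 * (1 + norm x) ^ 1" for h x :: "real^'n"
    proof (cases "h = 0")
      case False
      have "norm (cis (h \<bullet> x) - 1) \<le> norm h * norm x"
        by (rule order_trans[OF norm_cis_diff_le Cauchy_Schwarz_ineq2])
      then have "norm (cis (h \<bullet> x) - 1) / norm h \<le> norm x" using False by (simp add: field_simps)
      then show ?thesis by (simp add: norm_divide)
    qed simp
    then show "\<exists>k C. \<forall>f\<in>A. \<forall>x. norm (f x) \<le> C * (1 + norm x) ^ k"
      using \<open>X A\<close> moderate_bounded_bound unfolding X_def by blast
  next
    fix A i assume "X A"
    have "partial_deriv i (\<lambda>x. (cis (h \<bullet> x) - 1) / of_real (norm h)) \<in> Ch" if "norm h \<le> 1" for h :: "real^'n"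
    proof -
      have "partial_deriv i (\<lambda>x. (cis (h \<bullet> x) - 1) / of_real (norm h)) =
         (\<lambda>x. (\<i> * of_real (h $ i) / of_real (norm h)) * cis (h \<bullet> x))"
        using partial_deriv_eq[OF D[of h]] by (auto simp: inner_axis)
      moreover have "norm (\<i> * of_real (h $ i) / of_real (norm h)) \<le> 1"
        using component_le_norm_cart[of h i] by (simp add: norm_mult norm_divide divide_le_eq_1)
      ultimately show ?thesis using that unfolding Ch_def by blast
    qed
    then have "partial_deriv i ` ?D \<subseteq> Ch" by blast
    moreover have "X Ch" unfolding X_def Ch_def using moderate_characters by blast
    ultimately show "\<exists>A'. X A' \<and> partial_deriv i ` A \<subseteq> A'"
      using \<open>X A\<close> moderate_bounded_deriv unfolding X_def by blast
  next
    fix A f and x :: "real^'n" assume "X A" "f \<in> A"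
    then show "f differentiable (at x)"
      unfolding X_def using differentiableI[OF D] smooth_imp_differentiable unfolding moderate_bounded_def by blast
  qed (simp add: X_def)
qed

section \<open>The Fourier transform of Schwartz functions\<close>

subsection \<open>Integrability\<close>

text \<open>A product over the coordinates, so that its integral reduces to the one of \<open>1 / (1 + y\<^sup>2)\<close>, but still
  bounded below by a negative power of \<open>1 + \<bar>x\<bar>\<close>.\<close>

definition decay_weight :: "real^'n::finite \<Rightarrow> real" where
  "decay_weight x = (\<Prod>b\<in>Basis. inverse (1 + (x \<bullet> b)\<^sup>2))"

lemma decay_weight_nonneg: "0 \<le> decay_weight x"
  unfolding decay_weight_def by (intro prod_nonneg) auto

lemma borel_measurable_decay_weight [measurable]: "decay_weight \<in> borel_measurable borel"
  unfolding decay_weight_def[abs_def] by measurable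

lemma integrable_decay_weight: "integrable lborel (decay_weight :: real^'n::finite \<Rightarrow> real)"
proof (rule integrableI_nonneg)
  have 1: "integrable lborel (\<lambda>x::real. inverse (1 + x\<^sup>2))"
    using integrable_inverse_1_plus_square by (simp add: set_integrable_def)
  have "(\<integral>\<^sup>+ x. ennreal (decay_weight x) \<partial>(lborel :: (real^'n) measure)) =
      (\<integral>\<^sup>+ x. (\<Prod>b\<in>Basis. (\<lambda>y. ennreal (inverse (1 + y\<^sup>2))) (x \<bullet> b)) \<partial>(lborel :: (real^'n) measure))"
    unfolding decay_weight_def by (simp add: prod_ennreal)
  also have "\<dots> = (\<Prod>b\<in>(Basis :: (real^'n) set). (\<integral>\<^sup>+ x. ennreal (inverse (1 + x\<^sup>2)) \<partial>lborel))"
    by (rule nn_integral_lborel_prod) auto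
  also have "\<dots> < \<infinity>"
    using 1 by (auto simp: nn_integral_eq_integral ennreal_power ennreal_less_top)
  finally show "(\<integral>\<^sup>+ x. ennreal (decay_weight x) \<partial>(lborel :: (real^'n) measure)) < \<infinity>" .
qed (auto simp: decay_weight_nonneg)

lemma decay_weight_lower: "1 \<le> (1 + norm x) ^ (2 * CARD('n)) * decay_weight (x :: real^'n::finite)"
proof -
  have "1 + (x \<bullet> b)\<^sup>2 \<le> (1 + norm x)\<^sup>2" if "b \<in> Basis" for b
  proof -
    have "(x \<bullet> b)\<^sup>2 \<le> (norm x)\<^sup>2" using Basis_le_norm[OF that, of x] by (simp add: abs_le_square_iff[symmetric])
    moreover have "(1 + norm x)\<^sup>2 = 1 + (norm x)\<^sup>2 + 2 * norm x" by (simp add: power2_sum)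
    ultimately show ?thesis using norm_ge_zero[of x] by linarith
  qed
  then have "(\<Prod>b\<in>Basis. 1 + (x \<bullet> b)\<^sup>2) \<le> (\<Prod>b\<in>(Basis :: (real^'n) set). (1 + norm x)\<^sup>2)"
    by (intro prod_mono) auto
  also have "\<dots> = (1 + norm x) ^ (2 * CARD('n))" by (simp add: power_mult)
  finally have *: "(\<Prod>b\<in>Basis. 1 + (x \<bullet> b)\<^sup>2) \<le> (1 + norm x) ^ (2 * CARD('n))" .
  have pos: "0 < (\<Prod>b\<in>Basis. 1 + (x \<bullet> b)\<^sup>2)" by (intro prod_pos) (auto intro: add_pos_nonneg)
  have "1 = (\<Prod>b\<in>Basis. 1 + (x \<bullet> b)\<^sup>2) * decay_weight x"
  proof -
    have "decay_weight x = inverse (\<Prod>b\<in>Basis. 1 + (x \<bullet> b)\<^sup>2)"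
      using prod_inversef[of "\<lambda>b. 1 + (x \<bullet> b)\<^sup>2" Basis] unfolding decay_weight_def o_def by simp
    then show ?thesis using pos by (metis less_irrefl right_inverse)
  qed
  also have "\<dots> \<le> (1 + norm x) ^ (2 * CARD('n)) * decay_weight x"
    by (rule mult_right_mono[OF * decay_weight_nonneg])
  finally show ?thesis .
qed

lemma decay_bound:
  fixes x :: "real^'n::finite"
  assumes "(1 + norm x) ^ (2 * CARD('n)) * a \<le> C" "0 \<le> a"
  shows "a \<le> C * decay_weight x"
proof -
  have "a \<le> a * ((1 + norm x) ^ (2 * CARD('n)) * decay_weight x)"
    using mult_left_mono[OF decay_weight_lower[of x] assms(2)] by simp
  also have "\<dots> = ((1 + norm x) ^ (2 * CARD('n)) * a) * decay_weight x" by simp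
  also have "\<dots> \<le> C * decay_weight x" by (rule mult_right_mono[OF assms(1) decay_weight_nonneg])
  finally show ?thesis .
qed

lemma schwartz_bounded_decay:
  fixes B :: "(real^'n::finite \<Rightarrow> complex) set"
  assumes "schwartz_bounded B"
  shows "\<exists>C\<ge>0. \<forall>f\<in>B. \<forall>x. norm (f x) \<le> C * decay_weight x"
proof -
  obtain C where C: "\<And>f x. f \<in> B \<Longrightarrow> (1 + norm x) ^ (2 * CARD('n)) * norm (f x) \<le> C"
    using schwartz_bounded_bound[OF assms] by blast
  have "norm (f x) \<le> \<bar>C\<bar> * decay_weight x" if "f \<in> B" for f x
    using C[OF that, of x] by (intro decay_bound) auto
  then show ?thesis by (intro exI[of _ "\<bar>C\<bar>"]) auto
qed

lemma schwartz_measurable: "schwartz f \<Longrightarrow> f \<in> borel_measurable borel"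
  by (intro borel_measurable_continuous_onI schwartz_continuous)

lemma schwartz_integrable: 
  assumes "schwartz f" shows "integrable lborel f"
proof -
  obtain C where C: "\<And>x. norm (f x) \<le> C * decay_weight x"
    using schwartz_bounded_decay[of "{f}"] assms by (auto simp: schwartz_bounded_singleton)
  show ?thesis
    by (rule Bochner_Integration.integrable_bound[OF integrable_mult_right[OF integrable_decay_weight, of C]])
       (use C schwartz_measurable[OF assms] in \<open>auto intro!: always_eventually order_trans[OF C]\<close>)
qed

lemma schwartz_bounded_L1:
  fixes B :: "(real^'n::finite \<Rightarrow> complex) set"
  assumes "schwartz_bounded B"
  shows "\<exists>C. \<forall>f\<in>B. (LINT x|lborel. norm (f x)) \<le> C"
proof -
  obtain C where C: "\<And>f x. f \<in> B \<Longrightarrow> norm (f x) \<le> C * decay_weight x"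
    using schwartz_bounded_decay[OF assms] by blast
  have "(LINT x|lborel. norm (f x)) \<le> (LINT x|lborel. C * decay_weight (x :: real^'n))" if "f \<in> B" for f
    using C[OF that] integrable_decay_weight schwartz_integrable[OF schwartz_bounded_imp_schwartz[OF assms that]]
    by (intro integral_mono) auto
  then show ?thesis by blast
qed

lemma character_integrable:
  "integrable lborel f \<Longrightarrow> integrable lborel (\<lambda>x::real^'n::finite. cis (- (x \<bullet> \<xi>)) * f x)"
  by (rule Bochner_Integration.integrable_bound[of _ f]) (auto simp: norm_mult cis_conv_exp)

lemma norm_fourier_le: "norm (fourier f \<xi>) \<le> (LINT x|lborel. norm (f x))"
  unfolding fourier_def
  by (rule order_trans[OF integral_norm_bound]) (simp add: norm_mult)

subsection \<open>Fourier transform and derivatives\<close>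

lemma norm_cis_second_order: "norm (cis a - 1 - \<i> * of_real a) \<le> a\<^sup>2"
proof -
  have 1: "(cis has_vector_derivative (\<i> * cis x)) (at x)" for x
    using has_derivative_cis[OF has_derivative_ident] by (simp add: has_vector_derivative_def)
  have "norm (cis a - cis 0 - (a - 0) *\<^sub>R (\<i> * cis 0)) \<le> (a - 0)\<^sup>2 * 1"
    by (rule second_order_taylor_bound[OF 1 has_vector_derivative_mult_right[OF 1]]) (simp add: norm_mult)
  then show ?thesis by (simp add: scaleR_conv_of_real mult.commute)
qed

lemma fourier_add:
  "integrable lborel f \<Longrightarrow> integrable lborel g \<Longrightarrow> fourier (\<lambda>x. f x + g x) \<xi> = fourier f \<xi> + fourier g \<xi>"
  unfolding fourier_def distrib_left
  by (intro Bochner_Integration.integral_add character_integrable)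

lemma fourier_cmult: "fourier (\<lambda>x. c * f x) \<xi> = c * fourier f \<xi>"
proof -
  have "(\<lambda>x. cis (- (x \<bullet> \<xi>)) * (c * f x)) = (\<lambda>x. c * (cis (- (x \<bullet> \<xi>)) * f x))" by (simp add: mult_ac)
  then show ?thesis unfolding fourier_def by simp
qed

lemma fourier_sum:
  "finite I \<Longrightarrow> (\<And>i. i \<in> I \<Longrightarrow> integrable lborel (f i)) \<Longrightarrow>
   fourier (\<lambda>x. \<Sum>i\<in>I. f i x) \<xi> = (\<Sum>i\<in>I. fourier (f i) \<xi>)"
  unfolding fourier_def sum_distrib_left
  by (intro Bochner_Integration.integral_sum character_integrable)

text \<open>The error of the first-order expansion of the character is at most \<open>\<bar>x\<bar>\<^sup>2 \<bar>h\<bar>\<^sup>2\<close>, and \<open>\<bar>x\<bar>\<^sup>2 f\<close> is integrable.\<close>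

lemma fourier_has_derivative:
  fixes f :: "real^'n::finite \<Rightarrow> complex"
  assumes f: "schwartz f"
  shows "(fourier f has_derivative
     (\<lambda>h. \<Sum>i\<in>UNIV. of_real (h $ i) * fourier (\<lambda>x. - \<i> * of_real (x $ i) * f x) \<xi>)) (at \<xi>)"
proof -
  define C where "C = (LINT x|lborel. norm (of_real (x \<bullet> x) * f x))"
  have S: "schwartz (\<lambda>x. - \<i> * of_real (x $ i) * f x)" for i
    by (intro schwartz_times moderate_cmult moderate_coord f)
  have S2: "schwartz (\<lambda>x. of_real (x \<bullet> x) * f x)" by (intro schwartz_times moderate_inner_self f)
  show ?thesis
  proof (rule has_derivativeI_sandwich[of 1 _ _ _ _ "\<lambda>y. norm (y - \<xi>) * C"])
    show "bounded_linear (\<lambda>h. \<Sum>i\<in>UNIV. of_real (h $ i) * fourier (\<lambda>x. - \<i> * of_real (x $ i) * f x) \<xi>)"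
      by (intro bounded_linear_sum bounded_linear_mult_const bounded_linear_compose[OF bounded_linear_of_real]
          bounded_linear_vec_nth)
    show "((\<lambda>y. norm (y - \<xi>) * C) \<longlongrightarrow> 0) (at \<xi>)"
      by (auto intro!: tendsto_eq_intros)
    fix y assume "y \<noteq> \<xi>"
    define h where "h = y - \<xi>"
    have "(\<Sum>i\<in>UNIV. of_real (h $ i) * fourier (\<lambda>x. - \<i> * of_real (x $ i) * f x) \<xi>) =
        (\<Sum>i\<in>UNIV. fourier (\<lambda>x. of_real (h $ i) * (- \<i> * of_real (x $ i) * f x)) \<xi>)"
      by (simp only: fourier_cmult)
    also have "\<dots> = fourier (\<lambda>x. \<Sum>i\<in>UNIV. of_real (h $ i) * (- \<i> * of_real (x $ i) * f x)) \<xi>"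
      by (rule fourier_sum[symmetric]) (rule finite, rule schwartz_integrable[OF schwartz_cmult[OF S]])
    also have "(\<lambda>x. \<Sum>i\<in>UNIV. of_real (h $ i) * (- \<i> * of_real (x $ i) * f x)) = (\<lambda>x. - \<i> * of_real (x \<bullet> h) * f x)"
      unfolding inner_eq_sum_coord sum_distrib_left sum_distrib_right by (simp add: mult_ac)
    finally have lin: "(\<Sum>i\<in>UNIV. of_real (h $ i) * fourier (\<lambda>x. - \<i> * of_real (x $ i) * f x) \<xi>) =
        (LINT x|lborel. cis (- (x \<bullet> \<xi>)) * (- \<i> * of_real (x \<bullet> h) * f x))" by (simp add: fourier_def)
    have inth: "integrable lborel (\<lambda>x. - \<i> * of_real (x \<bullet> h) * f x)"
    proof -
      have "schwartz (\<lambda>x. - \<i> * of_real (x \<bullet> h) * f x)"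
        unfolding inner_eq_sum_coord
        by (intro schwartz_times moderate_cmult moderate_sum moderate_times moderate_coord moderate_const1 f)
      then show ?thesis by (rule schwartz_integrable)
    qed
    note I1 = character_integrable[OF schwartz_integrable[OF f]]
    note I2 = character_integrable[OF inth]
    have "(fourier f y - fourier f \<xi>) - (LINT x|lborel. cis (- (x \<bullet> \<xi>)) * (- \<i> * of_real (x \<bullet> h) * f x)) =
       (LINT x|lborel. cis (- (x \<bullet> y)) * f x - cis (- (x \<bullet> \<xi>)) * f x - cis (- (x \<bullet> \<xi>)) * (- \<i> * of_real (x \<bullet> h) * f x))"
      unfolding fourier_def
      by (simp only: Bochner_Integration.integral_diff[OF Bochner_Integration.integrable_diff[OF I1 I1] I2]
          Bochner_Integration.integral_diff[OF I1 I1])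
    also have "norm \<dots> \<le> (LINT x|lborel. (norm h)\<^sup>2 * norm (of_real (x \<bullet> x) * f x))"
    proof (rule order_trans[OF integral_norm_bound], rule integral_mono)
      show "integrable lborel (\<lambda>x. norm (cis (- (x \<bullet> y)) * f x - cis (- (x \<bullet> \<xi>)) * f x - cis (- (x \<bullet> \<xi>)) * (- \<i> * of_real (x \<bullet> h) * f x)))"
        by (intro integrable_norm Bochner_Integration.integrable_diff character_integrable schwartz_integrable f inth)
      show "integrable lborel (\<lambda>x. (norm h)\<^sup>2 * norm (of_real (x \<bullet> x) * f x))"
        by (intro integrable_mult_right integrable_norm schwartz_integrable S2)
      fix x :: "real^'n"
      have "cis (- (x \<bullet> y)) = cis (- (x \<bullet> \<xi>)) * cis (- (x \<bullet> h))"
        by (simp add: h_def cis_mult inner_diff_right)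
      then have "cis (- (x \<bullet> y)) * f x - cis (- (x \<bullet> \<xi>)) * f x - cis (- (x \<bullet> \<xi>)) * (- \<i> * of_real (x \<bullet> h) * f x)
          = cis (- (x \<bullet> \<xi>)) * (cis (- (x \<bullet> h)) - 1 - \<i> * of_real (- (x \<bullet> h))) * f x"
        by (simp add: algebra_simps)
      then have "norm (cis (- (x \<bullet> y)) * f x - cis (- (x \<bullet> \<xi>)) * f x - cis (- (x \<bullet> \<xi>)) * (- \<i> * of_real (x \<bullet> h) * f x))
          = norm (cis (- (x \<bullet> h)) - 1 - \<i> * of_real (- (x \<bullet> h))) * norm (f x)"
        by (simp add: norm_mult)
      also have "\<dots> \<le> ((norm h)\<^sup>2 * (x \<bullet> x)) * norm (f x)"
      proof (rule mult_right_mono)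
        have "norm (cis (- (x \<bullet> h)) - 1 - \<i> * of_real (- (x \<bullet> h))) \<le> (- (x \<bullet> h))\<^sup>2"
          by (rule norm_cis_second_order)
        also have "\<dots> \<le> (norm h)\<^sup>2 * (x \<bullet> x)"
          using Cauchy_Schwarz_ineq[of x h] by (simp add: power2_norm_eq_inner mult.commute)
        finally show "norm (cis (- (x \<bullet> h)) - 1 - \<i> * of_real (- (x \<bullet> h))) \<le> (norm h)\<^sup>2 * (x \<bullet> x)" .
      qed simp
      finally show "norm (cis (- (x \<bullet> y)) * f x - cis (- (x \<bullet> \<xi>)) * f x - cis (- (x \<bullet> \<xi>)) * (- \<i> * of_real (x \<bullet> h) * f x))
         \<le> (norm h)\<^sup>2 * norm (of_real (x \<bullet> x) * f x)" by (simp add: norm_mult mult_ac)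
    qed
    also have "\<dots> = (norm h)\<^sup>2 * C" unfolding C_def by simp
    finally show "norm (fourier f y - fourier f \<xi> -
          (\<Sum>i\<in>UNIV. of_real ((y - \<xi>) $ i) * fourier (\<lambda>x. - \<i> * of_real (x $ i) * f x) \<xi>)) / norm (y - \<xi>)
        \<le> norm (y - \<xi>) * C"
      using \<open>y \<noteq> \<xi>\<close> unfolding h_def[symmetric] lin by (simp add: h_def divide_le_eq power2_eq_square mult_ac)
  qed simp
qed

lemma partial_deriv_fourier:
  assumes f: "schwartz f"
  shows "partial_deriv i (fourier f) = fourier (\<lambda>x. - \<i> * of_real (x $ i) * f x)"
proof
  show "partial_deriv i (fourier f) \<xi> = fourier (\<lambda>x. - \<i> * of_real (x $ i) * f x) \<xi>" for \<xi>
    unfolding partial_deriv_eq[OF fourier_has_derivative[OF f]]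
    by (subst sum.remove[of _ i]) (auto simp: axis_def intro!: sum.neutral)
qed

lemma integral_translate:
  fixes f :: "real^'n::finite \<Rightarrow> complex"
  assumes [measurable]: "f \<in> borel_measurable borel" and "c \<noteq> 0"
  shows "(LINT x|lborel. f x) = of_real (\<bar>c\<bar> ^ CARD('n)) * (LINT x|lborel. f (a + c *\<^sub>R x))"
proof -
  have "(LINT x|lborel. f x) = (LINT x|density (distr lborel borel (\<lambda>x. a + c *\<^sub>R x)) (\<lambda>_. \<bar>c\<bar> ^ CARD('n)). f x)"
    by (subst lborel_affine[OF assms(2), of a]) simp
  also have "\<dots> = (LINT x|distr lborel borel (\<lambda>x. a + c *\<^sub>R x). (\<bar>c\<bar> ^ CARD('n)) *\<^sub>R f x)"
    by (rule integral_density) auto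
  also have "\<dots> = (LINT x|lborel. (\<bar>c\<bar> ^ CARD('n)) *\<^sub>R f (a + c *\<^sub>R x))"
    by (rule integral_distr) auto
  also have "\<dots> = (\<bar>c\<bar> ^ CARD('n)) *\<^sub>R (LINT x|lborel. f (a + c *\<^sub>R x))" by simp
  finally show ?thesis unfolding scaleR_conv_of_real[where 'a=complex] .
qed

lemma partial_deriv_line:
  fixes f :: "real^'n::finite \<Rightarrow> complex"
  assumes "smooth f"
  shows "((\<lambda>s. f (x + s *\<^sub>R axis i 1)) has_vector_derivative partial_deriv i f (x + s *\<^sub>R axis i 1)) (at s)"
proof -
  obtain D where D: "(f has_derivative D) (at (x + s *\<^sub>R axis i 1))"
    using smooth_imp_differentiable[OF assms] unfolding differentiable_def by blast
  have "((\<lambda>s. f (x + s *\<^sub>R axis i 1)) has_derivative (\<lambda>h. D (h *\<^sub>R axis i 1))) (at s)"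
    by (rule has_derivative_compose[of "\<lambda>s. x + s *\<^sub>R axis i 1" _ s UNIV f D, OF _ D])
       (auto intro!: derivative_eq_intros)
  then show ?thesis
    using D unfolding has_vector_derivative_def partial_deriv_eq[OF D]
    by (simp add: linear_cmul has_derivative_linear)
qed

lemma vector_derivative_quotient_limit:
  fixes f :: "real \<Rightarrow> 'b::real_normed_vector"
  assumes "(f has_vector_derivative v) (at 0)" and "f 0 = a"
  shows "((\<lambda>s. (f s - a) /\<^sub>R s) \<longlongrightarrow> v) (at 0)"
proof (rule LIM_zero_cancel, rule tendsto_norm_zero_cancel)
  have "((\<lambda>h. norm (f (0 + h) - f 0 - h *\<^sub>R v) / norm h) \<longlongrightarrow> 0) (at 0)"
    using assms(1) unfolding has_vector_derivative_def has_derivative_at by blast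
  moreover have "norm (f (0 + h) - f 0 - h *\<^sub>R v) / norm h = norm ((f h - a) /\<^sub>R h - v)" if "h \<noteq> 0" for h
  proof -
    have "(f h - a) /\<^sub>R h - v = (f (0 + h) - f 0 - h *\<^sub>R v) /\<^sub>R h"
      using that by (simp add: assms(2) scaleR_diff_right)
    then show ?thesis by (simp add: divide_inverse mult.commute)
  qed
  then have "\<forall>\<^sub>F h in at 0. norm (f (0 + h) - f 0 - h *\<^sub>R v) / norm h = norm ((f h - a) /\<^sub>R h - v)"
    by (auto simp: eventually_at_filter)
  ultimately show "((\<lambda>h. norm ((f h - a) /\<^sub>R h - v)) \<longlongrightarrow> 0) (at 0)"
    by (rule Lim_transform_eventually)
qed

text \<open>The integrals of difference quotients vanish because the Lebesgue measure is invariant under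
  translations, and dominated convergence passes to the limit.\<close>

lemma integral_partial_deriv:
  fixes g :: "real^'n::finite \<Rightarrow> complex"
  assumes g: "schwartz g"
  shows "(LINT x|lborel. partial_deriv i g x) = 0"
proof -
  let ?e = "axis i 1 :: real^'n"
  define q where "q = (\<lambda>n x. (g (x + inverse (real (Suc n)) *\<^sub>R ?e) - g x) * of_real (real (Suc n)))"
  have gm [measurable]: "g \<in> borel_measurable borel" by (rule schwartz_measurable[OF g])
  have gm' [measurable]: "partial_deriv i g \<in> borel_measurable borel"
    by (rule schwartz_measurable[OF schwartz_partial_deriv[OF g]])
  obtain C where C: "\<And>x. (1 + norm x) ^ (2 * CARD('n)) * norm (partial_deriv i g x) \<le> C"
    using schwartz_bounded_bound[of "{partial_deriv i g}" "2 * CARD('n)"] schwartz_partial_deriv[OF g]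
    unfolding schwartz_bounded_singleton by blast
  have bound: "norm (partial_deriv i g (x + s *\<^sub>R ?e)) \<le> (2 ^ (2 * CARD('n)) * C) * decay_weight x"
    if s: "0 \<le> s" "s \<le> 1" for x s
  proof (rule decay_bound)
    have "norm x \<le> norm (x + s *\<^sub>R ?e) + norm (s *\<^sub>R ?e)"
      using norm_triangle_ineq4[of "x + s *\<^sub>R ?e" "s *\<^sub>R ?e"] by simp
    moreover have "norm (s *\<^sub>R ?e) \<le> 1" using s by simp
    ultimately have "1 + norm x \<le> 2 * (1 + norm (x + s *\<^sub>R ?e))" using norm_ge_zero[of "x + s *\<^sub>R ?e"] unfolding distrib_left by linarith
    then have "(1 + norm x) ^ (2 * CARD('n)) \<le> 2 ^ (2 * CARD('n)) * (1 + norm (x + s *\<^sub>R ?e)) ^ (2 * CARD('n))"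
      unfolding power_mult_distrib[symmetric] by (intro power_mono) auto
    then have "(1 + norm x) ^ (2 * CARD('n)) * norm (partial_deriv i g (x + s *\<^sub>R ?e))
      \<le> (2 ^ (2 * CARD('n)) * (1 + norm (x + s *\<^sub>R ?e)) ^ (2 * CARD('n))) * norm (partial_deriv i g (x + s *\<^sub>R ?e))"
      by (rule mult_right_mono) simp
    also have "\<dots> \<le> 2 ^ (2 * CARD('n)) * C"
      using C[of "x + s *\<^sub>R ?e"] by (simp add: mult.assoc)
    finally show "(1 + norm x) ^ (2 * CARD('n)) * norm (partial_deriv i g (x + s *\<^sub>R ?e)) \<le> 2 ^ (2 * CARD('n)) * C" .
  qed simp
  have zero: "(LINT x|lborel. q n x) = 0" for n
  proof -
    have "(LINT x|lborel. g (x + inverse (real (Suc n)) *\<^sub>R ?e)) = (LINT x|lborel. g x)"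
      using integral_translate[OF gm, of 1 "inverse (real (Suc n)) *\<^sub>R ?e"] by (simp add: add.commute)
    moreover have "integrable lborel (\<lambda>x. g (x + inverse (real (Suc n)) *\<^sub>R ?e))"
    proof -
      have "integrable (distr lborel borel ((+) (inverse (real (Suc n)) *\<^sub>R ?e))) g"
        unfolding lborel_distr_plus by (rule schwartz_integrable[OF g])
      then have "integrable lborel (g \<circ> ((+) (inverse (real (Suc n)) *\<^sub>R ?e)))"
        by (subst (asm) integrable_distr_eq) (auto simp: o_def)
      then show ?thesis by (simp add: o_def add.commute)
    qed
    ultimately show ?thesis unfolding q_def
      using schwartz_integrable[OF g] by (simp add: Bochner_Integration.integral_diff)
  qed
  have "(\<lambda>n. LINT x|lborel. q n x) \<longlonglongrightarrow> (LINT x|lborel. partial_deriv i g x)"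
  proof (rule integral_dominated_convergence[where w="\<lambda>x. (2 ^ (2 * CARD('n)) * C) * decay_weight x"])
    show "integrable lborel (\<lambda>x::real^'n. (2 ^ (2 * CARD('n)) * C) * decay_weight x)"
      by (intro integrable_mult_right integrable_decay_weight)
    show "AE x in lborel. (\<lambda>n. q n x) \<longlonglongrightarrow> partial_deriv i g x"
    proof (rule AE_I2)
      fix x
      have "((\<lambda>s. g (x + s *\<^sub>R ?e)) has_vector_derivative partial_deriv i g x) (at 0)"
        using partial_deriv_line[OF schwartz_smooth[OF g], of x i 0] by simp
      then have "((\<lambda>s. (g (x + s *\<^sub>R ?e) - g x) /\<^sub>R s) \<longlongrightarrow> partial_deriv i g x) (at 0)"
        by (simp add: vector_derivative_quotient_limit)
      moreover have "filterlim (\<lambda>n. inverse (real (Suc n))) (at 0) sequentially"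
        using LIMSEQ_inverse_real_of_nat by (auto simp: filterlim_at)
      ultimately have "(\<lambda>n. (g (x + inverse (real (Suc n)) *\<^sub>R ?e) - g x) /\<^sub>R inverse (real (Suc n)))
          \<longlonglongrightarrow> partial_deriv i g x" by (rule filterlim_compose)
      then show "(\<lambda>n. q n x) \<longlonglongrightarrow> partial_deriv i g x"
        unfolding q_def by (simp add: scaleR_conv_of_real mult.commute)
    qed
    show "AE x in lborel. norm (q n x) \<le> (2 ^ (2 * CARD('n)) * C) * decay_weight x" for n
    proof (rule AE_I2)
      fix x
      have "norm (g (x + inverse (real (Suc n)) *\<^sub>R ?e) - g (x + 0 *\<^sub>R ?e))
         \<le> \<bar>inverse (real (Suc n)) - 0\<bar> * ((2 ^ (2 * CARD('n)) * C) * decay_weight x)"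
      proof (rule vector_mean_value_bound[OF partial_deriv_line[OF schwartz_smooth[OF g]]])
        fix s assume "s \<in> closed_segment 0 (inverse (real (Suc n)))"
        then have "0 \<le> s" "s \<le> inverse (real (Suc n))" by (auto simp: closed_segment_eq_real_ivl)
        moreover have "inverse (real (Suc n)) \<le> 1" by (simp add: inverse_le_1_iff)
        ultimately show "norm (partial_deriv i g (x + s *\<^sub>R ?e)) \<le> (2 ^ (2 * CARD('n)) * C) * decay_weight x"
          by (intro bound) auto
      qed
      then have "norm (g (x + inverse (real (Suc n)) *\<^sub>R ?e) - g x)
         \<le> ((2 ^ (2 * CARD('n)) * C) * decay_weight x) / real (Suc n)"
        by (simp add: divide_inverse mult.commute del: of_nat_Suc)
      then have "norm (g (x + inverse (real (Suc n)) *\<^sub>R ?e) - g x) * real (Suc n)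
         \<le> (2 ^ (2 * CARD('n)) * C) * decay_weight x"
        by (subst (asm) pos_le_divide_eq) auto
      then show "norm (q n x) \<le> (2 ^ (2 * CARD('n)) * C) * decay_weight x"
        unfolding q_def norm_mult norm_of_real by simp
    qed
  qed (auto simp: q_def)
  then show ?thesis unfolding zero by (simp add: LIMSEQ_const_iff)
qed

lemma fourier_partial_deriv:
  fixes f :: "real^'n::finite \<Rightarrow> complex"
  assumes f: "schwartz f"
  shows "fourier (partial_deriv i f) \<xi> = \<i> * of_real (\<xi> $ i) * fourier f \<xi>"
proof -
  let ?c = "\<lambda>x. 1 * cis ((- \<xi>) \<bullet> x)"
  have c: "schwartz (\<lambda>x. ?c x * f x)"
    using moderate_character[of "- \<xi>"] f by (auto intro: schwartz_times)
  have pc: "partial_deriv i ?c x = 1 * (\<i> * of_real ((- \<xi>) \<bullet> axis i 1) * cis ((- \<xi>) \<bullet> x))" for x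
    by (rule partial_deriv_eq[OF has_derivative_cis_inner])
  have "partial_deriv i (\<lambda>x. ?c x * f x) x =
      - (\<i> * of_real (\<xi> $ i)) * (cis (- (x \<bullet> \<xi>)) * f x) + cis (- (x \<bullet> \<xi>)) * partial_deriv i f x" for x
    using partial_deriv_mult[OF differentiableI[OF has_derivative_cis_inner] schwartz_differentiable[OF f], of i 1 "- \<xi>" x]
    unfolding pc by (simp add: inner_axis inner_commute algebra_simps)
  then have "0 = (LINT x|lborel. - (\<i> * of_real (\<xi> $ i)) * (cis (- (x \<bullet> \<xi>)) * f x) + cis (- (x \<bullet> \<xi>)) * partial_deriv i f x)"
    using integral_partial_deriv[OF c, of i] by simp
  also have "\<dots> = - (\<i> * of_real (\<xi> $ i)) * fourier f \<xi> + fourier (partial_deriv i f) \<xi>"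
    unfolding fourier_def
    by (subst Bochner_Integration.integral_add)
       (rule integrable_mult_right character_integrable schwartz_integrable f schwartz_partial_deriv
         | simp only: integral_mult_right_zero)+
  finally show ?thesis by (simp add: algebra_simps)
qed

text \<open>The derivative of a transform is the transform of a multiple, so the transforms of bounded sets
  form a class closed under derivatives. Weights on the transform become derivatives of the
  function, which are bounded in \<open>L\<^sup>1\<close>.\<close>

lemma schwartz_bounded_fourier:
  fixes B :: "(real^'n::finite \<Rightarrow> complex) set"
  assumes "schwartz_bounded B"
  shows "schwartz_bounded (fourier ` B)"
proof (rule schwartz_bounded_coinduct[of "\<lambda>A. \<exists>B. schwartz_bounded B \<and> A = fourier ` B"])
  fix A i assume "\<exists>B::(real^'n \<Rightarrow> complex) set. schwartz_bounded B \<and> A = fourier ` B"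
  then obtain B :: "(real^'n \<Rightarrow> complex) set" where B: "schwartz_bounded B" "A = fourier ` B" by blast
  have "schwartz_bounded (fun_times {\<lambda>x. - \<i> * of_real (x $ i)} B)"
    by (intro schwartz_bounded_times moderate_cmult moderate_coord B)
  moreover have "partial_deriv i ` A \<subseteq> fourier ` fun_times {\<lambda>x. - \<i> * of_real (x $ i)} B"
    unfolding B image_image
  proof (rule image_subsetI)
    fix f assume f: "f \<in> B"
    have "partial_deriv i (fourier f) = fourier (\<lambda>x. - \<i> * of_real (x $ i) * f x)"
      by (rule partial_deriv_fourier[OF schwartz_bounded_imp_schwartz[OF B(1) f]])
    then show "partial_deriv i (fourier f) \<in> fourier ` fun_times {\<lambda>x. - \<i> * of_real (x $ i)} B"
      using f by (auto intro!: imageI fun_timesI)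
  qed
  ultimately show "\<exists>A'. (\<exists>B. schwartz_bounded B \<and> A' = fourier ` B) \<and> partial_deriv i ` A \<subseteq> A'" by blast
next
  fix A k assume "\<exists>B::(real^'n \<Rightarrow> complex) set. schwartz_bounded B \<and> A = fourier ` B"
  then obtain B :: "(real^'n \<Rightarrow> complex) set" where B: "schwartz_bounded B" "A = fourier ` B" by blast
  have "\<exists>C. \<forall>f\<in>B. \<forall>x. (1 + norm x) ^ k * norm (fourier f x) \<le> C"
    using B(1)
  proof (induction k arbitrary: B)
    case 0
    then show ?case using schwartz_bounded_L1[of B] norm_fourier_le
      by (metis mult_1 order_trans power_0)
  next
    case (Suc k)
    obtain C where C: "\<And>f x. f \<in> B \<Longrightarrow> (1 + norm x) ^ k * norm (fourier f x) \<le> C"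
      using Suc by blast
    have "\<exists>D. \<forall>f\<in>partial_deriv i ` B. \<forall>x. (1 + norm x) ^ k * norm (fourier f x) \<le> D" for i
      by (rule Suc.IH[OF schwartz_bounded_deriv[OF Suc.prems]])
    then obtain D where "\<And>i. \<forall>f\<in>partial_deriv i ` B. \<forall>x. (1 + norm x) ^ k * norm (fourier f x) \<le> D i"
      by metis
    then have D: "(1 + norm x) ^ k * norm (fourier (partial_deriv i f) x) \<le> D i" if "f \<in> B" for i f x
      using that by blast
    have "(1 + norm x) ^ Suc k * norm (fourier f x) \<le> C + (\<Sum>i\<in>UNIV. D i)" if f: "f \<in> B" for f x
    proof -
      have "(1 + norm x) ^ Suc k * norm (fourier f x) \<le> (1 + (\<Sum>i\<in>UNIV. \<bar>x $ i\<bar>)) * ((1 + norm x) ^ k * norm (fourier f x))"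
        using norm_le_l1_cart[of x] by (simp add: mult.assoc mult_right_mono)
      also have "\<dots> = (1 + norm x) ^ k * norm (fourier f x) + (\<Sum>i\<in>UNIV. (1 + norm x) ^ k * (\<bar>x $ i\<bar> * norm (fourier f x)))"
        by (simp add: distrib_right distrib_left sum_distrib_right sum_distrib_left mult_ac)
      also have "\<dots> = (1 + norm x) ^ k * norm (fourier f x) + (\<Sum>i\<in>UNIV. (1 + norm x) ^ k * norm (fourier (partial_deriv i f) x))"
        by (simp add: fourier_partial_deriv[OF schwartz_bounded_imp_schwartz[OF Suc.prems f]] norm_mult)
      also have "\<dots> \<le> C + (\<Sum>i\<in>UNIV. D i)"
        using C[OF f] D[OF f] by (intro add_mono sum_mono) auto
      finally show ?thesis .
    qed
    then show ?case by blast
  qed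
  then show "\<exists>C. \<forall>f\<in>A. \<forall>x. (1 + norm x) ^ k * norm (f x) \<le> C" unfolding B by blast
next
  fix A f and x :: "real^'n"
  assume "\<exists>B::(real^'n \<Rightarrow> complex) set. schwartz_bounded B \<and> A = fourier ` B" "f \<in> A"
  then show "f differentiable (at x)"
    using differentiableI[OF fourier_has_derivative] schwartz_bounded_imp_schwartz by blast
qed (use assms in blast)

lemma schwartz_fourier: "schwartz f \<Longrightarrow> schwartz (fourier f)"
  using schwartz_bounded_fourier[of "{f}"] by (simp add: schwartz_bounded_singleton)

lemma inv_fourier_eq: "inv_fourier f x = fourier f (- x) / of_real ((2 * pi) ^ CARD('n))"
  for x :: "real^'n::finite"
  unfolding inv_fourier_def fourier_def by (simp add: inner_commute)

lemma schwartz_reflect: "schwartz f \<Longrightarrow> schwartz (\<lambda>x. f (- x))"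
  using schwartz_bounded_reflect[of "{f}"] by (simp add: schwartz_bounded_singleton)

lemma schwartz_inv_fourier:
  fixes f :: "real^'n::finite \<Rightarrow> complex"
  assumes "schwartz f" shows "schwartz (inv_fourier f)"
  using schwartz_cmult[OF schwartz_reflect[OF schwartz_fourier[OF assms]], of "inverse (of_real ((2 * pi) ^ CARD('n)))"]
  unfolding inv_fourier_eq[abs_def] by (simp add: divide_inverse mult.commute)

subsection \<open>Decaying radial functions\<close>

lemma power_times_exp_bounded:
  assumes "c > (0::real)"
  shows "\<exists>C. \<forall>y\<ge>0. (1 + y) ^ k * exp (- (c * y)) \<le> C"
proof (intro exI allI impI)
  fix y :: real assume y: "y \<ge> 0"
  let ?z = "c * (1 + y)"
  have z: "?z \<ge> 0" using assms y by simp
  have "?z ^ k /\<^sub>R fact k \<le> (\<Sum>n. ?z ^ n /\<^sub>R fact n)"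
    using sum_le_suminf[OF summable_exp_generic[of ?z], of "{k}"] z by simp
  then have "?z ^ k / fact k \<le> exp ?z" by (simp add: exp_def divide_inverse mult.commute)
  moreover have "?z ^ k = c ^ k * (1 + y) ^ k" by (rule power_mult_distrib)
  moreover have "exp ?z = exp c * exp (c * y)" by (simp add: distrib_left exp_add)
  ultimately have "(c ^ k * (1 + y) ^ k) / fact k \<le> exp c * exp (c * y)" by simp
  then have "(1 + y) ^ k * c ^ k \<le> fact k * exp c * exp (c * y)"
    by (simp add: divide_le_eq mult_ac)
  then show "(1 + y) ^ k * exp (- (c * y)) \<le> fact k * exp c / c ^ k"
    using assms by (simp add: exp_minus field_simps)
qed

definition decaying_jet :: "real \<Rightarrow> (nat \<Rightarrow> real \<Rightarrow> complex) \<Rightarrow> bool" where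
  "decaying_jet c D \<longleftrightarrow> jet D \<and> (\<forall>n. \<exists>C. \<forall>y\<ge>0. norm (D n y) \<le> C * exp (- (c * y)))"

lemma decaying_jet_jet: "decaying_jet c D \<Longrightarrow> jet D"
  by (simp add: decaying_jet_def)

lemma decaying_jet_bound:
  assumes "decaying_jet c D"
  shows "\<exists>C\<ge>0. \<forall>y\<ge>0. norm (D n y) \<le> C * exp (- (c * y))"
proof -
  obtain C where C: "\<And>y. y \<ge> 0 \<Longrightarrow> norm (D n y) \<le> C * exp (- (c * y))"
    using assms unfolding decaying_jet_def by blast
  have "0 \<le> C" using order_trans[OF norm_ge_zero C[of 0]] by simp
  then show ?thesis using C by blast
qed

lemma decaying_jet_bounded:
  assumes "decaying_jet c D" "c \<ge> 0"
  shows "\<exists>C. \<forall>y\<ge>0. norm (D n y) \<le> C"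
proof -
  obtain C where C: "C \<ge> 0" "\<And>y. y \<ge> 0 \<Longrightarrow> norm (D n y) \<le> C * exp (- (c * y))"
    using decaying_jet_bound[OF assms(1)] by blast
  have "norm (D n y) \<le> C" if "y \<ge> 0" for y
  proof -
    have "C * exp (- (c * y)) \<le> C * 1" using C(1) that assms(2) by (intro mult_left_mono) auto
    then show ?thesis using C(2)[OF that] by simp
  qed
  then show ?thesis by blast
qed

lemma decaying_jet_schwartz:
  assumes D: "decaying_jet c D" and "c > 0" "t > 0"
  shows "schwartz (\<lambda>x::real^'n::finite. D 0 (t * (x \<bullet> x)))"
proof -
  have "schwartz_bounded {\<lambda>x::real^'n. J 0 (x \<bullet> x) | J. J \<in> {\<lambda>n y. of_real (t ^ n) * D n (t * y)}}"
  proof (rule radial_schwartz)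
    show "jet J" if "J \<in> {\<lambda>n y. of_real (t ^ n) * D n (t * y)}" for J
      using that jet_dilate[OF decaying_jet_jet[OF D]] by simp
    fix n k
    obtain C where C: "C \<ge> 0" "\<And>y. y \<ge> 0 \<Longrightarrow> norm (D n y) \<le> C * exp (- (c * y))"
      using decaying_jet_bound[OF D] by blast
    obtain K where K: "\<And>y. y \<ge> 0 \<Longrightarrow> (1 + y) ^ k * exp (- ((c * t) * y)) \<le> K"
      using power_times_exp_bounded[of "c * t" k] assms by auto
    have "(1 + y) ^ k * norm (of_real (t ^ n) * D n (t * y)) \<le> t ^ n * C * K" if y: "y \<ge> 0" for y
    proof -
      have "(1 + y) ^ k * norm (of_real (t ^ n) * D n (t * y)) = t ^ n * ((1 + y) ^ k * norm (D n (t * y)))"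
        using \<open>t > 0\<close> by (simp add: norm_mult norm_power)
      also have "\<dots> \<le> t ^ n * ((1 + y) ^ k * (C * exp (- (c * (t * y)))))"
        using C(2)[of "t * y"] y \<open>t > 0\<close> by (intro mult_left_mono) auto
      also have "\<dots> = t ^ n * C * ((1 + y) ^ k * exp (- ((c * t) * y)))" by (simp add: mult_ac)
      also have "\<dots> \<le> t ^ n * C * K" using K[OF y] C(1) \<open>t > 0\<close> by (intro mult_left_mono) auto
      finally show ?thesis .
    qed
    then show "\<exists>C. \<forall>J\<in>{\<lambda>n y. of_real (t ^ n) * D n (t * y)}. \<forall>y\<ge>0. (1 + y) ^ k * norm (J n y) \<le> C"
      by blast
  qed
  then show ?thesis by (rule schwartz_bounded_imp_schwartz) force
qed

definition exp_jet :: "complex \<Rightarrow> nat \<Rightarrow> real \<Rightarrow> complex" where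
  "exp_jet r n y = (- r) ^ n * exp (- r * of_real y)"

lemma exp_jet_decaying:
  assumes "Re r \<ge> c"
  shows "decaying_jet c (exp_jet r)"
  unfolding decaying_jet_def jet_def
proof (intro conjI allI)
  fix n y
  have "((\<lambda>y. exp (y *\<^sub>R (- r))) has_vector_derivative (- r * exp (y *\<^sub>R (- r)))) (at y)"
    using exp_scaleR_has_vector_derivative_left[of "- r" y] by simp
  then have "((\<lambda>y. (- r) ^ n * exp (y *\<^sub>R (- r))) has_vector_derivative ((- r) ^ n * (- r * exp (y *\<^sub>R (- r))))) (at y)"
    by (rule has_vector_derivative_mult_right)
  then show "(exp_jet r n has_vector_derivative exp_jet r (Suc n) y) (at y)"
    unfolding exp_jet_def by (simp add: scaleR_conv_of_real mult_ac)
next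
  fix n
  have "norm (exp_jet r n y) \<le> norm r ^ n * exp (- (c * y))" if "y \<ge> 0" for y
    using assms that unfolding exp_jet_def norm_mult norm_power norm_minus_cancel norm_exp_eq_Re
    by (intro mult_left_mono) (auto simp: mult_right_mono)
  then show "\<exists>C. \<forall>y\<ge>0. norm (exp_jet r n y) \<le> C * exp (- (c * y))" by blast
qed

subsection \<open>Gaussians\<close>

definition gauss :: "real \<Rightarrow> real^'n::finite \<Rightarrow> real" where
  "gauss a x = exp (- (a * (x \<bullet> x)))"

lemma gauss_pos: "0 < gauss a x" by (simp add: gauss_def)

lemma gauss_eq_jet: "of_real (gauss a x) = exp_jet 1 0 (a * (x \<bullet> x))"
  by (simp add: gauss_def exp_jet_def exp_of_real flip: of_real_mult of_real_minus)

lemma schwartz_gauss: "a > 0 \<Longrightarrow> schwartz (\<lambda>x::real^'n::finite. of_real (gauss a x))"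
  unfolding gauss_eq_jet by (rule decaying_jet_schwartz[OF exp_jet_decaying, of 1]) auto

lemma borel_measurable_gauss [measurable]: "gauss a \<in> borel_measurable borel"
  unfolding gauss_def[abs_def] by measurable

lemma nn_integral_gauss_line:
  assumes "a > 0"
  shows "(\<integral>\<^sup>+ y. ennreal (exp (- (a * y\<^sup>2))) \<partial>lborel) = ennreal (sqrt (pi / a))"
proof -
  define s where "s = sqrt (1 / (2 * a))"
  have s: "s\<^sup>2 = 1 / (2 * a)" "s > 0" using assms by (auto simp: s_def)
  have eq: "exp (- (a * y\<^sup>2)) = sqrt (pi / a) * normal_density 0 s y" for y
    using assms by (simp add: normal_density_def s field_simps real_sqrt_divide)
  have "(\<integral>\<^sup>+ y. ennreal (exp (- (a * y\<^sup>2))) \<partial>lborel) = ennreal (LINT y|lborel. exp (- (a * y\<^sup>2)))"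
    unfolding eq using s by (intro nn_integral_eq_integral) (use assms in \<open>auto intro!: integrable_mult_right integrable_normal_density AE_I2 mult_nonneg_nonneg\<close>)
  then show ?thesis unfolding eq using s by simp
qed

lemma nn_integral_gauss:
  assumes "a > 0"
  shows "(\<integral>\<^sup>+ x. ennreal (gauss a x) \<partial>(lborel :: (real^'n::finite) measure)) = ennreal (sqrt (pi / a) ^ CARD('n))"
proof -
  have "gauss a x = (\<Prod>b\<in>(Basis :: (real^'n) set). exp (- (a * (x \<bullet> b)\<^sup>2)))" for x
    unfolding gauss_def euclidean_inner[of x x] by (simp add: exp_sum sum_distrib_left power2_eq_square flip: sum_negf)
  then have "(\<integral>\<^sup>+ x. ennreal (gauss a x) \<partial>(lborel :: (real^'n) measure)) =
     (\<integral>\<^sup>+ x. (\<Prod>b\<in>Basis. (\<lambda>y. ennreal (exp (- (a * y\<^sup>2)))) (x \<bullet> b)) \<partial>(lborel :: (real^'n) measure))"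
    by (simp add: prod_ennreal)
  also have "\<dots> = (\<Prod>b\<in>(Basis :: (real^'n) set). (\<integral>\<^sup>+ y. ennreal (exp (- (a * y\<^sup>2))) \<partial>lborel))"
    by (rule nn_integral_lborel_prod) auto
  also have "\<dots> = ennreal (sqrt (pi / a) ^ CARD('n))"
    unfolding nn_integral_gauss_line[OF assms] by (simp add: ennreal_power assms less_imp_le)
  finally show ?thesis .
qed

lemma integrable_gauss: "a > 0 \<Longrightarrow> integrable lborel (gauss a :: real^'n::finite \<Rightarrow> real)"
  using nn_integral_gauss[of a, where 'n='n] by (intro integrableI_nonneg) (auto simp: gauss_def)

lemma integral_gauss:
  "a > 0 \<Longrightarrow> (LINT x|lborel. gauss a (x :: real^'n::finite)) = sqrt (pi / a) ^ CARD('n)"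
  using nn_integral_gauss[of a, where 'n='n] nn_integral_eq_integral[OF integrable_gauss[of a, where 'n='n]]
  by (simp add: gauss_pos less_imp_le)

text \<open>The equation \<open>g' = - 2 a x g\<close> of the Gaussian turns into an equation of the same kind for its
  transform, so the quotient of the transform and the expected Gaussian has derivative zero.\<close>

lemma fourier_gauss:
  fixes \<xi> :: "real^'n::finite"
  assumes a: "a > 0"
  shows "fourier (\<lambda>x. of_real (gauss a x)) \<xi> = of_real (sqrt (pi / a) ^ CARD('n) * gauss (1 / (4 * a)) \<xi>)"
proof -
  define g where "g = (\<lambda>x::real^'n. complex_of_real (gauss a x))"
  define G where "G = fourier g"
  define b where "b = 1 / (4 * a)"
  have S: "schwartz g" unfolding g_def by (rule schwartz_gauss[OF a])
  have pd: "partial_deriv i g = (\<lambda>x. - 2 * of_real a * (of_real (x $ i) * g x))" for i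
  proof
    fix x
    have "(g has_derivative (\<lambda>h. of_real (2 * (x \<bullet> h)) * (- of_real a * exp_jet 1 0 (a * (x \<bullet> x))))) (at x)"
    proof -
      have "((\<lambda>y. exp_jet 1 0 (a * y)) has_vector_derivative (- of_real a * exp_jet 1 0 (a * (x \<bullet> x)))) (at (x \<bullet> x))"
        using jetD[OF jet_dilate[OF decaying_jet_jet[OF exp_jet_decaying[of 1 1]]], of a 0 "x \<bullet> x"]
        by (simp add: exp_jet_def)
      from has_derivative_radial[OF this] show ?thesis unfolding g_def gauss_eq_jet .
    qed
    from partial_deriv_eq[OF this]
    show "partial_deriv i g x = - 2 * of_real a * (of_real (x $ i) * g x)"
      unfolding g_def gauss_eq_jet by (simp add: inner_axis)
  qed
  have F: "fourier (\<lambda>x. - \<i> * of_real (x $ i) * g x) \<xi> = - of_real (2 * b * \<xi> $ i) * G \<xi>" for i \<xi>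
  proof -
    have "fourier (\<lambda>x. - \<i> * of_real (x $ i) * g x) \<xi> = fourier (\<lambda>x. (\<i> * of_real (2 * b)) * partial_deriv i g x) \<xi>"
      unfolding pd b_def using a by (simp add: mult_ac)
    also have "\<dots> = (\<i> * of_real (2 * b)) * (\<i> * of_real (\<xi> $ i) * G \<xi>)"
      unfolding fourier_cmult fourier_partial_deriv[OF S] G_def ..
    finally show ?thesis by (simp add: mult_ac)
  qed
  have dG: "(G has_derivative (\<lambda>h. - of_real (2 * b * (\<xi> \<bullet> h)) * G \<xi>)) (at \<xi>)" for \<xi>
  proof -
    have "(\<Sum>i\<in>UNIV. of_real (h $ i) * fourier (\<lambda>x. - \<i> * of_real (x $ i) * g x) \<xi>) = - of_real (2 * b * (\<xi> \<bullet> h)) * G \<xi>" for h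
      unfolding F of_real_mult inner_eq_sum_coord by (simp add: sum_distrib_left sum_distrib_right sum_negf mult_ac)
    then show ?thesis using fourier_has_derivative[OF S, of \<xi>] unfolding G_def by simp
  qed
  have "((\<lambda>\<xi>. G \<xi> * exp (of_real b * of_real (\<xi> \<bullet> \<xi>))) has_derivative (\<lambda>h. 0)) (at \<xi>)" for \<xi> :: "real^'n"
  proof -
    have "((\<lambda>\<xi>::real^'n. exp (of_real b * complex_of_real (\<xi> \<bullet> \<xi>))) has_derivative
        (\<lambda>h. of_real (2 * (\<xi> \<bullet> h)) * (of_real b * exp (of_real b * of_real (\<xi> \<bullet> \<xi>))))) (at \<xi>)"
    proof (rule has_derivative_radial[of "\<lambda>y. exp (of_real b * complex_of_real y)"])
      show "((\<lambda>y. exp (of_real b * complex_of_real y)) has_vector_derivative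
          of_real b * exp (of_real b * of_real (\<xi> \<bullet> \<xi>))) (at (\<xi> \<bullet> \<xi>))"
        using exp_scaleR_has_vector_derivative_left[of "complex_of_real b" "\<xi> \<bullet> \<xi>"]
        by (simp add: scaleR_conv_of_real mult.commute)
    qed
    from has_derivative_mult[OF dG this] show ?thesis
      by (rule has_derivative_eq_rhs) (simp add: fun_eq_iff algebra_simps)
  qed
  then obtain c where c: "\<And>\<xi>. G \<xi> * exp (of_real b * of_real (\<xi> \<bullet> \<xi>)) = c"
    using has_derivative_zero_constant[OF convex_UNIV, of "\<lambda>\<xi>. G \<xi> * exp (of_real b * of_real (\<xi> \<bullet> \<xi>))"] by auto
  have "c = G 0" using c[of 0] by simp
  also have "G 0 = (LINT x|lborel. g x)" unfolding G_def fourier_def by simp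
  also have "\<dots> = of_real (sqrt (pi / a) ^ CARD('n))"
    unfolding g_def integral_complex_of_real integral_gauss[OF a] ..
  finally have c0: "c = of_real (sqrt (pi / a) ^ CARD('n))" .
  have "G \<xi> = c * exp (- (of_real b * of_real (\<xi> \<bullet> \<xi>)))"
    using c[of \<xi>] by (simp add: exp_minus field_simps)
  also have "exp (- (of_real b * of_real (\<xi> \<bullet> \<xi>))) = complex_of_real (gauss b \<xi>)"
    by (simp add: gauss_def exp_of_real[symmetric])
  finally show ?thesis unfolding c0 G_def g_def b_def of_real_mult .
qed

text \<open>The probability density whose Fourier transform is \<open>gauss (1 / (4 * a))\<close>.\<close>

definition gauss_kernel :: "real \<Rightarrow> real^'n::finite \<Rightarrow> real" where
  "gauss_kernel a x = gauss a x / sqrt (pi / a) ^ CARD('n)"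

lemma gauss_kernel_pos: "a > 0 \<Longrightarrow> 0 < gauss_kernel a x"
  by (simp add: gauss_kernel_def gauss_pos)

lemma borel_measurable_gauss_kernel [measurable]: "gauss_kernel a \<in> borel_measurable borel"
  unfolding gauss_kernel_def[abs_def] by measurable

lemma integrable_gauss_kernel: "a > 0 \<Longrightarrow> integrable lborel (gauss_kernel a :: real^'n::finite \<Rightarrow> real)"
  unfolding gauss_kernel_def[abs_def] by (intro integrable_divide integrable_gauss)

lemma integral_gauss_kernel: "a > 0 \<Longrightarrow> (LINT x|lborel. gauss_kernel a (x :: real^'n::finite)) = 1"
  unfolding gauss_kernel_def by (simp add: integral_gauss)

lemma fourier_gauss_kernel:
  fixes \<xi> :: "real^'n::finite"
  assumes a: "a > 0"
  shows "fourier (\<lambda>x. of_real (gauss (1 / (4 * a)) x)) \<xi> = of_real ((2 * pi) ^ CARD('n) * gauss_kernel a \<xi>)"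
proof -
  have "sqrt (pi / (1 / (4 * a))) * sqrt (pi / a) = 2 * pi"
    using a by (simp flip: real_sqrt_mult) (simp add: real_sqrt_mult power2_eq_square[symmetric])
  then have "sqrt (pi / (1 / (4 * a))) ^ CARD('n) * sqrt (pi / a) ^ CARD('n) = (2 * pi) ^ CARD('n)"
    by (simp only: power_mult_distrib[symmetric])
  moreover have "sqrt (pi / a) ^ CARD('n) > 0" using a by simp
  ultimately have "sqrt (pi / (1 / (4 * a))) ^ CARD('n) = (2 * pi) ^ CARD('n) / sqrt (pi / a) ^ CARD('n)"
    by (metis less_irrefl nonzero_eq_divide_eq)
  then show ?thesis
    using fourier_gauss[of "1 / (4 * a)" \<xi>] a unfolding gauss_kernel_def by simp
qed

text \<open>A dilation replaces the narrowing kernel by a fixed one and moves the arguments of \<open>f\<close> towards \<open>y\<close>.\<close>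

lemma gauss_approximate_identity:
  fixes f :: "real^'n::finite \<Rightarrow> complex"
  assumes cont: "continuous_on UNIV f" and bd: "\<And>x. norm (f x) \<le> M"
  shows "(\<lambda>n. LINT x|lborel. f x * of_real (gauss_kernel (real (Suc n)) (x - y))) \<longlonglongrightarrow> f y"
proof -
  have [measurable]: "f \<in> borel_measurable borel" by (rule borel_measurable_continuous_onI[OF cont])
  have eq: "(LINT x|lborel. f x * of_real (gauss_kernel (real (Suc n)) (x - y))) =
     (LINT x|lborel. f (y + inverse (sqrt (real (Suc n))) *\<^sub>R x) * of_real (gauss_kernel 1 x))" for n
  proof -
    define r where "r = real (Suc n)"
    have r: "r > 0" by (simp add: r_def)
    have k: "inverse (sqrt r) ^ CARD('n) * gauss_kernel r (inverse (sqrt r) *\<^sub>R x) = gauss_kernel 1 x" for x :: "real^'n"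
    proof -
      have "r * (inverse (sqrt r) * inverse (sqrt r)) = 1" using r by (simp add: field_simps)
      then have "gauss r (inverse (sqrt r) *\<^sub>R x) = gauss 1 x"
        unfolding gauss_def by (simp add: mult.assoc[symmetric]) 
      moreover have "inverse (sqrt r) ^ CARD('n) / sqrt (pi / r) ^ CARD('n) = 1 / sqrt pi ^ CARD('n)"
        using r by (simp add: real_sqrt_divide power_divide field_simps)
      ultimately show ?thesis unfolding gauss_kernel_def
        by (metis (no_types, opaque_lifting) div_by_1 mult.commute times_divide_eq_right mult_1)
    qed
    have "(LINT x|lborel. f x * of_real (gauss_kernel r (x - y))) =
      of_real (\<bar>inverse (sqrt r)\<bar> ^ CARD('n)) * (LINT x|lborel. f (y + inverse (sqrt r) *\<^sub>R x) *
         of_real (gauss_kernel r ((y + inverse (sqrt r) *\<^sub>R x) - y)))"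
      using r by (intro integral_translate) auto
    also have "\<dots> = (LINT x|lborel. of_real (\<bar>inverse (sqrt r)\<bar> ^ CARD('n)) * (f (y + inverse (sqrt r) *\<^sub>R x) *
         of_real (gauss_kernel r ((y + inverse (sqrt r) *\<^sub>R x) - y))))"
      by (rule integral_mult_right_zero[symmetric])
    also have "(\<lambda>x. of_real (\<bar>inverse (sqrt r)\<bar> ^ CARD('n)) * (f (y + inverse (sqrt r) *\<^sub>R x) *
         of_real (gauss_kernel r ((y + inverse (sqrt r) *\<^sub>R x) - y)))) =
       (\<lambda>x. f (y + inverse (sqrt r) *\<^sub>R x) * of_real (gauss_kernel 1 x))"
      unfolding k[symmetric] using r by (simp add: mult_ac)
    finally show ?thesis unfolding r_def .
  qed
  have "(\<lambda>n. LINT x|lborel. f (y + inverse (sqrt (real (Suc n))) *\<^sub>R x) * of_real (gauss_kernel 1 x))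
     \<longlonglongrightarrow> (LINT x|lborel. f y * of_real (gauss_kernel 1 (x :: real^'n)))"
  proof (rule integral_dominated_convergence[where w="\<lambda>x. M * gauss_kernel 1 x"])
    show "AE x in lborel. (\<lambda>n. f (y + inverse (sqrt (real (Suc n))) *\<^sub>R x) * of_real (gauss_kernel 1 x))
        \<longlonglongrightarrow> f y * of_real (gauss_kernel 1 x)"
    proof (rule AE_I2)
      fix x :: "real^'n"
      have "(\<lambda>n. inverse (sqrt (real (Suc n)))) \<longlonglongrightarrow> 0"
        using tendsto_real_sqrt[OF LIMSEQ_inverse_real_of_nat] by (simp add: real_sqrt_inverse)
      then have "(\<lambda>n. y + inverse (sqrt (real (Suc n))) *\<^sub>R x) \<longlonglongrightarrow> y + 0 *\<^sub>R x"
        by (intro tendsto_intros)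
      then have "(\<lambda>n. f (y + inverse (sqrt (real (Suc n))) *\<^sub>R x)) \<longlonglongrightarrow> f y"
        using cont by (intro continuous_on_tendsto_compose[OF cont]) auto
      then show "(\<lambda>n. f (y + inverse (sqrt (real (Suc n))) *\<^sub>R x) * of_real (gauss_kernel 1 x))
        \<longlonglongrightarrow> f y * of_real (gauss_kernel 1 x)" by (intro tendsto_intros)
    qed
    show "AE x in lborel. norm (f (y + inverse (sqrt (real (Suc n))) *\<^sub>R x) * of_real (gauss_kernel 1 x)) \<le> M * gauss_kernel 1 x" for n
    proof (rule AE_I2)
      fix x :: "real^'n"
      have "0 \<le> gauss_kernel 1 x" using gauss_kernel_pos[of 1 x] by simp
      then show "norm (f (y + inverse (sqrt (real (Suc n))) *\<^sub>R x) * of_real (gauss_kernel 1 x)) \<le> M * gauss_kernel 1 x"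
        using bd by (simp add: norm_mult mult_right_mono)
    qed
  qed (auto intro: integrable_gauss_kernel)
  moreover have "(LINT x|lborel. f y * of_real (gauss_kernel 1 (x :: real^'n))) = f y"
    unfolding integral_mult_right_zero integral_complex_of_real integral_gauss_kernel[OF zero_less_one] by simp
  ultimately show ?thesis unfolding eq by (simp only:)
qed

subsection \<open>Inversion and Plancherel\<close>

lemma fourier_multiplication:
  fixes f g :: "real^'n::finite \<Rightarrow> complex"
  assumes f: "integrable lborel f" and g: "integrable lborel g"
  shows "(LINT x|lborel. fourier f x * g x) = (LINT x|lborel. f x * fourier g x)"
proof -
  have fm [measurable]: "f \<in> borel_measurable borel" and gm [measurable]: "g \<in> borel_measurable borel"
    using f g by (auto dest: borel_measurable_integrable)
  have cm [measurable]: "cis \<in> borel_measurable borel"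
    by (intro borel_measurable_continuous_onI continuous_intros)
  have int: "integrable (lborel \<Otimes>\<^sub>M lborel) (\<lambda>(x, y). cis (- (x \<bullet> y)) * (f x * g y))"
  proof (rule lborel_pair.Fubini_integrable)
    show "(\<lambda>(x, y). cis (- (x \<bullet> y)) * (f x * g y)) \<in> borel_measurable (lborel \<Otimes>\<^sub>M lborel)"
      by measurable
    show "integrable lborel (\<lambda>x. LINT y|lborel. norm (case (x, y) of (x, y) \<Rightarrow> cis (- (x \<bullet> y)) * (f x * g y)))"
      using f by (simp add: norm_mult)
    show "AE x in lborel. integrable lborel (\<lambda>y. case (x, y) of (x, y) \<Rightarrow> cis (- (x \<bullet> y)) * (f x * g y))"
    proof (rule AE_I2)
      fix x
      show "integrable lborel (\<lambda>y. case (x, y) of (x, y) \<Rightarrow> cis (- (x \<bullet> y)) * (f x * g y))"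
        using character_integrable[OF integrable_mult_right[OF g, of "f x"], of x]
        by (simp add: inner_commute)
    qed
  qed
  have "(LINT x|lborel. fourier f x * g x) = (LINT y|lborel. LINT x|lborel. cis (- (x \<bullet> y)) * (f x * g y))"
    unfolding fourier_def integral_mult_left_zero[symmetric] by (simp add: mult.assoc)
  also have "\<dots> = (LINT x|lborel. LINT y|lborel. cis (- (x \<bullet> y)) * (f x * g y))"
    using lborel_pair.Fubini_integral[OF int] .
  also have "\<dots> = (LINT x|lborel. f x * fourier g x)"
    unfolding fourier_def integral_mult_right_zero[symmetric] by (simp add: mult_ac inner_commute)
  finally show ?thesis .
qed

lemma fourier_modulate: "fourier (\<lambda>x. cis (y \<bullet> x) * g x) \<xi> = fourier g (\<xi> - y)"
proof -
  have "cis (- (x \<bullet> \<xi>)) * cis (y \<bullet> x) = cis (- (x \<bullet> (\<xi> - y)))" for x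
    by (simp add: cis_mult inner_diff_right inner_commute)
  then show ?thesis unfolding fourier_def mult.assoc[symmetric] by simp
qed

text \<open>Test the multiplication formula with a modulated Gaussian and let the Gaussian flatten: one side
  tends to the inversion integral, the other is an approximate identity at \<open>y\<close>.\<close>

lemma inv_fourier_fourier:
  fixes f :: "real^'n::finite \<Rightarrow> complex"
  assumes f: "schwartz f"
  shows "inv_fourier (fourier f) = f"
proof
  fix y
  let ?c = "complex_of_real ((2 * pi) ^ CARD('n))"
  obtain M where M: "\<And>x. norm (f x) \<le> M"
    using schwartz_bounded_bound[of "{f}" 0] f by (auto simp: schwartz_bounded_singleton)
  have eq: "?c * (LINT x|lborel. f x * of_real (gauss_kernel (real (Suc n)) (x - y))) =
     (LINT x|lborel. fourier f x * (cis (y \<bullet> x) * of_real (gauss (1 / (4 * real (Suc n))) x)))" for n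
  proof -
    have g: "schwartz (\<lambda>x::real^'n. cis (y \<bullet> x) * of_real (gauss (1 / (4 * real (Suc n))) x))"
      by (intro schwartz_times moderate_character schwartz_gauss) simp
    show ?thesis
      unfolding fourier_multiplication[OF schwartz_integrable[OF f] schwartz_integrable[OF g]]
        fourier_modulate fourier_gauss_kernel[OF of_nat_0_less_iff[THEN iffD2, OF zero_less_Suc]]
      by (simp add: mult_ac flip: integral_mult_right_zero del: of_nat_Suc)
  qed
  have "(\<lambda>n. ?c * (LINT x|lborel. f x * of_real (gauss_kernel (real (Suc n)) (x - y)))) \<longlonglongrightarrow> ?c * f y"
    by (intro tendsto_intros gauss_approximate_identity[OF schwartz_continuous[OF f] M])
  moreover have "(\<lambda>n. LINT x|lborel. fourier f x * (cis (y \<bullet> x) * of_real (gauss (1 / (4 * real (Suc n))) x)))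
     \<longlonglongrightarrow> (LINT x|lborel. fourier f x * (cis (y \<bullet> x) * of_real 1))"
  proof (rule integral_dominated_convergence[where w="\<lambda>x. norm (fourier f x)"])
    have m: "schwartz (\<lambda>x. cis (y \<bullet> x) * fourier f x)"
      by (intro schwartz_times moderate_character schwartz_fourier f)
    then show "(\<lambda>x. fourier f x * (cis (y \<bullet> x) * of_real 1)) \<in> borel_measurable lborel"
      using schwartz_measurable by (fastforce simp: mult.commute)
    have [measurable]: "(\<lambda>x. cis (y \<bullet> x) * fourier f x) \<in> borel_measurable borel"
      by (rule schwartz_measurable[OF m])
    have "(\<lambda>x. (cis (y \<bullet> x) * fourier f x) * of_real (gauss (1 / (4 * real (Suc n))) x)) \<in> borel_measurable lborel" for n
      by measurable
    then show "(\<lambda>x. fourier f x * (cis (y \<bullet> x) * of_real (gauss (1 / (4 * real (Suc n))) x))) \<in> borel_measurable lborel" for n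
      by (simp add: mult_ac)
    show "integrable lborel (\<lambda>x. norm (fourier f x))"
      by (intro integrable_norm schwartz_integrable schwartz_fourier f)
    show "AE x in lborel. (\<lambda>n. fourier f x * (cis (y \<bullet> x) * of_real (gauss (1 / (4 * real (Suc n))) x)))
       \<longlonglongrightarrow> fourier f x * (cis (y \<bullet> x) * of_real 1)"
    proof (rule AE_I2)
      fix x :: "real^'n"
      have eqg: "gauss (1 / (4 * r)) x = exp (- ((1 / 4) * inverse r * (x \<bullet> x)))" for r
      proof -
        have "1 / (4 * r) = 1 / 4 * inverse r" by (simp add: divide_simps)
        then show ?thesis by (simp only: gauss_def)
      qed
      have "(\<lambda>n. exp (- ((1 / 4) * inverse (real (Suc n)) * (x \<bullet> x)))) \<longlonglongrightarrow> exp (- ((1 / 4) * 0 * (x \<bullet> x)))"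
        by (intro tendsto_intros LIMSEQ_inverse_real_of_nat)
      then have "(\<lambda>n. gauss (1 / (4 * real (Suc n))) x) \<longlonglongrightarrow> 1"
        unfolding eqg by simp
      then show "(\<lambda>n. fourier f x * (cis (y \<bullet> x) * of_real (gauss (1 / (4 * real (Suc n))) x)))
       \<longlonglongrightarrow> fourier f x * (cis (y \<bullet> x) * of_real 1)" by (intro tendsto_intros)
    qed
    show "AE x in lborel. norm (fourier f x * (cis (y \<bullet> x) * of_real (gauss (1 / (4 * real (Suc n))) x)))
       \<le> norm (fourier f x)" for n
      by (rule AE_I2) (auto simp: norm_mult gauss_def intro!: mult_left_le)
  qed
  ultimately have "?c * f y = (LINT x|lborel. fourier f x * (cis (y \<bullet> x) * of_real 1))"
    unfolding eq by (rule LIMSEQ_unique)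
  then show "inv_fourier (fourier f) y = f y"
    unfolding inv_fourier_def by (simp add: mult.commute field_simps)
qed

lemma fourier_inv_fourier:
  fixes f :: "real^'n::finite \<Rightarrow> complex"
  assumes f: "schwartz f"
  shows "fourier (inv_fourier f) = f"
proof
  fix \<xi>
  have Fm: "fourier f \<in> borel_measurable borel" by (intro schwartz_measurable schwartz_fourier f)
  have m: "schwartz (\<lambda>x. cis (\<xi> \<bullet> x) * fourier f x)"
    by (intro schwartz_times moderate_character schwartz_fourier f)
  have "fourier (inv_fourier f) \<xi> = (LINT x|lborel. cis (- (x \<bullet> \<xi>)) * (fourier f (- x) / of_real ((2 * pi) ^ CARD('n))))"
    unfolding fourier_def[of "inv_fourier f"] inv_fourier_eq ..
  also have "\<dots> = (LINT x|lborel. (\<lambda>x. cis (\<xi> \<bullet> x) * fourier f x) (0 + (-1) *\<^sub>R x)) / of_real ((2 * pi) ^ CARD('n))"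
    by (simp add: inner_commute)
  also have "(LINT x|lborel. (\<lambda>x. cis (\<xi> \<bullet> x) * fourier f x) (0 + (-1) *\<^sub>R x)) = (LINT x|lborel. cis (\<xi> \<bullet> x) * fourier f x)"
    using integral_translate[OF schwartz_measurable[OF m], of "-1" 0] by simp
  also have "\<dots> / of_real ((2 * pi) ^ CARD('n)) = inv_fourier (fourier f) \<xi>" by (simp add: inv_fourier_def)
  finally show "fourier (inv_fourier f) \<xi> = f \<xi>" by (simp add: inv_fourier_fourier[OF f])
qed

text \<open>The multiplication formula applied to \<open>m\<close> and the complex conjugate of its transform.\<close>

lemma plancherel:
  fixes m :: "real^'n::finite \<Rightarrow> complex"
  assumes m: "schwartz m"
  shows "(LINT x|lborel. (norm (fourier m x))\<^sup>2) = (2 * pi) ^ CARD('n) * (LINT x|lborel. (norm (m x))\<^sup>2)"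
proof -
  let ?c = "complex_of_real ((2 * pi) ^ CARD('n))"
  have h: "schwartz (\<lambda>x. cnj (fourier m x))" by (intro schwartz_cnj schwartz_fourier m)
  have Fh: "fourier (\<lambda>x. cnj (fourier m x)) x = ?c * cnj (m x)" for x
  proof -
    have "fourier (\<lambda>x. cnj (fourier m x)) x = (LINT \<xi>|lborel. cnj (cis (x \<bullet> \<xi>) * fourier m \<xi>))"
      unfolding fourier_def[of "\<lambda>x. cnj (fourier m x)"]
      by (simp only: complex_cnj_mult cis_cnj inner_commute[of x])
    also have "\<dots> = cnj (LINT \<xi>|lborel. cis (x \<bullet> \<xi>) * fourier m \<xi>)" by (rule Bochner_Integration.integral_cnj)
    also have "\<dots> = cnj (?c * inv_fourier (fourier m) x)" unfolding inv_fourier_def by simp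
    finally show ?thesis by (simp add: inv_fourier_fourier[OF m])
  qed
  have "complex_of_real (LINT x|lborel. (norm (fourier m x))\<^sup>2) = (LINT x|lborel. fourier m x * cnj (fourier m x))"
    unfolding integral_complex_of_real[symmetric] by (simp only: complex_norm_square)
  also have "\<dots> = (LINT x|lborel. m x * fourier (\<lambda>x. cnj (fourier m x)) x)"
    by (intro fourier_multiplication schwartz_integrable m h)
  also have "\<dots> = ?c * (LINT x|lborel. m x * cnj (m x))"
    unfolding Fh mult.left_commute[of "m _" ?c] by (rule integral_mult_right_zero)
  also have "\<dots> = complex_of_real ((2 * pi) ^ CARD('n) * (LINT x|lborel. (norm (m x))\<^sup>2))"
    unfolding of_real_mult integral_complex_of_real[symmetric] by (simp only: complex_norm_square)
  finally show ?thesis by (simp only: of_real_eq_iff)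
qed

section \<open>Functionals on Schwartz space\<close>

text \<open>Every tempered distribution has this form of continuity, and it is visibly inherited by the
  compositions with the Fourier transform and with partial derivatives.\<close>

definition schwartz_functional :: "'n::finite distr \<Rightarrow> bool" where
  "schwartz_functional T \<longleftrightarrow>
     (\<forall>f g. schwartz f \<longrightarrow> schwartz g \<longrightarrow> T (\<lambda>x. f x + g x) = T f + T g) \<and>
     (\<forall>c f. schwartz f \<longrightarrow> T (\<lambda>x. c * f x) = c * T f) \<and>
     (\<forall>B. schwartz_bounded B \<longrightarrow> (\<exists>M. \<forall>f\<in>B. norm (T f) \<le> M))"

lemma functional_add:
  "schwartz_functional T \<Longrightarrow> schwartz f \<Longrightarrow> schwartz g \<Longrightarrow> T (\<lambda>x. f x + g x) = T f + T g"
  unfolding schwartz_functional_def by blast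

lemma functional_cmult: "schwartz_functional T \<Longrightarrow> schwartz f \<Longrightarrow> T (\<lambda>x. c * f x) = c * T f"
  unfolding schwartz_functional_def by blast

lemma functional_bounded: "schwartz_functional T \<Longrightarrow> schwartz_bounded B \<Longrightarrow> \<exists>M. \<forall>f\<in>B. norm (T f) \<le> M"
  unfolding schwartz_functional_def by blast

lemma functional_uminus: "schwartz_functional T \<Longrightarrow> schwartz f \<Longrightarrow> T (\<lambda>x. - f x) = - T f"
  using functional_cmult[of T f "-1"] by simp

lemma functional_diff:
  assumes "schwartz_functional T" "schwartz f" "schwartz g"
  shows "T (\<lambda>x. f x - g x) = T f - T g"
  using functional_add[OF assms(1,2) schwartz_uminus[OF assms(3)]] functional_uminus[OF assms(1,3)] by simp

lemma functional_zero: "schwartz_functional T \<Longrightarrow> T (\<lambda>x. 0) = 0"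
  using functional_cmult[OF _ schwartz_zero, of T 0] by simp

lemma functional_sum:
  assumes "schwartz_functional T" "\<And>i. i \<in> I \<Longrightarrow> schwartz (f i)"
  shows "T (\<lambda>x. \<Sum>i\<in>I. f i x) = (\<Sum>i\<in>I. T (f i))"
  using assms(2)
proof (induction I rule: infinite_finite_induct)
  case (insert i I)
  then have "T (\<lambda>x. f i x + (\<Sum>i\<in>I. f i x)) = T (f i) + T (\<lambda>x. \<Sum>i\<in>I. f i x)"
    by (intro functional_add assms(1) schwartz_sum) auto
  then show ?case using insert by simp
qed (simp_all add: functional_zero assms(1))

lemma tempered_imp_functional:
  fixes T :: "'n::finite distr"
  assumes "tempered T"
  shows "schwartz_functional T"
  unfolding schwartz_functional_def
proof (intro conjI allI impI)
  fix \<B> :: "(real^'n \<Rightarrow> complex) set" assume bounded: "schwartz_bounded \<B>"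
  obtain B k where B: "\<And>f. schwartz f \<Longrightarrow> norm (T f) \<le> B * schwartz_seminorm k f"
    using assms unfolding tempered_def by blast
  obtain C where C: "\<And>ds f x. f \<in> \<B> \<Longrightarrow> (1 + norm x) ^ k * norm (iter_deriv ds f x) \<le> C ds"
  proof -
    have "\<forall>ds. \<exists>C. \<forall>f\<in>\<B>. \<forall>x. (1 + norm x) ^ k * norm (iter_deriv ds f x) \<le> C"
      using bounded unfolding schwartz_bounded_def by blast
    then obtain C where "\<forall>ds. \<forall>f\<in>\<B>. \<forall>x. (1 + norm x) ^ k * norm (iter_deriv ds f x) \<le> C ds"
      by (rule choice[THEN exE])
    then show ?thesis using that by blast
  qed
  have "norm (T f) \<le> \<bar>B\<bar> * (\<Sum>ds | length ds \<le> k. C ds)" if f: "f \<in> \<B>" for f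
  proof -
    have le: "schwartz_seminorm k f \<le> (\<Sum>ds | length ds \<le> k. C ds)"
      unfolding schwartz_seminorm_def by (intro sum_mono cSUP_least C f) simp
    have ge: "0 \<le> schwartz_seminorm k f"
      unfolding schwartz_seminorm_def
    proof (intro sum_nonneg)
      fix ds :: "'n list"
      have "bdd_above (range (\<lambda>x. (1 + norm x) ^ k * norm (iter_deriv ds f x)))"
        using C[OF f] by (intro bdd_aboveI[of _ "C ds"]) auto
      then have "(1 + norm (0::real^'n)) ^ k * norm (iter_deriv ds f 0) \<le> (SUP x. (1 + norm x) ^ k * norm (iter_deriv ds f x))"
        by (intro cSUP_upper) auto
      then show "0 \<le> (SUP x. (1 + norm x) ^ k * norm (iter_deriv ds f x))"
        by (rule order_trans[rotated]) simp
    qed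
    have "norm (T f) \<le> B * schwartz_seminorm k f" by (rule B[OF schwartz_bounded_imp_schwartz[OF bounded f]])
    also have "\<dots> \<le> \<bar>B\<bar> * schwartz_seminorm k f" using ge by (intro mult_right_mono) auto
    also have "\<dots> \<le> \<bar>B\<bar> * (\<Sum>ds | length ds \<le> k. C ds)" using le by (intro mult_left_mono) auto
    finally show ?thesis .
  qed
  then show "\<exists>M. \<forall>f\<in>\<B>. norm (T f) \<le> M" by blast
qed (use assms in \<open>auto simp: tempered_def\<close>)

lemma functional_comp_fourier:
  fixes T :: "'n::finite distr"
  assumes T: "schwartz_functional T"
  shows "schwartz_functional (\<lambda>g. T (fourier g))"
  unfolding schwartz_functional_def
proof (intro conjI allI impI)
  fix f g :: "real^'n \<Rightarrow> complex" assume "schwartz f" "schwartz g"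
  then have "fourier (\<lambda>x. f x + g x) = (\<lambda>x. fourier f x + fourier g x)"
    by (intro ext fourier_add schwartz_integrable)
  then show "T (fourier (\<lambda>x. f x + g x)) = T (fourier f) + T (fourier g)"
    using functional_add[OF T schwartz_fourier[OF \<open>schwartz f\<close>] schwartz_fourier[OF \<open>schwartz g\<close>]] by simp
next
  fix c and f :: "real^'n \<Rightarrow> complex" assume "schwartz f"
  then have "fourier (\<lambda>x. c * f x) = (\<lambda>x. c * fourier f x)"
    by (intro ext fourier_cmult)
  then show "T (fourier (\<lambda>x. c * f x)) = c * T (fourier f)"
    using functional_cmult[OF T schwartz_fourier[OF \<open>schwartz f\<close>], of c] by simp
next
  fix B :: "(real^'n \<Rightarrow> complex) set" assume "schwartz_bounded B"
  from functional_bounded[OF T schwartz_bounded_fourier[OF this]]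
  show "\<exists>M. \<forall>f\<in>B. norm (T (fourier f)) \<le> M" by blast
qed

subsection \<open>Series in Schwartz space\<close>

text \<open>Absolutely convergent combinations of a bounded set form a bounded set. They take the place of the
  completeness of Schwartz space.\<close>

definition l1_combinations :: "real \<Rightarrow> (real^'n::finite \<Rightarrow> complex) set \<Rightarrow> (real^'n \<Rightarrow> complex) set" where
  "l1_combinations R B = {\<lambda>x. \<Sum>j. c j * f j x | (c :: nat \<Rightarrow> complex) f.
     summable (\<lambda>j. norm (c j)) \<and> (\<Sum>j. norm (c j)) \<le> R \<and> (\<forall>j. f j \<in> B)}"

lemma summable_l1_combination:
  fixes c :: "nat \<Rightarrow> complex" and v :: "nat \<Rightarrow> complex"
  assumes "summable (\<lambda>j. norm (c j))" "\<And>j. norm (v j) \<le> K"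
  shows "summable (\<lambda>j. c j * v j)" "norm (\<Sum>j. c j * v j) \<le> (\<Sum>j. norm (c j)) * K"
proof -
  have s: "summable (\<lambda>j. norm (c j) * K)" using assms(1) by (rule summable_mult2)
  have le: "norm (c j * v j) \<le> norm (c j) * K" for j
    using assms(2)[of j] by (simp add: norm_mult mult_left_mono)
  have sn: "summable (\<lambda>j. norm (c j * v j))"
    by (rule summable_comparison_test'[OF s, of 0]) (simp add: le[unfolded norm_mult] norm_mult)
  show "summable (\<lambda>j. c j * v j)" by (rule summable_norm_cancel[OF sn])
  have "norm (\<Sum>j. c j * v j) \<le> (\<Sum>j. norm (c j * v j))" by (rule summable_norm[OF sn])
  also have "\<dots> \<le> (\<Sum>j. norm (c j) * K)" by (intro suminf_le le sn s)
  also have "\<dots> = (\<Sum>j. norm (c j)) * K" by (rule suminf_mult2[OF assms(1), symmetric])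
  finally show "norm (\<Sum>j. c j * v j) \<le> (\<Sum>j. norm (c j)) * K" .
qed

lemma has_derivative_coordinates:
  fixes f :: "real^'n::finite \<Rightarrow> complex"
  assumes "f differentiable (at x)"
  shows "(f has_derivative (\<lambda>h. \<Sum>i\<in>UNIV. of_real (h $ i) * partial_deriv i f x)) (at x)"
proof -
  obtain D where D: "(f has_derivative D) (at x)" using assms unfolding differentiable_def by blast
  have lin: "linear D" by (rule has_derivative_linear[OF D])
  have "D h = (\<Sum>i\<in>UNIV. of_real (h $ i) * partial_deriv i f x)" for h
  proof -
    have "h = (\<Sum>i\<in>UNIV. (h $ i) *\<^sub>R axis i 1)"
      using basis_expansion[of h] by (simp add: scalar_mult_eq_scaleR)
    then have "D h = D (\<Sum>i\<in>UNIV. (h $ i) *\<^sub>R axis i 1)" by simp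
    also have "\<dots> = (\<Sum>i\<in>UNIV. (h $ i) *\<^sub>R D (axis i 1))"
      by (simp add: linear_sum[OF lin] linear_cmul[OF lin])
    finally show ?thesis by (simp add: partial_deriv_eq[OF D] scaleR_conv_of_real)
  qed
  then show ?thesis using D by (metis (no_types, lifting) has_derivative_eq_rhs ext)
qed

lemma l1_combination_has_derivative:
  fixes f :: "nat \<Rightarrow> real^'n::finite \<Rightarrow> complex"
  assumes B: "schwartz_bounded B" and c: "summable (\<lambda>j. norm (c j))" and f: "\<And>j. f j \<in> B"
  shows "((\<lambda>x. \<Sum>j. c j * f j x) has_derivative
     (\<lambda>h. \<Sum>i\<in>UNIV. of_real (h $ i) * (\<Sum>j. c j * partial_deriv i (f j) x))) (at x)"
proof -
  obtain C where C: "\<And>f x. f \<in> B \<Longrightarrow> norm (f x) \<le> C"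
    using schwartz_bounded_bound[OF B, of 0] by auto
  have "\<exists>D. \<forall>f\<in>partial_deriv i ` B. \<forall>x. norm (f x) \<le> D" for i
    using schwartz_bounded_bound[OF schwartz_bounded_deriv[OF B, of i], of 0] by auto
  then obtain D where D: "\<And>i f x. f \<in> B \<Longrightarrow> norm (partial_deriv i f x) \<le> D i" by (metis imageI)
  define K where "K = (\<Sum>i\<in>UNIV. D i)"
  have D0: "0 \<le> D i" for i using order_trans[OF norm_ge_zero D[OF f[of 0]]] .
  have sd: "summable (\<lambda>j. c j * partial_deriv i (f j) x)" for i x
    by (rule summable_l1_combination(1)[OF c D[OF f]])
  let ?f' = "\<lambda>n x h. c n * (\<Sum>i\<in>UNIV. of_real (h $ i) * partial_deriv i (f n) x)"
  let ?g' = "\<lambda>x h. \<Sum>i\<in>UNIV. of_real (h $ i) * (\<Sum>j. c j * partial_deriv i (f j) x)"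
  have "\<exists>g. \<forall>x\<in>UNIV. (\<lambda>n. c n * f n x) sums (g x) \<and> (g has_derivative ?g' x) (at x within UNIV)"
  proof (rule has_derivative_series)
    show "((\<lambda>x. c n * f n x) has_derivative ?f' n x) (at x within UNIV)" for n x
      by (intro has_derivative_mult_right has_derivative_coordinates schwartz_differentiable
          schwartz_bounded_imp_schwartz[OF B f])
    show "(\<lambda>n. c n * f n 0) sums (\<Sum>n. c n * f n 0)"
      by (rule summable_sums[OF summable_l1_combination(1)[OF c C[OF f]]])
    fix e :: real assume "e > 0"
    have "(\<lambda>n. (\<Sum>j. norm (c (j + n))) * K) \<longlonglongrightarrow> 0 * K"
      by (intro tendsto_intros suminf_exist_split2[OF c])
    then have "\<forall>\<^sub>F n in sequentially. (\<Sum>j. norm (c (j + n))) * K < e"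
      using \<open>e > 0\<close> by (intro order_tendstoD) auto
    then show "\<forall>\<^sub>F n in sequentially. \<forall>x\<in>UNIV. \<forall>h. norm ((\<Sum>i<n. ?f' i x h) - ?g' x h) \<le> e * norm h"
    proof (rule eventually_mono, intro ballI allI)
      fix n x and h :: "real^'n" assume n: "(\<Sum>j. norm (c (j + n))) * K < e"
      have cn: "summable (\<lambda>j. norm (c (j + n)))" using c by (rule summable_ignore_initial_segment)
      have "(\<Sum>j<n. ?f' j x h) = (\<Sum>i\<in>UNIV. of_real (h $ i) * (\<Sum>j<n. c j * partial_deriv i (f j) x))"
        unfolding sum_distrib_left by (subst sum.swap) (simp add: mult_ac)
      then have "(\<Sum>j<n. ?f' j x h) - ?g' x h = - (\<Sum>i\<in>UNIV. of_real (h $ i) * (\<Sum>j. c (j + n) * partial_deriv i (f (j + n)) x))"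
        unfolding suminf_split_initial_segment[OF sd, of _ _ n]
        by (simp add: distrib_left sum.distrib)
      also have "norm \<dots> \<le> (\<Sum>i\<in>UNIV. norm h * ((\<Sum>j. norm (c (j + n))) * D i))"
        unfolding norm_minus_cancel
      proof (rule order_trans[OF norm_sum], rule sum_mono)
        fix i
        have "norm (\<Sum>j. c (j + n) * partial_deriv i (f (j + n)) x) \<le> (\<Sum>j. norm (c (j + n))) * D i"
          by (rule summable_l1_combination(2)[OF cn D[OF f]])
        then show "norm (of_real (h $ i) * (\<Sum>j. c (j + n) * partial_deriv i (f (j + n)) x)) \<le> norm h * ((\<Sum>j. norm (c (j + n))) * D i)"
          unfolding norm_mult norm_of_real
          by (intro mult_mono component_le_norm_cart) auto
      qed
      also have "\<dots> = ((\<Sum>j. norm (c (j + n))) * K) * norm h"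
        unfolding K_def by (simp add: sum_distrib_left sum_distrib_right mult_ac)
      also have "\<dots> \<le> e * norm h" using n by (intro mult_right_mono) auto
      finally show "norm ((\<Sum>i<n. ?f' i x h) - ?g' x h) \<le> e * norm h" .
    qed
  qed auto
  then obtain g where g: "\<And>x. (\<lambda>n. c n * f n x) sums (g x)" "\<And>x. (g has_derivative ?g' x) (at x)" by auto
  have "g = (\<lambda>x. \<Sum>j. c j * f j x)" using g(1) sums_unique by fastforce
  then show ?thesis using g(2) by simp
qed

lemma schwartz_bounded_l1_combinations:
  fixes B :: "(real^'n::finite \<Rightarrow> complex) set"
  assumes "schwartz_bounded B"
  shows "schwartz_bounded (l1_combinations R B)"
proof (rule schwartz_bounded_coinduct[of "\<lambda>A. \<exists>B. schwartz_bounded B \<and> A = l1_combinations R B"])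
  fix A :: "(real^'n \<Rightarrow> complex) set" and f and x :: "real^'n"
  assume "\<exists>B. schwartz_bounded B \<and> A = l1_combinations R B" "f \<in> A"
  then show "f differentiable (at x)"
    unfolding l1_combinations_def using differentiableI[OF l1_combination_has_derivative] by blast
next
  fix A :: "(real^'n \<Rightarrow> complex) set" and i
  assume "\<exists>B. schwartz_bounded B \<and> A = l1_combinations R B"
  then obtain B where B: "schwartz_bounded B" and A: "A = l1_combinations R B" by blast
  have "partial_deriv i f \<in> l1_combinations R (partial_deriv i ` B)" if "f \<in> A" for f
  proof -
    obtain c g where f: "f = (\<lambda>x. \<Sum>j. c j * g j x)" "summable (\<lambda>j. norm (c j))" "(\<Sum>j. norm (c j)) \<le> R" "\<And>j. g j \<in> B"
      using \<open>f \<in> A\<close> unfolding A l1_combinations_def by blast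
    have "partial_deriv i f x = (\<Sum>j. c j * partial_deriv i (g j) x)" for x
      unfolding f partial_deriv_eq[OF l1_combination_has_derivative[OF B f(2,4)]]
      by (subst sum.remove[of _ i]) (auto simp: axis_def intro!: sum.neutral)
    then have "partial_deriv i f = (\<lambda>x. \<Sum>j. c j * partial_deriv i (g j) x)" by blast
    then show ?thesis using f(2-4) unfolding l1_combinations_def
      by (intro CollectI exI[of _ c] exI[of _ "\<lambda>j. partial_deriv i (g j)"]) auto
  qed
  then show "\<exists>A'. (\<exists>B. schwartz_bounded B \<and> A' = l1_combinations R B) \<and> partial_deriv i ` A \<subseteq> A'"
    using schwartz_bounded_deriv[OF B] by blast
next
  fix A :: "(real^'n \<Rightarrow> complex) set" and k
  assume "\<exists>B. schwartz_bounded B \<and> A = l1_combinations R B"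
  then obtain B where B: "schwartz_bounded B" and A: "A = l1_combinations R B" by blast
  obtain C where C: "\<And>f x. f \<in> B \<Longrightarrow> (1 + norm x) ^ k * norm (f x) \<le> C"
    using schwartz_bounded_bound[OF B] by blast
  have "(1 + norm x) ^ k * norm (f x) \<le> R * C" if "f \<in> A" for f x
  proof -
    obtain c g where f: "f = (\<lambda>x. \<Sum>j. c j * g j x)" "summable (\<lambda>j. norm (c j))" "(\<Sum>j. norm (c j)) \<le> R" "\<And>j. g j \<in> B"
      using \<open>f \<in> A\<close> unfolding A l1_combinations_def by blast
    have p: "(1 + norm x) ^ k > 0" by (simp add: add_pos_nonneg)
    have b: "norm (g j x) \<le> C / (1 + norm x) ^ k" for j
      using C[OF f(4), of x] p by (simp add: field_simps)
    have C0: "0 \<le> C / (1 + norm x) ^ k" using order_trans[OF norm_ge_zero b] .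
    have "norm (f x) \<le> (\<Sum>j. norm (c j)) * (C / (1 + norm x) ^ k)"
      unfolding f by (rule summable_l1_combination(2)[OF f(2) b])
    also have "\<dots> \<le> R * (C / (1 + norm x) ^ k)" using f(3) C0 by (rule mult_right_mono)
    finally show ?thesis using p by (simp add: field_simps)
  qed
  then show "\<exists>C. \<forall>f\<in>A. \<forall>x. (1 + norm x) ^ k * norm (f x) \<le> C" by blast
qed (use assms in blast)

text \<open>The tail of the series from index \<open>m\<close> is \<open>(1/3)\<^sup>m\<close> times an element of a fixed bounded set.\<close>

lemma functional_series:
  assumes T: "schwartz_functional T" and B: "schwartz_bounded B" and f: "\<And>j. f j \<in> B"
    and c: "\<And>j. norm (c j) \<le> (1/3) ^ j"
  shows "schwartz (\<lambda>x. \<Sum>j. c j * f j x)" "(\<lambda>j. c j * T (f j)) sums T (\<lambda>x. \<Sum>j. c j * f j x)"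
proof -
  have s3: "summable (\<lambda>j. (1/3::real) ^ j)" by (rule summable_geometric) simp
  have sc: "summable (\<lambda>j. norm (c j))"
    by (rule summable_comparison_test'[OF s3, of 0]) (use c in auto)
  have tail: "(\<lambda>x. \<Sum>j. (3 ^ m * c (j + m)) * f (j + m) x) \<in> l1_combinations (3/2) B" for m
  proof -
    have b: "norm (3 ^ m * c (j + m)) \<le> (1/3) ^ j" for j
      using c[of "j + m"] by (simp add: norm_mult norm_power power_add power_divide field_simps)
    have s: "summable (\<lambda>j. norm (3 ^ m * c (j + m)))"
      by (rule summable_comparison_test'[OF s3, of 0]) (use b in auto)
    have "(\<Sum>j. norm (3 ^ m * c (j + m))) \<le> (\<Sum>j. (1/3::real) ^ j)"
      by (intro suminf_le b s s3)
    also have "\<dots> = 3/2" by (subst suminf_geometric) auto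
    finally show ?thesis using s f unfolding l1_combinations_def
      by (intro CollectI exI[of _ "\<lambda>j. 3 ^ m * c (j + m)"] exI[of _ "\<lambda>j. f (j + m)"]) auto
  qed
  have L: "schwartz_bounded (l1_combinations (3/2) B)" by (rule schwartz_bounded_l1_combinations[OF B])
  show S: "schwartz (\<lambda>x. \<Sum>j. c j * f j x)"
    using schwartz_bounded_imp_schwartz[OF L tail[of 0]] by simp
  obtain M where M: "\<And>g. g \<in> l1_combinations (3/2) B \<Longrightarrow> norm (T g) \<le> M"
    using functional_bounded[OF T L] by blast
  obtain C where C: "\<And>f x. f \<in> B \<Longrightarrow> norm (f x) \<le> C"
    using schwartz_bounded_bound[OF B, of 0] by auto
  have Sf: "schwartz (\<lambda>x. c j * f j x)" for j
    by (intro schwartz_cmult schwartz_bounded_imp_schwartz[OF B f])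
  have diff: "norm ((\<Sum>j<m. c j * T (f j)) - T (\<lambda>x. \<Sum>j. c j * f j x)) \<le> (1/3) ^ m * M" for m
  proof -
    have "(\<Sum>j. c j * f j x) - (\<Sum>j<m. c j * f j x) = (1/3) ^ m * (\<Sum>j. (3 ^ m * c (j + m)) * f (j + m) x)" for x
    proof -
      have s: "summable (\<lambda>j. c j * f j x)" by (rule summable_l1_combination(1)[OF sc C[OF f]])
      have "(\<Sum>j. (3 ^ m * c (j + m)) * f (j + m) x) = 3 ^ m * (\<Sum>j. c (j + m) * f (j + m) x)"
        unfolding mult.assoc by (rule suminf_mult[OF summable_ignore_initial_segment[OF s]])
      then show ?thesis
        unfolding suminf_split_initial_segment[OF s, of m] by (simp add: power_divide)
    qed
    then have "T (\<lambda>x. \<Sum>j. c j * f j x) - T (\<lambda>x. \<Sum>j<m. c j * f j x) =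
        (1/3) ^ m * T (\<lambda>x. \<Sum>j. (3 ^ m * c (j + m)) * f (j + m) x)"
      by (simp flip: functional_diff[OF T S schwartz_sum[OF Sf]]
          functional_cmult[OF T schwartz_bounded_imp_schwartz[OF L tail]])
    moreover have "T (\<lambda>x. \<Sum>j<m. c j * f j x) = (\<Sum>j<m. c j * T (f j))"
      using functional_sum[OF T Sf, where I="{..<m}"] functional_cmult[OF T schwartz_bounded_imp_schwartz[OF B f]] by simp
    ultimately have "(\<Sum>j<m. c j * T (f j)) - T (\<lambda>x. \<Sum>j. c j * f j x) =
        - ((1/3) ^ m * T (\<lambda>x. \<Sum>j. (3 ^ m * c (j + m)) * f (j + m) x))" by (simp add: algebra_simps)
    then have "norm ((\<Sum>j<m. c j * T (f j)) - T (\<lambda>x. \<Sum>j. c j * f j x)) =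
        (1/3) ^ m * norm (T (\<lambda>x. \<Sum>j. (3 ^ m * c (j + m)) * f (j + m) x))"
      by (simp only: norm_minus_cancel norm_mult norm_power) simp
    then show ?thesis using M[OF tail[of m]] by (simp add: mult_left_mono)
  qed
  have "(\<lambda>m. (1/3) ^ m * M) \<longlonglongrightarrow> 0 * M"
    by (rule tendsto_mult_right[OF LIMSEQ_realpow_zero]) auto
  then have "(\<lambda>m. (1/3) ^ m * M) \<longlonglongrightarrow> 0" by simp
  then have "(\<lambda>m. (\<Sum>j<m. c j * T (f j)) - T (\<lambda>x. \<Sum>j. c j * f j x)) \<longlonglongrightarrow> 0"
    by (rule Lim_null_comparison[OF always_eventually[OF allI[OF diff]]])
  then show "(\<lambda>j. c j * T (f j)) sums T (\<lambda>x. \<Sum>j. c j * f j x)"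
    unfolding sums_def by (rule LIM_zero_cancel)
qed

subsection \<open>Uniform boundedness\<close>

lemma sign_choice:
  fixes a b :: complex
  shows "\<exists>e. (e = 1 \<or> e = -1) \<and> norm b \<le> norm (a + e * b)"
proof (rule ccontr)
  assume "\<not> ?thesis"
  then have "norm (a + b) < norm b" "norm (a - b) < norm b"
    by (auto simp: not_le dest: spec[of _ 1] spec[of _ "-1"])
  moreover have "2 * norm b = norm ((a + b) - (a - b))" by (simp add: norm_mult flip: mult_2)
  ultimately show False using norm_triangle_ineq4[of "a + b" "a - b"] by linarith
qed

text \<open>If the assertion fails, there are indices \<open>s\<^sub>k\<close> for which the supremum \<open>N\<^sub>k\<close> of \<open>w s\<^sub>k\<close> on \<open>B\<close> exceeds \<open>4\<^sup>k\<close>, and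
  functions \<open>f\<^sub>k\<close> in \<open>B\<close> that attain \<open>2/3\<close> of it. The series \<open>\<Sum>j. \<plusminus> (1/3)\<^sup>j f\<^sub>j\<close> with suitable signs then contradicts
  pointwise boundedness: its terms up to the \<open>k\<close>-th contribute at least \<open>(2/3) (1/3)\<^sup>k N\<^sub>k\<close> to the pairing with
  \<open>w s\<^sub>k\<close>, the later terms at most \<open>(1/2) (1/3)\<^sup>k N\<^sub>k\<close>, and the difference is at least \<open>(4/3)\<^sup>k / 6\<close>.\<close>

lemma uniform_boundedness:
  fixes w :: "'s \<Rightarrow> 'n::finite distr"
  assumes w: "\<And>s. s \<in> S \<Longrightarrow> schwartz_functional (w s)"
    and pointwise: "\<And>f. schwartz f \<Longrightarrow> \<exists>M. \<forall>s\<in>S. norm (w s f) \<le> M"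
    and B: "schwartz_bounded B"
  shows "\<exists>M. \<forall>s\<in>S. \<forall>f\<in>B. norm (w s f) \<le> M"
proof (rule ccontr)
  assume unb: "\<not> ?thesis"
  define N where "N = (\<lambda>s. SUP f\<in>B. norm (w s f))"
  have bdd: "bdd_above ((\<lambda>f. norm (w s f)) ` B)" if "s \<in> S" for s
    using functional_bounded[OF w[OF that] B] by (auto simp: bdd_above_def)
  have N: "norm (w s f) \<le> N s" if "s \<in> S" "f \<in> B" for s f
    unfolding N_def by (rule cSUP_upper[OF that(2) bdd[OF that(1)]])
  have "\<exists>s f. s \<in> S \<and> f \<in> B \<and> 4 ^ k < N s \<and> 2/3 * N s < norm (w s f)" for k :: nat
  proof -
    obtain s f where sf: "s \<in> S" "f \<in> B" "4 ^ k < norm (w s f)" using unb by (meson not_le)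
    then have big: "4 ^ k < N s" using N by fastforce
    then have "0 < N s" using zero_less_power[of "4::real" k] by linarith
    then have "2/3 * N s < N s" by simp
    then obtain g where "g \<in> B" "2/3 * N s < norm (w s g)"
      using less_cSUP_iff[OF _ bdd[OF sf(1)]] sf(2) unfolding N_def by blast
    then show ?thesis using sf big by blast
  qed
  then obtain s f where sf: "\<And>k. s k \<in> S" "\<And>k. f k \<in> B" "\<And>k::nat. 4 ^ k < N (s k)"
    "\<And>k. 2/3 * N (s k) < norm (w (s k) (f k))" by metis
  have Sf: "schwartz (f k)" for k by (rule schwartz_bounded_imp_schwartz[OF B sf(2)])
  \<comment> \<open>the signs are chosen one by one so that the \<open>k\<close>-th term never cancels against its predecessors\<close>
  have "\<exists>P. \<forall>k. schwartz (P k) \<and> (\<exists>e. (e = 1 \<or> e = -1) \<and> P (Suc k) = (\<lambda>x. P k x + (e * (1/3) ^ k) * f k x) \<and>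
      norm ((1/3) ^ k * w (s k) (f k)) \<le> norm (w (s k) (P k) + e * ((1/3) ^ k * w (s k) (f k))))"
  proof (rule dependent_nat_choice)
    show "\<exists>p::real^'n \<Rightarrow> complex. schwartz p" using schwartz_zero by blast
    fix p :: "real^'n \<Rightarrow> complex" and k :: nat assume p: "schwartz p"
    obtain e where e: "e = 1 \<or> e = -1" "norm ((1/3) ^ k * w (s k) (f k)) \<le> norm (w (s k) p + e * ((1/3) ^ k * w (s k) (f k)))"
      using sign_choice by blast
    show "\<exists>q. schwartz q \<and> (\<exists>e. (e = 1 \<or> e = -1) \<and> q = (\<lambda>x. p x + (e * (1/3) ^ k) * f k x) \<and>
      norm ((1/3) ^ k * w (s k) (f k)) \<le> norm (w (s k) p + e * ((1/3) ^ k * w (s k) (f k))))"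
      using e by (intro exI[of _ "\<lambda>x. p x + (e * (1/3) ^ k) * f k x"] conjI schwartz_plus schwartz_cmult p Sf) blast
  qed
  then obtain P where P: "\<And>k. schwartz (P k)" and eex: "\<forall>k. \<exists>e. (e = 1 \<or> e = -1) \<and> P (Suc k) = (\<lambda>x. P k x + (e * (1/3) ^ k) * f k x) \<and>
      norm ((1/3) ^ k * w (s k) (f k)) \<le> norm (w (s k) (P k) + e * ((1/3) ^ k * w (s k) (f k)))"
    by blast
  from choice[OF eex]
  obtain e where e: "\<And>k. e k = 1 \<or> e k = (-1::complex)"
    and PS: "\<And>k. P (Suc k) = (\<lambda>x. P k x + (e k * (1/3) ^ k) * f k x)"
    and ge: "\<And>k. norm ((1/3) ^ k * w (s k) (f k)) \<le> norm (w (s k) (P k) + e k * ((1/3) ^ k * w (s k) (f k)))"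
    by blast
  define c where "c = (\<lambda>k. e k * (1/3) ^ k)"
  have c: "norm (c k) = (1/3) ^ k" for k
    using e[of k] by (auto simp: c_def norm_mult norm_power norm_divide)
  define F where "F = (\<lambda>x. \<Sum>j. c j * f j x)"
  have SF: "schwartz F" unfolding F_def using c by (intro functional_series(1)[OF w[OF sf(1)] B sf(2)]) auto
  obtain M where M: "\<And>s. s \<in> S \<Longrightarrow> norm (w s F) \<le> M" using pointwise[OF SF] by blast
  obtain M0 where M0: "\<And>s. s \<in> S \<Longrightarrow> norm (w s (P 0)) \<le> M0" using pointwise[OF P] by blast
  have le: "(4/3) ^ k * (1/6) \<le> M + M0" for k
  proof -
    have T: "schwartz_functional (w (s k))" by (rule w[OF sf(1)])
    have wP: "w (s k) (P m) = w (s k) (P 0) + (\<Sum>j<m. c j * w (s k) (f j))" for m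
      by (induction m) (simp_all add: PS functional_add[OF T P schwartz_cmult[OF Sf]] functional_cmult[OF T Sf] c_def)
    have sums: "(\<lambda>j. c j * w (s k) (f j)) sums w (s k) F"
      unfolding F_def using c by (intro functional_series(2)[OF T B sf(2)]) auto
    have sm: "summable (\<lambda>j. c j * w (s k) (f j))" using sums by (rule sums_summable)
    have sm3: "summable (\<lambda>j. norm (c (j + Suc k)))" unfolding c
      by (rule summable_ignore_initial_segment) (rule summable_geometric, simp)
    have "w (s k) F = (\<Sum>j. c (j + Suc k) * w (s k) (f (j + Suc k))) + (\<Sum>j<Suc k. c j * w (s k) (f j))"
      unfolding sums_unique[OF sums] by (rule suminf_split_initial_segment[OF sm])
    then have eq: "w (s k) (P (Suc k)) = w (s k) F + w (s k) (P 0) - (\<Sum>j. c (j + Suc k) * w (s k) (f (j + Suc k)))"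
      unfolding wP[of "Suc k"] by simp
    have tail: "norm (\<Sum>j. c (j + Suc k) * w (s k) (f (j + Suc k))) \<le> (1/3) ^ k * (1/2) * N (s k)"
    proof -
      have "norm (\<Sum>j. c (j + Suc k) * w (s k) (f (j + Suc k))) \<le> (\<Sum>j. norm (c (j + Suc k))) * N (s k)"
        by (rule summable_l1_combination(2)[OF sm3 N[OF sf(1) sf(2)]])
      also have "(\<Sum>j. norm (c (j + Suc k))) = (\<Sum>j. (1/3) ^ Suc k * (1/3) ^ j)"
        unfolding c by (simp add: power_add mult_ac)
      also have "\<dots> = (1/3) ^ Suc k * (\<Sum>j. (1/3) ^ j)" by (rule suminf_mult) (rule summable_geometric, simp)
      also have "\<dots> = (1/3) ^ k * (1/2)" by (subst suminf_geometric) auto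
      finally show ?thesis .
    qed
    have "w (s k) (P (Suc k)) = w (s k) (P k) + e k * ((1/3) ^ k * w (s k) (f k))"
      unfolding wP[of "Suc k"] wP[of k] by (simp add: c_def)
    then have "(1/3) ^ k * norm (w (s k) (f k)) \<le> norm (w (s k) (P (Suc k)))"
      using ge[of k] by (simp add: norm_mult norm_power norm_divide)
    also have "\<dots> \<le> norm (w (s k) F) + norm (w (s k) (P 0)) + norm (\<Sum>j. c (j + Suc k) * w (s k) (f (j + Suc k)))"
      unfolding eq by (rule order_trans[OF norm_triangle_ineq4]) (intro add_right_mono norm_triangle_ineq)
    also have "\<dots> \<le> M + M0 + (1/3) ^ k * (1/2) * N (s k)"
      by (intro add_mono M M0 sf(1) tail)
    finally have 1: "(1/3) ^ k * norm (w (s k) (f k)) - (1/3) ^ k * (1/2) * N (s k) \<le> M + M0" by simp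
    have 2: "(1/3) ^ k * (2/3 * N (s k)) \<le> (1/3) ^ k * norm (w (s k) (f k))"
      using sf(4)[of k] by (intro mult_left_mono) auto
    have "(1/3) ^ k * (2/3 * N (s k)) = (1/3) ^ k * (1/2) * N (s k) + (1/3) ^ k * (1/6) * N (s k)"
      by (simp add: field_simps)
    then have "(1/3) ^ k * (1/6) * N (s k) \<le> M + M0" using 1 2 by linarith
    moreover have "(1/3) ^ k * (1/6) * 4 ^ k \<le> (1/3) ^ k * (1/6) * N (s k)"
      using sf(3)[of k] by (intro mult_left_mono) auto
    ultimately show ?thesis by (simp add: power_divide)
  qed
  obtain k where k: "(M + M0) * 6 < (4/3 :: real) ^ k" using real_arch_pow[of "4/3"] by auto
  have "a * 6 < x \<Longrightarrow> x * (1/6) \<le> a \<Longrightarrow> False" for a x :: real by linarith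
  from this[OF k le] show False .
qed

subsection \<open>Functionals moving along curves of test functions\<close>

lemma caratheodory_vector_derivative:
  fixes b :: "real \<Rightarrow> 'b::real_normed_vector"
  assumes "(b \<longlongrightarrow> b s) (at s within S)"
  shows "((\<lambda>r. (r - s) *\<^sub>R b r) has_vector_derivative b s) (at s within S)"
  unfolding has_vector_derivative_def
proof (rule has_derivativeI_sandwich[of 1 _ _ _ _ "\<lambda>r. norm (b r - b s)"])
  show "((\<lambda>r. norm (b r - b s)) \<longlongrightarrow> 0) (at s within S)"
    using assms by (intro tendsto_norm_zero LIM_zero)
  fix y assume "y \<noteq> s"
  have "(y - s) *\<^sub>R b y - (s - s) *\<^sub>R b s - (y - s) *\<^sub>R b s = (y - s) *\<^sub>R (b y - b s)"
    by (simp add: scaleR_diff_right)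
  then show "norm ((y - s) *\<^sub>R b y - (s - s) *\<^sub>R b s - (y - s) *\<^sub>R b s) / norm (y - s) \<le> norm (b y - b s)"
    using \<open>y \<noteq> s\<close> by simp
qed (auto intro: bounded_linear_scaleR_left)

text \<open>Caratheodory's form of differentiability for a pairing along a moving test function, apart from the
  motion of the functional itself. The Taylor remainder of the multiplier is paired with functionals
  that depend on time, which is where uniform boundedness enters.\<close>

lemma functional_curve_expansion:
  fixes w :: "real \<Rightarrow> 'n::finite distr"
  assumes w: "\<And>s. s \<in> {0..t} \<Longrightarrow> schwartz_functional (w s)"
    and cont: "\<And>f. schwartz f \<Longrightarrow> continuous_on {0..t} (\<lambda>s. w s f)"
    and m: "smooth_curve {0..t} m m'" and f: "schwartz f" and s: "s \<in> {0..t}"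
  shows "\<exists>b. (\<forall>r\<in>{0..t}. w r (\<lambda>x. m r x * f x) = w r (\<lambda>x. m s x * f x) + (r - s) *\<^sub>R b r) \<and>
     b s = w s (\<lambda>x. m' s x * f x) \<and> (b \<longlongrightarrow> b s) (at s within {0..t})"
proof -
  obtain Q where Q: "moderate_bounded Q" "\<And>s t'. s \<in> {0..t} \<Longrightarrow> t' \<in> {0..t} \<Longrightarrow> \<exists>r\<in>Q. \<forall>x.
        m t' x = m s x + of_real (t' - s) * m' s x + of_real ((t' - s)\<^sup>2) * r x"
    using m unfolding smooth_curve_def by blast
  have mod: "moderate (m r)" "moderate (m' r)" if "r \<in> {0..t}" for r
    using m that moderate_bounded_imp_moderate unfolding smooth_curve_def by blast+
  obtain \<rho> where \<rho>: "\<And>r. r \<in> {0..t} \<Longrightarrow> \<rho> r \<in> Q" "\<And>r x. r \<in> {0..t} \<Longrightarrow>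
        m r x = m s x + of_real (r - s) * m' s x + of_real ((r - s)\<^sup>2) * \<rho> r x"
    using Q(2)[OF s] by metis
  have B: "schwartz_bounded (fun_times Q {f})"
    by (intro schwartz_bounded_times Q) (simp add: schwartz_bounded_singleton f)
  have "\<exists>M. \<forall>s\<in>{0..t}. norm (w s g) \<le> M" if "schwartz g" for g
    using compact_imp_bounded[OF compact_continuous_image[OF cont[OF that] compact_Icc]]
    by (simp add: bounded_iff)
  then obtain M where M: "\<And>s g. s \<in> {0..t} \<Longrightarrow> g \<in> fun_times Q {f} \<Longrightarrow> norm (w s g) \<le> M"
    using uniform_boundedness[of "{0..t}" w, OF w _ B] by blast
  have \<rho>f: "(\<lambda>x. \<rho> r x * f x) \<in> fun_times Q {f}" if "r \<in> {0..t}" for r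
    by (rule fun_timesI[OF \<rho>(1)[OF that] singletonI]) simp
  define b where "b = (\<lambda>r. w r (\<lambda>x. m' s x * f x) + (r - s) *\<^sub>R w r (\<lambda>x. \<rho> r x * f x))"
  have exp: "w r (\<lambda>x. m r x * f x) = w r (\<lambda>x. m s x * f x) + (r - s) *\<^sub>R b r" if r: "r \<in> {0..t}" for r
  proof -
    note T = w[OF r]
    have S1: "schwartz (\<lambda>x. m s x * f x)" by (intro schwartz_times mod s f)
    have S2: "schwartz (\<lambda>x. m' s x * f x)" by (intro schwartz_times mod s f)
    have S3: "schwartz (\<lambda>x. \<rho> r x * f x)" by (rule schwartz_bounded_imp_schwartz[OF B \<rho>f[OF r]])
    have "(\<lambda>x. m r x * f x) = (\<lambda>x. (m s x * f x + of_real (r - s) * (m' s x * f x)) + of_real ((r - s)\<^sup>2) * (\<rho> r x * f x))"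
      unfolding \<rho>(2)[OF r] by (simp add: distrib_right mult.assoc)
    then have "w r (\<lambda>x. m r x * f x) = w r (\<lambda>x. (m s x * f x + of_real (r - s) * (m' s x * f x)) + of_real ((r - s)\<^sup>2) * (\<rho> r x * f x))"
      by simp
    also have "\<dots> = w r (\<lambda>x. m s x * f x + of_real (r - s) * (m' s x * f x)) + w r (\<lambda>x. of_real ((r - s)\<^sup>2) * (\<rho> r x * f x))"
      by (intro functional_add T schwartz_plus schwartz_cmult S1 S2 S3)
    also have "w r (\<lambda>x. m s x * f x + of_real (r - s) * (m' s x * f x)) = w r (\<lambda>x. m s x * f x) + w r (\<lambda>x. of_real (r - s) * (m' s x * f x))"
      by (intro functional_add T schwartz_cmult S1 S2)
    also have "w r (\<lambda>x. of_real (r - s) * (m' s x * f x)) = of_real (r - s) * w r (\<lambda>x. m' s x * f x)"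
      by (rule functional_cmult[OF T S2])
    also have "w r (\<lambda>x. of_real ((r - s)\<^sup>2) * (\<rho> r x * f x)) = of_real ((r - s)\<^sup>2) * w r (\<lambda>x. \<rho> r x * f x)"
      by (rule functional_cmult[OF T S3])
    finally show ?thesis unfolding b_def
      by (simp add: scaleR_conv_of_real power2_eq_square algebra_simps)
  qed
  have "((\<lambda>r. w r (\<lambda>x. m' s x * f x)) \<longlongrightarrow> w s (\<lambda>x. m' s x * f x)) (at s within {0..t})"
    using cont[OF schwartz_times[OF mod(2)[OF s] f]] s unfolding continuous_on_def by blast
  moreover have "((\<lambda>r. (r - s) *\<^sub>R w r (\<lambda>x. \<rho> r x * f x)) \<longlongrightarrow> 0) (at s within {0..t})"
  proof (rule Lim_null_comparison)
    show "((\<lambda>r. \<bar>r - s\<bar> * M) \<longlongrightarrow> 0) (at s within {0..t})"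
      by (auto intro!: tendsto_eq_intros)
    show "\<forall>\<^sub>F r in at s within {0..t}. norm ((r - s) *\<^sub>R w r (\<lambda>x. \<rho> r x * f x)) \<le> \<bar>r - s\<bar> * M"
      using M \<rho>f by (auto simp: eventually_at_filter intro!: always_eventually mult_left_mono)
  qed
  ultimately have "(b \<longlongrightarrow> w s (\<lambda>x. m' s x * f x) + 0) (at s within {0..t})"
    unfolding b_def by (rule tendsto_add)
  moreover have "b s = w s (\<lambda>x. m' s x * f x)" by (simp add: b_def)
  ultimately show ?thesis using exp by auto
qed

lemma continuous_on_functional_curve:
  fixes w :: "real \<Rightarrow> 'n::finite distr"
  assumes w: "\<And>s. s \<in> {0..t} \<Longrightarrow> schwartz_functional (w s)"
    and cont: "\<And>f. schwartz f \<Longrightarrow> continuous_on {0..t} (\<lambda>s. w s f)"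
    and m: "smooth_curve {0..t} m m'" and f: "schwartz f"
  shows "continuous_on {0..t} (\<lambda>s. w s (\<lambda>x. m s x * f x))"
  unfolding continuous_on_def
proof
  fix s assume s: "s \<in> {0..t}"
  obtain b where b: "\<And>r. r \<in> {0..t} \<Longrightarrow> w r (\<lambda>x. m r x * f x) = w r (\<lambda>x. m s x * f x) + (r - s) *\<^sub>R b r"
     "(b \<longlongrightarrow> b s) (at s within {0..t})"
    using functional_curve_expansion[OF w cont m f s] by blast
  have ms: "moderate (m s)"
    using m s moderate_bounded_imp_moderate unfolding smooth_curve_def by blast
  have "((\<lambda>r. w r (\<lambda>x. m s x * f x) + (r - s) *\<^sub>R b r) \<longlongrightarrow> w s (\<lambda>x. m s x * f x) + (s - s) *\<^sub>R b s) (at s within {0..t})"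
    using cont[OF schwartz_times[OF ms f]] s unfolding continuous_on_def
    by (intro tendsto_intros b(2)) blast
  then have "((\<lambda>r. w r (\<lambda>x. m s x * f x) + (r - s) *\<^sub>R b r) \<longlongrightarrow> w s (\<lambda>x. m s x * f x)) (at s within {0..t})"
    by simp
  then show "((\<lambda>s. w s (\<lambda>x. m s x * f x)) \<longlongrightarrow> w s (\<lambda>x. m s x * f x)) (at s within {0..t})"
    by (rule Lim_transform_eventually) (auto simp: eventually_at_filter b(1))
qed

text \<open>The product rule: the first summand comes from the motion of the functional, the second from the
  motion of the test function.\<close>

lemma functional_curve_derivative:
  fixes w :: "real \<Rightarrow> 'n::finite distr"
  assumes w: "\<And>s. s \<in> {0..t} \<Longrightarrow> schwartz_functional (w s)"
    and cont: "\<And>f. schwartz f \<Longrightarrow> continuous_on {0..t} (\<lambda>s. w s f)"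
    and m: "smooth_curve {0..t} m m'" and f: "schwartz f" and s: "0 < s" "s < t"
    and d: "((\<lambda>r. w r (\<lambda>x. m s x * f x)) has_vector_derivative d) (at s)"
  shows "((\<lambda>r. w r (\<lambda>x. m r x * f x)) has_vector_derivative (d + w s (\<lambda>x. m' s x * f x))) (at s)"
proof -
  have s': "s \<in> {0..t}" using s by simp
  obtain b where b: "\<And>r. r \<in> {0..t} \<Longrightarrow> w r (\<lambda>x. m r x * f x) = w r (\<lambda>x. m s x * f x) + (r - s) *\<^sub>R b r"
     "b s = w s (\<lambda>x. m' s x * f x)" "(b \<longlongrightarrow> b s) (at s within {0..t})"
    using functional_curve_expansion[OF w cont m f s'] by blast
  have "((\<lambda>r. w r (\<lambda>x. m s x * f x) + (r - s) *\<^sub>R b r) has_vector_derivative (d + b s)) (at s within {0..t})"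
    by (rule has_vector_derivative_add[OF has_vector_derivative_at_within[OF d] caratheodory_vector_derivative[OF b(3)]])
  then have "((\<lambda>r. w r (\<lambda>x. m r x * f x)) has_vector_derivative (d + b s)) (at s within {0..t})"
    by (rule has_vector_derivative_transform[OF s' b(1), rotated])
  then show ?thesis unfolding b(2) at_within_Icc_at[OF s] .
qed

lemma smooth_curve_reverse:
  assumes "smooth_curve {0..t} m m'"
  shows "smooth_curve {0..t} (\<lambda>s. m (t - s)) (\<lambda>s x. - m' (t - s) x)"
proof -
  obtain R where R: "moderate_bounded R" "\<And>s r. s \<in> {0..t} \<Longrightarrow> r \<in> {0..t} \<Longrightarrow> \<exists>q\<in>R. \<forall>x.
        m r x = m s x + of_real (r - s) * m' s x + of_real ((r - s)\<^sup>2) * q x"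
    and 1: "moderate_bounded (m ` {0..t})" "moderate_bounded (m' ` {0..t})"
    using assms unfolding smooth_curve_def by blast
  have "moderate_bounded ((\<lambda>s. m (t - s)) ` {0..t})"
    by (rule moderate_bounded_subset[OF 1(1)]) auto
  moreover have "moderate_bounded ((\<lambda>s x. - m' (t - s) x) ` {0..t})"
  proof (rule moderate_bounded_subset[OF moderate_bounded_times[OF moderate_const1[of "-1"] 1(2)]], rule image_subsetI)
    fix s assume "s \<in> {0..t}"
    then show "(\<lambda>x. - m' (t - s) x) \<in> fun_times {\<lambda>x. - 1} (m' ` {0..t})"
      by (intro fun_timesI[OF singletonI imageI[of "t - s"]]) auto
  qed
  moreover have "\<exists>q\<in>R. \<forall>x. m (t - r) x = m (t - s) x + of_real (r - s) * (- m' (t - s) x) + of_real ((r - s)\<^sup>2) * q x"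
    if "s \<in> {0..t}" "r \<in> {0..t}" for s r
  proof -
    obtain q where "q \<in> R" "\<And>x. m (t - r) x = m (t - s) x + of_real ((t - r) - (t - s)) * m' (t - s) x + of_real (((t - r) - (t - s))\<^sup>2) * q x"
      using R(2)[of "t - s" "t - r"] \<open>s \<in> {0..t}\<close> \<open>r \<in> {0..t}\<close> by auto
    moreover have "((t - r) - (t - s))\<^sup>2 = (r - s)\<^sup>2" "of_real ((t - r) - (t - s)) * m' (t - s) x = of_real (r - s) * (- m' (t - s) x)" for x
      by (simp_all add: power2_commute algebra_simps)
    ultimately show ?thesis by metis
  qed
  ultimately show ?thesis using R(1) unfolding smooth_curve_def by blast
qed

section \<open>The scalar multipliers of the linearised system\<close>

subsection \<open>Dividing a decaying jet by its variable\<close>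

lemma jet_continuous: "jet D \<Longrightarrow> continuous_on S (D n)"
  by (intro continuous_at_imp_continuous_on ballI has_vector_derivative_continuous) (auto dest: jetD)

lemma jet_average:
  assumes D: "jet D"
  shows "jet (\<lambda>n y. integral {0..1} (\<lambda>\<theta>. of_real (\<theta> ^ n) * D n (\<theta> * y)))"
  unfolding jet_def
proof (intro allI)
  fix n y
  have cont: "continuous_on A (\<lambda>z. D k (snd z * fst z))" for A :: "(real \<times> real) set" and k
    by (rule continuous_on_compose2[OF jet_continuous[OF D, of UNIV k]]) (auto intro!: continuous_intros)
  have "((\<lambda>y. integral (cbox 0 1) (\<lambda>\<theta>. of_real (\<theta> ^ n) * D n (\<theta> * y))) has_vector_derivative
      integral (cbox 0 1) (\<lambda>\<theta>. of_real (\<theta> ^ Suc n) * D (Suc n) (\<theta> * y))) (at y within UNIV)"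
  proof (rule leibniz_rule_vector_derivative)
    fix x \<theta> :: real
    show "((\<lambda>y. of_real (\<theta> ^ n) * D n (\<theta> * y)) has_vector_derivative of_real (\<theta> ^ Suc n) * D (Suc n) (\<theta> * x)) (at x within UNIV)"
      using jetD[OF jet_dilate[OF D]] by simp
  next
    fix x :: real
    have "continuous_on (cbox 0 1) (\<lambda>\<theta>. D n (\<theta> * x))"
      by (rule continuous_on_compose2[OF jet_continuous[OF D, of UNIV]]) (auto intro!: continuous_intros)
    then show "(\<lambda>\<theta>. of_real (\<theta> ^ n) * D n (\<theta> * x)) integrable_on cbox 0 1"
      by (intro integrable_continuous continuous_intros)
  next
    show "continuous_on (UNIV \<times> cbox 0 1) (\<lambda>(x, \<theta>). of_real (\<theta> ^ Suc n) * D (Suc n) (\<theta> * x))"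
      using cont by (auto simp: split_beta intro!: continuous_intros)
  qed auto
  then show "((\<lambda>y. integral {0..1} (\<lambda>\<theta>. of_real (\<theta> ^ n) * D n (\<theta> * y))) has_vector_derivative
      integral {0..1} (\<lambda>\<theta>. of_real (\<theta> ^ Suc n) * D (Suc n) (\<theta> * y))) (at y)" by simp
qed

text \<open>The quotient is the average of \<open>D'\<close> over the segment from \<open>0\<close> to \<open>y\<close>, which is smooth.\<close>

lemma jet_divide:
  assumes D: "jet D" and D0: "D 0 0 = 0"
  shows "\<exists>H. jet H \<and> (\<forall>y. D 0 y = of_real y * H 0 y)"
proof (intro exI conjI allI)
  show "jet (\<lambda>n y. integral {0..1} (\<lambda>\<theta>. of_real (\<theta> ^ n) * D (Suc n) (\<theta> * y)))"
    using jet_average[OF jet_shift[OF D]] .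
  fix y :: real
  have "((\<lambda>\<theta>. of_real y * D (Suc 0) (\<theta> * y)) has_integral D 0 (1 * y) - D 0 (0 * y)) {0..1}"
  proof (rule fundamental_theorem_of_calculus)
    fix \<theta> :: real
    have "((\<lambda>\<theta>. D 0 (y * \<theta>)) has_vector_derivative of_real y * D (Suc 0) (y * \<theta>)) (at \<theta>)"
      using jetD[OF jet_dilate[OF D, of y], of 0 \<theta>] by simp
    then show "((\<lambda>\<theta>. D 0 (\<theta> * y)) has_vector_derivative of_real y * D (Suc 0) (\<theta> * y)) (at \<theta> within {0..1})"
      by (simp add: mult.commute has_vector_derivative_at_within)
  qed simp
  from integral_unique[OF this]
  have "D 0 y = integral {0..1} (\<lambda>\<theta>. of_real y * D (Suc 0) (\<theta> * y))"
    using D0 by simp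
  then show "D 0 y = of_real y * integral {0..1} (\<lambda>\<theta>. of_real (\<theta> ^ 0) * D (Suc 0) (\<theta> * y))"
    by (simp add: integral_mult_right)
qed

lemma decaying_near_and_far:
  fixes g :: "real \<Rightarrow> complex"
  assumes "continuous_on {0..1} g" "c \<ge> 0" "\<And>y. y \<ge> 1 \<Longrightarrow> norm (g y) \<le> K * exp (- (c * y))"
  shows "\<exists>C. \<forall>y\<ge>0. norm (g y) \<le> C * exp (- (c * y))"
proof -
  obtain L where L: "\<And>y. y \<in> {0..1} \<Longrightarrow> norm (g y) \<le> L"
    using compact_imp_bounded[OF compact_continuous_image[OF assms(1) compact_Icc]]
    by (metis bounded_iff imageI)
  have L0: "0 \<le> L" using order_trans[OF norm_ge_zero L[of 0]] by simp
  have "norm (g y) \<le> (L * exp c + \<bar>K\<bar>) * exp (- (c * y))" if y: "y \<ge> 0" for y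
  proof (cases "y \<ge> 1")
    case True
    have "norm (g y) \<le> K * exp (- (c * y))" by (rule assms(3)[OF True])
    also have "\<dots> \<le> (L * exp c + \<bar>K\<bar>) * exp (- (c * y))"
      using L0 by (intro mult_right_mono) (auto intro: add_increasing)
    finally show ?thesis .
  next
    case False
    have "exp (c * y) \<le> exp c" using False y assms(2) by (auto intro: mult_left_le)
    then have "1 \<le> exp c * exp (- (c * y))" by (simp add: exp_minus field_simps)
    then have "L * 1 \<le> L * (exp c * exp (- (c * y)))" by (rule mult_left_mono[OF _ L0])
    moreover have "norm (g y) \<le> L" using L False y by auto
    moreover have "0 \<le> \<bar>K\<bar> * exp (- (c * y))" by simp
    ultimately show ?thesis unfolding distrib_right mult.assoc by linarith
  qed
  then show ?thesis by blast
qed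

text \<open>Differentiating \<open>y H = D\<close> repeatedly gives \<open>y H\<^sub>n + n H\<^sub>n\<^sub>-\<^sub>1 = D\<^sub>n\<close>. For \<open>y \<ge> 1\<close> this transfers the decay from \<open>D\<close> to
  \<open>H\<close> by induction on \<open>n\<close>, and on the rest of the half-line continuity is enough.\<close>

lemma decaying_jet_divide:
  assumes D: "decaying_jet c D" and c: "c \<ge> 0" and D0: "D 0 0 = 0"
  shows "\<exists>H. decaying_jet c H \<and> (\<forall>y. D 0 y = of_real y * H 0 y)"
proof -
  obtain H where H: "jet H" "\<And>y. D 0 y = of_real y * H 0 y"
    using jet_divide[OF decaying_jet_jet[OF D] D0] by blast
  have rec: "of_real y * H n y + of_nat n * H (n - 1) y = D n y" for n y
  proof (induction n arbitrary: y)
    case 0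
    then show ?case using H(2) by simp
  next
    case (Suc n)
    have id: "((\<lambda>y. of_real y :: complex) has_vector_derivative of_real 1) (at y)"
      by (rule has_vector_derivative_of_real) auto
    have "((\<lambda>y. of_real y * H n y + of_nat n * H (n - 1) y) has_vector_derivative
       ((of_real y * H (Suc n) y + of_real 1 * H n y) + of_nat n * H (Suc (n - 1)) y)) (at y)"
      by (rule has_vector_derivative_add[OF has_vector_derivative_mult[OF id jetD[OF H(1)]]
            has_vector_derivative_mult_right[OF jetD[OF H(1)]]])
    moreover have "(D n has_vector_derivative D (Suc n) y) (at y)"
      by (rule jetD[OF decaying_jet_jet[OF D]])
    moreover have "(\<lambda>y. of_real y * H n y + of_nat n * H (n - 1) y) = D n" using Suc by blast
    ultimately have "D (Suc n) y = (of_real y * H (Suc n) y + of_real 1 * H n y) + of_nat n * H (Suc (n - 1)) y"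
      by (metis vector_derivative_unique_at)
    then show ?case by (cases n) (simp_all add: algebra_simps)
  qed
  have "\<exists>C. \<forall>y\<ge>0. norm (H n y) \<le> C * exp (- (c * y))" for n
  proof (induction n)
    case bound: (Suc n)
    then obtain C where C: "\<And>y. y \<ge> 0 \<Longrightarrow> norm (H n y) \<le> C * exp (- (c * y))" by blast
    obtain K where K: "\<And>y. y \<ge> 0 \<Longrightarrow> norm (D (Suc n) y) \<le> K * exp (- (c * y))"
      using decaying_jet_bound[OF D] by blast
    have far: "norm (H (Suc n) y) \<le> (K + of_nat (Suc n) * C) * exp (- (c * y))" if y: "y \<ge> 1" for y
    proof -
      have "of_real y * H (Suc n) y = D (Suc n) y - of_nat (Suc n) * H n y"
        using rec[of y "Suc n"] by (simp add: algebra_simps)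
      then have "y * norm (H (Suc n) y) = norm (D (Suc n) y - of_nat (Suc n) * H n y)"
        using y by (metis abs_of_nonneg le_numeral_extra(1) norm_mult norm_of_real order_trans)
      also have "\<dots> \<le> norm (D (Suc n) y) + of_nat (Suc n) * norm (H n y)"
        by (rule order_trans[OF norm_triangle_ineq4]) (simp add: norm_mult del: of_nat_Suc)
      also have "\<dots> \<le> K * exp (- (c * y)) + of_nat (Suc n) * (C * exp (- (c * y)))"
        using C[of y] K[of y] y by (intro add_mono mult_left_mono) auto
      finally have "y * norm (H (Suc n) y) \<le> (K + of_nat (Suc n) * C) * exp (- (c * y))"
        by (simp add: algebra_simps)
      moreover have "norm (H (Suc n) y) \<le> y * norm (H (Suc n) y)"
        using mult_right_mono[OF y, of "norm (H (Suc n) y)"] by simp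
      ultimately show ?thesis by linarith
    qed
    show ?case by (rule decaying_near_and_far[OF jet_continuous[OF H(1)] c far])
  next
    case 0
    obtain K where K: "\<And>y. y \<ge> 0 \<Longrightarrow> norm (D 0 y) \<le> K * exp (- (c * y))"
      using decaying_jet_bound[OF D] by blast
    have far: "norm (H 0 y) \<le> K * exp (- (c * y))" if y: "y \<ge> 1" for y
    proof -
      have "norm (H 0 y) \<le> y * norm (H 0 y)"
        using mult_right_mono[OF y, of "norm (H 0 y)"] by simp
      also have "\<dots> = norm (D 0 y)" using H(2)[of y] y by (simp add: norm_mult)
      also have "\<dots> \<le> K * exp (- (c * y))" using K[of y] y by simp
      finally show ?thesis .
    qed
    show ?case by (rule decaying_near_and_far[OF jet_continuous[OF H(1)] c far])
  qed
  then show ?thesis using H unfolding decaying_jet_def by blast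
qed

lemma decaying_jet_add:
  assumes "decaying_jet c D" "decaying_jet c E"
  shows "decaying_jet c (\<lambda>n y. D n y + E n y)"
  unfolding decaying_jet_def jet_def
proof (intro conjI allI)
  show "((\<lambda>y. D n y + E n y) has_vector_derivative D (Suc n) y + E (Suc n) y) (at y)" for n y
    using assms by (intro has_vector_derivative_add jetD decaying_jet_jet)
  fix n
  obtain C K where "\<And>y. y \<ge> 0 \<Longrightarrow> norm (D n y) \<le> C * exp (- (c * y))" "\<And>y. y \<ge> 0 \<Longrightarrow> norm (E n y) \<le> K * exp (- (c * y))"
    using decaying_jet_bound[OF assms(1)] decaying_jet_bound[OF assms(2)] by blast
  then have "norm (D n y + E n y) \<le> (C + K) * exp (- (c * y))" if "y \<ge> 0" for y
    using that unfolding distrib_right by (intro norm_triangle_le add_mono)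
  then show "\<exists>C. \<forall>y\<ge>0. norm (D n y + E n y) \<le> C * exp (- (c * y))" by blast
qed

lemma decaying_jet_cmult:
  assumes "decaying_jet c D"
  shows "decaying_jet c (\<lambda>n y. a * D n y)"
  unfolding decaying_jet_def jet_def
proof (intro conjI allI)
  show "((\<lambda>y. a * D n y) has_vector_derivative a * D (Suc n) y) (at y)" for n y
    using assms by (intro has_vector_derivative_mult_right jetD decaying_jet_jet)
  fix n
  obtain C where "\<And>y. y \<ge> 0 \<Longrightarrow> norm (D n y) \<le> C * exp (- (c * y))"
    using decaying_jet_bound[OF assms(1)] by blast
  then have "norm (a * D n y) \<le> (norm a * C) * exp (- (c * y))" if "y \<ge> 0" for y
    using that by (simp add: norm_mult mult.assoc mult_left_mono)
  then show "\<exists>C. \<forall>y\<ge>0. norm (a * D n y) \<le> C * exp (- (c * y))" by blast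
qed

lemma decaying_jet_shift: "decaying_jet c D \<Longrightarrow> decaying_jet c (\<lambda>n. D (Suc n))"
  unfolding decaying_jet_def using jet_shift by blast

lemma decaying_jet_mono:
  assumes "decaying_jet c D" "c' \<le> c"
  shows "decaying_jet c' D"
  unfolding decaying_jet_def
proof (intro conjI allI)
  show "jet D" by (rule decaying_jet_jet[OF assms(1)])
  fix n
  obtain C where C: "C \<ge> 0" "\<And>y. y \<ge> 0 \<Longrightarrow> norm (D n y) \<le> C * exp (- (c * y))"
    using decaying_jet_bound[OF assms(1)] by blast
  have "norm (D n y) \<le> C * exp (- (c' * y))" if "y \<ge> 0" for y
    by (rule order_trans[OF C(2)[OF that]])
       (use C(1) assms(2) that in \<open>auto intro!: mult_left_mono mult_right_mono\<close>)
  then show "\<exists>C. \<forall>y\<ge>0. norm (D n y) \<le> C * exp (- (c' * y))" by blast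
qed

subsection \<open>The damped oscillator\<close>

lemma oscillator_distinct_roots:
  fixes r1 r2 :: complex
  assumes "r1 \<noteq> r2" "Re r1 \<ge> c" "Re r2 \<ge> c"
  defines "b \<equiv> \<lambda>n y. (1 / (r2 - r1)) * exp_jet r1 n y + (- 1 / (r2 - r1)) * exp_jet r2 n y"
  shows "decaying_jet c b" "b 0 0 = 0" "b (Suc 0) 0 = 1"
    "b (Suc (Suc n)) y = - (r1 + r2) * b (Suc n) y - (r1 * r2) * b n y"
proof -
  show "decaying_jet c b" unfolding b_def
    by (intro decaying_jet_add decaying_jet_cmult exp_jet_decaying assms)
  show "b 0 0 = 0" by (simp add: b_def exp_jet_def)
  have "b (Suc 0) 0 = r2 / (r2 - r1) - r1 / (r2 - r1)"
    by (simp add: b_def exp_jet_def)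
  also have "\<dots> = (r2 - r1) / (r2 - r1)" by (rule diff_divide_distrib[symmetric])
  finally show "b (Suc 0) 0 = 1" using assms(1) by simp
  show "b (Suc (Suc n)) y = - (r1 + r2) * b (Suc n) y - (r1 * r2) * b n y"
  proof -
    have gen: "a * (- r1 * (- r1 * e1)) + a' * (- r2 * (- r2 * e2)) =
      - (r1 + r2) * (a * (- r1 * e1) + a' * (- r2 * e2)) - (r1 * r2) * (a * e1 + a' * e2)" for a a' e1 e2
      by (simp add: algebra_simps)
    have Suc: "exp_jet r (Suc n) y = - r * exp_jet r n y" for r n y by (simp add: exp_jet_def)
    show ?thesis unfolding b_def Suc by (rule gen)
  qed
qed

lemma oscillator_double_root:
  fixes r :: real
  assumes "r > c"
  defines "b \<equiv> \<lambda>n y. ((- of_real r) ^ n * of_real y + of_nat n * (- of_real r) ^ (n - 1)) * exp (- of_real r * of_real y) :: complex"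
  shows "decaying_jet c b" "b 0 0 = 0" "b (Suc 0) 0 = 1"
    "b (Suc (Suc n)) y = - (2 * of_real r) * b (Suc n) y - (of_real r)\<^sup>2 * b n y"
proof -
  show rec: "b (Suc (Suc n)) y = - (2 * of_real r) * b (Suc n) y - (of_real r)\<^sup>2 * b n y" for n y
    by (cases n) (simp_all add: b_def algebra_simps power2_eq_square)
  show "b 0 0 = 0" "b (Suc 0) 0 = 1" by (simp_all add: b_def)
  show "decaying_jet c b" unfolding decaying_jet_def jet_def
  proof (intro conjI allI)
    fix n y
    have 1: "((\<lambda>y. exp (- of_real r * of_real y) :: complex) has_vector_derivative (- of_real r * exp (- of_real r * of_real y))) (at y)"
      using jetD[OF decaying_jet_jet[OF exp_jet_decaying[of "Re (of_real r)" "of_real r"]], of 0 y]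
      unfolding exp_jet_def[abs_def] by simp
    have "((\<lambda>y. of_real y :: complex) has_vector_derivative of_real 1) (at y)"
      by (rule has_vector_derivative_of_real) auto
    then have 2: "((\<lambda>y. (- of_real r) ^ n * of_real y + of_nat n * (- of_real r) ^ (n - 1) :: complex) has_vector_derivative
       ((- of_real r) ^ n * of_real 1 + 0)) (at y)"
      by (intro has_vector_derivative_add has_vector_derivative_mult_right has_vector_derivative_const)
    show "(b n has_vector_derivative b (Suc n) y) (at y)"
      unfolding b_def
      by (rule has_vector_derivative_eq_rhs[OF has_vector_derivative_mult[OF 2 1]])
         (cases n; simp add: algebra_simps)
  next
    fix n
    obtain K where K: "\<And>y. y \<ge> 0 \<Longrightarrow> (1 + y) ^ 1 * exp (- ((r - c) * y)) \<le> K"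
      using power_times_exp_bounded[of "r - c" 1] assms(1) by auto
    let ?M = "\<bar>r\<bar> ^ n + of_nat n * \<bar>r\<bar> ^ (n - 1)"
    have "norm (b n y) \<le> (?M * K) * exp (- (c * y))" if y: "y \<ge> 0" for y
    proof -
      have "norm (b n y) \<le> (\<bar>r\<bar> ^ n * y + of_nat n * \<bar>r\<bar> ^ (n - 1)) * exp (- (r * y))"
        unfolding b_def norm_mult norm_exp_eq_Re using y
        by (intro mult_mono order_trans[OF norm_triangle_ineq]) (auto simp: norm_mult norm_power)
      also have "\<dots> \<le> (?M * (1 + y)) * exp (- (r * y))"
        using y by (intro mult_right_mono) (auto simp: algebra_simps)
      also have "exp (- (r * y)) = exp (- ((r - c) * y)) * exp (- (c * y))"
        by (simp add: algebra_simps flip: exp_add)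
      also have "(?M * (1 + y)) * (exp (- ((r - c) * y)) * exp (- (c * y))) =
          ?M * ((1 + y) ^ 1 * exp (- ((r - c) * y))) * exp (- (c * y))" by (simp only: mult.assoc power_one_right)
      also have "\<dots> \<le> (?M * K) * exp (- (c * y))"
        using K[OF y] by (intro mult_right_mono mult_left_mono) auto
      finally show ?thesis .
    qed
    then show "\<exists>C. \<forall>y\<ge>0. norm (b n y) \<le> C * exp (- (c * y))" by blast
  qed
qed

text \<open>The solutions are combinations of \<open>exp (- r y)\<close> for the roots of \<open>r\<^sup>2 - \<nu> r + \<kappa> = 0\<close>. Both roots have positive real part
  because \<open>\<nu>\<close> and \<open>\<kappa>\<close> are positive. A double root, where \<open>y exp (- r y)\<close> appears, is treated separately at the price of
  some of the decay rate.\<close>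

lemma oscillator_exists:
  fixes \<nu> \<kappa> :: real
  assumes "\<nu> > 0" "\<kappa> > 0"
  shows "\<exists>c>0. \<exists>b. decaying_jet c b \<and> b 0 0 = 0 \<and> b (Suc 0) 0 = 1 \<and>
     (\<forall>n y. b (Suc (Suc n)) y = - of_real \<nu> * b (Suc n) y - of_real \<kappa> * b n y)"
proof (cases "\<nu>\<^sup>2 / 4 = \<kappa>")
  case True
  define r where "r = \<nu> / 2"
  have "complex_of_real \<nu> = 2 * of_real r" "complex_of_real \<kappa> = (of_real r)\<^sup>2"
    using True by (simp_all add: r_def power_divide flip: of_real_power)
  then show ?thesis
    using oscillator_double_root[of "\<nu> / 4" r] assms by (intro exI[of _ "\<nu> / 4"]) (auto simp: r_def)
next
  case False
  define x where "x = \<nu>\<^sup>2 / 4 - \<kappa>"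
  define w where "w = csqrt (of_real x)"
  have w2: "w\<^sup>2 = of_real x" by (simp add: w_def)
  have "Re w = sqrt ((\<bar>x\<bar> + x) / 2)" by (simp add: w_def)
  also have "\<dots> < \<nu> / 2"
    using assms by (intro real_less_lsqrt) (auto simp: x_def power_divide abs_if)
  finally have Rew: "Re w < \<nu> / 2" .
  have Rew0: "0 \<le> Re w" by (simp add: w_def)
  define c where "c = \<nu> / 2 - Re w"
  have "w \<noteq> 0"
  proof
    assume "w = 0"
    then have "complex_of_real x = 0" using w2 by simp
    then have "x = 0" by (simp only: of_real_eq_0_iff)
    then show False using False by (simp add: x_def)
  qed
  then have ne: "of_real (\<nu> / 2) - w \<noteq> of_real (\<nu> / 2) + w" by simp
  have c: "Re (of_real (\<nu> / 2) - w) \<ge> c" "Re (of_real (\<nu> / 2) + w) \<ge> c"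
    using Rew0 by (simp_all add: c_def)
  have "(of_real (\<nu> / 2) - w) + (of_real (\<nu> / 2) + w) = of_real \<nu>"
    by simp
  moreover have "(of_real (\<nu> / 2) - w) * (of_real (\<nu> / 2) + w) = of_real \<kappa>"
  proof -
    have "(of_real (\<nu> / 2) - w) * (of_real (\<nu> / 2) + w) = (of_real (\<nu> / 2))\<^sup>2 - w\<^sup>2"
      by (simp add: algebra_simps power2_eq_square)
    also have "\<dots> = of_real ((\<nu> / 2)\<^sup>2 - x)" unfolding w2 by simp
    finally show ?thesis by (simp add: x_def power_divide)
  qed
  ultimately show ?thesis
    using oscillator_distinct_roots[OF ne c] Rew by (intro exI[of _ c]) (auto simp: c_def)
qed

subsection \<open>The entries of the propagator\<close>

lemma divided_jet_derivative:
  assumes D: "jet D" and H: "jet H" and DH: "\<And>y. D 0 y = of_real y * H 0 y"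
  shows "D (Suc 0) y = H 0 y + of_real y * H (Suc 0) y"
proof -
  have id: "((\<lambda>y. of_real y :: complex) has_vector_derivative of_real 1) (at y)"
    by (rule has_vector_derivative_of_real) auto
  have "D 0 = (\<lambda>y. of_real y * H 0 y)" using DH by blast
  then have "((\<lambda>y. of_real y * H 0 y) has_vector_derivative D (Suc 0) y) (at y)"
    using jetD[OF D, of 0 y] by simp
  from vector_derivative_unique_at[OF this has_vector_derivative_mult[OF id jetD[OF H]]]
  show ?thesis by simp
qed

text \<open>The functions \<open>\<beta>'\<close>, \<open>\<beta>' + \<nu> \<beta>\<close>, \<open>exp (- \<mu> y)\<close> and \<open>exp (- y)\<close> all equal \<open>1\<close> at \<open>0\<close>, so their differences, like \<open>\<beta>\<close>, are
  divisible by \<open>y\<close>.\<close>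

lemma propagator_exists:
  fixes \<mu> \<nu> \<kappa> :: real
  assumes "\<mu> > 0" "\<nu> > 0" "\<kappa> > 0"
  shows "\<exists>c>0. \<exists>\<beta> B D A. c \<le> 1 \<and> c \<le> \<mu> \<and> decaying_jet c \<beta> \<and> decaying_jet c B \<and> decaying_jet c D \<and> decaying_jet c A \<and>
     \<beta> 0 0 = 0 \<and> \<beta> (Suc 0) 0 = 1 \<and>
     (\<forall>n y. \<beta> (Suc (Suc n)) y = - of_real \<nu> * \<beta> (Suc n) y - of_real \<kappa> * \<beta> n y) \<and>
     (\<forall>y. \<beta> 0 y = of_real y * B 0 y) \<and>
     (\<forall>y. \<beta> (Suc 0) y - exp_jet (of_real \<mu>) 0 y = of_real y * D 0 y) \<and>
     (\<forall>y. \<beta> (Suc 0) y + of_real \<nu> * \<beta> 0 y - exp_jet 1 0 y = of_real y * A 0 y)"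
proof -
  obtain c0 \<beta> where c0: "c0 > 0" and \<beta>: "decaying_jet c0 \<beta>" "\<beta> 0 0 = 0" "\<beta> (Suc 0) 0 = 1"
     and ode: "\<And>n y. \<beta> (Suc (Suc n)) y = - of_real \<nu> * \<beta> (Suc n) y - of_real \<kappa> * \<beta> n y"
    using oscillator_exists[OF assms(2,3)] by blast
  define c where "c = min c0 (min 1 \<mu>)"
  have c: "c > 0" "c \<le> 1" "c \<le> \<mu>" "c \<le> c0" using c0 assms by (auto simp: c_def)
  have \<beta>c: "decaying_jet c \<beta>" by (rule decaying_jet_mono[OF \<beta>(1) c(4)])
  have "decaying_jet c (\<lambda>n y. \<beta> (Suc n) y + (-1) * exp_jet (of_real \<mu>) n y)"
    using c by (intro decaying_jet_add decaying_jet_cmult decaying_jet_shift \<beta>c exp_jet_decaying) auto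
  from decaying_jet_divide[OF this] obtain D where D: "decaying_jet c D"
     "\<And>y. \<beta> (Suc 0) y + (-1) * exp_jet (of_real \<mu>) 0 y = of_real y * D 0 y"
    using c \<beta> by (auto simp: exp_jet_def)
  have "decaying_jet c (\<lambda>n y. (\<beta> (Suc n) y + of_real \<nu> * \<beta> n y) + (-1) * exp_jet 1 n y)"
    using c by (intro decaying_jet_add decaying_jet_cmult decaying_jet_shift \<beta>c exp_jet_decaying) auto
  from decaying_jet_divide[OF this] obtain A where A: "decaying_jet c A"
     "\<And>y. (\<beta> (Suc 0) y + of_real \<nu> * \<beta> 0 y) + (-1) * exp_jet 1 0 y = of_real y * A 0 y"
    using c \<beta> by (auto simp: exp_jet_def)
  obtain B where B: "decaying_jet c B" "\<And>y. \<beta> 0 y = of_real y * B 0 y"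
    using decaying_jet_divide[OF \<beta>c _ \<beta>(2)] c by auto
  show ?thesis
    using c \<beta>c \<beta> ode D A B by (intro exI[of _ c] conjI exI[of _ \<beta>] exI[of _ B] exI[of _ D] exI[of _ A]) auto
qed

lemma smooth_curve_coefficient_radial:
  fixes p :: "real^'n::finite \<Rightarrow> complex"
  assumes "moderate p" and D: "decaying_jet c D" "c \<ge> 0"
  shows "smooth_curve {0..t} (\<lambda>\<tau> \<xi>. p \<xi> * D 0 (\<tau> * (\<xi> \<bullet> \<xi>)))
     (\<lambda>\<tau> \<xi>. p \<xi> * (of_real (\<xi> \<bullet> \<xi>) * D (Suc 0) (\<tau> * (\<xi> \<bullet> \<xi>))))"
proof -
  have "{0..t} \<subseteq> {-\<bar>t\<bar>..\<bar>t\<bar>}" by auto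
  from smooth_curve_times[OF smooth_curve_const[OF assms(1)]
      smooth_curve_radial[OF decaying_jet_jet[OF D(1)] decaying_jet_bounded[OF D]] this]
  show ?thesis by simp
qed

lemma smooth_curve_coefficient_time_radial:
  fixes p :: "real^'n::finite \<Rightarrow> complex"
  assumes "moderate p" and D: "decaying_jet c D" "c \<ge> 0"
  shows "smooth_curve {0..t} (\<lambda>\<tau> \<xi>. p \<xi> * (of_real \<tau> * D 0 (\<tau> * (\<xi> \<bullet> \<xi>))))
     (\<lambda>\<tau> \<xi>. p \<xi> * (D 0 (\<tau> * (\<xi> \<bullet> \<xi>)) + of_real \<tau> * (of_real (\<xi> \<bullet> \<xi>) * D (Suc 0) (\<tau> * (\<xi> \<bullet> \<xi>)))))"
proof -
  have S: "{0..t} \<subseteq> {-\<bar>t\<bar>..\<bar>t\<bar>}" by auto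
  have "smooth_curve {0..t} (\<lambda>\<tau> \<xi>::real^'n. of_real \<tau> * D 0 (\<tau> * (\<xi> \<bullet> \<xi>)))
     (\<lambda>\<tau> \<xi>. 1 * D 0 (\<tau> * (\<xi> \<bullet> \<xi>)) + of_real \<tau> * (of_real (\<xi> \<bullet> \<xi>) * D (Suc 0) (\<tau> * (\<xi> \<bullet> \<xi>))))"
    by (rule smooth_curve_times[OF smooth_curve_id[OF S]
        smooth_curve_radial[OF decaying_jet_jet[OF D(1)] decaying_jet_bounded[OF D]] S])
  from smooth_curve_times[OF smooth_curve_const[OF assms(1)] this S]
  show ?thesis by simp
qed

section \<open>Solutions are given by the propagator\<close>

subsection \<open>Duality\<close>

text \<open>The system for \<open>Q = q \<circ> fourier\<close> and \<open>U = u \<circ> fourier\<close>: a partial derivative of a distribution has become a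
  polynomial factor on the test function.\<close>

locale fourier_side_solution =
  fixes \<mu> lam \<kappa> :: real and Q :: "real \<Rightarrow> 'n::finite distr" and U :: "real \<Rightarrow> 'n \<Rightarrow> 'n distr"
  assumes functional_Q: "\<And>s. s \<ge> 0 \<Longrightarrow> schwartz_functional (Q s)"
    and functional_U: "\<And>s i. s \<ge> 0 \<Longrightarrow> schwartz_functional (U s i)"
    and continuous_Q: "\<And>g. schwartz g \<Longrightarrow> continuous_on {0..} (\<lambda>s. Q s g)"
    and continuous_U: "\<And>i g. schwartz g \<Longrightarrow> continuous_on {0..} (\<lambda>s. U s i g)"
    and derivative_Q: "\<And>s g. s > 0 \<Longrightarrow> schwartz g \<Longrightarrow>
        ((\<lambda>s. Q s g) has_vector_derivative (\<Sum>i\<in>UNIV. U s i (\<lambda>\<xi>. - \<i> * of_real (\<xi> $ i) * g \<xi>))) (at s)"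
    and derivative_U: "\<And>s j g. s > 0 \<Longrightarrow> schwartz g \<Longrightarrow>
        ((\<lambda>s. U s j g) has_vector_derivative
           (of_real \<mu> * U s j (\<lambda>\<xi>. - of_real (\<xi> \<bullet> \<xi>) * g \<xi>)
            + of_real (lam + \<mu>) * (\<Sum>k\<in>UNIV. U s k (\<lambda>\<xi>. - (of_real (\<xi> $ k) * of_real (\<xi> $ j)) * g \<xi>))
            - of_real \<kappa> * Q s (\<lambda>\<xi>. (\<i> * of_real (\<xi> $ j) * of_real (\<xi> \<bullet> \<xi>)) * g \<xi>))) (at s)"
begin

text \<open>The functions \<open>a\<close> and \<open>b\<close> solve the transposed system. Pairing them at time \<open>t - s\<close> with the solution at time
  \<open>s\<close> gives a function of \<open>s\<close> that is continuous on the closed interval and has derivative zero inside.\<close>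

lemma duality:
  fixes a a' :: "real \<Rightarrow> real^'n \<Rightarrow> complex" and b b' :: "'n \<Rightarrow> real \<Rightarrow> real^'n \<Rightarrow> complex"
  assumes t: "t > 0" and g: "schwartz g"
    and a: "smooth_curve {0..t} a a'" and b: "\<And>i. smooth_curve {0..t} (b i) (b' i)"
    and ode_a: "\<And>\<tau> \<xi>. a' \<tau> \<xi> = - \<i> * of_real \<kappa> * of_real (\<xi> \<bullet> \<xi>) * (\<Sum>j\<in>UNIV. of_real (\<xi> $ j) * b j \<tau> \<xi>)"
    and ode_b: "\<And>i \<tau> \<xi>. b' i \<tau> \<xi> = - \<i> * of_real (\<xi> $ i) * a \<tau> \<xi> - of_real \<mu> * of_real (\<xi> \<bullet> \<xi>) * b i \<tau> \<xi>
        - of_real (lam + \<mu>) * of_real (\<xi> $ i) * (\<Sum>j\<in>UNIV. of_real (\<xi> $ j) * b j \<tau> \<xi>)"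
  shows "Q t (\<lambda>\<xi>. a 0 \<xi> * g \<xi>) + (\<Sum>i\<in>UNIV. U t i (\<lambda>\<xi>. b i 0 \<xi> * g \<xi>)) =
    Q 0 (\<lambda>\<xi>. a t \<xi> * g \<xi>) + (\<Sum>i\<in>UNIV. U 0 i (\<lambda>\<xi>. b i t \<xi> * g \<xi>))"
proof -
  define H where "H = (\<lambda>s. Q s (\<lambda>\<xi>. a (t - s) \<xi> * g \<xi>) + (\<Sum>i\<in>UNIV. U s i (\<lambda>\<xi>. b i (t - s) \<xi> * g \<xi>)))"
  note ra = smooth_curve_reverse[OF a] and rb = smooth_curve_reverse[OF b]
  have cQ: "continuous_on {0..t} (\<lambda>s. Q s f)" if "schwartz f" for f
    by (rule continuous_on_subset[OF continuous_Q[OF that]]) auto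
  have cU: "continuous_on {0..t} (\<lambda>s. U s i f)" if "schwartz f" for f i
    by (rule continuous_on_subset[OF continuous_U[OF that]]) auto
  have fQ: "schwartz_functional (Q s)" if "s \<in> {0..t}" for s using that functional_Q by simp
  have fU: "schwartz_functional (U s i)" if "s \<in> {0..t}" for s i using that functional_U by simp
  have contH: "continuous_on {0..t} H" unfolding H_def
    by (intro continuous_on_add continuous_on_sum continuous_on_functional_curve[OF fQ cQ ra g]
        continuous_on_functional_curve[OF fU cU rb g])
  have derH: "(H has_vector_derivative 0) (at s)" if s: "0 < s" "s < t" for s
  proof -
    have s': "t - s \<in> {0..t}" using s by auto
    have ma: "moderate (a (t - s))" "moderate (a' (t - s))"
      using a s' moderate_bounded_imp_moderate unfolding smooth_curve_def by blast+
    have mb: "moderate (b i (t - s))" "moderate (b' i (t - s))" for i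
      using b[of i] s' moderate_bounded_imp_moderate unfolding smooth_curve_def by blast+
    define ag where "ag = (\<lambda>\<xi>. a (t - s) \<xi> * g \<xi>)"
    define bg where "bg = (\<lambda>i \<xi>. b i (t - s) \<xi> * g \<xi>)"
    have Sa: "schwartz ag" unfolding ag_def by (intro schwartz_times ma g)
    have Sb: "schwartz (bg i)" for i unfolding bg_def by (intro schwartz_times mb g)
    note TQ = functional_Q[OF less_imp_le[OF s(1)]] and TU = functional_U[OF less_imp_le[OF s(1)]]
    \<comment> \<open>the pairings in terms of which both halves of the derivative are expressed\<close>
    define P where "P = (\<lambda>i. U s i (\<lambda>\<xi>. - \<i> * of_real (\<xi> $ i) * ag \<xi>))"
    define V where "V = (\<lambda>i. U s i (\<lambda>\<xi>. - of_real (\<xi> \<bullet> \<xi>) * bg i \<xi>))"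
    define W where "W = (\<lambda>k j. U s k (\<lambda>\<xi>. - (of_real (\<xi> $ k) * of_real (\<xi> $ j)) * bg j \<xi>))"
    define X where "X = (\<lambda>j. Q s (\<lambda>\<xi>. (\<i> * of_real (\<xi> $ j) * of_real (\<xi> \<bullet> \<xi>)) * bg j \<xi>))"
    have SP: "schwartz (\<lambda>\<xi>. - \<i> * of_real (\<xi> $ i) * ag \<xi>)" for i
      by (intro schwartz_times moderate_cmult moderate_coord Sa)
    have SV: "schwartz (\<lambda>\<xi>. - of_real (\<xi> \<bullet> \<xi>) * bg i \<xi>)" for i
      by (intro schwartz_times moderate_uminus moderate_inner_self Sb)
    have SW: "schwartz (\<lambda>\<xi>. - (of_real (\<xi> $ k) * of_real (\<xi> $ j)) * bg j \<xi>)" for k j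
      by (intro schwartz_times moderate_uminus moderate_times moderate_coord Sb)
    have SX: "schwartz (\<lambda>\<xi>. (\<i> * of_real (\<xi> $ j) * of_real (\<xi> \<bullet> \<xi>)) * bg j \<xi>)" for j
      by (intro schwartz_times moderate_times moderate_inner_self moderate_coord moderate_const1 Sb)
    have 1: "((\<lambda>r. Q r (\<lambda>\<xi>. a (t - r) \<xi> * g \<xi>)) has_vector_derivative
        ((\<Sum>i\<in>UNIV. P i) + Q s (\<lambda>\<xi>. - a' (t - s) \<xi> * g \<xi>))) (at s)"
      using derivative_Q[OF s(1) Sa] unfolding P_def ag_def
      by (intro functional_curve_derivative[OF fQ cQ ra g s])
    have 2: "((\<lambda>r. U r i (\<lambda>\<xi>. b i (t - r) \<xi> * g \<xi>)) has_vector_derivative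
        ((of_real \<mu> * V i + of_real (lam + \<mu>) * (\<Sum>k\<in>UNIV. W k i) - of_real \<kappa> * X i) + U s i (\<lambda>\<xi>. - b' i (t - s) \<xi> * g \<xi>))) (at s)" for i
      using derivative_U[OF s(1) Sb[of i], of i] unfolding V_def W_def X_def bg_def
      by (intro functional_curve_derivative[OF fU cU rb g s])
    have Qa: "Q s (\<lambda>\<xi>. - a' (t - s) \<xi> * g \<xi>) = of_real \<kappa> * (\<Sum>j\<in>UNIV. X j)"
    proof -
      have "(\<lambda>\<xi>. - a' (t - s) \<xi> * g \<xi>) = (\<lambda>\<xi>. of_real \<kappa> * (\<Sum>j\<in>UNIV. (\<i> * of_real (\<xi> $ j) * of_real (\<xi> \<bullet> \<xi>)) * bg j \<xi>))"
        unfolding ode_a bg_def by (simp add: sum_distrib_left sum_distrib_right sum_negf mult_ac)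
      then have "Q s (\<lambda>\<xi>. - a' (t - s) \<xi> * g \<xi>) =
          Q s (\<lambda>\<xi>. of_real \<kappa> * (\<Sum>j\<in>UNIV. (\<i> * of_real (\<xi> $ j) * of_real (\<xi> \<bullet> \<xi>)) * bg j \<xi>))" by (rule arg_cong)
      also have "\<dots> = of_real \<kappa> * Q s (\<lambda>\<xi>. \<Sum>j\<in>UNIV. (\<i> * of_real (\<xi> $ j) * of_real (\<xi> \<bullet> \<xi>)) * bg j \<xi>)"
        by (rule functional_cmult[OF TQ schwartz_sum[OF SX]])
      also have "Q s (\<lambda>\<xi>. \<Sum>j\<in>UNIV. (\<i> * of_real (\<xi> $ j) * of_real (\<xi> \<bullet> \<xi>)) * bg j \<xi>) = (\<Sum>j\<in>UNIV. X j)"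
        unfolding X_def by (rule functional_sum[OF TQ SX])
      finally show ?thesis .
    qed
    have Ub: "U s i (\<lambda>\<xi>. - b' i (t - s) \<xi> * g \<xi>) = - P i - of_real \<mu> * V i - of_real (lam + \<mu>) * (\<Sum>k\<in>UNIV. W i k)" for i
    proof -
      have "(\<lambda>\<xi>. - b' i (t - s) \<xi> * g \<xi>) = (\<lambda>\<xi>. (- (- \<i> * of_real (\<xi> $ i) * ag \<xi>) - of_real \<mu> * (- of_real (\<xi> \<bullet> \<xi>) * bg i \<xi>))
          - of_real (lam + \<mu>) * (\<Sum>k\<in>UNIV. - (of_real (\<xi> $ i) * of_real (\<xi> $ k)) * bg k \<xi>))"
      proof
        fix \<xi>
        have "(\<Sum>k\<in>UNIV. - (of_real (\<xi> $ i) * of_real (\<xi> $ k)) * bg k \<xi>) =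
            - (of_real (\<xi> $ i) * (\<Sum>j\<in>UNIV. of_real (\<xi> $ j) * b j (t - s) \<xi>) * g \<xi>)"
          unfolding bg_def by (simp add: sum_distrib_left sum_distrib_right mult_ac sum_negf)
        then show "- b' i (t - s) \<xi> * g \<xi> = (- (- \<i> * of_real (\<xi> $ i) * ag \<xi>) - of_real \<mu> * (- of_real (\<xi> \<bullet> \<xi>) * bg i \<xi>))
          - of_real (lam + \<mu>) * (\<Sum>k\<in>UNIV. - (of_real (\<xi> $ i) * of_real (\<xi> $ k)) * bg k \<xi>)"
          unfolding ode_b ag_def bg_def by (simp add: algebra_simps)
      qed
      moreover have "U s i (\<lambda>\<xi>. (- (- \<i> * of_real (\<xi> $ i) * ag \<xi>) - of_real \<mu> * (- of_real (\<xi> \<bullet> \<xi>) * bg i \<xi>))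
          - of_real (lam + \<mu>) * (\<Sum>k\<in>UNIV. - (of_real (\<xi> $ i) * of_real (\<xi> $ k)) * bg k \<xi>)) =
          - P i - of_real \<mu> * V i - of_real (lam + \<mu>) * (\<Sum>k\<in>UNIV. W i k)"
      proof -
        have "U s i (\<lambda>\<xi>. (- (- \<i> * of_real (\<xi> $ i) * ag \<xi>) - of_real \<mu> * (- of_real (\<xi> \<bullet> \<xi>) * bg i \<xi>))
          - of_real (lam + \<mu>) * (\<Sum>k\<in>UNIV. - (of_real (\<xi> $ i) * of_real (\<xi> $ k)) * bg k \<xi>)) =
          U s i (\<lambda>\<xi>. - (- \<i> * of_real (\<xi> $ i) * ag \<xi>) - of_real \<mu> * (- of_real (\<xi> \<bullet> \<xi>) * bg i \<xi>))
          - U s i (\<lambda>\<xi>. of_real (lam + \<mu>) * (\<Sum>k\<in>UNIV. - (of_real (\<xi> $ i) * of_real (\<xi> $ k)) * bg k \<xi>))"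
          by (rule functional_diff[OF TU schwartz_minus[OF schwartz_uminus[OF SP] schwartz_cmult[OF SV]] schwartz_cmult[OF schwartz_sum[OF SW]]])
        also have "U s i (\<lambda>\<xi>. of_real (lam + \<mu>) * (\<Sum>k\<in>UNIV. - (of_real (\<xi> $ i) * of_real (\<xi> $ k)) * bg k \<xi>)) =
          of_real (lam + \<mu>) * U s i (\<lambda>\<xi>. \<Sum>k\<in>UNIV. - (of_real (\<xi> $ i) * of_real (\<xi> $ k)) * bg k \<xi>)"
          by (rule functional_cmult[OF TU schwartz_sum[OF SW]])
        also have "U s i (\<lambda>\<xi>. \<Sum>k\<in>UNIV. - (of_real (\<xi> $ i) * of_real (\<xi> $ k)) * bg k \<xi>) = (\<Sum>k\<in>UNIV. W i k)"
          unfolding W_def by (rule functional_sum[OF TU SW])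
        also have "U s i (\<lambda>\<xi>. - (- \<i> * of_real (\<xi> $ i) * ag \<xi>) - of_real \<mu> * (- of_real (\<xi> \<bullet> \<xi>) * bg i \<xi>)) =
          U s i (\<lambda>\<xi>. - (- \<i> * of_real (\<xi> $ i) * ag \<xi>)) - U s i (\<lambda>\<xi>. of_real \<mu> * (- of_real (\<xi> \<bullet> \<xi>) * bg i \<xi>))"
          by (rule functional_diff[OF TU schwartz_uminus[OF SP] schwartz_cmult[OF SV]])
        also have "U s i (\<lambda>\<xi>. - (- \<i> * of_real (\<xi> $ i) * ag \<xi>)) = - P i"
          unfolding P_def by (rule functional_uminus[OF TU SP])
        also have "U s i (\<lambda>\<xi>. of_real \<mu> * (- of_real (\<xi> \<bullet> \<xi>) * bg i \<xi>)) = of_real \<mu> * V i"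
          unfolding V_def by (rule functional_cmult[OF TU SV])
        finally show ?thesis .
      qed
      ultimately show ?thesis by simp
    qed
    have "((\<Sum>i\<in>UNIV. P i) + Q s (\<lambda>\<xi>. - a' (t - s) \<xi> * g \<xi>)) +
        (\<Sum>i\<in>UNIV. (of_real \<mu> * V i + of_real (lam + \<mu>) * (\<Sum>k\<in>UNIV. W k i) - of_real \<kappa> * X i) + U s i (\<lambda>\<xi>. - b' i (t - s) \<xi> * g \<xi>)) = 0"
    proof -
      have "(\<Sum>i\<in>UNIV. \<Sum>k\<in>UNIV. W k i) = (\<Sum>i\<in>UNIV. \<Sum>k\<in>UNIV. W i k)" by (rule sum.swap)
      then show ?thesis unfolding Qa Ub
        by (simp add: sum.distrib sum_subtractf sum_negf sum_distrib_left[symmetric] algebra_simps)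
    qed
    moreover have "(H has_vector_derivative ((\<Sum>i\<in>UNIV. P i) + Q s (\<lambda>\<xi>. - a' (t - s) \<xi> * g \<xi>)) +
        (\<Sum>i\<in>UNIV. (of_real \<mu> * V i + of_real (lam + \<mu>) * (\<Sum>k\<in>UNIV. W k i) - of_real \<kappa> * X i) + U s i (\<lambda>\<xi>. - b' i (t - s) \<xi> * g \<xi>))) (at s)"
      unfolding H_def by (rule has_vector_derivative_add[OF 1 has_vector_derivative_sum[OF 2]])
    ultimately show ?thesis by simp
  qed
  have "H t = H 0"
  proof (rule has_derivative_zero_unique_strong_interval[of "{0, t}" 0 t])
    fix s assume "s \<in> {0..t} - {0, t}"
    then have "(H has_vector_derivative 0) (at s)" by (intro derH) auto
    then show "(H has_derivative (\<lambda>h. 0)) (at s within {0..t})"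
      by (simp add: has_vector_derivative_def has_derivative_at_withinI)
  qed (use t contH in auto)
  then show ?thesis by (simp add: H_def)
qed

end

lemma partial_derivs_fourier:
  fixes g :: "real^'n::finite \<Rightarrow> complex"
  assumes "schwartz g"
  shows "partial_deriv i (partial_deriv j (fourier g)) = fourier (\<lambda>\<xi>. - (of_real (\<xi> $ i) * of_real (\<xi> $ j)) * g \<xi>)"
    and "partial_deriv k (partial_deriv i (partial_deriv j (fourier g))) =
       fourier (\<lambda>\<xi>. \<i> * of_real (\<xi> $ k) * of_real (\<xi> $ i) * of_real (\<xi> $ j) * g \<xi>)"
proof -
  have 1: "schwartz (\<lambda>\<xi>. - \<i> * of_real (\<xi> $ j) * g \<xi>)"
    by (intro schwartz_times moderate_cmult moderate_coord assms)
  have 2: "partial_deriv i (partial_deriv j (fourier g)) = fourier (\<lambda>\<xi>. - \<i> * of_real (\<xi> $ i) * (- \<i> * of_real (\<xi> $ j) * g \<xi>))"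
    unfolding partial_deriv_fourier[OF assms] by (rule partial_deriv_fourier[OF 1])
  have S: "schwartz (\<lambda>\<xi>. - \<i> * of_real (\<xi> $ i) * (- \<i> * of_real (\<xi> $ j) * g \<xi>))"
    by (intro schwartz_times[OF _ 1] moderate_cmult moderate_coord)
  show "partial_deriv k (partial_deriv i (partial_deriv j (fourier g))) =
       fourier (\<lambda>\<xi>. \<i> * of_real (\<xi> $ k) * of_real (\<xi> $ i) * of_real (\<xi> $ j) * g \<xi>)"
    unfolding 2 partial_deriv_fourier[OF S] by (simp add: mult_ac)
  show "partial_deriv i (partial_deriv j (fourier g)) = fourier (\<lambda>\<xi>. - (of_real (\<xi> $ i) * of_real (\<xi> $ j)) * g \<xi>)"
    unfolding 2 by (simp add: mult_ac)
qed

lemma korteweg_solution_fourier_side: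
  assumes "korteweg_solution \<mu> lam \<kappa> q0 u0 q u"
  shows "fourier_side_solution \<mu> lam \<kappa> (\<lambda>s g. q s (fourier g)) (\<lambda>s i g. u s i (fourier g))"
proof
  fix s :: real and g :: "real^'a \<Rightarrow> complex" and j
  note sol = assms[unfolded korteweg_solution_def]
  have TQ: "schwartz_functional (q s)" and TU: "schwartz_functional (u s i)" if "s \<ge> 0" for s i
    using sol that by (auto intro: tempered_imp_functional)
  show "s \<ge> 0 \<Longrightarrow> schwartz_functional (\<lambda>g. q s (fourier g))" by (intro functional_comp_fourier TQ)
  show "s \<ge> 0 \<Longrightarrow> schwartz_functional (\<lambda>g. u s j (fourier g))" by (intro functional_comp_fourier TU)
  assume g: "schwartz g"
  show "continuous_on {0..} (\<lambda>s. q s (fourier g))" "continuous_on {0..} (\<lambda>s. u s j (fourier g))"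
    using sol schwartz_fourier[OF g] by auto
  assume s: "s > 0"
  have "((\<lambda>s. q s (fourier g)) has_vector_derivative - distr_div (u s) (fourier g)) (at s)"
    using sol schwartz_fourier[OF g] s by auto
  moreover have "- distr_div (u s) (fourier g) = (\<Sum>i\<in>UNIV. u s i (fourier (\<lambda>\<xi>. - \<i> * of_real (\<xi> $ i) * g \<xi>)))"
    unfolding distr_div_def distr_partial_def partial_deriv_fourier[OF g] by (simp add: sum_negf)
  ultimately show "((\<lambda>s. q s (fourier g)) has_vector_derivative (\<Sum>i\<in>UNIV. u s i (fourier (\<lambda>\<xi>. - \<i> * of_real (\<xi> $ i) * g \<xi>)))) (at s)"
    by simp
  have S2: "schwartz (fourier (\<lambda>\<xi>. - (of_real (\<xi> $ i) * of_real (\<xi> $ k)) * g \<xi>))" for i k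
    by (intro schwartz_fourier schwartz_times moderate_uminus moderate_times moderate_coord g)
  have lap: "distr_laplacian (u s j) (fourier g) = u s j (fourier (\<lambda>\<xi>. - of_real (\<xi> \<bullet> \<xi>) * g \<xi>))"
  proof -
    have "distr_laplacian (u s j) (fourier g) = (\<Sum>i\<in>UNIV. u s j (fourier (\<lambda>\<xi>. - (of_real (\<xi> $ i) * of_real (\<xi> $ i)) * g \<xi>)))"
      unfolding distr_laplacian_def distr_div_def distr_grad_def distr_partial_def partial_derivs_fourier[OF g] by simp
    also have "\<dots> = u s j (\<lambda>x. \<Sum>i\<in>UNIV. fourier (\<lambda>\<xi>. - (of_real (\<xi> $ i) * of_real (\<xi> $ i)) * g \<xi>) x)"
      by (rule functional_sum[OF TU[OF less_imp_le[OF s]] S2, symmetric])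
    also have "(\<lambda>x. \<Sum>i\<in>UNIV. fourier (\<lambda>\<xi>. - (of_real (\<xi> $ i) * of_real (\<xi> $ i)) * g \<xi>) x) =
        fourier (\<lambda>\<xi>. \<Sum>i\<in>UNIV. - (of_real (\<xi> $ i) * of_real (\<xi> $ i)) * g \<xi>)"
      by (intro ext fourier_sum[symmetric] schwartz_integrable schwartz_times moderate_uminus moderate_times moderate_coord g) auto
    also have "(\<lambda>\<xi>. \<Sum>i\<in>UNIV. - (of_real (\<xi> $ i) * of_real (\<xi> $ i)) * g \<xi>) = (\<lambda>\<xi>. - of_real (\<xi> \<bullet> \<xi>) * g \<xi>)"
      unfolding inner_eq_sum_coord by (simp add: sum_negf sum_distrib_right)
    finally show ?thesis .
  qed
  have grad_div: "distr_grad (distr_div (u s)) j (fourier g) =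
      (\<Sum>k\<in>UNIV. u s k (fourier (\<lambda>\<xi>. - (of_real (\<xi> $ k) * of_real (\<xi> $ j)) * g \<xi>)))"
    unfolding distr_div_def distr_grad_def distr_partial_def partial_derivs_fourier[OF g] by (simp add: sum_negf)
  have S3: "schwartz (fourier (\<lambda>\<xi>. \<i> * of_real (\<xi> $ k) * of_real (\<xi> $ i) * of_real (\<xi> $ j) * g \<xi>))" for i k j
    by (intro schwartz_fourier schwartz_times[OF _ g] moderate_times moderate_const1 moderate_coord)
  have grad_lap: "distr_grad (distr_laplacian (q s)) j (fourier g) =
      - q s (fourier (\<lambda>\<xi>. (\<i> * of_real (\<xi> $ j) * of_real (\<xi> \<bullet> \<xi>)) * g \<xi>))"
  proof -
    have "distr_grad (distr_laplacian (q s)) j (fourier g) =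
       - (\<Sum>i\<in>UNIV. q s (fourier (\<lambda>\<xi>. \<i> * of_real (\<xi> $ i) * of_real (\<xi> $ i) * of_real (\<xi> $ j) * g \<xi>)))"
      unfolding distr_laplacian_def distr_div_def distr_grad_def distr_partial_def partial_derivs_fourier(2)[OF g] by simp
    also have "(\<Sum>i\<in>UNIV. q s (fourier (\<lambda>\<xi>. \<i> * of_real (\<xi> $ i) * of_real (\<xi> $ i) * of_real (\<xi> $ j) * g \<xi>))) =
        q s (\<lambda>x. \<Sum>i\<in>UNIV. fourier (\<lambda>\<xi>. \<i> * of_real (\<xi> $ i) * of_real (\<xi> $ i) * of_real (\<xi> $ j) * g \<xi>) x)"
      by (rule functional_sum[OF TQ[OF less_imp_le[OF s]] S3, symmetric])
    also have "(\<lambda>x. \<Sum>i\<in>UNIV. fourier (\<lambda>\<xi>. \<i> * of_real (\<xi> $ i) * of_real (\<xi> $ i) * of_real (\<xi> $ j) * g \<xi>) x) =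
        fourier (\<lambda>\<xi>. \<Sum>i\<in>UNIV. \<i> * of_real (\<xi> $ i) * of_real (\<xi> $ i) * of_real (\<xi> $ j) * g \<xi>)"
      by (intro ext fourier_sum[symmetric] schwartz_integrable schwartz_times[OF _ g] moderate_times moderate_const1 moderate_coord) auto
    also have "(\<lambda>\<xi>. \<Sum>i\<in>UNIV. \<i> * of_real (\<xi> $ i) * of_real (\<xi> $ i) * of_real (\<xi> $ j) * g \<xi>) =
        (\<lambda>\<xi>. (\<i> * of_real (\<xi> $ j) * of_real (\<xi> \<bullet> \<xi>)) * g \<xi>)"
      unfolding inner_eq_sum_coord by (simp add: sum_distrib_left sum_distrib_right mult_ac)
    finally show ?thesis .
  qed
  have "((\<lambda>s. u s j (fourier g)) has_vector_derivative
             of_real \<mu> * distr_laplacian (u s j) (fourier g)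
           + of_real (lam + \<mu>) * distr_grad (distr_div (u s)) j (fourier g)
           + of_real \<kappa> * distr_grad (distr_laplacian (q s)) j (fourier g)) (at s)"
    using sol schwartz_fourier[OF g] s by blast
  then show "((\<lambda>s. u s j (fourier g)) has_vector_derivative
           (of_real \<mu> * u s j (fourier (\<lambda>\<xi>. - of_real (\<xi> \<bullet> \<xi>) * g \<xi>))
            + of_real (lam + \<mu>) * (\<Sum>k\<in>UNIV. u s k (fourier (\<lambda>\<xi>. - (of_real (\<xi> $ k) * of_real (\<xi> $ j)) * g \<xi>)))
            - of_real \<kappa> * q s (fourier (\<lambda>\<xi>. (\<i> * of_real (\<xi> $ j) * of_real (\<xi> \<bullet> \<xi>)) * g \<xi>)))) (at s)"
    unfolding lap grad_div grad_lap by simp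
qed

subsection \<open>The solution formula\<close>

text \<open>The projection onto the compressible part has the symbol \<open>\<xi>\<^sub>i \<xi>\<^sub>j / \<bar>\<xi>\<bar>\<^sup>2\<close>, which is not smooth at the
  origin. The quotients \<open>B\<close> and \<open>D\<close> of \<open>\<beta>\<close> and \<open>\<beta>' - exp (- \<mu> s)\<close> by \<open>s\<close> absorb its denominator. The quotient \<open>A\<close>
  measures the distance of \<open>\<alpha>\<close> from the heat factor \<open>exp (- s)\<close>.\<close>

locale propagator =
  fixes \<mu> lam \<kappa> c :: real and \<beta> B D A :: "nat \<Rightarrow> real \<Rightarrow> complex"
  assumes c: "0 < c" "c \<le> 1" "c \<le> \<mu>"
    and jets: "decaying_jet c \<beta>" "decaying_jet c B" "decaying_jet c D" "decaying_jet c A"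
    and \<beta>0: "\<beta> 0 0 = 0" "\<beta> (Suc 0) 0 = 1"
    and \<beta>_ode: "\<beta> (Suc (Suc n)) y = - of_real (lam + 2 * \<mu>) * \<beta> (Suc n) y - of_real \<kappa> * \<beta> n y"
    and B: "\<beta> 0 y = of_real y * B 0 y"
    and D: "\<beta> (Suc 0) y - exp_jet (of_real \<mu>) 0 y = of_real y * D 0 y"
    and A: "\<beta> (Suc 0) y + of_real (lam + 2 * \<mu>) * \<beta> 0 y - exp_jet 1 0 y = of_real y * A 0 y"
begin

abbreviation \<alpha> :: "nat \<Rightarrow> real \<Rightarrow> complex" where
  "\<alpha> n y \<equiv> \<beta> (Suc n) y + of_real (lam + 2 * \<mu>) * \<beta> n y"

lemma \<alpha>_jet: "decaying_jet c \<alpha>"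
  by (intro decaying_jet_add decaying_jet_cmult decaying_jet_shift jets)

lemma c_nonneg: "0 \<le> c" using c by simp

lemma exp_\<mu>_jet: "decaying_jet c (exp_jet (of_real \<mu>))"
  by (rule exp_jet_decaying) (use c in simp)

lemma B': "\<beta> (Suc 0) y = B 0 y + of_real y * B (Suc 0) y"
  by (rule divided_jet_derivative[OF decaying_jet_jet[OF jets(1)] decaying_jet_jet[OF jets(2)]], rule B)

lemma D': "\<beta> (Suc (Suc 0)) y - exp_jet (of_real \<mu>) (Suc 0) y = D 0 y + of_real y * D (Suc 0) y"
proof -
  have "jet (\<lambda>n y. \<beta> (Suc n) y + (-1) * exp_jet (of_real \<mu>) n y)"
    by (intro decaying_jet_jet[of c] decaying_jet_add decaying_jet_cmult decaying_jet_shift jets exp_\<mu>_jet)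
  from divided_jet_derivative[OF this decaying_jet_jet[OF jets(3)], of y]
  show ?thesis using D by simp
qed

end

locale korteweg_propagation = fourier_side_solution + propagator
begin

text \<open>Duality for the solution of the transposed system that starts from \<open>a = 1\<close>, \<open>b = 0\<close>.\<close>

lemma formula_Q:
  assumes t: "t > 0" and g: "schwartz g"
  shows "Q t g = Q 0 (\<lambda>\<xi>. \<alpha> 0 (t * (\<xi> \<bullet> \<xi>)) * g \<xi>)
    + (\<Sum>i\<in>UNIV. U 0 i (\<lambda>\<xi>. ((- \<i> * of_real (\<xi> $ i)) * (of_real t * B 0 (t * (\<xi> \<bullet> \<xi>)))) * g \<xi>))"
proof -
  define a where "a = (\<lambda>\<tau> (\<xi> :: real^'a). 1 * \<alpha> 0 (\<tau> * (\<xi> \<bullet> \<xi>)))"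
  define b where "b = (\<lambda>i \<tau> (\<xi> :: real^'a). (- \<i> * of_real (\<xi> $ i)) * (of_real \<tau> * B 0 (\<tau> * (\<xi> \<bullet> \<xi>))))"
  have sum: "(\<Sum>j\<in>UNIV. of_real (\<xi> $ j) * b j \<tau> \<xi>) = - \<i> * \<beta> 0 (\<tau> * (\<xi> \<bullet> \<xi>))" for \<tau> \<xi>
  proof -
    have "(\<Sum>j\<in>UNIV. of_real (\<xi> $ j) * b j \<tau> \<xi>) = - \<i> * of_real (\<xi> \<bullet> \<xi>) * (of_real \<tau> * B 0 (\<tau> * (\<xi> \<bullet> \<xi>)))"
      unfolding b_def inner_eq_sum_coord[of \<xi> \<xi>] sum_distrib_left sum_distrib_right by (simp add: mult_ac)
    then show ?thesis unfolding B[of "\<tau> * (\<xi> \<bullet> \<xi>)"] by (simp add: mult_ac)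
  qed
  have "Q t (\<lambda>\<xi>. a 0 \<xi> * g \<xi>) + (\<Sum>i\<in>UNIV. U t i (\<lambda>\<xi>. b i 0 \<xi> * g \<xi>)) =
    Q 0 (\<lambda>\<xi>. a t \<xi> * g \<xi>) + (\<Sum>i\<in>UNIV. U 0 i (\<lambda>\<xi>. b i t \<xi> * g \<xi>))"
  proof (rule duality[OF t g])
    show "smooth_curve {0..t} a (\<lambda>\<tau> \<xi>. 1 * (of_real (\<xi> \<bullet> \<xi>) * \<alpha> (Suc 0) (\<tau> * (\<xi> \<bullet> \<xi>))))"
      unfolding a_def by (rule smooth_curve_coefficient_radial[OF moderate_const1 \<alpha>_jet c_nonneg])
    show "smooth_curve {0..t} (b i) (\<lambda>\<tau> \<xi>. (- \<i> * of_real (\<xi> $ i)) * (B 0 (\<tau> * (\<xi> \<bullet> \<xi>)) + of_real \<tau> * (of_real (\<xi> \<bullet> \<xi>) * B (Suc 0) (\<tau> * (\<xi> \<bullet> \<xi>)))))" for i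
      unfolding b_def by (intro smooth_curve_coefficient_time_radial[OF _ jets(2) c_nonneg] moderate_cmult moderate_coord)
    show "1 * (of_real (\<xi> \<bullet> \<xi>) * \<alpha> (Suc 0) (\<tau> * (\<xi> \<bullet> \<xi>))) = - \<i> * of_real \<kappa> * of_real (\<xi> \<bullet> \<xi>) * (\<Sum>j\<in>UNIV. of_real (\<xi> $ j) * b j \<tau> \<xi>)" for \<tau> \<xi>
      unfolding sum \<beta>_ode by (simp add: algebra_simps)
    show "(- \<i> * of_real (\<xi> $ i)) * (B 0 (\<tau> * (\<xi> \<bullet> \<xi>)) + of_real \<tau> * (of_real (\<xi> \<bullet> \<xi>) * B (Suc 0) (\<tau> * (\<xi> \<bullet> \<xi>)))) =
        - \<i> * of_real (\<xi> $ i) * a \<tau> \<xi> - of_real \<mu> * of_real (\<xi> \<bullet> \<xi>) * b i \<tau> \<xi>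
        - of_real (lam + \<mu>) * of_real (\<xi> $ i) * (\<Sum>j\<in>UNIV. of_real (\<xi> $ j) * b j \<tau> \<xi>)" for i \<tau> \<xi>
    proof -
      have 1: "B 0 (\<tau> * (\<xi> \<bullet> \<xi>)) + of_real \<tau> * (of_real (\<xi> \<bullet> \<xi>) * B (Suc 0) (\<tau> * (\<xi> \<bullet> \<xi>))) = \<beta> (Suc 0) (\<tau> * (\<xi> \<bullet> \<xi>))"
        unfolding B' by simp
      have 2: "of_real (\<xi> \<bullet> \<xi>) * b i \<tau> \<xi> = - \<i> * of_real (\<xi> $ i) * \<beta> 0 (\<tau> * (\<xi> \<bullet> \<xi>))"
        unfolding b_def B[of "\<tau> * (\<xi> \<bullet> \<xi>)"] by (simp add: mult_ac)
      show ?thesis unfolding 1 sum mult.assoc[of "of_real \<mu>"] 2 a_def by (simp add: algebra_simps)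
    qed
  qed
  moreover have "(\<lambda>\<xi>. a 0 \<xi> * g \<xi>) = g" by (simp add: a_def \<beta>0)
  moreover have "U t i (\<lambda>\<xi>. b i 0 \<xi> * g \<xi>) = 0" for i
    using functional_zero[OF functional_U[OF less_imp_le[OF t]]] by (simp add: b_def)
  ultimately show ?thesis by (simp add: a_def b_def)
qed

text \<open>Duality for the solution of the transposed system that starts from \<open>a = 0\<close> and \<open>b\<close> the \<open>j\<close>-th unit vector.\<close>

lemma formula_U:
  assumes t: "t > 0" and g: "schwartz g"
  shows "U t j g = Q 0 (\<lambda>\<xi>. ((- \<i> * of_real \<kappa> * of_real (\<xi> $ j)) * \<beta> 0 (t * (\<xi> \<bullet> \<xi>))) * g \<xi>)
    + (\<Sum>i\<in>UNIV. U 0 i (\<lambda>\<xi>. ((if i = j then 1 else 0) * exp_jet (of_real \<mu>) 0 (t * (\<xi> \<bullet> \<xi>))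
         + (of_real (\<xi> $ i) * of_real (\<xi> $ j)) * (of_real t * D 0 (t * (\<xi> \<bullet> \<xi>)))) * g \<xi>))"
proof -
  define \<delta> where "\<delta> = (\<lambda>i. if i = j then 1 else 0 :: complex)"
  define a where "a = (\<lambda>\<tau> (\<xi> :: real^'a). (- \<i> * of_real \<kappa> * of_real (\<xi> $ j)) * \<beta> 0 (\<tau> * (\<xi> \<bullet> \<xi>)))"
  define b where "b = (\<lambda>i \<tau> (\<xi> :: real^'a). \<delta> i * exp_jet (of_real \<mu>) 0 (\<tau> * (\<xi> \<bullet> \<xi>))
      + (of_real (\<xi> $ i) * of_real (\<xi> $ j)) * (of_real \<tau> * D 0 (\<tau> * (\<xi> \<bullet> \<xi>))))"
  have sum: "(\<Sum>i\<in>UNIV. of_real (\<xi> $ i) * b i \<tau> \<xi>) = of_real (\<xi> $ j) * \<beta> (Suc 0) (\<tau> * (\<xi> \<bullet> \<xi>))" for \<tau> \<xi>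
  proof -
    have "(\<Sum>i\<in>UNIV. of_real (\<xi> $ i) * b i \<tau> \<xi>) = of_real (\<xi> $ j) * exp_jet (of_real \<mu>) 0 (\<tau> * (\<xi> \<bullet> \<xi>))
       + of_real (\<xi> \<bullet> \<xi>) * (of_real (\<xi> $ j) * (of_real \<tau> * D 0 (\<tau> * (\<xi> \<bullet> \<xi>))))"
    proof -
      have 1: "of_real (\<xi> $ i) * (\<delta> i * exp_jet (of_real \<mu>) 0 (\<tau> * (\<xi> \<bullet> \<xi>))) =
          (if i = j then of_real (\<xi> $ j) * exp_jet (of_real \<mu>) 0 (\<tau> * (\<xi> \<bullet> \<xi>)) else 0)" for i
        by (simp add: \<delta>_def)
      show ?thesis unfolding b_def inner_eq_sum_coord[of \<xi> \<xi>] distrib_left sum.distrib sum_distrib_right 1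
        by (simp add: mult_ac)
    qed
    then show ?thesis using D[of "\<tau> * (\<xi> \<bullet> \<xi>)"] by (simp add: algebra_simps)
  qed
  have "Q t (\<lambda>\<xi>. a 0 \<xi> * g \<xi>) + (\<Sum>i\<in>UNIV. U t i (\<lambda>\<xi>. b i 0 \<xi> * g \<xi>)) =
    Q 0 (\<lambda>\<xi>. a t \<xi> * g \<xi>) + (\<Sum>i\<in>UNIV. U 0 i (\<lambda>\<xi>. b i t \<xi> * g \<xi>))"
  proof (rule duality[OF t g])
    show "smooth_curve {0..t} a (\<lambda>\<tau> \<xi>. (- \<i> * of_real \<kappa> * of_real (\<xi> $ j)) * (of_real (\<xi> \<bullet> \<xi>) * \<beta> (Suc 0) (\<tau> * (\<xi> \<bullet> \<xi>))))"
      unfolding a_def by (intro smooth_curve_coefficient_radial[OF _ jets(1) c_nonneg] moderate_cmult moderate_coord)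
    show "smooth_curve {0..t} (b i) (\<lambda>\<tau> \<xi>. \<delta> i * (of_real (\<xi> \<bullet> \<xi>) * exp_jet (of_real \<mu>) (Suc 0) (\<tau> * (\<xi> \<bullet> \<xi>)))
        + (of_real (\<xi> $ i) * of_real (\<xi> $ j)) * (D 0 (\<tau> * (\<xi> \<bullet> \<xi>)) + of_real \<tau> * (of_real (\<xi> \<bullet> \<xi>) * D (Suc 0) (\<tau> * (\<xi> \<bullet> \<xi>)))))" for i
      unfolding b_def
      by (intro smooth_curve_add smooth_curve_coefficient_time_radial[OF _ jets(3) c_nonneg]
          smooth_curve_coefficient_radial[OF _ exp_\<mu>_jet c_nonneg] moderate_times moderate_coord moderate_const1)
    show "(- \<i> * of_real \<kappa> * of_real (\<xi> $ j)) * (of_real (\<xi> \<bullet> \<xi>) * \<beta> (Suc 0) (\<tau> * (\<xi> \<bullet> \<xi>))) =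
        - \<i> * of_real \<kappa> * of_real (\<xi> \<bullet> \<xi>) * (\<Sum>j\<in>UNIV. of_real (\<xi> $ j) * b j \<tau> \<xi>)" for \<tau> \<xi>
      unfolding sum by (simp add: mult_ac)
    show "\<delta> i * (of_real (\<xi> \<bullet> \<xi>) * exp_jet (of_real \<mu>) (Suc 0) (\<tau> * (\<xi> \<bullet> \<xi>)))
        + (of_real (\<xi> $ i) * of_real (\<xi> $ j)) * (D 0 (\<tau> * (\<xi> \<bullet> \<xi>)) + of_real \<tau> * (of_real (\<xi> \<bullet> \<xi>) * D (Suc 0) (\<tau> * (\<xi> \<bullet> \<xi>)))) =
        - \<i> * of_real (\<xi> $ i) * a \<tau> \<xi> - of_real \<mu> * of_real (\<xi> \<bullet> \<xi>) * b i \<tau> \<xi>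
        - of_real (lam + \<mu>) * of_real (\<xi> $ i) * (\<Sum>j\<in>UNIV. of_real (\<xi> $ j) * b j \<tau> \<xi>)" for i \<tau> \<xi>
    proof -
      define E where "E = exp_jet (of_real \<mu>) 0 (\<tau> * (\<xi> \<bullet> \<xi>))"
      have E: "exp_jet (of_real \<mu>) (Suc 0) (\<tau> * (\<xi> \<bullet> \<xi>)) = - of_real \<mu> * E"
        by (simp add: E_def exp_jet_def)
      have 1: "D 0 (\<tau> * (\<xi> \<bullet> \<xi>)) + of_real \<tau> * (of_real (\<xi> \<bullet> \<xi>) * D (Suc 0) (\<tau> * (\<xi> \<bullet> \<xi>))) =
          - of_real (lam + 2 * \<mu>) * \<beta> (Suc 0) (\<tau> * (\<xi> \<bullet> \<xi>)) - of_real \<kappa> * \<beta> 0 (\<tau> * (\<xi> \<bullet> \<xi>)) + of_real \<mu> * E"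
        using D'[of "\<tau> * (\<xi> \<bullet> \<xi>)"] unfolding E \<beta>_ode by (simp add: mult.assoc)
      have 2: "of_real (\<xi> \<bullet> \<xi>) * b i \<tau> \<xi> = \<delta> i * of_real (\<xi> \<bullet> \<xi>) * E
          + of_real (\<xi> $ i) * of_real (\<xi> $ j) * (\<beta> (Suc 0) (\<tau> * (\<xi> \<bullet> \<xi>)) - E)"
        using D[of "\<tau> * (\<xi> \<bullet> \<xi>)"] unfolding E_def[symmetric] b_def by (simp add: algebra_simps)
      show ?thesis unfolding 1 E sum mult.assoc[of "of_real \<mu>" _ "b i \<tau> \<xi>"] 2 a_def by (simp add: algebra_simps)
    qed
  qed
  moreover have "Q t (\<lambda>\<xi>. a 0 \<xi> * g \<xi>) = 0"
    using functional_zero[OF functional_Q[OF less_imp_le[OF t]]] by (simp add: a_def \<beta>0)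
  moreover have "(\<Sum>i\<in>UNIV. U t i (\<lambda>\<xi>. b i 0 \<xi> * g \<xi>)) = U t j g"
  proof -
    have "U t i (\<lambda>\<xi>. b i 0 \<xi> * g \<xi>) = (if i = j then U t j g else 0)" for i
      using functional_zero[OF functional_U[OF less_imp_le[OF t]]] by (simp add: b_def \<delta>_def exp_jet_def)
    then show ?thesis by simp
  qed
  ultimately show ?thesis by (simp add: a_def b_def \<delta>_def)
qed

end

section \<open>Littlewood--Paley pieces\<close>

lemma sum_telescope_symmetric:
  fixes h :: "int \<Rightarrow> 'a::ab_group_add"
  shows "(\<Sum>l\<in>{- int n..<int n}. h (l + 1) - h l) = h (int n) - h (- int n)"
proof (induction n)
  case (Suc n)
  have "{- int (Suc n)..<int (Suc n)} = insert (int n) (insert (- int (Suc n)) {- int n..<int n})" by auto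
  then show ?case using Suc by (simp add: algebra_simps)
qed simp

text \<open>The sum samples \<open>x exp (- c x)\<close> along a geometric progression, and \<open>x exp (- c x)\<close> is integrable for the scale-invariant
  measure \<open>dx / x\<close>. Therefore the starting point \<open>t\<close> of the progression does not matter.\<close>

lemma dyadic_exponential_sum:
  assumes c: "c > (0::real)"
  shows "\<exists>C>0. \<forall>t>0. \<forall>n::nat. (\<Sum>l\<in>{- int n..<int n}. (4 powi l * t) * exp (- (c * (4 powi l * t)))) \<le> C"
proof -
  obtain K where K: "\<And>x. x \<ge> 0 \<Longrightarrow> (1 + x) ^ 2 * exp (- (c * x)) \<le> K"
    using power_times_exp_bounded[OF c] by blast
  have K0: "0 \<le> K" using order_trans[OF _ K[of 0]] by simp
  \<comment> \<open>the increments of \<open>x / (1 + x)\<close> along the dyadic sequence dominate the summands\<close>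
  define h where "h = (\<lambda>x::real. x / (1 + x))"
  have step: "x * exp (- (c * x)) \<le> 2 * K * (h (4 * x) - h x)" if x: "x > 0" for x
  proof -
    have eq: "h (4 * x) - h x = 3 * x / ((1 + 4 * x) * (1 + x))"
      using x unfolding h_def by (simp add: divide_simps) (simp add: algebra_simps)
    have "(1 + 4 * x) * (1 + x) \<le> 4 * (1 + x)\<^sup>2" using x by (simp add: power2_eq_square algebra_simps)
    then have "(1 + 4 * x) * (1 + x) * exp (- (c * x)) \<le> 4 * (1 + x)\<^sup>2 * exp (- (c * x))"
      by (rule mult_right_mono) simp
    also have "\<dots> \<le> 4 * K" using K[of x] x by simp
    also have "\<dots> \<le> 6 * K" using K0 by simp
    finally have "exp (- (c * x)) \<le> 6 * K / ((1 + 4 * x) * (1 + x))"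
      using x by (simp add: pos_le_divide_eq mult.commute)
    then have "x * exp (- (c * x)) \<le> x * (6 * K / ((1 + 4 * x) * (1 + x)))"
      using x by (intro mult_left_mono) auto
    then show ?thesis unfolding eq by (simp add: field_simps)
  qed
  have "(\<Sum>l\<in>{- int n..<int n}. (4 powi l * t) * exp (- (c * (4 powi l * t)))) \<le> 2 * K + 1"
    if t: "t > 0" for t n
  proof -
    have pos: "4 powi l * t > 0" for l using t by simp
    have "(\<Sum>l\<in>{- int n..<int n}. (4 powi l * t) * exp (- (c * (4 powi l * t))))
       \<le> (\<Sum>l\<in>{- int n..<int n}. 2 * K * (h (4 powi (l + 1) * t) - h (4 powi l * t)))"
    proof (rule sum_mono)
      fix l :: int
      have "4 powi (l + 1) * t = 4 * (4 powi l * t)" by (simp add: power_int_add)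
      then show "(4 powi l * t) * exp (- (c * (4 powi l * t))) \<le> 2 * K * (h (4 powi (l + 1) * t) - h (4 powi l * t))"
        using step[OF pos[of l]] by (simp only:)
    qed
    also have "\<dots> = 2 * K * (h (4 powi (int n) * t) - h (4 powi (- int n) * t))"
      unfolding sum_distrib_left[symmetric] sum_telescope_symmetric[of "\<lambda>l. h (4 powi l * t)"] ..
    also have "\<dots> \<le> 2 * K * 1"
    proof (rule mult_left_mono)
      have "h (4 powi (int n) * t) \<le> 1" "0 \<le> h (4 powi (- int n) * t)"
        using pos[of "int n"] pos[of "- int n"] unfolding h_def by (auto simp: divide_le_eq_1)
      then show "h (4 powi (int n) * t) - h (4 powi (- int n) * t) \<le> 1" by linarith
    qed (use K0 in simp)
    finally show ?thesis by simp
  qed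
  then show ?thesis using K0 by (intro exI[of _ "2 * K + 1"]) auto
qed

lemma schwartz_dilation:
  fixes f :: "real^'n::finite \<Rightarrow> complex"
  assumes f: "schwartz f" and c: "c \<noteq> 0"
  shows "schwartz (\<lambda>x. f (c *\<^sub>R x))"
  unfolding schwartz_def
proof (intro conjI allI)
  show "smooth (\<lambda>x. f (c *\<^sub>R x))" by (rule smooth_dilation[OF schwartz_smooth[OF f]])
  fix k ds
  obtain B where B: "\<And>x. (1 + norm x) ^ k * norm (iter_deriv ds f x) \<le> B"
    using f unfolding schwartz_def by blast
  define K where "K = 1 + inverse \<bar>c\<bar>"
  have "(1 + norm x) ^ k * norm (iter_deriv ds (\<lambda>x. f (c *\<^sub>R x)) x) \<le> K ^ k * \<bar>c\<bar> ^ length ds * B" for x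
  proof -
    have "1 + norm x \<le> K * (1 + norm (c *\<^sub>R x))"
      using c unfolding K_def by (simp add: field_simps)
    then have "(1 + norm x) ^ k \<le> K ^ k * (1 + norm (c *\<^sub>R x)) ^ k"
      unfolding power_mult_distrib[symmetric] by (intro power_mono) auto
    then have "(1 + norm x) ^ k * norm (iter_deriv ds (\<lambda>x. f (c *\<^sub>R x)) x) \<le>
        (K ^ k * (1 + norm (c *\<^sub>R x)) ^ k) * (\<bar>c\<bar> ^ length ds * norm (iter_deriv ds f (c *\<^sub>R x)))"
      unfolding iter_deriv_dilation[OF schwartz_smooth[OF f]] by (simp add: norm_mult norm_power mult_right_mono)
    also have "\<dots> = K ^ k * \<bar>c\<bar> ^ length ds * ((1 + norm (c *\<^sub>R x)) ^ k * norm (iter_deriv ds f (c *\<^sub>R x)))"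
      by (simp add: mult_ac)
    also have "\<dots> \<le> K ^ k * \<bar>c\<bar> ^ length ds * B"
      by (intro mult_left_mono B) (simp add: K_def)
    finally show ?thesis .
  qed
  then show "\<exists>B. \<forall>x. (1 + norm x) ^ k * norm (iter_deriv ds (\<lambda>x. f (c *\<^sub>R x)) x) \<le> B" by blast
qed

locale littlewood_paley_pair =
  fixes \<phi> chi :: "real^'n::finite \<Rightarrow> real"
  assumes lp: "littlewood_paley \<phi> chi"
begin

definition ring :: "int \<Rightarrow> real^'n \<Rightarrow> complex" where
  "ring l \<xi> = of_real (\<phi> ((2 powi (- l)) *\<^sub>R \<xi>))"

definition low :: "int \<Rightarrow> real^'n \<Rightarrow> complex" where
  "low l \<xi> = of_real (chi ((2 powi (- l)) *\<^sub>R \<xi>))"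

lemma phi_support: "\<phi> \<xi> \<noteq> 0 \<Longrightarrow> 3/4 \<le> norm \<xi> \<and> norm \<xi> \<le> 8/3"
  using lp closure_subset[of "{\<xi>. \<phi> \<xi> \<noteq> 0}"] unfolding littlewood_paley_def by blast

lemma chi_support: "chi \<xi> \<noteq> 0 \<Longrightarrow> norm \<xi> \<le> 4/3"
  using lp closure_subset[of "{\<xi>. chi \<xi> \<noteq> 0}"] unfolding littlewood_paley_def by auto

lemma schwartz_ring: "schwartz (ring l)"
proof -
  have "schwartz (\<lambda>\<xi>. of_real (\<phi> \<xi>))"
    using lp unfolding littlewood_paley_def
    by (intro compact_support_schwartz[of _ "8/3"]) (auto simp: subset_iff)
  then show ?thesis unfolding ring_def[abs_def] by (intro schwartz_dilation) auto
qed

lemma schwartz_chi: "schwartz (\<lambda>\<xi>. of_real (chi \<xi>))"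
  using lp unfolding littlewood_paley_def
  by (intro compact_support_schwartz[of _ "4/3"]) auto

lemma schwartz_low: "schwartz (low l)"
  unfolding low_def[abs_def] by (rule schwartz_dilation[OF schwartz_chi]) auto

text \<open>The low-frequency partitions of unity at two consecutive levels differ in one ring only.\<close>

lemma ring_eq: "ring l \<xi> = low (l + 1) \<xi> - low l \<xi>"
proof -
  define \<eta> where "\<eta> = (2 powi (- l)) *\<^sub>R \<xi>"
  have sum: "((\<lambda>l::int. \<phi> ((2 powi (- l)) *\<^sub>R \<xi>)) has_sum (1 - chi \<xi>)) {0..}" for \<xi>
    using lp unfolding littlewood_paley_def by blast
  have "((\<lambda>k. \<phi> ((2 powi (- k)) *\<^sub>R \<eta>)) has_sum (1 - chi ((2 powi (-1)) *\<^sub>R \<eta>))) {1..}"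
  proof -
    have "(\<lambda>k. \<phi> ((2 powi (- k)) *\<^sub>R \<eta>)) \<circ> (\<lambda>k. k + 1) = (\<lambda>k. \<phi> ((2 powi (- k)) *\<^sub>R ((2 powi (-1)) *\<^sub>R \<eta>)))"
      by (auto simp: power_int_add power_int_diff fun_eq_iff power_int_minus field_simps)
    moreover have "(\<lambda>k::int. k + 1) ` {0..} = {1..}"
      using image_add_atLeast[of 1 "0::int"] by (simp add: add.commute)
    ultimately show ?thesis
      using has_sum_reindex[of "\<lambda>k::int. k + 1" "{0..}" "\<lambda>k. \<phi> ((2 powi (- k)) *\<^sub>R \<eta>)" "1 - chi ((2 powi (-1)) *\<^sub>R \<eta>)"]
        sum[of "(2 powi (-1)) *\<^sub>R \<eta>"] by simp
  qed
  moreover have "((\<lambda>k::int. \<phi> ((2 powi (- k)) *\<^sub>R \<eta>)) has_sum \<phi> \<eta>) {0}"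
    using has_sum_finite[of "{0::int}" "\<lambda>k. \<phi> ((2 powi (- k)) *\<^sub>R \<eta>)"] by simp
  ultimately have "((\<lambda>k. \<phi> ((2 powi (- k)) *\<^sub>R \<eta>)) has_sum (\<phi> \<eta> + (1 - chi ((2 powi (-1)) *\<^sub>R \<eta>)))) ({0} \<union> {1..})"
    by (intro has_sum_Un_disjoint) auto
  moreover have "{0} \<union> {1..} = {0::int..}" by auto
  ultimately have "\<phi> \<eta> + (1 - chi ((2 powi (-1)) *\<^sub>R \<eta>)) = 1 - chi \<eta>"
    using has_sum_unique[OF sum[of \<eta>]] by simp
  moreover have "(2 powi (-1)) *\<^sub>R \<eta> = (2 powi (- (l + 1))) *\<^sub>R \<xi>"
  proof -
    have "2 powi (-1) * 2 powi (- l) = (2::real) powi (- (l + 1))"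
      by (subst power_int_add[symmetric]) (auto simp: algebra_simps)
    then show ?thesis unfolding \<eta>_def scaleR_scaleR by (simp only:)
  qed
  ultimately have "\<phi> \<eta> + (1 - chi ((2 powi (- (l + 1))) *\<^sub>R \<xi>)) = 1 - chi \<eta>" by (simp only:)
  then have "\<phi> \<eta> = chi ((2 powi (- (l + 1))) *\<^sub>R \<xi>) - chi \<eta>" by linarith
  then show ?thesis unfolding ring_def low_def \<eta>_def by (simp only: of_real_diff)
qed

lemma chi_eq_1:
  assumes "norm \<xi> < 3/4" shows "chi \<xi> = 1"
proof -
  have "\<phi> ((2 powi (- l)) *\<^sub>R \<xi>) = 0" if "l \<in> {0..}" for l :: int
  proof (rule ccontr)
    assume "\<phi> ((2 powi (- l)) *\<^sub>R \<xi>) \<noteq> 0"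
    from phi_support[OF this] have "3/4 \<le> 2 powi (- l) * norm \<xi>" by simp
    also have "\<dots> \<le> 1 * norm \<xi>"
      using that by (intro mult_right_mono) (auto simp: power_int_minus intro!: power_int_le_one one_le_power_int simp: inverse_le_1_iff)
    finally show False using assms by simp
  qed
  then have "((\<lambda>l::int. \<phi> ((2 powi (- l)) *\<^sub>R \<xi>)) has_sum 0) {0..}" by (rule has_sum_0)
  moreover have "((\<lambda>l::int. \<phi> ((2 powi (- l)) *\<^sub>R \<xi>)) has_sum (1 - chi \<xi>)) {0..}"
    using lp unfolding littlewood_paley_def by blast
  ultimately show ?thesis using has_sum_unique by fastforce
qed

lemma low_eq_1: "norm \<xi> < 3/4 * 2 powi l \<Longrightarrow> low l \<xi> = 1"
  unfolding low_def using chi_eq_1[of "(2 powi (- l)) *\<^sub>R \<xi>"]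
  by (simp add: power_int_minus field_simps)

lemma low_eq_0: "norm \<xi> > 4/3 * 2 powi l \<Longrightarrow> low l \<xi> = 0"
  unfolding low_def using chi_support[of "(2 powi (- l)) *\<^sub>R \<xi>"]
  by (fastforce simp: power_int_minus field_simps)

lemma ring_support: "ring l \<xi> \<noteq> 0 \<Longrightarrow> 3/4 * 2 powi l \<le> norm \<xi> \<and> norm \<xi> \<le> 8/3 * 2 powi l"
  unfolding ring_def using phi_support[of "(2 powi (- l)) *\<^sub>R \<xi>"]
  by (simp add: power_int_minus field_simps)

text \<open>A Schwartz function that equals \<open>1\<close> on the ring and lives at frequencies comparable to \<open>2\<^sup>l\<close>. It
  allows a multiplier to be localised without changing its effect on a dyadic block.\<close>

definition fat_ring :: "int \<Rightarrow> real^'n \<Rightarrow> complex" where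
  "fat_ring l \<xi> = low (l + 2) \<xi> - low (l - 1) \<xi>"

lemma schwartz_fat_ring: "schwartz (fat_ring l)"
  unfolding fat_ring_def[abs_def] by (intro schwartz_minus schwartz_low)

lemma ring_fat_ring: "ring l \<xi> * fat_ring l \<xi> = ring l \<xi>"
proof (cases "ring l \<xi> = 0")
  case False
  have p: "2 powi (l + 2) = 4 * (2::real) powi l" "2 powi (l - 1) = (2 powi l) / (2::real)"
    by (simp_all add: power_int_add power_int_diff)
  have pos: "(2::real) powi l > 0" by simp
  have "low (l + 2) \<xi> = 1"
    using ring_support[OF False] pos by (intro low_eq_1, unfold p) linarith
  moreover have "low (l - 1) \<xi> = 0"
    using ring_support[OF False] pos by (intro low_eq_0, unfold p) linarith
  ultimately show ?thesis by (simp add: fat_ring_def)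
qed simp

lemma fat_ring_support:
  assumes "fat_ring l \<xi> \<noteq> 0"
  shows "3/8 * 2 powi l \<le> norm \<xi>" "norm \<xi> \<le> 16/3 * 2 powi l"
proof -
  have p: "2 powi (l + 2) = 4 * (2::real) powi l" "2 powi (l - 1) = (2 powi l) / (2::real)"
    by (simp_all add: power_int_add power_int_diff)
  have pos: "(2::real) powi l > 0" by simp
  show "3/8 * 2 powi l \<le> norm \<xi>"
  proof (rule ccontr)
    assume "\<not> ?thesis"
    then have "low (l - 1) \<xi> = 1" "low (l + 2) \<xi> = 1"
      using pos by (intro low_eq_1, unfold p, linarith)+
    then show False using assms by (simp add: fat_ring_def)
  qed
  show "norm \<xi> \<le> 16/3 * 2 powi l"
  proof (rule ccontr)
    assume "\<not> ?thesis"
    then have "low (l - 1) \<xi> = 0" "low (l + 2) \<xi> = 0"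
      using pos by (intro low_eq_0, unfold p, linarith)+
    then show False using assms by (simp add: fat_ring_def)
  qed
qed

lemma fat_ring_bounded: "\<exists>X>0. \<forall>l \<xi>. norm (fat_ring l \<xi>) \<le> X"
proof -
  obtain X where X: "\<And>\<xi>. norm (complex_of_real (chi \<xi>)) \<le> X"
    using schwartz_bounded_bound[of "{\<lambda>\<xi>. of_real (chi \<xi>)}" 0] schwartz_chi
    by (auto simp: schwartz_bounded_singleton)
  have "norm (fat_ring l \<xi>) \<le> X + X + 1" for l \<xi>
  proof -
    have "norm (fat_ring l \<xi>) \<le> norm (low (l + 2) \<xi>) + norm (low (l - 1) \<xi>)"
      unfolding fat_ring_def by (rule norm_triangle_ineq4)
    also have "\<dots> \<le> X + X" unfolding low_def by (intro add_mono X)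
    finally show ?thesis by simp
  qed
  moreover have "0 \<le> X" using order_trans[OF norm_ge_zero X] .
  ultimately show ?thesis by (intro exI[of _ "X + X + 1"]) auto
qed

subsection \<open>Decomposition of a functional\<close>

text \<open>On the support of \<open>1 - low n\<close> the frequency is at least \<open>3/4 * 2\<^sup>n\<close>, so the factor \<open>2\<^sup>n\<close> costs one power of the decay
  of \<open>h\<close>.\<close>

lemma high_frequencies_bounded:
  assumes h: "schwartz h"
  shows "schwartz_bounded {\<lambda>\<xi>. 2 ^ n * ((1 - low (int n) \<xi>) * h \<xi>) | n. True}"
proof -
  define A where "A = {\<lambda>\<xi>. (1 - low (int n) \<xi>) * h \<xi> | n. True}"
  have low: "moderate_bounded {low (int n) | n. True}"
  proof (rule moderate_bounded_subset[OF moderate_dilations[OF schwartz_chi]])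
    show "{low (int n) | n. True} \<subseteq> {\<lambda>x. complex_of_real (chi (c *\<^sub>R x)) |c. 0 \<le> c \<and> c \<le> 1}"
    proof
      fix f assume "f \<in> {low (int n) | n. True}"
      then obtain n where "f = (\<lambda>x. complex_of_real (chi ((2 powi (- int n)) *\<^sub>R x)))"
        by (auto simp: low_def[abs_def])
      moreover have "0 \<le> (2::real) powi (- int n)" "(2::real) powi (- int n) \<le> 1"
        by (simp_all add: power_int_minus inverse_le_1_iff)
      ultimately show "f \<in> {\<lambda>x. complex_of_real (chi (c *\<^sub>R x)) |c. 0 \<le> c \<and> c \<le> 1}" by blast
    qed
  qed
  have "schwartz_bounded (fun_times (fun_plus {\<lambda>x. 1} (fun_times {\<lambda>x. -1} {low (int n) | n. True})) {h})"
    by (intro schwartz_bounded_times moderate_bounded_plus moderate_bounded_times moderate_const1 low)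
       (simp add: schwartz_bounded_singleton h)
  moreover have "A \<subseteq> fun_times (fun_plus {\<lambda>x. 1} (fun_times {\<lambda>x. -1} {low (int n) | n. True})) {h}"
  proof
    fix f assume "f \<in> A"
    then obtain n where f: "f = (\<lambda>\<xi>. (1 - low (int n) \<xi>) * h \<xi>)" unfolding A_def by blast
    have "low (int n) \<in> {low (int n) | n. True}" by blast
    then have 1: "(\<lambda>\<xi>. (-1) * low (int n) \<xi>) \<in> fun_times {\<lambda>x. -1} {low (int n) | n. True}"
      by (rule fun_timesI[OF singletonI]) simp
    have 2: "(\<lambda>\<xi>. 1 + (-1) * low (int n) \<xi>) \<in> fun_plus {\<lambda>x. 1} (fun_times {\<lambda>x. -1} {low (int n) | n. True})"
      by (rule fun_plusI[OF singletonI 1]) simp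
    show "f \<in> fun_times (fun_plus {\<lambda>x. 1} (fun_times {\<lambda>x. -1} {low (int n) | n. True})) {h}"
      by (rule fun_timesI[OF 2 singletonI]) (simp add: f)
  qed
  ultimately have A: "schwartz_bounded A" by (rule schwartz_bounded_subset)
  have deriv: "iter_deriv ds (\<lambda>\<xi>. 2 ^ n * f \<xi>) = (\<lambda>\<xi>. 2 ^ n * iter_deriv ds f \<xi>)" if "smooth f"
    for n ds and f :: "real^'n \<Rightarrow> complex"
    by (rule iter_deriv_bounded_linear[OF that bounded_linear_mult_right])
  show ?thesis
    unfolding schwartz_bounded_def
  proof (intro conjI ballI allI)
    fix f assume "f \<in> {\<lambda>\<xi>. 2 ^ n * ((1 - low (int n) \<xi>) * h \<xi>) | n. True}"
    then obtain n where "f = (\<lambda>\<xi>. 2 ^ n * ((1 - low (int n) \<xi>) * h \<xi>))" by blast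
    moreover have "schwartz (\<lambda>\<xi>. (1 - low (int n) \<xi>) * h \<xi>)"
      by (rule schwartz_bounded_imp_schwartz[OF A]) (auto simp: A_def)
    ultimately show "smooth f" using schwartz_cmult schwartz_smooth by blast
  next
    fix k ds
    obtain C where C: "\<And>f x. f \<in> A \<Longrightarrow> (1 + norm x) ^ Suc k * norm (iter_deriv ds f x) \<le> C"
      using A unfolding schwartz_bounded_def by meson
    have "(1 + norm x) ^ k * norm (iter_deriv ds (\<lambda>\<xi>. 2 ^ n * ((1 - low (int n) \<xi>) * h \<xi>)) x) \<le> 4/3 * C" for n x
    proof -
      let ?f = "\<lambda>\<xi>. (1 - low (int n) \<xi>) * h \<xi>"
      have fA: "?f \<in> A" by (auto simp: A_def)
      have sm: "smooth ?f" by (rule schwartz_smooth[OF schwartz_bounded_imp_schwartz[OF A fA]])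
      show ?thesis
      proof (cases "norm x < 3/4 * 2 ^ n")
        case True
        have "closure {\<xi>. ?f \<xi> \<noteq> 0} \<subseteq> {\<xi>. 3/4 * 2 ^ n \<le> norm \<xi>}"
        proof (rule closure_minimal)
          show "{\<xi>. ?f \<xi> \<noteq> 0} \<subseteq> {\<xi>. 3/4 * 2 ^ n \<le> norm \<xi>}"
          proof
            fix \<xi> assume "\<xi> \<in> {\<xi>. ?f \<xi> \<noteq> 0}"
            then have "low (int n) \<xi> \<noteq> 1" by auto
            then show "\<xi> \<in> {\<xi>. 3/4 * 2 ^ n \<le> norm \<xi>}"
              using low_eq_1[of \<xi> "int n"] by (force simp: not_le[symmetric])
          qed
          show "closed {\<xi>::real^'n. 3/4 * 2 ^ n \<le> norm \<xi>}"
            by (intro closed_Collect_le continuous_intros)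
        qed
        then have "x \<notin> closure {\<xi>. ?f \<xi> \<noteq> 0}" using True by auto
        then have "iter_deriv ds ?f x = 0" by (rule iter_deriv_supp)
        moreover have "0 \<le> C" using order_trans[OF _ C[OF fA, of 0]] by simp
        ultimately show ?thesis unfolding deriv[OF sm] by simp
      next
        case False
        then have "2 ^ n \<le> 4/3 * (1 + norm x)" by simp
        then have "(1 + norm x) ^ k * (2 ^ n * norm (iter_deriv ds ?f x)) \<le> (1 + norm x) ^ k * (4/3 * (1 + norm x) * norm (iter_deriv ds ?f x))"
          by (intro mult_left_mono mult_right_mono) auto
        also have "\<dots> = 4/3 * ((1 + norm x) ^ Suc k * norm (iter_deriv ds ?f x))" by simp
        also have "\<dots> \<le> 4/3 * C" by (intro mult_left_mono C fA) simp
        finally show ?thesis unfolding deriv[OF sm] by (simp add: norm_mult norm_power)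
      qed
    qed
    then show "\<exists>C. \<forall>f\<in>{\<lambda>\<xi>. 2 ^ n * ((1 - low (int n) \<xi>) * h \<xi>) | n. True}. \<forall>x. (1 + norm x) ^ k * norm (iter_deriv ds f x) \<le> C"
      by blast
  qed
qed

lemma low_high_limit:
  assumes G: "schwartz_functional G" and h: "schwartz h"
  shows "(\<lambda>n. G (\<lambda>\<xi>. low (int n) \<xi> * h \<xi>)) \<longlonglongrightarrow> G h"
proof -
  obtain M where M: "\<And>f. f \<in> {\<lambda>\<xi>. 2 ^ n * ((1 - low (int n) \<xi>) * h \<xi>) | n. True} \<Longrightarrow> norm (G f) \<le> M"
    using functional_bounded[OF G high_frequencies_bounded[OF h]] by blast
  have S: "schwartz (\<lambda>\<xi>. low (int n) \<xi> * h \<xi>)" for n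
    by (intro schwartz_times schwartz_imp_moderate schwartz_low h)
  have "norm (G (\<lambda>\<xi>. low (int n) \<xi> * h \<xi>) - G h) \<le> (1/2) ^ n * M" for n
  proof -
    have S': "schwartz (\<lambda>\<xi>. (1 - low (int n) \<xi>) * h \<xi>)"
      using schwartz_minus[OF h S[of n]] by (simp add: algebra_simps)
    have "G h - G (\<lambda>\<xi>. low (int n) \<xi> * h \<xi>) = G (\<lambda>\<xi>. (1 - low (int n) \<xi>) * h \<xi>)"
      using functional_diff[OF G h S[of n]] by (simp add: algebra_simps)
    then have "2 ^ n * (G h - G (\<lambda>\<xi>. low (int n) \<xi> * h \<xi>)) = G (\<lambda>\<xi>. 2 ^ n * ((1 - low (int n) \<xi>) * h \<xi>))"
      using functional_cmult[OF G S', of "2 ^ n"] by simp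
    moreover have "norm (G (\<lambda>\<xi>. 2 ^ n * ((1 - low (int n) \<xi>) * h \<xi>))) \<le> M" by (rule M) blast
    ultimately have "2 ^ n * norm (G h - G (\<lambda>\<xi>. low (int n) \<xi> * h \<xi>)) \<le> M"
      by (metis norm_mult norm_numeral norm_power)
    then show ?thesis by (simp add: norm_minus_commute power_divide field_simps)
  qed
  moreover have "(\<lambda>n. (1/2) ^ n * M) \<longlonglongrightarrow> 0"
    using tendsto_mult_right[OF LIMSEQ_realpow_zero[of "1/2"], of M] by simp
  ultimately have "(\<lambda>n. G (\<lambda>\<xi>. low (int n) \<xi> * h \<xi>) - G h) \<longlonglongrightarrow> 0"
    by (rule Lim_null_comparison[OF always_eventually[OF allI]])
  then show ?thesis by (rule LIM_zero_cancel)
qed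

lemma low_cutoff_eq:
  assumes "schwartz h"
  shows "low_cutoff chi j T (fourier h) = T (fourier (\<lambda>\<xi>. low j \<xi> * h \<xi>))"
  unfolding low_cutoff_def fourier_multiplier_def distr_inv_fourier_def distr_mult_def distr_fourier_def
    inv_fourier_fourier[OF assms] low_def ..

lemma dyadic_block_eq:
  "dyadic_block \<phi> l T f = T (fourier (\<lambda>\<xi>. ring l \<xi> * inv_fourier f \<xi>))"
  unfolding dyadic_block_def fourier_multiplier_def distr_inv_fourier_def distr_mult_def distr_fourier_def ring_def ..

text \<open>The space \<open>\<S>'\<^sub>h\<close> with the continuity expressed through bounded sets, in which form it is evidently stable
  under partial derivatives.\<close>

definition low_vanishing :: "'n distr \<Rightarrow> bool" where
  "low_vanishing T \<longleftrightarrow> schwartz_functional T \<and>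
     (\<forall>f. schwartz f \<longrightarrow> ((\<lambda>j. low_cutoff chi j T f) \<longlongrightarrow> 0) at_bot)"

lemma tempered_h_low_vanishing: "tempered_h chi T \<Longrightarrow> low_vanishing T"
  unfolding tempered_h_def low_vanishing_def by (simp add: tempered_imp_functional)

lemma low_vanishing_functional: "low_vanishing T \<Longrightarrow> schwartz_functional T"
  by (simp add: low_vanishing_def)

lemma distr_partial_fourier:
  assumes T: "schwartz_functional T" and h: "schwartz h"
  shows "distr_partial i T (fourier h) = T (fourier (\<lambda>\<xi>. \<i> * of_real (\<xi> $ i) * h \<xi>))"
proof -
  have S: "schwartz (\<lambda>\<xi>. \<i> * of_real (\<xi> $ i) * h \<xi>)"
    by (intro schwartz_times moderate_cmult moderate_coord h)
  have "distr_partial i T (fourier h) = - T (fourier (\<lambda>\<xi>. - (\<i> * of_real (\<xi> $ i) * h \<xi>)))"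
    unfolding distr_partial_def partial_deriv_fourier[OF h] by simp
  also have "\<dots> = T (fourier (\<lambda>\<xi>. \<i> * of_real (\<xi> $ i) * h \<xi>))"
    using functional_uminus[OF functional_comp_fourier[OF T] S] by simp
  finally show ?thesis .
qed

lemma low_vanishing_partial:
  assumes T: "low_vanishing T"
  shows "low_vanishing (distr_partial i T)"
  unfolding low_vanishing_def
proof (intro conjI allI impI)
  have TF: "schwartz_functional T" by (rule low_vanishing_functional[OF T])
  show "schwartz_functional (distr_partial i T)"
    unfolding schwartz_functional_def
  proof (intro conjI allI impI)
    fix f g :: "real^'n \<Rightarrow> complex" assume "schwartz f" "schwartz g"
    then have "partial_deriv i (\<lambda>x. f x + g x) = (\<lambda>x. partial_deriv i f x + partial_deriv i g x)"
      by (intro ext partial_deriv_add schwartz_differentiable)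
    then show "distr_partial i T (\<lambda>x. f x + g x) = distr_partial i T f + distr_partial i T g"
      unfolding distr_partial_def
      using functional_add[OF TF schwartz_partial_deriv[OF \<open>schwartz f\<close>] schwartz_partial_deriv[OF \<open>schwartz g\<close>]] by simp
  next
    fix c and f :: "real^'n \<Rightarrow> complex" assume f: "schwartz f"
    then have "partial_deriv i (\<lambda>x. c * f x) = (\<lambda>x. c * partial_deriv i f x)"
      using partial_deriv_mult[of "\<lambda>_. c" _ f] schwartz_differentiable[OF f] by (auto simp: partial_deriv_const)
    then show "distr_partial i T (\<lambda>x. c * f x) = c * distr_partial i T f"
      unfolding distr_partial_def using functional_cmult[OF TF schwartz_partial_deriv[OF f], of c] by simp
  next
    fix \<B> :: "(real^'n \<Rightarrow> complex) set" assume "schwartz_bounded \<B>"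
    from functional_bounded[OF TF schwartz_bounded_deriv[OF this]]
    show "\<exists>M. \<forall>f\<in>\<B>. norm (distr_partial i T f) \<le> M" by (auto simp: distr_partial_def)
  qed
  fix f :: "real^'n \<Rightarrow> complex" assume f: "schwartz f"
  define h where "h = inv_fourier f"
  have h: "schwartz h" "f = fourier h" unfolding h_def by (simp_all add: schwartz_inv_fourier fourier_inv_fourier f)
  have S: "schwartz (\<lambda>\<xi>. \<i> * of_real (\<xi> $ i) * h \<xi>)"
    by (intro schwartz_times moderate_cmult moderate_coord h)
  have "low_cutoff chi j (distr_partial i T) f = low_cutoff chi j T (fourier (\<lambda>\<xi>. \<i> * of_real (\<xi> $ i) * h \<xi>))" for j
  proof -
    have L: "schwartz (\<lambda>\<xi>. low j \<xi> * h \<xi>)" by (intro schwartz_times schwartz_imp_moderate schwartz_low h)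
    show ?thesis unfolding h(2) low_cutoff_eq[OF h(1)] low_cutoff_eq[OF S] distr_partial_fourier[OF TF L]
      by (simp add: mult_ac)
  qed
  then show "((\<lambda>j. low_cutoff chi j (distr_partial i T) f) \<longlongrightarrow> 0) at_bot"
    using T schwartz_fourier[OF S] unfolding low_vanishing_def by simp
qed

text \<open>The sum telescopes to a difference of two low-frequency cutoffs. The upper one tends to the identity
  on every functional, the lower one vanishes in the limit by assumption.\<close>

lemma littlewood_paley_decomposition:
  assumes T: "low_vanishing T" and h: "schwartz h"
  shows "(\<lambda>n. \<Sum>l\<in>{- int n..<int n}. T (fourier (\<lambda>\<xi>. ring l \<xi> * h \<xi>))) \<longlonglongrightarrow> T (fourier h)"
proof -
  define G where "G = (\<lambda>g. T (fourier g))"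
  have TG: "schwartz_functional G" unfolding G_def
    using T by (intro functional_comp_fourier low_vanishing_functional)
  have S: "schwartz (\<lambda>\<xi>. low j \<xi> * h \<xi>)" for j
    by (intro schwartz_times schwartz_imp_moderate schwartz_low h)
  have ring: "G (\<lambda>\<xi>. ring l \<xi> * h \<xi>) = G (\<lambda>\<xi>. low (l + 1) \<xi> * h \<xi>) - G (\<lambda>\<xi>. low l \<xi> * h \<xi>)" for l
    unfolding ring_eq left_diff_distrib by (rule functional_diff[OF TG S S])
  have "((\<lambda>j. low_cutoff chi j T (fourier h)) \<longlongrightarrow> 0) at_bot"
    using T schwartz_fourier[OF h] unfolding low_vanishing_def by blast
  then have "((\<lambda>j. G (\<lambda>\<xi>. low j \<xi> * h \<xi>)) \<longlongrightarrow> 0) at_bot"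
    unfolding low_cutoff_eq[OF h] G_def .
  then have low0: "(\<lambda>n. G (\<lambda>\<xi>. low (- int n) \<xi> * h \<xi>)) \<longlonglongrightarrow> 0"
  proof (rule filterlim_compose)
    have "\<forall>\<^sub>F n in sequentially. - int n \<le> Z" for Z
      by (rule eventually_sequentiallyI[of "nat (- Z)"]) linarith
    then show "filterlim (\<lambda>n. - int n) at_bot sequentially" by (simp add: filterlim_at_bot)
  qed
  have "(\<lambda>n. G (\<lambda>\<xi>. low (int n) \<xi> * h \<xi>) - G (\<lambda>\<xi>. low (- int n) \<xi> * h \<xi>)) \<longlonglongrightarrow> G h - 0"
    by (intro tendsto_diff low_high_limit TG h low0)
  then have "(\<lambda>n. \<Sum>l\<in>{- int n..<int n}. G (\<lambda>\<xi>. ring l \<xi> * h \<xi>)) \<longlonglongrightarrow> G h"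
    unfolding ring sum_telescope_symmetric[of "\<lambda>l. G (\<lambda>\<xi>. low l \<xi> * h \<xi>)"] by simp
  then show ?thesis unfolding G_def .
qed

end

section \<open>Pointwise values of smoothed distributions\<close>

text \<open>The function representing \<open>m(D) T\<close>.\<close>

definition smoothed :: "'n::finite distr \<Rightarrow> (real^'n \<Rightarrow> complex) \<Rightarrow> real^'n \<Rightarrow> complex" where
  "smoothed T m y = T (fourier (\<lambda>\<xi>. cis (y \<bullet> \<xi>) * m \<xi>)) / of_real ((2 * pi) ^ CARD('n))"

text \<open>Translating \<open>y\<close> multiplies the test function by a character, and the difference quotients of
  characters are bounded.\<close>

lemma smoothed_continuous:
  fixes T :: "'n::finite distr"
  assumes T: "schwartz_functional T" and m: "schwartz m"
  shows "continuous_on UNIV (smoothed T m)"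
proof -
  define G where "G = (\<lambda>g. T (fourier g))"
  have G: "schwartz_functional G" unfolding G_def by (rule functional_comp_fourier[OF T])
  have "((\<lambda>z. G (\<lambda>\<xi>. cis (z \<bullet> \<xi>) * m \<xi>)) \<longlongrightarrow> G (\<lambda>\<xi>. cis (y \<bullet> \<xi>) * m \<xi>)) (at y)" for y :: "real^'n"
  proof -
    have em: "schwartz (\<lambda>\<xi>. cis (y \<bullet> \<xi>) * m \<xi>)" for y :: "real^'n"
      by (intro schwartz_times moderate_character m)
    define R where "R = {\<lambda>x::real^'n. (cis (h \<bullet> x) - 1) / of_real (norm h) | h. norm h \<le> 1}"
    have B: "schwartz_bounded (fun_times R {\<lambda>\<xi>. cis (y \<bullet> \<xi>) * m \<xi>})"
      unfolding R_def by (intro schwartz_bounded_times moderate_character_differences) (simp add: schwartz_bounded_singleton em)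
    obtain M where M: "\<And>f. f \<in> fun_times R {\<lambda>\<xi>. cis (y \<bullet> \<xi>) * m \<xi>} \<Longrightarrow> norm (G f) \<le> M"
      using functional_bounded[OF G B] by blast
    have "norm (G (\<lambda>\<xi>. cis (z \<bullet> \<xi>) * m \<xi>) - G (\<lambda>\<xi>. cis (y \<bullet> \<xi>) * m \<xi>)) \<le> norm (z - y) * M" if z: "norm (z - y) \<le> 1" for z
    proof -
      define h where "h = z - y"
      have r: "(\<lambda>\<xi>. ((cis (h \<bullet> \<xi>) - 1) / of_real (norm h)) * (cis (y \<bullet> \<xi>) * m \<xi>)) \<in> fun_times R {\<lambda>\<xi>. cis (y \<bullet> \<xi>) * m \<xi>}"
        using z unfolding R_def h_def by (intro fun_timesI[OF _ singletonI refl]) blast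
      have "cis (z \<bullet> \<xi>) * m \<xi> - cis (y \<bullet> \<xi>) * m \<xi> = of_real (norm h) * (((cis (h \<bullet> \<xi>) - 1) / of_real (norm h)) * (cis (y \<bullet> \<xi>) * m \<xi>))" for \<xi>
      proof (cases "h = 0")
        case False
        have "cis (z \<bullet> \<xi>) = cis (h \<bullet> \<xi>) * cis (y \<bullet> \<xi>)" by (simp add: h_def cis_mult inner_diff_left)
        then show ?thesis using False by (simp add: field_simps)
      qed (simp add: h_def)
      then have "G (\<lambda>\<xi>. cis (z \<bullet> \<xi>) * m \<xi>) - G (\<lambda>\<xi>. cis (y \<bullet> \<xi>) * m \<xi>) =
          G (\<lambda>\<xi>. of_real (norm h) * (((cis (h \<bullet> \<xi>) - 1) / of_real (norm h)) * (cis (y \<bullet> \<xi>) * m \<xi>)))"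
        using functional_diff[OF G em em, of z y] by simp
      also have "\<dots> = of_real (norm h) * G (\<lambda>\<xi>. ((cis (h \<bullet> \<xi>) - 1) / of_real (norm h)) * (cis (y \<bullet> \<xi>) * m \<xi>))"
        by (rule functional_cmult[OF G schwartz_bounded_imp_schwartz[OF B r]])
      finally show ?thesis using M[OF r] by (simp add: norm_mult h_def mult_left_mono)
    qed
    then have "\<forall>\<^sub>F z in at y. norm (G (\<lambda>\<xi>. cis (z \<bullet> \<xi>) * m \<xi>) - G (\<lambda>\<xi>. cis (y \<bullet> \<xi>) * m \<xi>)) \<le> norm (z - y) * M"
      unfolding eventually_at dist_norm by (intro exI[of _ 1]) auto
    moreover have "((\<lambda>z. norm (z - y) * M) \<longlongrightarrow> 0) (at y)"
      by (auto intro!: tendsto_eq_intros)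
    ultimately have "((\<lambda>z. G (\<lambda>\<xi>. cis (z \<bullet> \<xi>) * m \<xi>) - G (\<lambda>\<xi>. cis (y \<bullet> \<xi>) * m \<xi>)) \<longlongrightarrow> 0) (at y)"
      by (rule Lim_null_comparison)
    then show ?thesis by (rule LIM_zero_cancel)
  qed
  then have "continuous_on UNIV (\<lambda>z. G (\<lambda>\<xi>. cis (z \<bullet> \<xi>) * m \<xi>))" by (simp add: continuous_on_def)
  then show ?thesis unfolding smoothed_def[abs_def] G_def
    by (intro continuous_intros) auto
qed

lemma smoothed_measurable:
  "schwartz_functional T \<Longrightarrow> schwartz m \<Longrightarrow> smoothed T m \<in> borel_measurable borel"
  by (intro borel_measurable_continuous_onI smoothed_continuous)

lemma fourier_reflect:
  fixes f :: "real^'n::finite \<Rightarrow> complex"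
  assumes "schwartz f"
  shows "fourier (\<lambda>x. f (- x)) \<xi> = fourier f (- \<xi>)"
proof -
  have "schwartz (\<lambda>x. cis (\<xi> \<bullet> x) * f x)" by (intro schwartz_times moderate_character assms)
  from integral_translate[OF schwartz_measurable[OF this], of "-1" 0]
  show ?thesis unfolding fourier_def by (simp add: inner_commute)
qed

text \<open>The multiplication formula for a reflection of \<open>f\<close> and a modulation of \<open>\<psi>\<close>.\<close>

lemma fourier_multiplier_convolution:
  fixes f \<psi> :: "real^'n::finite \<Rightarrow> complex"
  assumes f: "schwartz f" and \<psi>: "schwartz \<psi>"
  shows "fourier (\<lambda>\<xi>. \<psi> \<xi> * inv_fourier f \<xi>) x = (LINT y|lborel. f y * fourier \<psi> (x - y)) / of_real ((2 * pi) ^ CARD('n))"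
proof -
  let ?c = "complex_of_real ((2 * pi) ^ CARD('n))"
  have e: "schwartz (\<lambda>\<xi>. cis ((- x) \<bullet> \<xi>) * \<psi> \<xi>)" by (intro schwartz_times moderate_character \<psi>)
  have fr: "schwartz (\<lambda>x. f (- x))" by (rule schwartz_reflect[OF f])
  have "fourier (\<lambda>\<xi>. \<psi> \<xi> * inv_fourier f \<xi>) x = (LINT \<xi>|lborel. cis (- (\<xi> \<bullet> x)) * (\<psi> \<xi> * inv_fourier f \<xi>))"
    by (simp only: fourier_def)
  also have "\<dots> = (LINT \<xi>|lborel. fourier (\<lambda>x. f (- x)) \<xi> * (cis ((- x) \<bullet> \<xi>) * \<psi> \<xi>) / ?c)"
    unfolding inv_fourier_eq fourier_reflect[OF f]
    by (rule Bochner_Integration.integral_cong) (simp_all add: inner_commute mult_ac)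
  also have "\<dots> = (LINT \<xi>|lborel. fourier (\<lambda>x. f (- x)) \<xi> * (cis ((- x) \<bullet> \<xi>) * \<psi> \<xi>)) / ?c"
    by (rule integral_divide_zero)
  also have "(LINT \<xi>|lborel. fourier (\<lambda>x. f (- x)) \<xi> * (cis ((- x) \<bullet> \<xi>) * \<psi> \<xi>)) =
      (LINT y|lborel. f (- y) * fourier \<psi> (y - (- x)))"
    unfolding fourier_multiplication[OF schwartz_integrable[OF fr] schwartz_integrable[OF e]] fourier_modulate ..
  also have "\<dots> = (LINT y|lborel. f y * fourier \<psi> (x - y))"
  proof -
    have [measurable]: "f \<in> borel_measurable borel" "fourier \<psi> \<in> borel_measurable borel"
      by (auto intro: schwartz_measurable f schwartz_fourier \<psi>)
    have "(\<lambda>y. f y * fourier \<psi> (x - y)) \<in> borel_measurable borel" by measurable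
    from integral_translate[OF this, of "-1" 0] show ?thesis by (simp add: add.commute)
  qed
  finally show ?thesis .
qed

lemma represents_measurable:
  "represents g T \<Longrightarrow> g \<in> borel_measurable borel"
  unfolding represents_def by simp

lemma borel_measurable_vec_nth: "(\<lambda>v :: complex^'i::finite. v $ i) \<in> borel_measurable borel"
  by (intro borel_measurable_continuous_onI continuous_intros)

lemma represents_component_measurable:
  assumes "represents g T" shows "(\<lambda>x. g x $ i) \<in> borel_measurable borel"
  using measurable_compose[OF represents_measurable[OF assms] borel_measurable_vec_nth] .

lemma smoothed_represented:
  fixes Ts :: "'i::finite \<Rightarrow> 'n::finite distr"
  assumes g: "represents g Ts" and \<psi>: "schwartz \<psi>"
  shows "smoothed (Ts i) \<psi> y = (LINT x|lborel. g x $ i * fourier \<psi> (x - y)) / of_real ((2 * pi) ^ CARD('n))"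
proof -
  have "schwartz (\<lambda>\<xi>. cis (y \<bullet> \<xi>) * \<psi> \<xi>)" by (intro schwartz_times moderate_character \<psi>)
  then have "Ts i (fourier (\<lambda>\<xi>. cis (y \<bullet> \<xi>) * \<psi> \<xi>)) = (LINT x|lborel. g x $ i * fourier (\<lambda>\<xi>. cis (y \<bullet> \<xi>) * \<psi> \<xi>) x)"
    using g schwartz_fourier unfolding represents_def by blast
  then show ?thesis unfolding smoothed_def fourier_modulate by simp
qed

lemma norm_smoothed_represented:
  fixes Ts :: "'i::finite \<Rightarrow> 'n::finite distr"
  assumes g: "represents g Ts" and \<psi>: "schwartz \<psi>"
    and M: "(\<integral>\<^sup>+x. ennreal (norm (g x $ i) * norm (fourier \<psi> (x - y))) \<partial>lborel) \<le> ennreal M" "0 \<le> M"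
  shows "norm (smoothed (Ts i) \<psi> y) \<le> M / (2 * pi) ^ CARD('n)"
proof -
  have [measurable]: "(\<lambda>x. g x $ i) \<in> borel_measurable borel" "fourier \<psi> \<in> borel_measurable borel"
    by (auto intro: schwartz_measurable schwartz_fourier \<psi> represents_component_measurable[OF g])
  have "norm (LINT x|lborel. g x $ i * fourier \<psi> (x - y)) \<le> M"
  proof (cases "integrable lborel (\<lambda>x. g x $ i * fourier \<psi> (x - y))")
    case True
    have "ennreal (norm (LINT x|lborel. g x $ i * fourier \<psi> (x - y))) \<le> (\<integral>\<^sup>+x. ennreal (norm (g x $ i * fourier \<psi> (x - y))) \<partial>lborel)"
      by (rule integral_norm_bound_ennreal[OF True])
    also have "\<dots> \<le> ennreal M" using M(1) by (simp add: norm_mult)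
    finally show ?thesis using M(2) by (simp add: ennreal_le_iff)
  next
    case False
    then show ?thesis using M(2) by (simp add: not_integrable_integral_eq)
  qed
  then have "norm (smoothed (Ts i) \<psi> y) \<le> M / norm (complex_of_real ((2 * pi) ^ CARD('n)))"
    unfolding smoothed_represented[OF g \<psi>] norm_divide by (intro divide_right_mono) auto
  then show ?thesis by (simp add: norm_power norm_mult)
qed

text \<open>Fubini's theorem exchanges the pairing with the integral over the test function.\<close>

lemma represented_multiplier:
  fixes Ts :: "'i::finite \<Rightarrow> 'n::finite distr"
  assumes g: "represents g Ts" and \<psi>: "schwartz \<psi>" and f: "schwartz f"
    and M: "\<And>y. (\<integral>\<^sup>+x. ennreal (norm (g x $ i) * norm (fourier \<psi> (x - y))) \<partial>lborel) \<le> ennreal M"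
  shows "Ts i (fourier (\<lambda>\<xi>. \<psi> \<xi> * inv_fourier f \<xi>)) = (LINT y|lborel. f y * smoothed (Ts i) \<psi> y)"
proof -
  let ?c = "complex_of_real ((2 * pi) ^ CARD('n))"
  have [measurable]: "(\<lambda>x. g x $ i) \<in> borel_measurable borel" "fourier \<psi> \<in> borel_measurable borel" "f \<in> borel_measurable borel"
    by (auto intro: schwartz_measurable schwartz_fourier \<psi> f represents_component_measurable[OF g])
  have int: "integrable (lborel \<Otimes>\<^sub>M lborel) (\<lambda>(x, y). g x $ i * (f y * fourier \<psi> (x - y)))"
  proof (rule integrableI_bounded)
    show "(\<lambda>(x, y). g x $ i * (f y * fourier \<psi> (x - y))) \<in> borel_measurable (lborel \<Otimes>\<^sub>M lborel)"
      by measurable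
    have "(\<integral>\<^sup>+z. ennreal (norm (case z of (x, y) \<Rightarrow> g x $ i * (f y * fourier \<psi> (x - y)))) \<partial>(lborel \<Otimes>\<^sub>M lborel)) =
      (\<integral>\<^sup>+y. \<integral>\<^sup>+x. ennreal (norm (case (x, y) of (x, y) \<Rightarrow> g x $ i * (f y * fourier \<psi> (x - y)))) \<partial>lborel \<partial>lborel)"
      by (rule lborel_pair.nn_integral_snd[symmetric]) measurable
    also have "\<dots> = (\<integral>\<^sup>+y. ennreal (norm (f y)) * (\<integral>\<^sup>+x. ennreal (norm (g x $ i) * norm (fourier \<psi> (x - y))) \<partial>lborel) \<partial>lborel)"
      by (subst nn_integral_cmult[symmetric]) (auto simp: norm_mult ennreal_mult' mult_ac)
    also have "\<dots> \<le> (\<integral>\<^sup>+y. ennreal (norm (f y)) * ennreal M \<partial>lborel)"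
      by (intro nn_integral_mono mult_left_mono M) auto
    also have "\<dots> = (\<integral>\<^sup>+y. ennreal (norm (f y)) \<partial>lborel) * ennreal M"
      by (rule nn_integral_multc) auto
    also have "\<dots> < \<infinity>"
      using schwartz_integrable[OF f] unfolding integrable_iff_bounded by (simp add: ennreal_mult_less_top)
    finally show "(\<integral>\<^sup>+z. ennreal (norm (case z of (x, y) \<Rightarrow> g x $ i * (f y * fourier \<psi> (x - y)))) \<partial>(lborel \<Otimes>\<^sub>M lborel)) < \<infinity>" .
  qed
  have "schwartz (\<lambda>\<xi>. \<psi> \<xi> * inv_fourier f \<xi>)"
    by (intro schwartz_times schwartz_imp_moderate \<psi> schwartz_inv_fourier f)
  then have "Ts i (fourier (\<lambda>\<xi>. \<psi> \<xi> * inv_fourier f \<xi>)) = (LINT x|lborel. g x $ i * fourier (\<lambda>\<xi>. \<psi> \<xi> * inv_fourier f \<xi>) x)"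
    using g schwartz_fourier unfolding represents_def by blast
  also have "\<dots> = (LINT x|lborel. (LINT y|lborel. g x $ i * (f y * fourier \<psi> (x - y))) / ?c)"
    unfolding fourier_multiplier_convolution[OF f \<psi>] by simp
  also have "\<dots> = (LINT x|lborel. (LINT y|lborel. g x $ i * (f y * fourier \<psi> (x - y)))) / ?c"
    by (rule integral_divide_zero)
  also have "(LINT x|lborel. (LINT y|lborel. g x $ i * (f y * fourier \<psi> (x - y)))) =
      (LINT y|lborel. (LINT x|lborel. g x $ i * (f y * fourier \<psi> (x - y))))"
    by (rule lborel_pair.Fubini_integral[OF int, symmetric])
  also have "\<dots> / ?c = (LINT y|lborel. (LINT x|lborel. g x $ i * (f y * fourier \<psi> (x - y))) / ?c)"
    by (rule integral_divide_zero[symmetric])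
  also have "\<dots> = (LINT y|lborel. f y * smoothed (Ts i) \<psi> y)"
    unfolding smoothed_represented[OF g \<psi>] mult.left_commute[of _ "f _"] by simp
  finally show ?thesis .
qed

subsection \<open>Square integrable representatives\<close>

lemma epowr_two: "epowr (ennreal r) 2 = ennreal (r\<^sup>2)" if "r \<ge> 0"
  using that by (cases "r = 0") (simp_all add: epowr_def)

lemma epowr_half_le:
  assumes "epowr X (1/2) \<le> ennreal e" "0 \<le> e"
  shows "X \<le> ennreal (e\<^sup>2)"
proof (cases "X = \<infinity>")
  case True
  then show ?thesis using assms by (simp add: epowr_def top_unique)
next
  case False
  then obtain r where r: "X = ennreal r" "0 \<le> r" by (cases X) auto
  have "sqrt r \<le> e" using assms r by (simp add: epowr_def powr_half_sqrt ennreal_le_iff)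
  then have "(sqrt r)\<^sup>2 \<le> e\<^sup>2" using r by (intro power_mono) auto
  then show ?thesis using r by (simp add: ennreal_leI)
qed

lemma eLp_norm_two_le:
  assumes "eLp_norm M 2 u \<le> ennreal e" "0 \<le> e"
  shows "(\<integral>\<^sup>+x. epowr (u x) 2 \<partial>M) \<le> ennreal (e\<^sup>2)"
  using assms unfolding eLp_norm_def by (intro epowr_half_le) simp_all

lemma power2_le_imp_le_ennreal:
  fixes x y :: ennreal
  assumes "x\<^sup>2 \<le> y\<^sup>2" shows "x \<le> y"
proof (cases "y = top")
  case False
  then obtain s where s: "y = ennreal s" "0 \<le> s" by (cases y) auto
  have "x \<noteq> top"
  proof
    assume "x = top"
    then have "top \<le> ennreal (s\<^sup>2)" using assms s by (simp add: power2_eq_square ennreal_mult)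
    then show False by (simp add: top_unique)
  qed
  then obtain r where r: "x = ennreal r" "0 \<le> r" by (cases x) auto
  have "r\<^sup>2 \<le> s\<^sup>2" using assms r s by (simp add: ennreal_power)
  then show ?thesis using r s power2_le_imp_le by (auto intro!: ennreal_leI)
qed simp

lemma square_integrable_pairing:
  fixes g :: "real^'n::finite \<Rightarrow> complex^'i::finite" and h :: "real^'n \<Rightarrow> complex"
  assumes g: "g \<in> borel_measurable borel" and e: "eLp_norm lborel 2 (\<lambda>x. ennreal (norm (g x))) \<le> ennreal e" "0 \<le> e"
    and h: "schwartz h"
  shows "(\<integral>\<^sup>+x. ennreal (norm (g x $ i) * norm (h (x - y))) \<partial>lborel) \<le> ennreal (e * sqrt (LINT x|lborel. (norm (h x))\<^sup>2))"
proof -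
  have [measurable]: "h \<in> borel_measurable borel" by (rule schwartz_measurable[OF h])
  note [measurable] = g
  have gi: "(\<lambda>x. g x $ i) \<in> borel_measurable borel"
    using measurable_compose[OF g borel_measurable_vec_nth] .
  note [measurable] = gi
  define H where "H = (LINT x|lborel. (norm (h x))\<^sup>2)"
  have H0: "0 \<le> H" unfolding H_def by (intro integral_nonneg_AE) auto
  have hint: "integrable lborel (\<lambda>x. (norm (h x))\<^sup>2)"
  proof -
    have "integrable lborel (\<lambda>x. h x * cnj (h x))"
      by (intro schwartz_integrable schwartz_times[OF schwartz_imp_moderate[OF h]] schwartz_cnj h)
    then have "integrable lborel (\<lambda>x. norm (h x * cnj (h x)))" by (rule integrable_norm)
    then show ?thesis by (simp add: norm_mult power2_eq_square)
  qed
  have shift: "(\<integral>\<^sup>+x. ennreal ((norm (h (x - y)))\<^sup>2) \<partial>lborel) = ennreal H"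
  proof -
    have "(\<integral>\<^sup>+x. ennreal ((norm (h (x - y)))\<^sup>2) \<partial>lborel) =
       (\<integral>\<^sup>+x. ennreal ((norm (h x))\<^sup>2) \<partial>distr lborel borel ((+) (- y)))"
      by (subst nn_integral_distr) auto
    also have "\<dots> = (\<integral>\<^sup>+x. ennreal ((norm (h x))\<^sup>2) \<partial>lborel)" by (simp add: lborel_distr_plus)
    also have "\<dots> = ennreal H" unfolding H_def by (rule nn_integral_eq_integral[OF hint]) auto
    finally show ?thesis .
  qed
  have "(\<integral>\<^sup>+x. ennreal (norm (g x $ i)) * ennreal (norm (h (x - y))) \<partial>lborel)\<^sup>2 \<le>
     (\<integral>\<^sup>+x. (ennreal (norm (g x $ i)))\<^sup>2 \<partial>lborel) * (\<integral>\<^sup>+x. (ennreal (norm (h (x - y))))\<^sup>2 \<partial>lborel)"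
    by (rule Cauchy_Schwarz_nn_integral) measurable
  also have "\<dots> \<le> ennreal (e\<^sup>2) * ennreal H"
  proof (rule mult_mono)
    have "(\<integral>\<^sup>+x. (ennreal (norm (g x $ i)))\<^sup>2 \<partial>lborel) \<le> (\<integral>\<^sup>+x. epowr (ennreal (norm (g x))) 2 \<partial>lborel)"
      by (intro nn_integral_mono) (auto simp: epowr_two ennreal_power intro!: ennreal_leI power_mono Finite_Cartesian_Product.norm_nth_le)
    also have "\<dots> \<le> ennreal (e\<^sup>2)" by (rule eLp_norm_two_le[OF e])
    finally show "(\<integral>\<^sup>+x. (ennreal (norm (g x $ i)))\<^sup>2 \<partial>lborel) \<le> ennreal (e\<^sup>2)" .
    show "(\<integral>\<^sup>+x. (ennreal (norm (h (x - y))))\<^sup>2 \<partial>lborel) \<le> ennreal H"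
      using shift by (simp add: ennreal_power)
  qed auto
  also have "\<dots> = (ennreal (e * sqrt H))\<^sup>2"
    using H0 e(2) by (simp add: ennreal_power power_mult_distrib flip: ennreal_mult')
  finally have "(\<integral>\<^sup>+x. ennreal (norm (g x $ i)) * ennreal (norm (h (x - y))) \<partial>lborel) \<le> ennreal (e * sqrt H)"
    using power2_le_imp_le_ennreal by blast
  then show ?thesis unfolding H_def by (simp add: ennreal_mult')
qed

section \<open>The smoothing estimate\<close>

lemma square_summable_of_eLp_norm:
  fixes u :: "int \<Rightarrow> ennreal"
  assumes "eLp_norm (count_space UNIV) 2 u \<le> ennreal b" "0 \<le> b"
  shows "u l < \<infinity>" "finite F \<Longrightarrow> (\<Sum>l\<in>F. (enn2real (u l))\<^sup>2) \<le> b\<^sup>2"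
proof -
  have I: "(\<integral>\<^sup>+l. epowr (u l) 2 \<partial>count_space UNIV) \<le> ennreal (b\<^sup>2)"
    by (rule eLp_norm_two_le[OF assms])
  have fin: "u l < \<infinity>" for l
  proof (rule ccontr)
    assume "\<not> u l < \<infinity>"
    then have "epowr (u l) 2 = \<infinity>" by (simp add: epowr_def top.not_eq_extremum)
    moreover have "epowr (u l) 2 \<le> (\<integral>\<^sup>+l. epowr (u l) 2 \<partial>count_space UNIV)"
      by (rule nn_integral_ge_point) simp
    ultimately have "(\<integral>\<^sup>+l. epowr (u l) 2 \<partial>count_space UNIV) = \<infinity>" by (simp add: top_unique)
    then show False using I by (simp add: top_unique)
  qed
  show "u l < \<infinity>" by (rule fin)
  assume F: "finite F"
  have "(\<Sum>l\<in>F. epowr (u l) 2) = (\<integral>\<^sup>+l. epowr (u l) 2 \<partial>count_space F)"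
    by (rule nn_integral_count_space_finite[OF F, symmetric])
  also have "\<dots> \<le> (\<integral>\<^sup>+l. epowr (u l) 2 \<partial>count_space UNIV)"
    by (simp add: nn_integral_count_space_indicator nn_integral_mono indicator_def)
  also have "\<dots> \<le> ennreal (b\<^sup>2)" by (rule I)
  finally have "(\<Sum>l\<in>F. epowr (u l) 2) \<le> ennreal (b\<^sup>2)" .
  moreover have "epowr (u l) 2 = ennreal ((enn2real (u l))\<^sup>2)" for l
    using fin[of l] epowr_two[of "enn2real (u l)"] ennreal_enn2real[of "u l"] by simp
  ultimately have "ennreal (\<Sum>l\<in>F. (enn2real (u l))\<^sup>2) \<le> ennreal (b\<^sup>2)" by (simp add: sum_ennreal)
  then show "(\<Sum>l\<in>F. (enn2real (u l))\<^sup>2) \<le> b\<^sup>2" by (simp add: ennreal_le_iff)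
qed

context littlewood_paley_pair
begin

text \<open>As \<open>ring l\<close> equals its product with \<open>fat_ring l\<close>, the multiplier \<open>ring l * m\<close> acts on \<open>T\<close> as the Schwartz multiplier
  \<open>fat_ring l * m\<close> acts on the dyadic block. The block is square integrable, so Cauchy--Schwarz and
  Plancherel's theorem apply.\<close>

lemma dyadic_block_estimate:
  fixes Ts :: "'i::finite \<Rightarrow> 'n distr"
  assumes T: "schwartz_functional (Ts i)"
    and d: "distr_Lp_norm 2 (\<lambda>i. dyadic_block \<phi> l (Ts i)) = ennreal d" "0 \<le> d"
    and m: "schwartz m"
  shows "norm (smoothed (Ts i) (\<lambda>\<xi>. ring l \<xi> * m \<xi>) y) \<le> d * sqrt (LINT \<xi>|lborel. (norm (fat_ring l \<xi> * m \<xi>))\<^sup>2)"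
    and "schwartz f \<Longrightarrow> Ts i (fourier (\<lambda>\<xi>. (ring l \<xi> * m \<xi>) * inv_fourier f \<xi>)) =
       (LINT y|lborel. f y * smoothed (Ts i) (\<lambda>\<xi>. ring l \<xi> * m \<xi>) y)"
proof -
  define \<psi> where "\<psi> = (\<lambda>\<xi>. fat_ring l \<xi> * m \<xi>)"
  define P where "P = (2 * pi) ^ CARD('n)"
  have P1: "1 \<le> P" unfolding P_def using pi_ge_two by (intro one_le_power) simp
  have \<psi>: "schwartz \<psi>" unfolding \<psi>_def by (intro schwartz_times schwartz_imp_moderate schwartz_fat_ring m)
  define R where "R = (\<lambda>i. dyadic_block \<phi> l (Ts i))"
  have R: "R i (fourier h) = Ts i (fourier (\<lambda>\<xi>. ring l \<xi> * h \<xi>))" if "schwartz h" for h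
    unfolding R_def dyadic_block_eq inv_fourier_fourier[OF that] ..
  have sm: "smoothed (R i) \<psi> y = smoothed (Ts i) (\<lambda>\<xi>. ring l \<xi> * m \<xi>) y" for y
  proof -
    have "schwartz (\<lambda>\<xi>. cis (y \<bullet> \<xi>) * \<psi> \<xi>)" by (intro schwartz_times moderate_character \<psi>)
    moreover have "(\<lambda>\<xi>. ring l \<xi> * (cis (y \<bullet> \<xi>) * \<psi> \<xi>)) = (\<lambda>\<xi>. cis (y \<bullet> \<xi>) * (ring l \<xi> * m \<xi>))"
    proof
      fix \<xi>
      have "ring l \<xi> * (cis (y \<bullet> \<xi>) * \<psi> \<xi>) = cis (y \<bullet> \<xi>) * ((ring l \<xi> * fat_ring l \<xi>) * m \<xi>)"
        by (simp add: \<psi>_def mult_ac)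
      then show "ring l \<xi> * (cis (y \<bullet> \<xi>) * \<psi> \<xi>) = cis (y \<bullet> \<xi>) * (ring l \<xi> * m \<xi>)"
        by (simp only: ring_fat_ring)
    qed
    ultimately show ?thesis unfolding smoothed_def using R by simp
  qed
  have ex: "\<exists>g. represents g R \<and> eLp_norm lborel 2 (\<lambda>x. ennreal (norm (g x))) \<le> ennreal (d + e)" if "e > 0" for e
  proof -
    have "distr_Lp_norm 2 R < ennreal (d + e)"
      using d that unfolding R_def by (simp add: ennreal_lessI)
    then show ?thesis unfolding distr_Lp_norm_def by (auto simp: INF_less_iff intro: less_imp_le)
  qed
  have bd: "(\<integral>\<^sup>+x. ennreal (norm (g x $ i) * norm (fourier \<psi> (x - y))) \<partial>lborel) \<le>
      ennreal ((d + e) * sqrt (P * (LINT \<xi>|lborel. (norm (\<psi> \<xi>))\<^sup>2)))"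
    if "represents g R" "eLp_norm lborel 2 (\<lambda>x. ennreal (norm (g x))) \<le> ennreal (d + e)" "e > 0" for g e y
    using square_integrable_pairing[OF represents_measurable[OF that(1)] that(2) _ schwartz_fourier[OF \<psi>], of i y] d(2) that(3)
    unfolding plancherel[OF \<psi>] P_def by simp
  show "norm (smoothed (Ts i) (\<lambda>\<xi>. ring l \<xi> * m \<xi>) y) \<le> d * sqrt (LINT \<xi>|lborel. (norm (fat_ring l \<xi> * m \<xi>))\<^sup>2)"
  proof -
    define S where "S = sqrt (LINT \<xi>|lborel. (norm (\<psi> \<xi>))\<^sup>2)"
    have S0: "0 \<le> S" unfolding S_def by (intro real_sqrt_ge_zero integral_nonneg_AE) auto
    have le: "norm (smoothed (R i) \<psi> y) \<le> (d + e) * S" if e: "e > 0" for e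
    proof -
      obtain g where g: "represents g R" "eLp_norm lborel 2 (\<lambda>x. ennreal (norm (g x))) \<le> ennreal (d + e)"
        using ex[OF e] by blast
      have "norm (smoothed (R i) \<psi> y) \<le> ((d + e) * sqrt (P * (LINT \<xi>|lborel. (norm (\<psi> \<xi>))\<^sup>2))) / (2 * pi) ^ CARD('n)"
        using bd[OF g e] d(2) e P1
        by (intro norm_smoothed_represented[OF g(1) \<psi>]) (auto intro!: mult_nonneg_nonneg integral_nonneg_AE)
      also have "\<dots> = (d + e) * S * (sqrt P / P)"
        unfolding P_def[symmetric] S_def by (simp add: real_sqrt_mult)
      also have "\<dots> \<le> (d + e) * S * 1"
      proof (rule mult_left_mono)
        have "sqrt P \<le> P" using P1 by (intro real_le_lsqrt) (auto simp: power2_eq_square)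
        then show "sqrt P / P \<le> 1" using P1 by simp
      qed (use d(2) e S0 in auto)
      finally show ?thesis by simp
    qed
    have "norm (smoothed (R i) \<psi> y) \<le> d * S"
    proof (rule field_le_epsilon)
      fix e :: real assume e: "e > 0"
      have "norm (smoothed (R i) \<psi> y) \<le> (d + e / (S + 1)) * S"
        using e S0 by (intro le) simp
      also have "\<dots> = d * S + e * (S / (S + 1))" by (simp add: algebra_simps)
      also have "e * (S / (S + 1)) \<le> e * 1" using S0 e by (intro mult_left_mono) auto
      finally show "norm (smoothed (R i) \<psi> y) \<le> d * S + e" by simp
    qed
    then have "norm (smoothed (Ts i) (\<lambda>\<xi>. ring l \<xi> * m \<xi>) y) \<le> d * S" by (simp only: sm)
    then show ?thesis unfolding S_def \<psi>_def .
  qed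
  assume f: "schwartz f"
  obtain g where g: "represents g R" "eLp_norm lborel 2 (\<lambda>x. ennreal (norm (g x))) \<le> ennreal (d + 1)"
    using ex[of 1] by auto
  have "R i (fourier (\<lambda>\<xi>. \<psi> \<xi> * inv_fourier f \<xi>)) = (LINT y|lborel. f y * smoothed (R i) \<psi> y)"
    by (rule represented_multiplier[OF g(1) \<psi> f bd[OF g]]) simp
  moreover have "R i (fourier (\<lambda>\<xi>. \<psi> \<xi> * inv_fourier f \<xi>)) = Ts i (fourier (\<lambda>\<xi>. (ring l \<xi> * m \<xi>) * inv_fourier f \<xi>))"
  proof -
    have "schwartz (\<lambda>\<xi>. \<psi> \<xi> * inv_fourier f \<xi>)"
      by (intro schwartz_times schwartz_imp_moderate \<psi> schwartz_inv_fourier f)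
    moreover have "ring l \<xi> * (\<psi> \<xi> * inv_fourier f \<xi>) = (ring l \<xi> * m \<xi>) * inv_fourier f \<xi>" for \<xi>
    proof -
      have "ring l \<xi> * (\<psi> \<xi> * inv_fourier f \<xi>) = ((ring l \<xi> * fat_ring l \<xi>) * m \<xi>) * inv_fourier f \<xi>"
        by (simp add: \<psi>_def mult_ac)
      then show ?thesis by (simp only: ring_fat_ring)
    qed
    ultimately show ?thesis using R by (simp only:)
  qed
  ultimately show "Ts i (fourier (\<lambda>\<xi>. (ring l \<xi> * m \<xi>) * inv_fourier f \<xi>)) =
       (LINT y|lborel. f y * smoothed (Ts i) (\<lambda>\<xi>. ring l \<xi> * m \<xi>) y)" by (simp add: sm)
qed

text \<open>On the support of \<open>fat_ring l\<close> the Gaussian is at most its value at \<open>\<bar>\<xi>\<bar> = 3/8 * 2\<^sup>l\<close>, whence the constant \<open>9/64\<close>, and the volume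
  of the support is of order \<open>2\<^bsup>l N\<^esup>\<close>.\<close>

lemma fat_ring_L2:
  assumes c: "c > 0"
  shows "\<exists>K>0. \<forall>l t M m. t > 0 \<longrightarrow> M \<ge> 0 \<longrightarrow> schwartz m \<longrightarrow> (\<forall>\<xi>. norm (m \<xi>) \<le> M * exp (- (c * (t * (\<xi> \<bullet> \<xi>))))) \<longrightarrow>
     sqrt (LINT \<xi>|lborel. (norm (fat_ring l \<xi> * m \<xi>))\<^sup>2) \<le>
       K * M * exp (- ((c * (9/64)) * (4 powi l * t))) * 2 powr (of_int l * (real CARD('n) / 2))"
proof -
  obtain X where X: "X > 0" "\<And>l \<xi>. norm (fat_ring l \<xi>) \<le> X" using fat_ring_bounded by blast
  define V where "V = unit_ball_vol (real CARD('n))"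
  have V: "V > 0" unfolding V_def by (rule unit_ball_vol_pos) simp
  define K where "K = X * sqrt (V * (16/3) ^ CARD('n))"
  have "sqrt (LINT \<xi>|lborel. (norm (fat_ring l \<xi> * m \<xi>))\<^sup>2) \<le>
       K * M * exp (- ((c * (9/64)) * (4 powi l * t))) * 2 powr (of_int l * (real CARD('n) / 2))"
    if t: "t > 0" and M: "M \<ge> 0" and m: "schwartz m" and b: "\<And>\<xi>. norm (m \<xi>) \<le> M * exp (- (c * (t * (\<xi> \<bullet> \<xi>))))"
    for l t M m
  proof -
    define r where "r = (2::real) powi l"
    have r: "r > 0" "4 powi l = r\<^sup>2" unfolding r_def
      by (simp, simp add: power2_eq_square del: power_int_mult_distrib flip: power_int_mult_distrib)
    define E where "E = X * (M * exp (- ((c * (9/64)) * (r\<^sup>2 * t))))"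
    have E0: "0 \<le> E" using X M by (simp add: E_def)
    have pt: "(norm (fat_ring l \<xi> * m \<xi>))\<^sup>2 \<le> E\<^sup>2 * indicator (cball 0 (16/3 * r)) \<xi>" for \<xi>
    proof (cases "fat_ring l \<xi> = 0")
      case False
      from fat_ring_support[OF False] have n: "3/8 * r \<le> norm \<xi>" "norm \<xi> \<le> 16/3 * r" by (simp_all add: r_def)
      have "9/64 * r\<^sup>2 = (3/8 * r)\<^sup>2" by (simp add: power2_eq_square)
      also have "\<dots> \<le> (norm \<xi>)\<^sup>2" using n r by (intro power_mono) auto
      finally have "9/64 * r\<^sup>2 \<le> \<xi> \<bullet> \<xi>" by (simp add: power2_norm_eq_inner)
      then have "c * t * (9/64 * r\<^sup>2) \<le> c * t * (\<xi> \<bullet> \<xi>)" using c t by (intro mult_left_mono) auto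
      then have "exp (- (c * (t * (\<xi> \<bullet> \<xi>)))) \<le> exp (- ((c * (9/64)) * (r\<^sup>2 * t)))" by (simp add: mult_ac)
      then have "norm (m \<xi>) \<le> M * exp (- ((c * (9/64)) * (r\<^sup>2 * t)))"
        by (intro order_trans[OF b] mult_left_mono M)
      then have "norm (fat_ring l \<xi> * m \<xi>) \<le> E"
        unfolding norm_mult E_def using X by (intro mult_mono) auto
      then have "(norm (fat_ring l \<xi> * m \<xi>))\<^sup>2 \<le> E\<^sup>2" by (intro power_mono) auto
      then show ?thesis using n by simp
    qed (use E0 in \<open>simp add: indicator_def\<close>)
    have meas: "emeasure lborel (cball (0::real^'n) (16/3 * r)) = ennreal (V * (16/3 * r) ^ CARD('n))"
      using emeasure_cball[of "16/3 * r" "0::real^'n"] r unfolding V_def by simp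
    have "(LINT \<xi>|lborel. (norm (fat_ring l \<xi> * m \<xi>))\<^sup>2) \<le> (LINT \<xi>|lborel. E\<^sup>2 * indicator (cball (0::real^'n) (16/3 * r)) \<xi>)"
    proof (rule integral_mono_AE')
      show "integrable lborel (\<lambda>\<xi>. E\<^sup>2 * indicator (cball (0::real^'n) (16/3 * r)) \<xi>)"
        using meas by (intro integrable_mult_right integrable_real_indicator) auto
    qed (use pt in auto)
    also have "\<dots> = E\<^sup>2 * (V * (16/3 * r) ^ CARD('n))"
      using meas V r by (simp add: measure_def)
    finally have "sqrt (LINT \<xi>|lborel. (norm (fat_ring l \<xi> * m \<xi>))\<^sup>2) \<le> sqrt (E\<^sup>2 * (V * (16/3 * r) ^ CARD('n)))"
      by (rule real_sqrt_le_mono)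
    also have "\<dots> = E * sqrt (V * (16/3) ^ CARD('n)) * sqrt (r ^ CARD('n))"
      unfolding power_mult_distrib using E0 by (simp add: real_sqrt_mult)
    also have "sqrt (r ^ CARD('n)) = 2 powr (of_int l * (real CARD('n) / 2))"
    proof -
      have "r = 2 powr (of_int l)" unfolding r_def by (simp add: powr_real_of_int')
      then have "r ^ CARD('n) = 2 powr (of_int l * real CARD('n))" by (simp add: powr_powr flip: powr_realpow)
      then have "sqrt (r ^ CARD('n)) = (2 powr (of_int l * real CARD('n))) powr (1/2)" by (simp add: powr_half_sqrt)
      then show ?thesis by (simp add: powr_powr)
    qed
    finally show ?thesis unfolding E_def K_def r(2) by (simp add: mult_ac)
  qed
  moreover have "K > 0" unfolding K_def using X V by simp
  ultimately show ?thesis by (intro exI[of _ K]) blast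
qed

text \<open>A Gaussian cutoff of the frequencies beyond \<open>1 / sqrt t\<close> gains the missing derivative of the embedding into bounded
  functions at the price \<open>1 / sqrt t\<close>. The blocks satisfy \<open>\<parallel>\<Delta>\<^sub>l m(D) T\<parallel> \<le> K M a\<^sub>l e\<^sub>l\<close> in the supremum norm with \<open>(a\<^sub>l)\<close> of
  \<open>\<ell>\<^sup>2\<close> norm at most \<open>b\<close> and \<open>e\<^sub>l = 2\<^sup>l exp (- c' 4\<^sup>l t)\<close> of \<open>\<ell>\<^sup>2\<close> norm \<open>O(1 / sqrt t)\<close>. The same bound for the partial sums
  dominates the convergence that identifies the sum with \<open>m(D) T\<close>.\<close>

theorem smoothing_estimate:
  assumes c: "c > 0"
  shows "\<exists>C>0. \<forall>(Ts :: 'i::finite \<Rightarrow> 'n distr) b. (\<forall>i. low_vanishing (Ts i)) \<longrightarrow> 0 \<le> b \<longrightarrow>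
     besov_norm \<phi> (real CARD('n) / 2 - 1) 2 2 Ts \<le> ennreal b \<longrightarrow>
     (\<forall>t M m. t > 0 \<longrightarrow> M \<ge> 0 \<longrightarrow> schwartz m \<longrightarrow> (\<forall>\<xi>. norm (m \<xi>) \<le> M * exp (- (c * (t * (\<xi> \<bullet> \<xi>))))) \<longrightarrow>
        (\<forall>i. (\<forall>y. norm (smoothed (Ts i) m y) \<le> C * M * b / sqrt t) \<and>
           (\<forall>f. schwartz f \<longrightarrow> Ts i (fourier (\<lambda>\<xi>. m \<xi> * inv_fourier f \<xi>)) = (LINT y|lborel. f y * smoothed (Ts i) m y))))"
proof -
  obtain K where K: "K > 0" "\<And>l t M m. t > 0 \<Longrightarrow> M \<ge> 0 \<Longrightarrow> schwartz m \<Longrightarrow> (\<forall>\<xi>. norm (m \<xi>) \<le> M * exp (- (c * (t * (\<xi> \<bullet> \<xi>))))) \<Longrightarrow>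
     sqrt (LINT \<xi>|lborel. (norm (fat_ring l \<xi> * m \<xi>))\<^sup>2) \<le>
       K * M * exp (- ((c * (9/64)) * (4 powi l * t))) * 2 powr (of_int l * (real CARD('n) / 2))"
    using fat_ring_L2[OF c] by blast
  obtain C1 where C1: "C1 > 0" "\<And>t n. t > 0 \<Longrightarrow> (\<Sum>l\<in>{- int n..<int n}. (4 powi l * t) * exp (- ((2 * (c * (9/64))) * (4 powi l * t)))) \<le> C1"
    using dyadic_exponential_sum[of "2 * (c * (9/64))"] c by auto
  define C where "C = K * sqrt C1"
  have "(\<forall>y. norm (smoothed (Ts i) m y) \<le> C * M * b / sqrt t) \<and>
      (\<forall>f. schwartz f \<longrightarrow> Ts i (fourier (\<lambda>\<xi>. m \<xi> * inv_fourier f \<xi>)) = (LINT y|lborel. f y * smoothed (Ts i) m y))"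
    if T: "\<And>i. low_vanishing (Ts i)" and b: "0 \<le> b" "besov_norm \<phi> (real CARD('n) / 2 - 1) 2 2 Ts \<le> ennreal b"
      and t: "t > 0" and M: "M \<ge> 0" and m: "schwartz m" "\<forall>\<xi>. norm (m \<xi>) \<le> M * exp (- (c * (t * (\<xi> \<bullet> \<xi>))))"
    for Ts :: "'i \<Rightarrow> 'n distr" and b t M m i
  proof -
    have TF: "schwartz_functional (Ts i)" using T low_vanishing_functional by blast
    define s where "s = real CARD('n) / 2 - 1"
    define D where "D = (\<lambda>l. distr_Lp_norm 2 (\<lambda>i. dyadic_block \<phi> l (Ts i)))"
    define a where "a = (\<lambda>l. enn2real (ennreal (2 powr (of_int l * s)) * D l))"
    define d where "d = (\<lambda>l. enn2real (D l))"
    have eLp: "eLp_norm (count_space UNIV) 2 (\<lambda>l. ennreal (2 powr (of_int l * s)) * D l) \<le> ennreal b"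
      using b(2) unfolding besov_norm_def D_def s_def .
    have Dfin: "D l < \<infinity>" for l
      using square_summable_of_eLp_norm(1)[OF eLp b(1), of l] by (auto simp: ennreal_mult_less_top)
    have D: "D l = ennreal (d l)" "0 \<le> d l" for l using Dfin[of l] by (simp_all add: d_def less_top)
    have a: "a l = 2 powr (of_int l * s) * d l" for l
      unfolding a_def D using D(2)[of l] by (simp flip: ennreal_mult)
    have a2: "(\<Sum>l\<in>F. (a l)\<^sup>2) \<le> b\<^sup>2" if "finite F" for F
      using square_summable_of_eLp_norm(2)[OF eLp b(1) that] unfolding a_def .
    define k where "k = (\<lambda>l. smoothed (Ts i) (\<lambda>\<xi>. ring l \<xi> * m \<xi>))"
    define e where "e = (\<lambda>l::int. 2 powr (of_int l) * exp (- ((c * (9/64)) * (4 powi l * t))))"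
    have Sr: "schwartz (\<lambda>\<xi>. ring l \<xi> * m \<xi>)" for l
      by (intro schwartz_times schwartz_imp_moderate schwartz_ring m(1))
    have kb: "norm (k l y) \<le> K * M * (a l * e l)" for l y
    proof -
      have "norm (k l y) \<le> d l * sqrt (LINT \<xi>|lborel. (norm (fat_ring l \<xi> * m \<xi>))\<^sup>2)"
        unfolding k_def using D m(1) unfolding D_def by (intro dyadic_block_estimate(1) TF)
      also have "\<dots> \<le> d l * (K * M * exp (- ((c * (9/64)) * (4 powi l * t))) * 2 powr (of_int l * (real CARD('n) / 2)))"
        by (intro mult_left_mono K(2) t M m D(2))
      also have "2 powr (of_int l * (real CARD('n) / 2)) = 2 powr (of_int l * s) * 2 powr (of_int l)"
        unfolding s_def by (simp add: algebra_simps flip: powr_add)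
      finally show ?thesis unfolding a e_def by (simp add: mult_ac)
    qed
    have e2: "(\<Sum>l\<in>{- int n..<int n}. (e l)\<^sup>2) \<le> C1 / t" for n
    proof -
      have "(e l)\<^sup>2 = (4 powi l * t) * exp (- ((2 * (c * (9/64))) * (4 powi l * t))) / t" for l
      proof -
        have "(2 powr (real_of_int l))\<^sup>2 = 4 powi l"
        proof -
          have "2 powr (real_of_int l) = 2 powi l" by (simp add: powr_real_of_int')
          then show ?thesis by (simp add: power2_eq_square flip: power_int_mult_distrib)
        qed
        moreover have "(exp (- ((c * (9/64)) * (4 powi l * t))))\<^sup>2 = exp (- ((2 * (c * (9/64))) * (4 powi l * t)))"
          by (simp add: power2_eq_square flip: exp_add)
        ultimately show ?thesis using t unfolding e_def power_mult_distrib by simp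
      qed
      then have "(\<Sum>l\<in>{- int n..<int n}. (e l)\<^sup>2) = (\<Sum>l\<in>{- int n..<int n}. (4 powi l * t) * exp (- ((2 * (c * (9/64))) * (4 powi l * t)))) / t"
        by (simp add: sum_divide_distrib)
      then show ?thesis using C1(2)[OF t, of n] t by (simp add: divide_right_mono)
    qed
    have sumb: "norm (\<Sum>l\<in>{- int n..<int n}. k l y) \<le> C * M * b / sqrt t" for n y
    proof -
      have "norm (\<Sum>l\<in>{- int n..<int n}. k l y) \<le> (\<Sum>l\<in>{- int n..<int n}. K * M * (a l * e l))"
        by (rule order_trans[OF norm_sum sum_mono[OF kb]])
      also have "\<dots> = K * M * (\<Sum>l\<in>{- int n..<int n}. a l * e l)" by (simp add: sum_distrib_left)
      also have "(\<Sum>l\<in>{- int n..<int n}. a l * e l) \<le> L2_set a {- int n..<int n} * L2_set e {- int n..<int n}"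
      proof (rule order_trans[OF _ L2_set_mult_ineq], rule sum_mono)
        show "a l * e l \<le> \<bar>a l\<bar> * \<bar>e l\<bar>" for l unfolding abs_mult[symmetric] by (rule abs_ge_self)
      qed
      also have "L2_set a {- int n..<int n} * L2_set e {- int n..<int n} \<le> b * sqrt (C1 / t)"
      proof (rule mult_mono)
        show "L2_set a {- int n..<int n} \<le> b" unfolding L2_set_def
          using a2[of "{- int n..<int n}"] b(1) by (intro real_le_lsqrt sum_nonneg) auto
        show "L2_set e {- int n..<int n} \<le> sqrt (C1 / t)" unfolding L2_set_def
          by (intro real_sqrt_le_mono e2)
      qed (use b(1) L2_set_nonneg in auto)
      finally have "norm (\<Sum>l\<in>{- int n..<int n}. k l y) \<le> K * M * (b * sqrt (C1 / t))"
        using K(1) M by (simp add: mult_left_mono)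
      then show ?thesis by (simp add: C_def real_sqrt_divide mult_ac)
    qed
    have lim: "(\<lambda>n. \<Sum>l\<in>{- int n..<int n}. k l y) \<longlonglongrightarrow> smoothed (Ts i) m y" for y
    proof -
      have em: "schwartz (\<lambda>\<xi>. cis (y \<bullet> \<xi>) * m \<xi>)" by (intro schwartz_times moderate_character m(1))
      have "k l y = Ts i (fourier (\<lambda>\<xi>. ring l \<xi> * (cis (y \<bullet> \<xi>) * m \<xi>))) / of_real ((2 * pi) ^ CARD('n))" for l
        unfolding k_def smoothed_def by (simp add: mult.left_commute)
      then show ?thesis
        using tendsto_divide[OF littlewood_paley_decomposition[OF T em] tendsto_const[of "of_real ((2 * pi) ^ CARD('n))"]]
        unfolding smoothed_def by (simp add: sum_divide_distrib)
    qed
    have bound: "norm (smoothed (Ts i) m y) \<le> C * M * b / sqrt t" for y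
      by (rule LIMSEQ_le_const2[OF tendsto_norm[OF lim]]) (use sumb in blast)
    moreover have "Ts i (fourier (\<lambda>\<xi>. m \<xi> * inv_fourier f \<xi>)) = (LINT y|lborel. f y * smoothed (Ts i) m y)"
      if f: "schwartz f" for f
    proof -
      have mf: "schwartz (\<lambda>\<xi>. m \<xi> * inv_fourier f \<xi>)"
        by (intro schwartz_times schwartz_imp_moderate m(1) schwartz_inv_fourier f)
      have [measurable]: "f \<in> borel_measurable borel" "\<And>l. k l \<in> borel_measurable borel" "smoothed (Ts i) m \<in> borel_measurable borel"
        unfolding k_def by (auto intro: schwartz_measurable f smoothed_measurable TF Sr m(1))
      have fk: "integrable lborel (\<lambda>y. f y * k l y)" for l
        by (rule Bochner_Integration.integrable_bound[OF integrable_mult_left[OF integrable_norm[OF schwartz_integrable[OF f]], of "K * M * (a l * e l)"]])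
           (auto simp: norm_mult intro!: AE_I2 order_trans[OF mult_left_mono[OF kb norm_ge_zero]] abs_ge_self mult_left_mono)
      have "(\<lambda>n. \<Sum>l\<in>{- int n..<int n}. Ts i (fourier (\<lambda>\<xi>. ring l \<xi> * (m \<xi> * inv_fourier f \<xi>)))) \<longlonglongrightarrow> Ts i (fourier (\<lambda>\<xi>. m \<xi> * inv_fourier f \<xi>))"
        by (rule littlewood_paley_decomposition[OF T mf])
      moreover have "(\<Sum>l\<in>{- int n..<int n}. Ts i (fourier (\<lambda>\<xi>. ring l \<xi> * (m \<xi> * inv_fourier f \<xi>)))) =
          (LINT y|lborel. f y * (\<Sum>l\<in>{- int n..<int n}. k l y))" for n
      proof -
        have "Ts i (fourier (\<lambda>\<xi>. ring l \<xi> * (m \<xi> * inv_fourier f \<xi>))) = (LINT y|lborel. f y * k l y)" for l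
          using dyadic_block_estimate(2)[OF TF D(1)[unfolded D_def] D(2) m(1) f] unfolding k_def by (simp add: mult.assoc)
        then show ?thesis
          unfolding sum_distrib_left using Bochner_Integration.integral_sum[of "{- int n..<int n}" lborel "\<lambda>l y. f y * k l y"] fk by simp
      qed
      moreover have "(\<lambda>n. LINT y|lborel. f y * (\<Sum>l\<in>{- int n..<int n}. k l y)) \<longlonglongrightarrow> (LINT y|lborel. f y * smoothed (Ts i) m y)"
      proof (rule integral_dominated_convergence[where w="\<lambda>y. norm (f y) * (C * M * b / sqrt t)"])
        show "integrable lborel (\<lambda>y. norm (f y) * (C * M * b / sqrt t))"
          by (intro integrable_mult_left integrable_norm schwartz_integrable f)
        show "AE y in lborel. (\<lambda>n. f y * (\<Sum>l\<in>{- int n..<int n}. k l y)) \<longlonglongrightarrow> f y * smoothed (Ts i) m y"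
          by (intro AE_I2 tendsto_mult tendsto_const lim)
        show "AE y in lborel. norm (f y * (\<Sum>l\<in>{- int n..<int n}. k l y)) \<le> norm (f y) * (C * M * b / sqrt t)" for n
          unfolding norm_mult by (intro AE_I2 mult_left_mono sumb) auto
      qed measurable
      ultimately show ?thesis using LIMSEQ_unique by simp
    qed
    ultimately show ?thesis by blast
  qed
  moreover have "C > 0" unfolding C_def using K C1 by simp
  ultimately show ?thesis by (intro exI[of _ C]) blast
qed

end

section \<open>The \<open>L\<^sup>\<infinity>\<close> norm of a distribution\<close>

lemma norm_vec_le_sum: "norm (v :: complex^'i::finite) \<le> (\<Sum>i\<in>UNIV. norm (v $ i))"
  unfolding norm_vec_def by (rule L2_set_le_sum) simp

lemma borel_measurable_vec_lambda:
  fixes k :: "'i::finite \<Rightarrow> 'a \<Rightarrow> complex"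
  assumes "\<And>i. k i \<in> borel_measurable M"
  shows "(\<lambda>x. \<chi> i. k i x) \<in> borel_measurable M"
proof -
  have "(\<lambda>x. \<chi> i. k i x) = (\<lambda>x. \<Sum>i\<in>UNIV. axis i (k i x))"
    by (auto simp: vec_eq_iff axis_def)
  moreover have "continuous_on UNIV (\<lambda>z. axis i z :: complex^'i)" for i
    unfolding axis_def by (intro continuous_on_vec_lambda) (case_tac "ia = i"; simp)
  then have "(\<lambda>z. axis i z :: complex^'i) \<in> borel_measurable borel" for i
    by (rule borel_measurable_continuous_onI)
  then have "(\<lambda>x. axis i (k i x) :: complex^'i) \<in> borel_measurable M" for i
    using measurable_compose[OF assms] by blast
  ultimately show ?thesis by simp
qed

lemma bounded_times_schwartz_integrable:
  fixes k f :: "real^'n::finite \<Rightarrow> complex"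
  assumes "k \<in> borel_measurable borel" "\<And>y. norm (k y) \<le> K" "schwartz f"
  shows "integrable lborel (\<lambda>y. k y * f y)"
proof (rule Bochner_Integration.integrable_bound[OF integrable_mult_right[OF integrable_norm[OF schwartz_integrable[OF assms(3)]], of K]])
  show "(\<lambda>y. k y * f y) \<in> borel_measurable lborel"
    using assms(1) schwartz_measurable[OF assms(3)] by measurable
  have "norm (k y * f y) \<le> norm (K * norm (f y))" for y
    using mult_right_mono[OF assms(2)[of y] norm_ge_zero[of "f y"]] by (simp add: norm_mult abs_mult)
      (meson abs_ge_self mult_right_mono norm_ge_zero order_trans)
  then show "AE y in lborel. norm (k y * f y) \<le> norm (K * norm (f y))" by simp
qed

lemma distr_Lp_norm_infinity_le:
  fixes T :: "'i::finite \<Rightarrow> 'n::finite distr" and k :: "'i \<Rightarrow> real^'n \<Rightarrow> complex"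
  assumes meas: "\<And>i. k i \<in> borel_measurable borel" and bd: "\<And>i y. norm (k i y) \<le> K"
    and rep: "\<And>i f. schwartz f \<Longrightarrow> T i f = (LINT y|lborel. f y * k i y)"
    and norm: "\<And>y. ennreal (norm (\<chi> i. k i y)) \<le> B"
  shows "distr_Lp_norm \<infinity> T \<le> B"
proof -
  define g where "g = (\<lambda>y. \<chi> i. k i y)"
  have g: "g \<in> borel_measurable lborel"
    unfolding g_def using borel_measurable_vec_lambda[of k borel] meas by simp
  have "represents g T"
    unfolding represents_def
  proof (intro conjI allI impI g)
    fix i and f :: "real^'n \<Rightarrow> complex" assume f: "schwartz f"
    show "integrable lborel (\<lambda>x. g x $ i * f x)"
      using bounded_times_schwartz_integrable[OF meas bd f] by (simp add: g_def)
    show "T i f = (LINT x|lborel. g x $ i * f x)" using rep[OF f] by (simp add: g_def mult.commute)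
  qed
  then have "distr_Lp_norm \<infinity> T \<le> eLp_norm lborel \<infinity> (\<lambda>x. ennreal (norm (g x)))"
    unfolding distr_Lp_norm_def by (intro INF_lower) simp
  also have "\<dots> = esssup lborel (\<lambda>x. ennreal (norm (g x)))" by (simp add: eLp_norm_def)
  also have "\<dots> \<le> B"
    using g norm by (intro esssup_I) (auto simp: g_def)
  finally show ?thesis .
qed

text \<open>Testing against translated Gaussian densities recovers the values of a continuous
  representative.\<close>

definition gauss_probe :: "real^'n::finite \<Rightarrow> nat \<Rightarrow> real^'n \<Rightarrow> complex" where
  "gauss_probe y n x = of_real (gauss_kernel (real (Suc n)) (x - y))"

lemma schwartz_gauss_probe: "schwartz (gauss_probe (y :: real^'n::finite) n)"
proof -
  have g: "schwartz (\<lambda>\<xi>::real^'n. cis (y \<bullet> \<xi>) * of_real (gauss (1 / (4 * real (Suc n))) \<xi>))"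
    by (intro schwartz_times moderate_character schwartz_gauss) simp
  have "gauss_probe y n = (\<lambda>x. inverse (of_real ((2 * pi) ^ CARD('n))) * fourier (\<lambda>\<xi>. cis (y \<bullet> \<xi>) * of_real (gauss (1 / (4 * real (Suc n))) \<xi>)) x)"
    unfolding fourier_modulate fourier_gauss_kernel[OF of_nat_0_less_iff[THEN iffD2, OF zero_less_Suc]]
    using pi_gt_zero by (auto simp: gauss_probe_def fun_eq_iff field_simps)
  then show ?thesis using schwartz_cmult[OF schwartz_fourier[OF g]] by simp
qed

lemma gauss_probe_mass: "(LINT x|lborel. norm (gauss_probe y n x)) = 1"
proof -
  have "(LINT x|lborel. norm (gauss_probe y n x)) = Re (LINT x|lborel. gauss_probe y n x)"
  proof -
    have "norm (gauss_probe y n x) = Re (gauss_probe y n x)" for x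
      using gauss_kernel_pos[of "real (Suc n)" "x - y"] by (simp add: gauss_probe_def)
    then show ?thesis by (simp add: schwartz_integrable[OF schwartz_gauss_probe])
  qed
  also have "(LINT x|lborel. gauss_probe y n x) = (LINT x|lborel. gauss_probe y n (y + 1 *\<^sub>R x))"
    using integral_translate[OF schwartz_measurable[OF schwartz_gauss_probe[of y n]], of 1 y] by simp
  also have "\<dots> = of_real (LINT x|lborel. gauss_kernel (real (Suc n)) (x :: real^'a))"
    unfolding gauss_probe_def integral_complex_of_real[symmetric] by simp
  also have "(LINT x|lborel. gauss_kernel (real (Suc n)) (x :: real^'a)) = 1"
    by (rule integral_gauss_kernel) simp
  finally show ?thesis by simp
qed

lemma norm_component_le_distr_Lp_norm:
  fixes T :: "'i::finite \<Rightarrow> 'n::finite distr"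
  assumes g: "represents g T"
    and e: "eLp_norm lborel \<infinity> (\<lambda>x. ennreal (norm (g x))) \<le> ennreal e"
  shows "AE x in lborel. ennreal (norm (g x $ i)) \<le> ennreal e"
proof -
  have "AE x in lborel. ennreal (norm (g x)) \<le> esssup lborel (\<lambda>x. ennreal (norm (g x)))"
    by (rule esssup_AE)
  then show ?thesis
  proof (rule AE_mp, intro AE_I2 impI)
    fix x assume "ennreal (norm (g x)) \<le> esssup lborel (\<lambda>x. ennreal (norm (g x)))"
    also have "\<dots> \<le> ennreal e" using e by (simp add: eLp_norm_def)
    finally have "ennreal (norm (g x)) \<le> ennreal e" .
    moreover have "ennreal (norm (g x $ i)) \<le> ennreal (norm (g x))"
      by (intro ennreal_leI Finite_Cartesian_Product.norm_nth_le)
    ultimately show "ennreal (norm (g x $ i)) \<le> ennreal e" by (rule order_trans[rotated])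
  qed
qed

lemma probe_le_distr_Lp_norm:
  fixes T :: "'n::finite distr"
  shows "ennreal (norm (T (gauss_probe y n))) \<le> distr_Lp_norm \<infinity> (scalar T)"
  unfolding distr_Lp_norm_def
proof (rule INF_greatest)
  fix g :: "real^'n \<Rightarrow> complex^unit" assume "g \<in> {g. represents g (scalar T)}"
  then have g: "represents g (scalar T)" by simp
  show "ennreal (norm (T (gauss_probe y n))) \<le> eLp_norm lborel \<infinity> (\<lambda>x. ennreal (norm (g x)))"
  proof (cases "eLp_norm lborel \<infinity> (\<lambda>x. ennreal (norm (g x)))")
    case (real e)
    have int: "integrable lborel (\<lambda>x. g x $ () * gauss_probe y n x)"
      and T: "T (gauss_probe y n) = (LINT x|lborel. g x $ () * gauss_probe y n x)"
      using g schwartz_gauss_probe unfolding represents_def by blast+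
    have "AE x in lborel. ennreal (norm (g x $ ())) \<le> ennreal e"
      by (rule norm_component_le_distr_Lp_norm[OF g]) (simp only: real order_refl)
    then have ae: "AE x in lborel. norm (g x $ () * gauss_probe y n x) \<le> e * norm (gauss_probe y n x)"
      by (rule AE_mp) (auto simp: norm_mult ennreal_le_iff real mult_right_mono)
    have "norm (T (gauss_probe y n)) \<le> (LINT x|lborel. norm (g x $ () * gauss_probe y n x))"
      unfolding T by (rule integral_norm_bound)
    also have "\<dots> \<le> (LINT x|lborel. e * norm (gauss_probe y n x))"
      using int ae by (intro integral_mono_AE) (auto intro!: integrable_mult_right integrable_norm schwartz_integrable schwartz_gauss_probe)
    also have "\<dots> = e" by (simp add: gauss_probe_mass)
    finally show ?thesis using real by (simp add: ennreal_leI)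
  qed simp
qed

text \<open>The probes are fixed test functions, so the norm becomes a supremum of quantities that inherit the
  continuity in time of the solution.\<close>

lemma distr_Lp_norm_eq_SUP_probe:
  fixes T :: "'n::finite distr" and k :: "real^'n \<Rightarrow> complex"
  assumes cont: "continuous_on UNIV k" and bd: "\<And>y. norm (k y) \<le> K"
    and rep: "\<And>f. schwartz f \<Longrightarrow> T f = (LINT y|lborel. f y * k y)"
  shows "distr_Lp_norm \<infinity> (scalar T) = (SUP p. ennreal (norm (T (gauss_probe (fst p) (snd p)))))"
proof (rule antisym)
  show "(SUP p. ennreal (norm (T (gauss_probe (fst p) (snd p))))) \<le> distr_Lp_norm \<infinity> (scalar T)"
    by (intro SUP_least probe_le_distr_Lp_norm)
  define S where "S = (SUP p. ennreal (norm (T (gauss_probe (fst p) (snd p)))))"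
  have S: "ennreal (norm (T (gauss_probe y n))) \<le> S" for y n
    unfolding S_def by (rule SUP_upper2[of "(y, n)"]) auto
  have k: "ennreal (norm (k y)) \<le> S" for y
  proof (rule LIMSEQ_le_const2)
    have "(\<lambda>n. T (gauss_probe y n)) \<longlonglongrightarrow> k y"
      using gauss_approximate_identity[OF cont bd, of y] rep[OF schwartz_gauss_probe[of y]]
      by (simp add: gauss_probe_def mult.commute)
    then show "(\<lambda>n. ennreal (norm (T (gauss_probe y n)))) \<longlonglongrightarrow> ennreal (norm (k y))"
      by (intro tendsto_ennrealI tendsto_norm)
  qed (use S in blast)
  show "distr_Lp_norm \<infinity> (scalar T) \<le> S"
  proof (rule distr_Lp_norm_infinity_le[of "\<lambda>_. k" K])
    show "k \<in> borel_measurable borel" by (rule borel_measurable_continuous_onI[OF cont])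
    have "norm (\<chi> i::unit. k y) = norm (k y)" for y by (simp add: norm_vec_def L2_set_def UNIV_unit)
    then show "ennreal (norm (\<chi> i::unit. k y)) \<le> S" for y using k by simp
  qed (use bd rep in auto)
qed

text \<open>The heat semigroup does not increase the \<open>L\<^sup>\<infinity>\<close> norm, because its kernel is a probability
  density.\<close>

lemma heat_contraction:
  fixes T :: "'n::finite distr"
  assumes fin: "distr_Lp_norm \<infinity> (scalar T) < \<infinity>" and t: "t > 0"
  shows "ennreal (norm (smoothed T (\<lambda>\<xi>. of_real (gauss t \<xi>)) y)) \<le> distr_Lp_norm \<infinity> (scalar T)"
    and "schwartz f \<Longrightarrow> T (fourier (\<lambda>\<xi>. of_real (gauss t \<xi>) * inv_fourier f \<xi>)) =
       (LINT y|lborel. f y * smoothed T (\<lambda>\<xi>. of_real (gauss t \<xi>)) y)"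
proof -
  define \<psi> where "\<psi> = (\<lambda>\<xi>::real^'n. complex_of_real (gauss t \<xi>))"
  have \<psi>: "schwartz \<psi>" unfolding \<psi>_def by (rule schwartz_gauss[OF t])
  define a where "a = 1 / (4 * t)"
  have a: "a > 0" using t by (simp add: a_def)
  define P where "P = (2 * pi) ^ CARD('n)"
  have P: "P > 0" by (simp add: P_def)
  have F: "fourier \<psi> z = of_real (P * gauss_kernel a z)" for z
    using fourier_gauss_kernel[OF a, of z] t unfolding \<psi>_def P_def a_def by simp
  have ex: "\<exists>g. represents g (scalar T) \<and> eLp_norm lborel \<infinity> (\<lambda>x. ennreal (norm (g x))) \<le> ennreal e"
    if "distr_Lp_norm \<infinity> (scalar T) < ennreal e" for e
    using that unfolding distr_Lp_norm_def by (auto simp: INF_less_iff intro: less_imp_le)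
  have bd: "(\<integral>\<^sup>+x. ennreal (norm (g x $ ()) * norm (fourier \<psi> (x - y))) \<partial>lborel) \<le> ennreal (e * P)"
    if g: "represents g (scalar T)" "eLp_norm lborel \<infinity> (\<lambda>x. ennreal (norm (g x))) \<le> ennreal e" and e: "e \<ge> 0" for g e y
  proof -
    have [measurable]: "(\<lambda>x. gauss_kernel a (x - y)) \<in> borel_measurable borel" by measurable
    have "AE x in lborel. ennreal (norm (g x $ ())) \<le> ennreal e"
      by (rule norm_component_le_distr_Lp_norm[OF g])
    then have "AE x in lborel. ennreal (norm (g x $ ()) * norm (fourier \<psi> (x - y))) \<le> ennreal (e * P) * ennreal (gauss_kernel a (x - y))"
    proof (rule AE_mp, intro AE_I2 impI)
      fix x assume "ennreal (norm (g x $ ())) \<le> ennreal e"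
      then have le: "norm (g x $ ()) \<le> e" using e by (simp add: ennreal_le_iff)
      have "norm (g x $ ()) * norm (fourier \<psi> (x - y)) = norm (g x $ ()) * (P * gauss_kernel a (x - y))"
        unfolding F using P gauss_kernel_pos[OF a, of "x - y"] by (simp add: norm_mult)
      also have "\<dots> \<le> e * (P * gauss_kernel a (x - y))"
        using P gauss_kernel_pos[OF a, of "x - y"] by (intro mult_right_mono le) auto
      finally show "ennreal (norm (g x $ ()) * norm (fourier \<psi> (x - y))) \<le> ennreal (e * P) * ennreal (gauss_kernel a (x - y))"
        using e P gauss_kernel_pos[OF a, of "x - y"] by (simp add: ennreal_leI mult.assoc flip: ennreal_mult)
    qed
    then have "(\<integral>\<^sup>+x. ennreal (norm (g x $ ()) * norm (fourier \<psi> (x - y))) \<partial>lborel) \<le>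
        (\<integral>\<^sup>+x. ennreal (e * P) * ennreal (gauss_kernel a (x - y)) \<partial>lborel)" by (rule nn_integral_mono_AE)
    also have "\<dots> = ennreal (e * P) * (\<integral>\<^sup>+x. ennreal (gauss_kernel a (x - y)) \<partial>lborel)"
      by (rule nn_integral_cmult) measurable
    also have "(\<integral>\<^sup>+x. ennreal (gauss_kernel a (x - y)) \<partial>lborel) = (\<integral>\<^sup>+x. ennreal (gauss_kernel a x) \<partial>distr lborel borel ((+) (- y)))"
      by (subst nn_integral_distr) auto
    also have "\<dots> = (\<integral>\<^sup>+x. ennreal (gauss_kernel a x) \<partial>(lborel :: (real^'n) measure))" by (simp add: lborel_distr_plus)
    also have "\<dots> = ennreal 1"
    proof -
      have "integrable lborel (gauss_kernel a :: real^'n \<Rightarrow> real)" by (rule integrable_gauss_kernel[OF a])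
      moreover have "AE x in (lborel :: (real^'n) measure). 0 \<le> gauss_kernel a x"
        by (intro AE_I2 less_imp_le gauss_kernel_pos a)
      ultimately show ?thesis
        by (simp only: nn_integral_eq_integral integral_gauss_kernel[OF a])
    qed
    finally show ?thesis by simp
  qed
  show "ennreal (norm (smoothed T (\<lambda>\<xi>. of_real (gauss t \<xi>)) y)) \<le> distr_Lp_norm \<infinity> (scalar T)"
  proof (rule dense_ge)
    fix z assume z: "distr_Lp_norm \<infinity> (scalar T) < z"
    show "ennreal (norm (smoothed T (\<lambda>\<xi>. of_real (gauss t \<xi>)) y)) \<le> z"
    proof (cases z)
      case (real e)
      obtain g where g: "represents g (scalar T)" "eLp_norm lborel \<infinity> (\<lambda>x. ennreal (norm (g x))) \<le> ennreal e"
        using ex z real by blast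
      have "norm (smoothed T \<psi> y) \<le> (e * P) / (2 * pi) ^ CARD('n)"
        using norm_smoothed_represented[OF g(1) \<psi> bd[OF g]] real P by simp
      then show ?thesis using P real unfolding P_def \<psi>_def by (simp add: ennreal_leI)
    qed simp
  qed
  assume f: "schwartz f"
  obtain e where e: "distr_Lp_norm \<infinity> (scalar T) = ennreal e" "0 \<le> e"
    using fin by (cases "distr_Lp_norm \<infinity> (scalar T)") auto
  have "distr_Lp_norm \<infinity> (scalar T) < ennreal (e + 1)" using e by (simp add: ennreal_lessI)
  then obtain g where g: "represents g (scalar T)" "eLp_norm lborel \<infinity> (\<lambda>x. ennreal (norm (g x))) \<le> ennreal (e + 1)"
    using ex by blast
  show "T (fourier (\<lambda>\<xi>. of_real (gauss t \<xi>) * inv_fourier f \<xi>)) =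
       (LINT y|lborel. f y * smoothed T (\<lambda>\<xi>. of_real (gauss t \<xi>)) y)"
    using represented_multiplier[OF g(1) \<psi> f bd[OF g]] e(2) unfolding \<psi>_def by simp
qed

section \<open>The estimates\<close>

lemma sum_plus_type: "(\<Sum>i\<in>UNIV. f i) = (\<Sum>l\<in>UNIV. f (Inl l)) + (\<Sum>l\<in>UNIV. f (Inr l))"
  for f :: "'a::finite + 'b::finite \<Rightarrow> 'c::comm_monoid_add"
  using sum.Plus[of UNIV UNIV f] by simp

text \<open>Half of the decay rate pays for the weight.\<close>

lemma decaying_jet_weighted_bound:
  assumes D: "decaying_jet c D" and c: "c > 0"
  shows "\<exists>K\<ge>0. \<forall>y\<ge>0. (1 + y) * norm (D 0 y) \<le> K * exp (- (c / 2 * y))"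
proof -
  obtain C where C: "C \<ge> 0" "\<And>y. y \<ge> 0 \<Longrightarrow> norm (D 0 y) \<le> C * exp (- (c * y))"
    using decaying_jet_bound[OF D] by blast
  obtain E where E: "\<And>y. y \<ge> 0 \<Longrightarrow> (1 + y) ^ 1 * exp (- (c / 2 * y)) \<le> E"
    using power_times_exp_bounded[of "c / 2" 1] c by auto
  have E0: "E \<ge> 0" using E[of 0] by simp
  have "(1 + y) * norm (D 0 y) \<le> (C * E) * exp (- (c / 2 * y))" if y: "y \<ge> 0" for y
  proof -
    have "(1 + y) * norm (D 0 y) \<le> (1 + y) * (C * exp (- (c * y)))"
      using y C(2)[OF y] by (intro mult_left_mono) auto
    also have "\<dots> = C * ((1 + y) ^ 1 * exp (- (c / 2 * y))) * exp (- (c / 2 * y))"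
      by (simp add: mult_ac flip: exp_add)
    also have "\<dots> \<le> C * E * exp (- (c / 2 * y))"
      using C(1) E[OF y] by (intro mult_right_mono mult_left_mono) auto
    finally show ?thesis .
  qed
  then show ?thesis using C(1) E0 by (intro exI[of _ "C * E"]) auto
qed

text \<open>Such a supremum is lower semicontinuous, whatever the size of the index set.\<close>

lemma borel_measurable_SUP_continuous:
  fixes F :: "'p \<Rightarrow> real \<Rightarrow> ennreal"
  assumes S: "open S" and F: "\<And>p. continuous_on S (F p)" and f: "\<And>t. t \<in> S \<Longrightarrow> f t = (SUP p. F p t)"
  shows "f \<in> borel_measurable (restrict_space lborel S)"
proof (rule borel_measurableI_greater)
  fix y
  have "{t \<in> space (restrict_space lborel S). y < f t} = (\<Union>p. F p -` {y<..} \<inter> S)"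
    using f by (auto simp: space_restrict_space less_SUP_iff)
  moreover have "open (\<Union>p. F p -` {y<..} \<inter> S)"
    using F S by (intro open_UN ballI) (auto simp: continuous_on_open_vimage)
  ultimately show "{t \<in> space (restrict_space lborel S). y < f t} \<in> sets (restrict_space lborel S)"
    using S by (auto simp: sets_restrict_space_iff)
qed

text \<open>The product \<open>t \<bar>\<xi>\<bar>\<^sup>2\<close> is the only dimensionless quantity, so a factor \<open>t \<xi>\<^sub>i \<xi>\<^sub>j\<close> is harmless and
  a factor \<open>t \<xi>\<^sub>i\<close> costs \<open>sqrt t\<close>.\<close>

lemma coordinate_product_weight:
  assumes "t > 0"
  shows "norm (complex_of_real (\<xi> $ i) * of_real (\<xi> $ j) * of_real t) \<le> 1 + t * (\<xi> \<bullet> \<xi>)"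
proof -
  have "\<bar>\<xi> $ i\<bar> * \<bar>\<xi> $ j\<bar> \<le> norm \<xi> * norm \<xi>"
    by (intro mult_mono component_le_norm_cart) auto
  then have "\<bar>\<xi> $ i\<bar> * \<bar>\<xi> $ j\<bar> * t \<le> (\<xi> \<bullet> \<xi>) * t"
    using assms by (intro mult_right_mono) (auto simp: dot_square_norm power2_eq_square)
  moreover have "norm (complex_of_real (\<xi> $ i) * of_real (\<xi> $ j) * of_real t) = \<bar>\<xi> $ i\<bar> * \<bar>\<xi> $ j\<bar> * t"
    using assms by (simp add: norm_mult)
  ultimately show ?thesis by (simp only: mult.commute[of t])
qed

lemma coordinate_weight:
  assumes "t > 0"
  shows "norm (- \<i> * complex_of_real (\<xi> $ i) * of_real t) \<le> sqrt t * (1 + t * (\<xi> \<bullet> \<xi>))"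
proof -
  have "\<bar>\<xi> $ i\<bar> * t \<le> norm \<xi> * t"
    using assms by (intro mult_right_mono component_le_norm_cart) auto
  also have "\<dots> = sqrt t * (sqrt t * norm \<xi>)" using assms by simp
  also have "sqrt t * norm \<xi> \<le> 1 + (sqrt t * norm \<xi>)\<^sup>2"
  proof -
    have "0 \<le> (sqrt t * norm \<xi> - 1)\<^sup>2" "0 \<le> sqrt t * norm \<xi>" using assms by auto
    then show ?thesis by (simp add: power2_eq_square algebra_simps)
  qed
  also have "(sqrt t * norm \<xi>)\<^sup>2 = t * (\<xi> \<bullet> \<xi>)"
    using assms by (simp add: power_mult_distrib power2_norm_eq_inner)
  finally show ?thesis using assms by (simp add: norm_mult mult_left_mono)
qed

context propagator
begin

text \<open>The Fourier multipliers that carry the family \<open>(\<nabla>q\<^sub>0, u\<^sub>0)\<close> to the family \<open>(\<nabla>q, u)\<close> at time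
  \<open>t\<close>.\<close>

definition flow_symbol :: "real \<Rightarrow> 'n + 'n \<Rightarrow> 'n + 'n \<Rightarrow> real^'n::finite \<Rightarrow> complex" where
  "flow_symbol t k i \<xi> = (case k of
     Inl j \<Rightarrow> (case i of
        Inl l \<Rightarrow> (if l = j then 1 else 0) * \<alpha> 0 (t * (\<xi> \<bullet> \<xi>))
      | Inr l \<Rightarrow> (of_real (\<xi> $ l) * of_real (\<xi> $ j) * of_real t) * B 0 (t * (\<xi> \<bullet> \<xi>)))
   | Inr j \<Rightarrow> (case i of
        Inl l \<Rightarrow> (if l = j then - of_real \<kappa> else 0) * \<beta> 0 (t * (\<xi> \<bullet> \<xi>))
      | Inr l \<Rightarrow> (if l = j then 1 else 0) * exp_jet (of_real \<mu>) 0 (t * (\<xi> \<bullet> \<xi>))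
               + (of_real (\<xi> $ l) * of_real (\<xi> $ j) * of_real t) * D 0 (t * (\<xi> \<bullet> \<xi>))))"

lemma flow_symbol_simps:
  "flow_symbol t (Inl j) (Inl l) \<xi> = (if l = j then 1 else 0) * \<alpha> 0 (t * (\<xi> \<bullet> \<xi>))"
  "flow_symbol t (Inl j) (Inr l) \<xi> = (of_real (\<xi> $ l) * of_real (\<xi> $ j) * of_real t) * B 0 (t * (\<xi> \<bullet> \<xi>))"
  "flow_symbol t (Inr j) (Inl l) \<xi> = (if l = j then - of_real \<kappa> else 0) * \<beta> 0 (t * (\<xi> \<bullet> \<xi>))"
  "flow_symbol t (Inr j) (Inr l) \<xi> = (if l = j then 1 else 0) * exp_jet (of_real \<mu>) 0 (t * (\<xi> \<bullet> \<xi>))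
     + (of_real (\<xi> $ l) * of_real (\<xi> $ j) * of_real t) * D 0 (t * (\<xi> \<bullet> \<xi>))"
  by (simp_all add: flow_symbol_def)

text \<open>The Fourier multipliers that carry \<open>(\<nabla>q\<^sub>0, u\<^sub>0)\<close> to the difference between \<open>q\<close> and the heat flow
  of \<open>q\<^sub>0\<close>.\<close>

definition remainder_symbol :: "real \<Rightarrow> 'n + 'n \<Rightarrow> real^'n::finite \<Rightarrow> complex" where
  "remainder_symbol t i \<xi> = (case i of
     Inl l \<Rightarrow> (- \<i> * of_real (\<xi> $ l) * of_real t) * A 0 (t * (\<xi> \<bullet> \<xi>))
   | Inr l \<Rightarrow> (- \<i> * of_real (\<xi> $ l) * of_real t) * B 0 (t * (\<xi> \<bullet> \<xi>)))"

lemma schwartz_jet: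
  "t > 0 \<Longrightarrow> decaying_jet c J \<Longrightarrow> schwartz (\<lambda>\<xi>::real^'n::finite. J 0 (t * (\<xi> \<bullet> \<xi>)))"
  using c by (intro decaying_jet_schwartz)

lemma schwartz_flow_symbol:
  assumes "t > 0" shows "schwartz (flow_symbol t k i :: real^'n::finite \<Rightarrow> complex)"
proof -
  note j = schwartz_jet[OF assms \<alpha>_jet] schwartz_jet[OF assms jets(1)] schwartz_jet[OF assms jets(2)]
    schwartz_jet[OF assms jets(3)] schwartz_jet[OF assms exp_\<mu>_jet]
  show ?thesis
    unfolding flow_symbol_def[abs_def]
    by (cases k; cases i; simp only: sum.case)
      (intro schwartz_plus schwartz_times j moderate_const1 moderate_times moderate_coord)+
qed

lemma schwartz_remainder_symbol:
  assumes "t > 0" shows "schwartz (remainder_symbol t i :: real^'n::finite \<Rightarrow> complex)"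
  unfolding remainder_symbol_def[abs_def]
  by (cases i; simp only: sum.case)
    (intro schwartz_times schwartz_jet[OF assms] jets moderate_const1 moderate_times moderate_coord)+

text \<open>Every entry is a decaying function of \<open>t \<bar>\<xi>\<bar>\<^sup>2\<close> times a Kronecker symbol or one of the weights just
  estimated.\<close>

lemma symbol_bounds:
  "\<exists>M\<ge>0. \<forall>t>0. \<forall>\<xi> :: real^'n::finite.
     (\<forall>k i. norm (flow_symbol t k i \<xi>) \<le> M * exp (- (c / 2 * (t * (\<xi> \<bullet> \<xi>))))) \<and>
     (\<forall>i. norm (remainder_symbol t i \<xi>) \<le> (sqrt t * M) * exp (- (c / 2 * (t * (\<xi> \<bullet> \<xi>)))))"
proof -
  obtain K1 where K1: "K1 \<ge> 0" "\<forall>y\<ge>0. (1 + y) * norm (\<alpha> 0 y) \<le> K1 * exp (- (c / 2 * y))"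
    using decaying_jet_weighted_bound[OF \<alpha>_jet c(1)] by blast
  obtain K2 where K2: "K2 \<ge> 0" "\<forall>y\<ge>0. (1 + y) * norm (B 0 y) \<le> K2 * exp (- (c / 2 * y))"
    using decaying_jet_weighted_bound[OF jets(2) c(1)] by blast
  obtain K3 where K3: "K3 \<ge> 0" "\<forall>y\<ge>0. (1 + y) * norm (- of_real \<kappa> * \<beta> 0 y) \<le> K3 * exp (- (c / 2 * y))"
    using decaying_jet_weighted_bound[OF decaying_jet_cmult[OF jets(1)] c(1)] by blast
  obtain K4 where K4: "K4 \<ge> 0" "\<forall>y\<ge>0. (1 + y) * norm (exp_jet (of_real \<mu>) 0 y) \<le> K4 * exp (- (c / 2 * y))"
    using decaying_jet_weighted_bound[OF exp_\<mu>_jet c(1)] by blast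
  obtain K5 where K5: "K5 \<ge> 0" "\<forall>y\<ge>0. (1 + y) * norm (D 0 y) \<le> K5 * exp (- (c / 2 * y))"
    using decaying_jet_weighted_bound[OF jets(3) c(1)] by blast
  obtain K6 where K6: "K6 \<ge> 0" "\<forall>y\<ge>0. (1 + y) * norm (A 0 y) \<le> K6 * exp (- (c / 2 * y))"
    using decaying_jet_weighted_bound[OF jets(4) c(1)] by blast
  define M where "M = K1 + K2 + K3 + K4 + K5 + K6"
  have weighted: "norm (w * J) \<le> r * (K * E)"
    if "norm w \<le> r * (1 + y)" "(1 + y) * norm J \<le> K * E" "0 \<le> r" for w J :: complex and y K E r :: real
  proof -
    have "norm (w * J) \<le> (r * (1 + y)) * norm J"
      unfolding norm_mult by (rule mult_right_mono[OF that(1)]) simp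
    also have "\<dots> = r * ((1 + y) * norm J)" by simp
    also have "\<dots> \<le> r * (K * E)" by (rule mult_left_mono[OF that(2,3)])
    finally show ?thesis .
  qed
  have "(\<forall>k i. norm (flow_symbol t k i \<xi>) \<le> M * exp (- (c / 2 * (t * (\<xi> \<bullet> \<xi>))))) \<and>
     (\<forall>i. norm (remainder_symbol t i \<xi>) \<le> (sqrt t * M) * exp (- (c / 2 * (t * (\<xi> \<bullet> \<xi>)))))"
    if t: "t > 0" for t and \<xi> :: "real^'n"
  proof -
    define y where "y = t * (\<xi> \<bullet> \<xi>)"
    have y: "y \<ge> 0" unfolding y_def using t by simp
    define E where "E = exp (- (c / 2 * y))"
    have E: "E > 0" by (simp add: E_def)
    note K = K1(2)[rule_format, OF y, folded E_def] K2(2)[rule_format, OF y, folded E_def]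
      K3(2)[rule_format, OF y, folded E_def] K4(2)[rule_format, OF y, folded E_def]
      K5(2)[rule_format, OF y, folded E_def] K6(2)[rule_format, OF y, folded E_def]
    have le: "K * E \<le> M * E" if "K \<in> {K1, K2, K3, K4 + K5, K6}" for K
      using that K1(1) K2(1) K3(1) K4(1) K5(1) K6(1) E by (intro mult_right_mono) (auto simp: M_def)
    have w: "norm (complex_of_real (\<xi> $ l) * of_real (\<xi> $ j) * of_real t) \<le> 1 * (1 + y)" for l j
      using coordinate_product_weight[OF t, of \<xi> l j] by (simp add: y_def)
    have d: "norm (if l = j then 1 else 0 :: complex) \<le> 1 * (1 + y)" for l j :: 'n
      using y by simp
    have v: "norm (- \<i> * complex_of_real (\<xi> $ l) * of_real t) \<le> sqrt t * (1 + y)" for l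
      using coordinate_weight[OF t, of \<xi> l] by (simp only: y_def)
    have "norm (flow_symbol t k i \<xi>) \<le> M * E" for k i
    proof (cases k; cases i)
      fix j l assume "k = Inl j" "i = Inl l"
      then have "norm (flow_symbol t k i \<xi>) \<le> 1 * (K1 * E)"
        unfolding flow_symbol_def y_def[symmetric] by (simp only: sum.case) (rule weighted[OF d K(1)], simp)
      then show ?thesis using le[of K1] by simp
    next
      fix j l assume "k = Inl j" "i = Inr l"
      then have "norm (flow_symbol t k i \<xi>) \<le> 1 * (K2 * E)"
        unfolding flow_symbol_def y_def[symmetric] by (simp only: sum.case) (rule weighted[OF w K(2)], simp)
      then show ?thesis using le[of K2] by simp
    next
      fix j l assume kl: "k = Inr j" "i = Inl l"
      have "norm (flow_symbol t k i \<xi>) = norm ((if l = j then 1 else 0) * (- of_real \<kappa> * \<beta> 0 y))"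
        unfolding kl flow_symbol_def y_def[symmetric] by simp
      also have "\<dots> \<le> 1 * (K3 * E)" by (rule weighted[OF d K(3)]) simp
      finally show ?thesis using le[of K3] by simp
    next
      fix j l assume "k = Inr j" "i = Inr l"
      then have "norm (flow_symbol t k i \<xi>) \<le> 1 * (K4 * E) + 1 * (K5 * E)"
        unfolding flow_symbol_def y_def[symmetric] 
        by (simp only: sum.case) (rule norm_triangle_le[OF add_mono[OF weighted[OF d K(4)] weighted[OF w K(5)]]], simp_all)
      then show ?thesis using le[of "K4 + K5"] by (simp add: distrib_right)
    qed
    moreover have "norm (remainder_symbol t i \<xi>) \<le> (sqrt t * M) * E" for i
    proof (cases i)
      case (Inl l)
      then have "norm (remainder_symbol t i \<xi>) \<le> sqrt t * (K6 * E)"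
        unfolding remainder_symbol_def y_def[symmetric] using t
        by (simp only: sum.case) (rule weighted[OF v K(6)], simp)
      also have "\<dots> \<le> sqrt t * (M * E)" using t by (intro mult_left_mono le) auto
      finally show ?thesis by simp
    next
      case (Inr l)
      then have "norm (remainder_symbol t i \<xi>) \<le> sqrt t * (K2 * E)"
        unfolding remainder_symbol_def y_def[symmetric] using t
        by (simp only: sum.case) (rule weighted[OF v K(2)], simp)
      also have "\<dots> \<le> sqrt t * (M * E)" using t by (intro mult_left_mono le) auto
      finally show ?thesis by simp
    qed
    ultimately show ?thesis unfolding E_def y_def by blast
  qed
  moreover have "M \<ge> 0" unfolding M_def using K1(1) K2(1) K3(1) K4(1) K5(1) K6(1) by simp
  ultimately show ?thesis by blast
qed

end

locale korteweg_flow = propagator \<mu> lam \<kappa> c \<beta> B D A + littlewood_paley_pair \<phi> chi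
  for \<mu> lam \<kappa> c \<beta> B D A and \<phi> chi :: "real^'n::finite \<Rightarrow> real" +
  fixes q0 :: "'n distr" and u0 :: "'n \<Rightarrow> 'n distr" and q u
  assumes solution: "korteweg_solution \<mu> lam \<kappa> q0 u0 q u"
    and data: "low_vanishing q0" "\<And>i. low_vanishing (u0 i)"
begin

sublocale korteweg_propagation \<mu> lam \<kappa> "\<lambda>s g. q s (fourier g)" "\<lambda>s i g. u s i (fourier g)" c \<beta> B D A
  by (intro korteweg_propagation.intro korteweg_solution_fourier_side[OF solution] propagator_axioms)

lemma initial_values: "schwartz f \<Longrightarrow> q 0 f = q0 f" "schwartz f \<Longrightarrow> u 0 i f = u0 i f"
  using solution unfolding korteweg_solution_def by auto

lemma q_functional: "s \<ge> 0 \<Longrightarrow> schwartz_functional (q s)"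
  using solution unfolding korteweg_solution_def by (auto intro: tempered_imp_functional)

abbreviation initial :: "'n + 'n \<Rightarrow> 'n distr" where
  "initial \<equiv> case_sum (distr_grad q0) u0"

lemma initial_low_vanishing: "low_vanishing (initial i)"
  by (cases i) (simp_all add: data distr_grad_def low_vanishing_partial)

lemma q0_functional: "schwartz_functional q0"
  by (rule low_vanishing_functional[OF data(1)])

lemma initial_gradient:
  assumes "schwartz g"
  shows "q0 (fourier (\<lambda>\<xi>. \<i> * of_real (\<xi> $ j) * g \<xi>)) = initial (Inl j) (fourier g)"
  by (simp add: distr_grad_def distr_partial_fourier[OF q0_functional assms])

text \<open>Writing \<open>\<alpha> = exp (- s) + s A(s)\<close> and \<open>s = t \<Sum>l. \<xi>\<^sub>l\<^sup>2\<close> leaves one factor \<open>\<xi>\<^sub>l\<close> for the gradient of \<open>q\<^sub>0\<close>.\<close>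

lemma q_representation:
  assumes t: "t > 0" and g: "schwartz g"
  shows "q t (fourier g) = q0 (fourier (\<lambda>\<xi>. of_real (gauss t \<xi>) * g \<xi>)) +
    (\<Sum>i\<in>UNIV. initial i (fourier (\<lambda>\<xi>. remainder_symbol t i \<xi> * g \<xi>)))"
proof -
  note FT = functional_comp_fourier[OF q0_functional]
  have S: "schwartz (\<lambda>\<xi>. (\<i> * of_real (\<xi> $ l)) * (remainder_symbol t (Inl l) \<xi> * g \<xi>))" for l
    by (intro schwartz_times[OF _ schwartz_times[OF schwartz_imp_moderate[OF schwartz_remainder_symbol[OF t]] g]]
        moderate_cmult moderate_coord)
  have Sa: "schwartz (\<lambda>\<xi>. \<alpha> 0 (t * (\<xi> \<bullet> \<xi>)) * g \<xi>)"
    by (intro schwartz_times[OF _ g] schwartz_imp_moderate schwartz_jet[OF t \<alpha>_jet])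
  have G: "schwartz (\<lambda>\<xi>. of_real (gauss t \<xi>) * g \<xi>)"
    by (intro schwartz_times schwartz_imp_moderate schwartz_gauss t g)
  have "\<alpha> 0 (t * (\<xi> \<bullet> \<xi>)) * g \<xi> = of_real (gauss t \<xi>) * g \<xi> +
      (\<Sum>l\<in>UNIV. (\<i> * of_real (\<xi> $ l)) * (remainder_symbol t (Inl l) \<xi> * g \<xi>))" for \<xi>
  proof -
    have "(\<Sum>l\<in>UNIV. (\<i> * of_real (\<xi> $ l)) * (remainder_symbol t (Inl l) \<xi> * g \<xi>)) =
        (\<Sum>l\<in>UNIV. of_real (\<xi> $ l) * of_real (\<xi> $ l)) * (of_real t * A 0 (t * (\<xi> \<bullet> \<xi>)) * g \<xi>)"
      unfolding sum_distrib_right by (rule sum.cong) (simp_all add: remainder_symbol_def algebra_simps)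
    also have "\<dots> = of_real (t * (\<xi> \<bullet> \<xi>)) * A 0 (t * (\<xi> \<bullet> \<xi>)) * g \<xi>"
      unfolding inner_eq_sum_coord[symmetric] by simp
    also have "\<dots> = (\<alpha> 0 (t * (\<xi> \<bullet> \<xi>)) - of_real (gauss t \<xi>)) * g \<xi>"
      unfolding A[symmetric] gauss_eq_jet ..
    finally show ?thesis by (simp add: algebra_simps)
  qed
  then have "q0 (fourier (\<lambda>\<xi>. \<alpha> 0 (t * (\<xi> \<bullet> \<xi>)) * g \<xi>)) = q0 (fourier (\<lambda>\<xi>. of_real (gauss t \<xi>) * g \<xi>)) +
      (\<Sum>l\<in>UNIV. q0 (fourier (\<lambda>\<xi>. (\<i> * of_real (\<xi> $ l)) * (remainder_symbol t (Inl l) \<xi> * g \<xi>))))"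
    using functional_add[OF FT G schwartz_sum[of UNIV "\<lambda>l \<xi>. (\<i> * of_real (\<xi> $ l)) * (remainder_symbol t (Inl l) \<xi> * g \<xi>)"]]
      functional_sum[OF FT, of UNIV "\<lambda>l \<xi>. (\<i> * of_real (\<xi> $ l)) * (remainder_symbol t (Inl l) \<xi> * g \<xi>)"] S
    by (simp only: UNIV_I)
  also have "(\<Sum>l\<in>UNIV. q0 (fourier (\<lambda>\<xi>. (\<i> * of_real (\<xi> $ l)) * (remainder_symbol t (Inl l) \<xi> * g \<xi>)))) =
      (\<Sum>l\<in>UNIV. initial (Inl l) (fourier (\<lambda>\<xi>. remainder_symbol t (Inl l) \<xi> * g \<xi>)))"
    by (intro sum.cong refl initial_gradient schwartz_times schwartz_imp_moderate schwartz_remainder_symbol t g)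
  finally have *: "q 0 (fourier (\<lambda>\<xi>. \<alpha> 0 (t * (\<xi> \<bullet> \<xi>)) * g \<xi>)) = q0 (fourier (\<lambda>\<xi>. of_real (gauss t \<xi>) * g \<xi>)) +
      (\<Sum>l\<in>UNIV. initial (Inl l) (fourier (\<lambda>\<xi>. remainder_symbol t (Inl l) \<xi> * g \<xi>)))"
    unfolding initial_values(1)[OF schwartz_fourier[OF Sa]] .
  have "u 0 l (fourier (\<lambda>\<xi>. ((- \<i> * of_real (\<xi> $ l)) * (of_real t * B 0 (t * (\<xi> \<bullet> \<xi>)))) * g \<xi>)) =
      initial (Inr l) (fourier (\<lambda>\<xi>. remainder_symbol t (Inr l) \<xi> * g \<xi>))" for l
  proof -
    have "(\<lambda>\<xi>. ((- \<i> * of_real (\<xi> $ l)) * (of_real t * B 0 (t * (\<xi> \<bullet> \<xi>)))) * g \<xi>) = (\<lambda>\<xi>. remainder_symbol t (Inr l) \<xi> * g \<xi>)"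
      by (simp add: remainder_symbol_def mult_ac)
    moreover have "schwartz (\<lambda>\<xi>. remainder_symbol t (Inr l) \<xi> * g \<xi>)"
      by (intro schwartz_times schwartz_imp_moderate schwartz_remainder_symbol t g)
    ultimately show ?thesis
      using initial_values(2)[OF schwartz_fourier] by (simp only: sum.case)
  qed
  then show ?thesis
    unfolding formula_Q[OF t g] * sum_plus_type by (simp only: add.assoc)
qed

text \<open>The gradient of \<open>q\<^sub>0\<close> absorbs a factor \<open>\<i> \<xi>\<^sub>j\<close>: in the equation for \<open>\<nabla>q\<close> it stems from the gradient on the left, in
  the equation for \<open>u\<close> from the capillary term.\<close>

lemma flow_representation:
  assumes t: "t > 0" and g: "schwartz g"
  shows "case_sum (distr_grad (q t)) (u t) k (fourier g) =
    (\<Sum>i\<in>UNIV. initial i (fourier (\<lambda>\<xi>. flow_symbol t k i \<xi> * g \<xi>)))"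
proof -
  have S: "schwartz (\<lambda>\<xi>. flow_symbol t k i \<xi> * g \<xi>)" for k i
    by (intro schwartz_times schwartz_imp_moderate schwartz_flow_symbol t g)
  have delta: "(\<Sum>l\<in>UNIV. initial (Inl l) (fourier (\<lambda>\<xi>. ((if l = j then a else 0) * J \<xi>) * g \<xi>))) =
      initial (Inl j) (fourier (\<lambda>\<xi>. (a * J \<xi>) * g \<xi>))" for j a and J :: "real^'n \<Rightarrow> complex"
  proof -
    have "initial (Inl l) (fourier (\<lambda>\<xi>. ((if l = j then a else 0) * J \<xi>) * g \<xi>)) =
      (if l = j then initial (Inl j) (fourier (\<lambda>\<xi>. (a * J \<xi>) * g \<xi>)) else 0)" for l
      using functional_zero[OF functional_comp_fourier[OF low_vanishing_functional[OF initial_low_vanishing[of "Inl l"]]]]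
      by simp
    then show ?thesis by simp
  qed
  show ?thesis
  proof (cases k)
    case (Inl j)
    have S1: "schwartz (\<lambda>\<xi>. \<i> * of_real (\<xi> $ j) * g \<xi>)"
      by (intro schwartz_times moderate_cmult moderate_coord g)
    have Sa: "schwartz (\<lambda>\<xi>. \<alpha> 0 (t * (\<xi> \<bullet> \<xi>)) * g \<xi>)"
      by (intro schwartz_times[OF _ g] schwartz_imp_moderate schwartz_jet[OF t \<alpha>_jet])
    have Sb: "schwartz (\<lambda>\<xi>. \<i> * of_real (\<xi> $ j) * (\<alpha> 0 (t * (\<xi> \<bullet> \<xi>)) * g \<xi>))"
      by (intro schwartz_times[OF _ Sa] moderate_cmult moderate_coord)
    have "case_sum (distr_grad (q t)) (u t) k (fourier g) = q t (fourier (\<lambda>\<xi>. \<i> * of_real (\<xi> $ j) * g \<xi>))"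
      using distr_partial_fourier[OF q_functional[OF less_imp_le[OF t]] g, of j] by (simp add: Inl distr_grad_def)
    also have "\<dots> = q 0 (fourier (\<lambda>\<xi>. \<i> * of_real (\<xi> $ j) * (\<alpha> 0 (t * (\<xi> \<bullet> \<xi>)) * g \<xi>))) +
       (\<Sum>l\<in>UNIV. u 0 l (fourier (\<lambda>\<xi>. flow_symbol t k (Inr l) \<xi> * g \<xi>)))"
      unfolding formula_Q[OF t S1] Inl flow_symbol_simps by (simp add: mult_ac)
    also have "q 0 (fourier (\<lambda>\<xi>. \<i> * of_real (\<xi> $ j) * (\<alpha> 0 (t * (\<xi> \<bullet> \<xi>)) * g \<xi>))) =
        initial (Inl j) (fourier (\<lambda>\<xi>. (1 * \<alpha> 0 (t * (\<xi> \<bullet> \<xi>))) * g \<xi>))"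
      unfolding initial_values(1)[OF schwartz_fourier[OF Sb]] initial_gradient[OF Sa] by simp
    also have "\<dots> = (\<Sum>l\<in>UNIV. initial (Inl l) (fourier (\<lambda>\<xi>. flow_symbol t k (Inl l) \<xi> * g \<xi>)))"
      unfolding Inl flow_symbol_simps delta[of j 1 "\<lambda>\<xi>. \<alpha> 0 (t * (\<xi> \<bullet> \<xi>))"] ..
    also have "(\<Sum>l\<in>UNIV. u 0 l (fourier (\<lambda>\<xi>. flow_symbol t k (Inr l) \<xi> * g \<xi>))) =
        (\<Sum>l\<in>UNIV. initial (Inr l) (fourier (\<lambda>\<xi>. flow_symbol t k (Inr l) \<xi> * g \<xi>)))"
      unfolding initial_values(2)[OF schwartz_fourier[OF S]] by simp
    finally show ?thesis unfolding sum_plus_type .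
  next
    case (Inr j)
    have Sa: "schwartz (\<lambda>\<xi>. ((- of_real \<kappa>) * \<beta> 0 (t * (\<xi> \<bullet> \<xi>))) * g \<xi>)"
      by (intro schwartz_times[OF _ g] schwartz_imp_moderate schwartz_cmult schwartz_jet[OF t jets(1)])
    have Sb: "schwartz (\<lambda>\<xi>. \<i> * of_real (\<xi> $ j) * (((- of_real \<kappa>) * \<beta> 0 (t * (\<xi> \<bullet> \<xi>))) * g \<xi>))"
      by (intro schwartz_times[OF _ Sa] moderate_cmult moderate_coord)
    have "case_sum (distr_grad (q t)) (u t) k (fourier g) = u t j (fourier g)" by (simp add: Inr)
    also have "\<dots> = q 0 (fourier (\<lambda>\<xi>. \<i> * of_real (\<xi> $ j) * (((- of_real \<kappa>) * \<beta> 0 (t * (\<xi> \<bullet> \<xi>))) * g \<xi>))) +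
       (\<Sum>l\<in>UNIV. u 0 l (fourier (\<lambda>\<xi>. flow_symbol t k (Inr l) \<xi> * g \<xi>)))"
      unfolding formula_U[OF t g] Inr flow_symbol_simps by (simp add: mult_ac)
    also have "q 0 (fourier (\<lambda>\<xi>. \<i> * of_real (\<xi> $ j) * (((- of_real \<kappa>) * \<beta> 0 (t * (\<xi> \<bullet> \<xi>))) * g \<xi>))) =
        initial (Inl j) (fourier (\<lambda>\<xi>. ((- of_real \<kappa>) * \<beta> 0 (t * (\<xi> \<bullet> \<xi>))) * g \<xi>))"
      unfolding initial_values(1)[OF schwartz_fourier[OF Sb]] initial_gradient[OF Sa] by simp
    also have "\<dots> = (\<Sum>l\<in>UNIV. initial (Inl l) (fourier (\<lambda>\<xi>. flow_symbol t k (Inl l) \<xi> * g \<xi>)))"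
      unfolding Inr flow_symbol_simps delta[of j "- of_real \<kappa>" "\<lambda>\<xi>. \<beta> 0 (t * (\<xi> \<bullet> \<xi>))"] ..
    also have "(\<Sum>l\<in>UNIV. u 0 l (fourier (\<lambda>\<xi>. flow_symbol t k (Inr l) \<xi> * g \<xi>))) =
        (\<Sum>l\<in>UNIV. initial (Inr l) (fourier (\<lambda>\<xi>. flow_symbol t k (Inr l) \<xi> * g \<xi>)))"
      unfolding initial_values(2)[OF schwartz_fourier[OF S]] by simp
    finally show ?thesis unfolding sum_plus_type .
  qed
qed

text \<open>A sum of smoothed data is represented by a continuous function that obeys the sum of the
  pointwise bounds.\<close>

lemma smoothed_sum_representation:
  assumes m: "\<And>i. schwartz (m i)"
    and bd: "\<And>i y. norm (smoothed (initial i) (m i) y) \<le> K"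
    and rep: "\<And>i f. schwartz f \<Longrightarrow> initial i (fourier (\<lambda>\<xi>. m i \<xi> * inv_fourier f \<xi>)) =
       (LINT y|lborel. f y * smoothed (initial i) (m i) y)"
  defines "k \<equiv> \<lambda>y. \<Sum>i\<in>UNIV. smoothed (initial i) (m i) y"
  shows "continuous_on UNIV k" "norm (k y) \<le> real CARD('n + 'n) * K"
    and "schwartz f \<Longrightarrow> (\<Sum>i\<in>UNIV. initial i (fourier (\<lambda>\<xi>. m i \<xi> * inv_fourier f \<xi>))) = (LINT y|lborel. f y * k y)"
proof -
  have cont: "continuous_on UNIV (smoothed (initial i) (m i))" for i
    by (rule smoothed_continuous[OF low_vanishing_functional[OF initial_low_vanishing] m])
  then show "continuous_on UNIV k" unfolding k_def by (intro continuous_on_sum) auto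
  show "norm (k y) \<le> real CARD('n + 'n) * K"
    unfolding k_def by (rule sum_norm_bound) (rule bd)
  assume f: "schwartz f"
  have "integrable lborel (\<lambda>y. f y * smoothed (initial i) (m i) y)" for i
    using bounded_times_schwartz_integrable[OF borel_measurable_continuous_onI[OF cont] bd f]
    by (simp add: mult.commute)
  then show "(\<Sum>i\<in>UNIV. initial i (fourier (\<lambda>\<xi>. m i \<xi> * inv_fourier f \<xi>))) = (LINT y|lborel. f y * k y)"
    unfolding rep[OF f] k_def sum_distrib_left by (subst Bochner_Integration.integral_sum) auto
qed

end

context propagator
begin

text \<open>The last equation is the form of the \<open>L\<^sup>\<infinity>\<close> norm of \<open>q\<close> from which its measurability in time follows.\<close>

lemma korteweg_flow_estimates:
  fixes \<phi> chi :: "real^'n::finite \<Rightarrow> real"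
  assumes lp: "littlewood_paley \<phi> chi"
  shows "\<exists>C>0. \<forall>q0 u0 q u b t. korteweg_flow \<mu> lam \<kappa> c \<beta> B D A \<phi> chi q0 u0 q u \<longrightarrow> 0 \<le> b \<longrightarrow>
     besov_norm \<phi> (real CARD('n) / 2 - 1) 2 2 (case_sum (distr_grad q0) u0) \<le> ennreal b \<longrightarrow> t > 0 \<longrightarrow>
     ennreal (sqrt t) * distr_Lp_norm \<infinity> (case_sum (distr_grad (q t)) (u t)) \<le> ennreal (C * b) \<and>
     (distr_Lp_norm \<infinity> (scalar q0) < \<infinity> \<longrightarrow>
       distr_Lp_norm \<infinity> (scalar (q t)) \<le> distr_Lp_norm \<infinity> (scalar q0) + ennreal (C * b) \<and>
       distr_Lp_norm \<infinity> (scalar (q t)) = (SUP p. ennreal (norm (q t (gauss_probe (fst p) (snd p))))))"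
proof -
  interpret littlewood_paley_pair \<phi> chi by (rule littlewood_paley_pair.intro[OF lp])
  obtain M where M: "M \<ge> 0"
    "\<And>t (\<xi>::real^'n) k i. t > 0 \<Longrightarrow> norm (flow_symbol t k i \<xi>) \<le> M * exp (- (c / 2 * (t * (\<xi> \<bullet> \<xi>))))"
    "\<And>t (\<xi>::real^'n) i. t > 0 \<Longrightarrow> norm (remainder_symbol t i \<xi>) \<le> (sqrt t * M) * exp (- (c / 2 * (t * (\<xi> \<bullet> \<xi>))))"
    using symbol_bounds by blast
  obtain C0 where C0: "C0 > 0"
    "\<And>(Ts :: 'n + 'n \<Rightarrow> 'n distr) b t M m i. (\<And>i. low_vanishing (Ts i)) \<Longrightarrow> 0 \<le> b \<Longrightarrow>
     besov_norm \<phi> (real CARD('n) / 2 - 1) 2 2 Ts \<le> ennreal b \<Longrightarrow>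
     t > 0 \<Longrightarrow> M \<ge> 0 \<Longrightarrow> schwartz m \<Longrightarrow> (\<And>\<xi>. norm (m \<xi>) \<le> M * exp (- (c / 2 * (t * (\<xi> \<bullet> \<xi>))))) \<Longrightarrow>
        (\<forall>y. norm (smoothed (Ts i) m y) \<le> C0 * M * b / sqrt t) \<and>
        (\<forall>f. schwartz f \<longrightarrow> Ts i (fourier (\<lambda>\<xi>. m \<xi> * inv_fourier f \<xi>)) = (LINT y|lborel. f y * smoothed (Ts i) m y))"
    using smoothing_estimate[of "c / 2", where 'i = "'n + 'n"] c(1) by auto
  define N where "N = real CARD('n + 'n)"
  \<comment> \<open>the first summand serves the first estimate, the second one the bound on \<open>q\<close>\<close>
  define C where "C = N * (N * (C0 * M)) + N * (C0 * M) + 1"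
  have N: "N \<ge> 0" by (simp add: N_def)
  have C: "C > 0" unfolding C_def using N C0(1) M(1) by (simp add: add_nonneg_pos)
  have "ennreal (sqrt t) * distr_Lp_norm \<infinity> (case_sum (distr_grad (q t)) (u t)) \<le> ennreal (C * b) \<and>
     (distr_Lp_norm \<infinity> (scalar q0) < \<infinity> \<longrightarrow>
       distr_Lp_norm \<infinity> (scalar (q t)) \<le> distr_Lp_norm \<infinity> (scalar q0) + ennreal (C * b) \<and>
       distr_Lp_norm \<infinity> (scalar (q t)) = (SUP p. ennreal (norm (q t (gauss_probe (fst p) (snd p))))))"
    if flow: "korteweg_flow \<mu> lam \<kappa> c \<beta> B D A \<phi> chi q0 u0 q u" and b: "0 \<le> b"
      "besov_norm \<phi> (real CARD('n) / 2 - 1) 2 2 (case_sum (distr_grad q0) u0) \<le> ennreal b" and t: "t > 0"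
    for q0 :: "'n distr" and u0 q u b t
  proof -
    interpret korteweg_flow \<mu> lam \<kappa> c \<beta> B D A \<phi> chi q0 u0 q u by (rule flow)
    define F where "F = (\<lambda>k i. flow_symbol t k i :: real^'n \<Rightarrow> complex)"
    define R where "R = (\<lambda>i. remainder_symbol t i :: real^'n \<Rightarrow> complex)"
    have F: "schwartz (F k i)" and R: "schwartz (R i)" for k i
      unfolding F_def R_def by (intro schwartz_flow_symbol schwartz_remainder_symbol t)+
    note est = C0(2)[OF initial_low_vanishing b t]
    note F_est = est[OF M(1) F M(2)[OF t, folded F_def]]
    have "sqrt t * M \<ge> 0" using t M(1) by simp
    note R_est = est[OF this R M(3)[OF t, folded R_def]]
    define kF where "kF = (\<lambda>k y. \<Sum>i\<in>UNIV. smoothed (initial i) (F k i) y)"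
    define kR where "kR = (\<lambda>y. \<Sum>i\<in>UNIV. smoothed (initial i) (R i) y)"
    have R_bd: "norm (smoothed (initial i) (R i) y) \<le> C0 * M * b" for i y
      using R_est[of i i, THEN conjunct1, rule_format, of y] t by (simp add: field_simps)
    have F_bd: "norm (smoothed (initial i) (F k i) y) \<le> C0 * M * b / sqrt t" for i k y
      using F_est[of i k i] by blast
    have F_eq: "schwartz f \<Longrightarrow> initial i (fourier (\<lambda>\<xi>. F k i \<xi> * inv_fourier f \<xi>)) =
       (LINT y|lborel. f y * smoothed (initial i) (F k i) y)" for i k f
      using F_est[of i k i] by blast
    note F_rep = smoothed_sum_representation[of "F k" "C0 * M * b / sqrt t" for k, OF F F_bd F_eq]
    have F_sum: "continuous_on UNIV (kF k)" "norm (kF k y) \<le> N * (C0 * M * b / sqrt t)"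
      "schwartz f \<Longrightarrow> (\<Sum>i\<in>UNIV. initial i (fourier (\<lambda>\<xi>. F k i \<xi> * inv_fourier f \<xi>))) = (LINT y|lborel. f y * kF k y)" for k y f
      unfolding kF_def N_def by - (rule F_rep(1), assumption, rule F_rep(2), assumption, rule F_rep(3), assumption+)
    have R_eq: "schwartz f \<Longrightarrow> initial i (fourier (\<lambda>\<xi>. R i \<xi> * inv_fourier f \<xi>)) =
       (LINT y|lborel. f y * smoothed (initial i) (R i) y)" for i f
      using R_est[of i i] by blast
    note R_rep = smoothed_sum_representation[of R "C0 * M * b", OF R R_bd R_eq]
    have R_sum: "continuous_on UNIV kR" "norm (kR y) \<le> N * (C0 * M * b)"
      "schwartz f \<Longrightarrow> (\<Sum>i\<in>UNIV. initial i (fourier (\<lambda>\<xi>. R i \<xi> * inv_fourier f \<xi>))) = (LINT y|lborel. f y * kR y)" for y f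
      unfolding kR_def N_def by - (rule R_rep(1), assumption, rule R_rep(2), assumption, rule R_rep(3), assumption+)
    have "distr_Lp_norm \<infinity> (case_sum (distr_grad (q t)) (u t)) \<le> ennreal (N * (N * (C0 * M * b / sqrt t)))"
    proof (rule distr_Lp_norm_infinity_le)
      show "kF k \<in> borel_measurable borel" for k by (rule borel_measurable_continuous_onI[OF F_sum(1)])
      show "norm (kF k y) \<le> N * (C0 * M * b / sqrt t)" for k y by (rule F_sum(2))
      show "case_sum (distr_grad (q t)) (u t) k f = (LINT y|lborel. f y * kF k y)" if f: "schwartz f" for k f
        using flow_representation[OF t schwartz_inv_fourier[OF f], of k] F_sum(3)[OF f, of k]
        unfolding fourier_inv_fourier[OF f] F_def by simp
      have "norm (\<chi> k. kF k y) \<le> (\<Sum>k\<in>UNIV. norm (kF k y))" for y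
        using norm_vec_le_sum[of "\<chi> k. kF k y"] by simp
      also have "(\<Sum>k\<in>UNIV. norm (kF k y)) \<le> N * (N * (C0 * M * b / sqrt t))" for y
        unfolding N_def by (rule sum_bounded_above[of UNIV, simplified]) (rule F_sum(2)[unfolded N_def])
      finally show "ennreal (norm (\<chi> k. kF k y)) \<le> ennreal (N * (N * (C0 * M * b / sqrt t)))" for y
        by (rule ennreal_leI)
    qed
    then have "ennreal (sqrt t) * distr_Lp_norm \<infinity> (case_sum (distr_grad (q t)) (u t)) \<le>
        ennreal (sqrt t) * ennreal (N * (N * (C0 * M * b / sqrt t)))" by (rule mult_left_mono) simp
    also have "\<dots> = ennreal (N * (N * (C0 * M)) * b)"
      using t N C0(1) M(1) b(1) by (simp add: mult_ac flip: ennreal_mult)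
    also have "\<dots> \<le> ennreal (C * b)"
      using N C0(1) M(1) b(1) by (intro ennreal_leI mult_right_mono) (simp_all add: C_def)
    finally have 1: "ennreal (sqrt t) * distr_Lp_norm \<infinity> (case_sum (distr_grad (q t)) (u t)) \<le> ennreal (C * b)" .
    have "distr_Lp_norm \<infinity> (scalar (q t)) \<le> distr_Lp_norm \<infinity> (scalar q0) + ennreal (C * b) \<and>
       distr_Lp_norm \<infinity> (scalar (q t)) = (SUP p. ennreal (norm (q t (gauss_probe (fst p) (snd p)))))"
      if fin: "distr_Lp_norm \<infinity> (scalar q0) < \<infinity>"
    proof -
      obtain a where a: "distr_Lp_norm \<infinity> (scalar q0) = ennreal a" "0 \<le> a"
        using fin by (cases "distr_Lp_norm \<infinity> (scalar q0)") auto
      define h where "h = smoothed q0 (\<lambda>\<xi>. of_real (gauss t \<xi>))"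
      have h: "norm (h y) \<le> a" for y
        using heat_contraction(1)[OF fin t, of y] a by (simp add: h_def ennreal_le_iff)
      have hc: "continuous_on UNIV h"
        unfolding h_def by (rule smoothed_continuous[OF q0_functional schwartz_gauss[OF t]])
      define k where "k = (\<lambda>y. h y + kR y)"
      have kc: "continuous_on UNIV k" unfolding k_def by (intro continuous_on_add hc R_sum(1))
      have kb: "norm (k y) \<le> a + N * (C0 * M * b)" for y
        unfolding k_def by (rule norm_triangle_le[OF add_mono[OF h R_sum(2)]])
      have rep: "q t f = (LINT y|lborel. f y * k y)" if f: "schwartz f" for f
      proof -
        have int: "integrable lborel (\<lambda>y. f y * h y)" "integrable lborel (\<lambda>y. f y * kR y)"
          using bounded_times_schwartz_integrable[OF borel_measurable_continuous_onI[OF hc] h f]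
            bounded_times_schwartz_integrable[OF borel_measurable_continuous_onI[OF R_sum(1)] R_sum(2) f]
          by (simp_all add: mult.commute)
        have "q t f = (LINT y|lborel. f y * h y) + (LINT y|lborel. f y * kR y)"
          using q_representation[OF t schwartz_inv_fourier[OF f]] R_sum(3)[OF f] heat_contraction(2)[OF fin t f]
          unfolding fourier_inv_fourier[OF f] R_def h_def by simp
        also have "\<dots> = (LINT y|lborel. f y * k y)"
          unfolding k_def distrib_left by (rule Bochner_Integration.integral_add[OF int, symmetric])
        finally show ?thesis .
      qed
      have "distr_Lp_norm \<infinity> (scalar (q t)) \<le> ennreal (a + N * (C0 * M * b))"
      proof (rule distr_Lp_norm_infinity_le[of "\<lambda>_. k" "a + N * (C0 * M * b)"])
        show "k \<in> borel_measurable borel" by (rule borel_measurable_continuous_onI[OF kc])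
        have "norm (\<chi> i::unit. k y) = norm (k y)" for y by (simp add: norm_vec_def L2_set_def UNIV_unit)
        then show "ennreal (norm (\<chi> i::unit. k y)) \<le> ennreal (a + N * (C0 * M * b))" for y
          using kb[of y] by (simp add: ennreal_leI)
      qed (use kb rep in auto)
      also have "\<dots> = ennreal a + ennreal (N * (C0 * M) * b)"
        using a(2) N C0(1) M(1) b(1) by (simp add: mult.assoc)
      also have "\<dots> \<le> distr_Lp_norm \<infinity> (scalar q0) + ennreal (C * b)"
        unfolding a using N C0(1) M(1) b(1) by (intro add_left_mono ennreal_leI mult_right_mono) (simp_all add: C_def)
      finally show ?thesis using distr_Lp_norm_eq_SUP_probe[OF kc kb rep] by simp
    qed
    then show ?thesis using 1 by blast
  qed
  then show ?thesis using C by blast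
qed

end

theorem proposition11:
  fixes \<mu> lam \<kappa> :: real and \<phi> chi :: "real^'n::finite \<Rightarrow> real"
  assumes "CARD('n) \<ge> 2" and "\<mu> > 0" and "lam + 2 * \<mu> > 0" and "\<kappa> > 0"
    and "littlewood_paley \<phi> chi"
  shows "\<exists>C>0. \<forall>(q0 :: 'n distr) (u0 :: 'n \<Rightarrow> 'n distr)
      (q :: real \<Rightarrow> 'n distr) (u :: real \<Rightarrow> 'n \<Rightarrow> 'n distr).
    scalar q0 \<in> besov_space \<phi> chi (real CARD('n) / 2) 2 2 \<longrightarrow>
    distr_Lp_norm \<infinity> (scalar q0) < \<infinity> \<longrightarrow>
    u0 \<in> besov_space \<phi> chi (real CARD('n) / 2 - 1) 2 2 \<longrightarrow>
    korteweg_solution \<mu> lam \<kappa> q0 u0 q u \<longrightarrow>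
    (\<forall>T>0.
      (SUP t\<in>{0..T}. ennreal (sqrt t) * distr_Lp_norm \<infinity> (case_sum (distr_grad (q t)) (u t)))
        \<le> ennreal C * besov_norm \<phi> (real CARD('n) / 2 - 1) 2 2 (case_sum (distr_grad q0) u0)
      \<and> eLp_norm (restrict_space lborel {0<..<T}) \<infinity> (\<lambda>t. distr_Lp_norm \<infinity> (scalar (q t)))
        \<le> distr_Lp_norm \<infinity> (scalar q0)
          + ennreal C * besov_norm \<phi> (real CARD('n) / 2 - 1) 2 2 (case_sum (distr_grad q0) u0))"
proof -
  obtain c \<beta> B D A where "propagator \<mu> lam \<kappa> c \<beta> B D A"
    using propagator_exists[OF assms(2,3,4)] unfolding propagator_def by blast
  then interpret propagator \<mu> lam \<kappa> c \<beta> B D A .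
  interpret littlewood_paley_pair \<phi> chi by (rule littlewood_paley_pair.intro[OF assms(5)])
  let ?besov = "\<lambda>q0 u0. besov_norm \<phi> (real CARD('n) / 2 - 1) 2 2 (case_sum (distr_grad q0) u0)"
  obtain C where C: "C > 0"
    "\<And>q0 u0 q u b t. korteweg_flow \<mu> lam \<kappa> c \<beta> B D A \<phi> chi q0 u0 q u \<Longrightarrow> 0 \<le> b \<Longrightarrow> ?besov q0 u0 \<le> ennreal b \<Longrightarrow> t > 0 \<Longrightarrow>
     ennreal (sqrt t) * distr_Lp_norm \<infinity> (case_sum (distr_grad (q t)) (u t)) \<le> ennreal (C * b)"
    "\<And>q0 u0 q u b t. korteweg_flow \<mu> lam \<kappa> c \<beta> B D A \<phi> chi q0 u0 q u \<Longrightarrow> 0 \<le> b \<Longrightarrow> ?besov q0 u0 \<le> ennreal b \<Longrightarrow> t > 0 \<Longrightarrow>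
     distr_Lp_norm \<infinity> (scalar q0) < \<infinity> \<Longrightarrow>
       distr_Lp_norm \<infinity> (scalar (q t)) \<le> distr_Lp_norm \<infinity> (scalar q0) + ennreal (C * b) \<and>
       distr_Lp_norm \<infinity> (scalar (q t)) = (SUP p. ennreal (norm (q t (gauss_probe (fst p) (snd p)))))"
    using korteweg_flow_estimates[OF assms(5)] by blast
  show ?thesis
  proof (intro exI[of _ C] conjI C(1) allI impI)
    fix q0 :: "'n distr" and u0 q u and T :: real
    assume q0: "scalar q0 \<in> besov_space \<phi> chi (real CARD('n) / 2) 2 2"
      and fin: "distr_Lp_norm \<infinity> (scalar q0) < \<infinity>"
      and u0: "u0 \<in> besov_space \<phi> chi (real CARD('n) / 2 - 1) 2 2"
      and sol: "korteweg_solution \<mu> lam \<kappa> q0 u0 q u" and T: "T > 0"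
    have flow: "korteweg_flow \<mu> lam \<kappa> c \<beta> B D A \<phi> chi q0 u0 q u"
      using q0 u0 sol unfolding besov_space_def
      by unfold_locales (auto intro: tempered_h_low_vanishing)
    show "(SUP t\<in>{0..T}. ennreal (sqrt t) * distr_Lp_norm \<infinity> (case_sum (distr_grad (q t)) (u t)))
        \<le> ennreal C * ?besov q0 u0"
    proof (cases "?besov q0 u0")
      case (real b)
      show ?thesis
      proof (rule SUP_least)
        fix t assume "t \<in> {0..T}"
        then show "ennreal (sqrt t) * distr_Lp_norm \<infinity> (case_sum (distr_grad (q t)) (u t)) \<le> ennreal C * ?besov q0 u0"
          using C(2)[OF flow real(1) eq_refl[OF real(2)], of t] C(1) real by (cases "t = 0") (auto simp: ennreal_mult)
      qed
    qed (use C(1) in \<open>simp add: ennreal_mult_top\<close>)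
    show "eLp_norm (restrict_space lborel {0<..<T}) \<infinity> (\<lambda>t. distr_Lp_norm \<infinity> (scalar (q t)))
        \<le> distr_Lp_norm \<infinity> (scalar q0) + ennreal C * ?besov q0 u0"
    proof (cases "?besov q0 u0")
      case (real b)
      note est = C(3)[OF flow real(1) eq_refl[OF real(2)] _ fin]
      have cont: "continuous_on {0<..<T} (\<lambda>t. ennreal (norm (q t (gauss_probe (fst p) (snd p)))))" for p
      proof -
        have "continuous_on {0..} (\<lambda>t. q t (gauss_probe (fst p) (snd p)))"
          using sol schwartz_gauss_probe unfolding korteweg_solution_def by blast
        then show ?thesis
          by (intro continuous_on_ennreal continuous_on_norm) (auto elim: continuous_on_subset)
      qed
      have "(\<lambda>t. distr_Lp_norm \<infinity> (scalar (q t))) \<in> borel_measurable (restrict_space lborel {0<..<T})"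
        by (rule borel_measurable_SUP_continuous[OF _ cont]) (use est in auto)
      moreover have "AE t in restrict_space lborel {0<..<T}. distr_Lp_norm \<infinity> (scalar (q t)) \<le> distr_Lp_norm \<infinity> (scalar q0) + ennreal (C * b)"
        by (intro AE_I2 est[THEN conjunct1]) (simp add: space_restrict_space)
      ultimately have "esssup (restrict_space lborel {0<..<T}) (\<lambda>t. distr_Lp_norm \<infinity> (scalar (q t))) \<le> distr_Lp_norm \<infinity> (scalar q0) + ennreal (C * b)"
        by (rule esssup_I)
      then show ?thesis using C(1) real by (simp add: eLp_norm_def ennreal_mult)
    qed (use C(1) in \<open>simp add: ennreal_mult_top\<close>)
  qed
qed

end
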